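(* Let $(\mathcal M,g)$ be a closed connected Riemannian manifold of dimension $n$. Assume that $n\ge3$, $p\in\{2,3,\dots,n\}$ and $u\in C^3(\mathcal M)$ satisfies the general $p$-Hessian equation on $\mathcal M$. Assume additionally that there exist non-negative continuous functions $\phi_3,\phi_4,\dots,\phi_8$ on $\mathcal M\times\mathbb R$ and functions $\omega_1,\dots,\omega_5\in\mathcal W$, where $$\mathcal W=\Bigl\{\omega\in C\bigl([0,+\infty),[0,+\infty)\bigr):\ \lim_{t\to+\infty}\tfrac{\omega(t)}{t}=0,\ \sup_{t\in[0,+\infty)}(\omega(t)-t)\le1\Bigr\},$$ such that for any $(x,t)\in\mathcal M\times\mathbb R$ and $(\alpha,v)\in T_x^*\mathcal M\times T_x\mathcal M$ there hold (in local coordinates $x^j$ at $x$): (i) $(A(\alpha,t))(v,v)\le\phi_3(x,t)\,g(v,v)\,\omega_1(|\alpha|_g^2)$; (ii) $(A(\alpha,t))(v,w)\le\phi_4(x,t)\bigl(g(v,v)g(w,w)\bigr)^{1/2}\omega_2(|\alpha|_g^2)$ for all $w\in T_x\mathcal M$ with $g(v,w)=0$; (iii) $g^{jk}(x)\tilde\nabla_{\tilde x^j}A_{rs}(\alpha,t)v^rv^s\alpha_k+\dfrac{\partial (A(\alpha,t))(v,v)}{\partial t}|\alpha|_g^2\le\phi_5(x,t)\,g(v,v)\,\omega_3(|\alpha|_g^4)$; (iv) $\displaystyle\int_0^1\theta\Bigl(D^2_{\theta\alpha}\bigl[(A(\cdot,t))(v,v)\bigr]\Bigr)(\alpha,\alpha)\,\mathrm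 d\theta\ge-\phi_6(x,t)\,g(v,v)(|\alpha|_g^2+1)$; (v) $g^{jk}(x)\tilde\nabla_{\tilde x^j}\varphi(\alpha,t)\alpha_k+\dfrac{\partial\varphi(\alpha,t)}{\partial t}|\alpha|_g^2\ge-\phi_7(x,t)\,\omega_4(|\alpha|_g^4)\max\Bigl\{1,\dfrac{|\alpha|_g^{2(p-1)}}{\varphi^{p-1}(\alpha,t)}\Bigr\}$; (vi) $\displaystyle\int_0^1\theta\bigl(D^2_{\theta\alpha}[\varphi(\cdot,t)]\bigr)(\alpha,\alpha)\,\mathrm d\theta\le\phi_8(x,t)(|\alpha|_g^2+1)\max\Bigl\{1,\dfrac{\omega_5(|\alpha|_g^{2(p-1)})}{\varphi^{p-1}(\alpha,t)}\Bigr\}$. Then there exists a positive constant $M$ depending only on $\mathcal M$, $g$, $n$, $p$, $A(\alpha,t)$, $\varphi(\alpha,t)$ and $\max_{\mathcal M}|u|$ such that $$\max_{\mathcal M}|\mathrm du|_g\le M .$$ Moreover, if $p=n$, the assumptions (ii)–(vi) can be omitted and (i) can be replaced with the weaker one: $$(A(\alpha,t))(v,v)\le\phi_3(x,t)\,g(v,v)(|\alpha|_g^2+1).$$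
   Context: Notation. $\sigma_p(\mu)=\sum_{1\le j_1<\dots<j_p\le n}\mu_{j_1}\cdots\mu_{j_p}$ for $\mu\in\mathbb R^n$; $\Gamma_p=\{\mu\in\mathbb R^n:\sigma_q(\mu)>0\ \forall q\in\{1,\dots,p\}\}$. "Closed" means compact without boundary. $\pi:T^*\mathcal M\to\mathcal M$ is the projection. $A$ is a smooth map assigning to each $(\alpha,t)\in T^*\mathcal M\times\mathbb R$ a symmetric bilinear form $A(\alpha,t)$ on $T_{\pi(\alpha)}\mathcal M$, with components $A_{jk}(\alpha,t)$ in local coordinates; $\varphi(\alpha,t)$ is a positive smooth function on $T^*\mathcal M\times\mathbb R$. For $u\in C^2(\mathcal M)$, $\mathrm du$ is its differential, $\nabla^2u$ its Hessian for the Levi-Civita connection, and $A(\mathrm du,u)$ is the tensor field $x\mapsto A(\mathrm du(x),u(x))$. For a symmetric $(0,2)$-tensor field $B$, $\lambda(g^{-1}B)(x)\in\mathbb R^n$ is the vector of eigenvalues, in non-decreasing order, of the matrix product $(g^{jk}(x))(B_{jk}(x))$ in any local coordinates, where $(g^{jk})=(g_{jk})^{-1}$. $|\alpha|_g=(g^{jk}\alpha_j\alpha_k)^{1/2}$. Repeated indices are summed. For $\psi\in C^2(T_x^*\mathcal M)$, $D^2_\alpha[\psi](\beta,\gamma)$ denotes the second (Fréchet) derivative of $\psi$ at $\alpha$ on the vector space $T_x^*\mathcal M$; $(A(\cdot,t))(v,v)$ and $\varphi(\cdot,t)$ are here regarded as functions on $T_x^*\mathcal M$. A constant "depending only on" a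 list of data can be chosen as a function of these data, uniformly in everything else. The general $p$-Hessian equation for $u\in C^2(\mathcal M)$ is: for all $x\in\mathcal M$, $$\sigma_p^{1/p}\bigl(\lambda(g^{-1}(A(\mathrm du,u)+\nabla^2u))(x)\bigr)=\varphi(\mathrm du(x),u(x)),\qquad \lambda(g^{-1}(A(\mathrm du,u)+\nabla^2u))(x)\in\Gamma_p .$$ Derivatives on $T^*\mathcal M$. Given local coordinates $x^j$ on $\mathcal U\subset\mathcal M$, let $(\tilde x^j,\tilde\alpha_j)$ be the canonical coordinates on $T^*\mathcal U$: $\tilde x^j(\alpha)=x^j(\pi(\alpha))$, $\tilde\alpha_j(\alpha)=\alpha(\partial/\partial x^j|_{\pi(\alpha)})=:\alpha_j$. Let $\Gamma^l_{jk}$ be the Christoffel symbols of $g$. Then $$\tilde\nabla_{\tilde x^j}\varphi(\alpha,t)=\frac{\partial\varphi(\cdot,t)}{\partial\tilde x^j}\Big|_\alpha+\Gamma^l_{jm}(\pi(\alpha))\frac{\partial\varphi(\cdot,t)}{\partial\tilde\alpha_m}\Big|_\alpha\alpha_l,$$ $$\tilde\nabla_{\tilde x^j}A_{rs}(\alpha,t)=\frac{\partial A_{rs}(\cdot,t)}{\partial\tilde x^j}\Big|_\alpha+\Gamma^l_{jm}(\pi(\alpha))\frac{\partial A_{rs}(\cdot,t)}{\partial\tilde\alpha_m}\Big|_\alpha\alpha_l-\Gamma^q_{rj}(\pi(\alpha))A_{qs}(\alpha,t)-\Gamma^q_{sj}(\pi(\alpha))A_{rq}(\alpha,t).$$ 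*)

theory Defs
  imports "HOL-Analysis.Analysis"
begin

section \<open>Functions of class \<open>C\<^sup>k\<close> on open subsets of Euclidean spaces\<close>

text \<open>To be used for open \<open>S\<close>. In finite dimension, \<open>f\<close> is of class \<open>C\<^sup>k\<^sup>+\<^sup>1\<close> iff it is differentiable
  and all its directional derivatives are of class \<open>C\<^sup>k\<close>.\<close>

primrec Ck_on :: "nat \<Rightarrow> ('a::euclidean_space \<Rightarrow> real) \<Rightarrow> 'a set \<Rightarrow> bool" where
  "Ck_on 0 f S \<longleftrightarrow> continuous_on S f"
| "Ck_on (Suc k) f S \<longleftrightarrow> (\<forall>x\<in>S. f differentiable (at x)) \<and>
     (\<forall>v. Ck_on k (\<lambda>x. frechet_derivative f (at x) v) S)"

definition smooth_fun_on :: "('a::euclidean_space \<Rightarrow> real) \<Rightarrow> 'a set \<Rightarrow> bool" where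
  "smooth_fun_on f S \<longleftrightarrow> (\<forall>k. Ck_on k f S)"

definition pd :: "'n::finite \<Rightarrow> (real^'n \<Rightarrow> real) \<Rightarrow> real^'n \<Rightarrow> real" where
  "pd j f y = frechet_derivative f (at y) (axis j 1)"


section \<open>Smooth manifolds of dimension \<open>CARD('n)\<close>\<close>

text \<open>The manifold is the whole type \<open>'m\<close>. A chart is a pair of its domain and its coordinate map;
  only the values of the coordinate map on the domain are meaningful.\<close>

type_synonym ('m,'n) chart = "'m set \<times> ('m \<Rightarrow> real^'n)"

abbreviation cdom :: "('m,'n) chart \<Rightarrow> 'm set" where "cdom c \<equiv> fst c"
abbreviation crd :: "('m,'n) chart \<Rightarrow> 'm \<Rightarrow> real^'n" where "crd c \<equiv> snd c"
abbreviation img :: "('m,'n) chart \<Rightarrow> (real^'n) set" where "img c \<equiv> snd c ` fst c"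
abbreviation cinv :: "('m,'n) chart \<Rightarrow> real^'n \<Rightarrow> 'm" where "cinv c \<equiv> inv_into (fst c) (snd c)"

definition is_chart :: "('m::topological_space,'n::finite) chart \<Rightarrow> bool" where
  "is_chart c \<longleftrightarrow> open (cdom c) \<and> open (img c) \<and> homeomorphism (cdom c) (img c) (crd c) (cinv c)"

definition compatible :: "('m::topological_space,'n::finite) chart \<Rightarrow> ('m,'n) chart \<Rightarrow> bool" where
  "compatible c d \<longleftrightarrow>
     (\<forall>i. smooth_fun_on (\<lambda>y. crd d (cinv c y) $ i) (crd c ` (cdom c \<inter> cdom d))) \<and>
     (\<forall>i. smooth_fun_on (\<lambda>y. crd c (cinv d y) $ i) (crd d ` (cdom c \<inter> cdom d)))"

text \<open>A smooth structure is a maximal smooth atlas, so its members are all the local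
  coordinate systems of the manifold.\<close>

definition smooth_structure :: "('m::topological_space,'n::finite) chart set \<Rightarrow> bool" where
  "smooth_structure \<A> \<longleftrightarrow>
     (\<forall>c\<in>\<A>. is_chart c) \<and> (\<Union>c\<in>\<A>. cdom c) = UNIV \<and> (\<forall>c\<in>\<A>. \<forall>d\<in>\<A>. compatible c d) \<and>
     (\<forall>c. is_chart c \<and> (\<forall>d\<in>\<A>. compatible c d) \<longrightarrow> c \<in> \<A>)"

definition Ck_fun :: "('m::topological_space,'n::finite) chart set \<Rightarrow> nat \<Rightarrow> ('m \<Rightarrow> real) \<Rightarrow> bool" where
  "Ck_fun \<A> k u \<longleftrightarrow> (\<forall>c\<in>\<A>. Ck_on k (\<lambda>y. u (cinv c y)) (img c))"

text \<open>Some chart around \<open>x\<close>. It is only used to define objects that do not depend on the choice.\<close>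

definition chart_at :: "('m,'n::finite) chart set \<Rightarrow> 'm \<Rightarrow> ('m,'n) chart" where
  "chart_at \<A> x = (SOME c. c \<in> \<A> \<and> x \<in> cdom c)"


section \<open>Tangent and cotangent vectors\<close>

text \<open>A tangent vector at \<open>x\<close> is the family of its coordinate vectors in all charts around \<open>x\<close>,
  related by the differentials of the coordinate changes (and \<open>0\<close> at the other charts).
  A cotangent vector is a linear functional on the tangent space (and \<open>0\<close> outside of it).
  A point of the cotangent bundle is a pair \<open>(x, \<alpha>)\<close>.\<close>

type_synonym ('m,'n) tvec = "('m,'n) chart \<Rightarrow> real^'n"
type_synonym ('m,'n) covec = "('m,'n) tvec \<Rightarrow> real"

definition tspace :: "('m,'n::finite) chart set \<Rightarrow> 'm \<Rightarrow> ('m,'n) tvec set" where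
  "tspace \<A> x = {v.
     (\<forall>c\<in>\<A>. \<forall>d\<in>\<A>. x \<in> cdom c \<longrightarrow> x \<in> cdom d \<longrightarrow>
        v d = frechet_derivative (\<lambda>y. crd d (cinv c y)) (at (crd c x)) (v c)) \<and>
     (\<forall>c. \<not> (c \<in> \<A> \<and> x \<in> cdom c) \<longrightarrow> v c = 0)}"

definition lincomb :: "real \<Rightarrow> ('m,'n::finite) tvec \<Rightarrow> real \<Rightarrow> ('m,'n) tvec \<Rightarrow> ('m,'n) tvec" where
  "lincomb r v s w = (\<lambda>c. r *\<^sub>R v c + s *\<^sub>R w c)"

text \<open>\<open>coord_vec \<A> c x j\<close> is \<open>\<partial>/\<partial>x\<^sup>j\<close> at \<open>x\<close> for the chart \<open>c\<close>.\<close>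

definition coord_vec :: "('m,'n::finite) chart set \<Rightarrow> ('m,'n) chart \<Rightarrow> 'm \<Rightarrow> 'n \<Rightarrow> ('m,'n) tvec" where
  "coord_vec \<A> c x j = (\<lambda>d. if d \<in> \<A> \<and> x \<in> cdom d
     then frechet_derivative (\<lambda>y. crd d (cinv c y)) (at (crd c x)) (axis j 1) else 0)"

definition cotspace :: "('m,'n::finite) chart set \<Rightarrow> 'm \<Rightarrow> ('m,'n) covec set" where
  "cotspace \<A> x = {\<alpha>.
     (\<forall>v\<in>tspace \<A> x. \<forall>w\<in>tspace \<A> x. \<forall>r s. \<alpha> (lincomb r v s w) = r * \<alpha> v + s * \<alpha> w) \<and>
     (\<forall>v. v \<notin> tspace \<A> x \<longrightarrow> \<alpha> v = 0)}"

definition cocomp :: "('m,'n::finite) chart set \<Rightarrow> ('m,'n) chart \<Rightarrow> 'm \<Rightarrow> ('m,'n) covec \<Rightarrow> real^'n" where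
  "cocomp \<A> c x \<alpha> = (\<chi> j. \<alpha> (coord_vec \<A> c x j))"

text \<open>The covector \<open>a\<^sub>j dx\<^sup>j\<close> at \<open>x\<close>, for the chart \<open>c\<close>.\<close>

definition covec_of :: "('m,'n::finite) chart set \<Rightarrow> ('m,'n) chart \<Rightarrow> 'm \<Rightarrow> real^'n \<Rightarrow> ('m,'n) covec" where
  "covec_of \<A> c x a = (\<lambda>v. if v \<in> tspace \<A> x then \<Sum>j\<in>UNIV. a $ j * v c $ j else 0)"

text \<open>The point of the cotangent bundle with canonical coordinates \<open>(y, a)\<close>.\<close>

definition cot_pt :: "('m,'n::finite) chart set \<Rightarrow> ('m,'n) chart \<Rightarrow> real^'n \<Rightarrow> real^'n \<Rightarrow> 'm \<times> ('m,'n) covec" where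
  "cot_pt \<A> c y a = (cinv c y, covec_of \<A> c (cinv c y) a)"

definition differential :: "('m,'n::finite) chart set \<Rightarrow> ('m \<Rightarrow> real) \<Rightarrow> 'm \<Rightarrow> ('m,'n) covec" where
  "differential \<A> u x = (let c = chart_at \<A> x in
     covec_of \<A> c x (\<chi> j. pd j (\<lambda>y. u (cinv c y)) (crd c x)))"

text \<open>\<open>second_deriv \<A> x \<psi> \<alpha> \<beta> \<gamma>\<close> is \<open>D\<^sup>2\<^sub>\<alpha>[\<psi>](\<beta>,\<gamma>)\<close>, where the cotangent space at \<open>x\<close> is
  identified with \<open>real^'n\<close> by means of a linear isomorphism.\<close>

definition second_deriv :: "('m,'n::finite) chart set \<Rightarrow> 'm \<Rightarrow> (('m,'n) covec \<Rightarrow> real) \<Rightarrow>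
    ('m,'n) covec \<Rightarrow> ('m,'n) covec \<Rightarrow> ('m,'n) covec \<Rightarrow> real" where
  "second_deriv \<A> x \<psi> \<alpha> \<beta> \<gamma> = (let c = chart_at \<A> x in
     frechet_derivative
       (\<lambda>a. frechet_derivative (\<lambda>b. \<psi> (covec_of \<A> c x b)) (at a) (cocomp \<A> c x \<gamma>))
       (at (cocomp \<A> c x \<alpha>)) (cocomp \<A> c x \<beta>))"


section \<open>Riemannian metrics\<close>

definition sym_bilinear_on :: "('m,'n::finite) tvec set \<Rightarrow> (('m,'n) tvec \<Rightarrow> ('m,'n) tvec \<Rightarrow> real) \<Rightarrow> bool" where
  "sym_bilinear_on T b \<longleftrightarrow>
     (\<forall>v\<in>T. \<forall>w\<in>T. b v w = b w v) \<and>
     (\<forall>v\<in>T. \<forall>w\<in>T. \<forall>z\<in>T. \<forall>r s. b (lincomb r v s w) z = r * b v z + s * b w z)"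

definition components :: "('m,'n::finite) chart set \<Rightarrow> ('m \<Rightarrow> ('m,'n) tvec \<Rightarrow> ('m,'n) tvec \<Rightarrow> real) \<Rightarrow>
    ('m,'n) chart \<Rightarrow> 'm \<Rightarrow> real^'n^'n" where
  "components \<A> B c x = (\<chi> j k. B x (coord_vec \<A> c x j) (coord_vec \<A> c x k))"

definition riemannian_metric :: "('m::topological_space,'n::finite) chart set \<Rightarrow>
    ('m \<Rightarrow> ('m,'n) tvec \<Rightarrow> ('m,'n) tvec \<Rightarrow> real) \<Rightarrow> bool" where
  "riemannian_metric \<A> g \<longleftrightarrow>
     (\<forall>x. sym_bilinear_on (tspace \<A> x) (g x)) \<and>
     (\<forall>x. \<forall>v\<in>tspace \<A> x. v \<noteq> (\<lambda>c. 0) \<longrightarrow> g x v v > 0) \<and>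
     (\<forall>c\<in>\<A>. \<forall>j k. smooth_fun_on (\<lambda>y. components \<A> g c (cinv c y) $ j $ k) (img c))"

definition ginv :: "('m,'n::finite) chart set \<Rightarrow> ('m \<Rightarrow> ('m,'n) tvec \<Rightarrow> ('m,'n) tvec \<Rightarrow> real) \<Rightarrow>
    ('m,'n) chart \<Rightarrow> 'm \<Rightarrow> real^'n^'n" where
  "ginv \<A> g c x = matrix_inv (components \<A> g c x)"

definition conorm :: "('m,'n::finite) chart set \<Rightarrow> ('m \<Rightarrow> ('m,'n) tvec \<Rightarrow> ('m,'n) tvec \<Rightarrow> real) \<Rightarrow>
    'm \<Rightarrow> ('m,'n) covec \<Rightarrow> real" where
  "conorm \<A> g x \<alpha> = (let c = chart_at \<A> x; a = cocomp \<A> c x \<alpha> in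
     sqrt (\<Sum>j\<in>UNIV. \<Sum>k\<in>UNIV. ginv \<A> g c x $ j $ k * a $ j * a $ k))"

text \<open>\<open>christoffel \<A> g c x l j k\<close> is \<open>\<Gamma>\<^sup>l\<^sub>j\<^sub>k(x)\<close>.\<close>

definition christoffel :: "('m,'n::finite) chart set \<Rightarrow> ('m \<Rightarrow> ('m,'n) tvec \<Rightarrow> ('m,'n) tvec \<Rightarrow> real) \<Rightarrow>
    ('m,'n) chart \<Rightarrow> 'm \<Rightarrow> 'n \<Rightarrow> 'n \<Rightarrow> 'n \<Rightarrow> real" where
  "christoffel \<A> g c x l j k = (let G = (\<lambda>r s y. components \<A> g c (cinv c y) $ r $ s) in
     1/2 * (\<Sum>m\<in>UNIV. ginv \<A> g c x $ l $ m *
       (pd j (G m k) (crd c x) + pd k (G j m) (crd c x) - pd m (G j k) (crd c x))))"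

text \<open>The Hessian \<open>(\<partial>\<^sub>j\<partial>\<^sub>k u - \<Gamma>\<^sup>l\<^sub>j\<^sub>k \<partial>\<^sub>l u) v\<^sup>j w\<^sup>k\<close> for the Levi-Civita connection.\<close>

definition hessian :: "('m,'n::finite) chart set \<Rightarrow> ('m \<Rightarrow> ('m,'n) tvec \<Rightarrow> ('m,'n) tvec \<Rightarrow> real) \<Rightarrow>
    ('m \<Rightarrow> real) \<Rightarrow> 'm \<Rightarrow> ('m,'n) tvec \<Rightarrow> ('m,'n) tvec \<Rightarrow> real" where
  "hessian \<A> g u x v w = (let c = chart_at \<A> x; U = (\<lambda>y. u (cinv c y)) in
     \<Sum>j\<in>UNIV. \<Sum>k\<in>UNIV.
       (pd j (pd k U) (crd c x) - (\<Sum>l\<in>UNIV. christoffel \<A> g c x l j k * pd l U (crd c x)))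
       * v c $ j * w c $ k)"


section \<open>Elementary symmetric functions of eigenvalues\<close>

text \<open>Vectors in \<open>\<real>\<^sup>n\<close> whose entries are ordered are lists of length \<open>n\<close>.\<close>

definition esym :: "nat \<Rightarrow> real list \<Rightarrow> real" where
  "esym p \<mu> = (\<Sum>J | J \<subseteq> {..<length \<mu>} \<and> card J = p. \<Prod>j\<in>J. \<mu> ! j)"

definition Gamma_cone :: "nat \<Rightarrow> nat \<Rightarrow> real list set" where
  "Gamma_cone n p = {\<mu>. length \<mu> = n \<and> (\<forall>q\<in>{1..p}. esym q \<mu> > 0)}"

text \<open>The eigenvalues, repeated according to multiplicity and in non-decreasing order, of a
  square matrix all of whose eigenvalues are real.\<close>

definition eigenvalues :: "real^'n^'n::finite \<Rightarrow> real list" where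
  "eigenvalues B = (THE l. sorted l \<and> length l = CARD('n) \<and>
     (\<forall>s. det (mat s - B) = (\<Prod>r\<leftarrow>l. s - r)))"

definition lambda_vec :: "('m,'n::finite) chart set \<Rightarrow> ('m \<Rightarrow> ('m,'n) tvec \<Rightarrow> ('m,'n) tvec \<Rightarrow> real) \<Rightarrow>
    ('m \<Rightarrow> ('m,'n) tvec \<Rightarrow> ('m,'n) tvec \<Rightarrow> real) \<Rightarrow> ('m,'n) chart \<Rightarrow> 'm \<Rightarrow> real list" where
  "lambda_vec \<A> g B c x = eigenvalues (ginv \<A> g c x ** components \<A> B c x)"


section \<open>The equation\<close>

type_synonym ('m,'n) cotform =
  "'m \<times> ('m,'n) covec \<Rightarrow> real \<Rightarrow> ('m,'n) tvec \<Rightarrow> ('m,'n) tvec \<Rightarrow> real"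
type_synonym ('m,'n) cotfun = "'m \<times> ('m,'n) covec \<Rightarrow> real \<Rightarrow> real"

definition form_component :: "('m,'n::finite) chart set \<Rightarrow> ('m,'n) cotform \<Rightarrow> ('m,'n) chart \<Rightarrow>
    'n \<Rightarrow> 'n \<Rightarrow> ('m,'n) cotfun" where
  "form_component \<A> A c r s P t = A P t (coord_vec \<A> c (fst P) r) (coord_vec \<A> c (fst P) s)"

definition smooth_cotfun_in :: "('m,'n::finite) chart set \<Rightarrow> ('m,'n) chart \<Rightarrow> ('m,'n) cotfun \<Rightarrow> bool" where
  "smooth_cotfun_in \<A> c f \<longleftrightarrow>
     smooth_fun_on (\<lambda>(y, a, t). f (cot_pt \<A> c y a) t) (img c \<times> UNIV \<times> UNIV)"

definition smooth_cotform :: "('m,'n::finite) chart set \<Rightarrow> ('m,'n) cotform \<Rightarrow> bool" where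
  "smooth_cotform \<A> A \<longleftrightarrow>
     (\<forall>x. \<forall>\<alpha>\<in>cotspace \<A> x. \<forall>t. sym_bilinear_on (tspace \<A> x) (A (x, \<alpha>) t)) \<and>
     (\<forall>c\<in>\<A>. \<forall>r s. smooth_cotfun_in \<A> c (form_component \<A> A c r s))"

definition pos_smooth_cotfun :: "('m,'n::finite) chart set \<Rightarrow> ('m,'n) cotfun \<Rightarrow> bool" where
  "pos_smooth_cotfun \<A> \<phi> \<longleftrightarrow>
     (\<forall>x. \<forall>\<alpha>\<in>cotspace \<A> x. \<forall>t. \<phi> (x, \<alpha>) t > 0) \<and>
     (\<forall>c\<in>\<A>. smooth_cotfun_in \<A> c \<phi>)"

definition solves_hessian_eq :: "('m,'n::finite) chart set \<Rightarrow>
    ('m \<Rightarrow> ('m,'n) tvec \<Rightarrow> ('m,'n) tvec \<Rightarrow> real) \<Rightarrow> nat \<Rightarrow>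
    ('m,'n) cotform \<Rightarrow> ('m,'n) cotfun \<Rightarrow> ('m \<Rightarrow> real) \<Rightarrow> bool" where
  "solves_hessian_eq \<A> g p A \<phi> u \<longleftrightarrow>
     (let B = (\<lambda>x v w. A (x, differential \<A> u x) (u x) v w + hessian \<A> g u x v w) in
      \<forall>x. \<forall>c\<in>\<A>. x \<in> cdom c \<longrightarrow>
        root p (esym p (lambda_vec \<A> g B c x)) = \<phi> (x, differential \<A> u x) (u x) \<and>
        lambda_vec \<A> g B c x \<in> Gamma_cone CARD('n) p)"


section \<open>Derivatives on the cotangent bundle\<close>

text \<open>\<open>horizontal\<close> is the common part \<open>\<partial>f/\<partial>x\<^sup>j + \<Gamma>\<^sup>l\<^sub>j\<^sub>m (\<partial>f/\<partial>\<alpha>\<^sub>m) \<alpha>\<^sub>l\<close> of the two derivatives below; for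
  \<open>f = \<phi>\<close> it is the whole derivative.\<close>

definition horizontal :: "('m,'n::finite) chart set \<Rightarrow> ('m \<Rightarrow> ('m,'n) tvec \<Rightarrow> ('m,'n) tvec \<Rightarrow> real) \<Rightarrow>
    ('m,'n) chart \<Rightarrow> 'n \<Rightarrow> ('m,'n) cotfun \<Rightarrow> 'm \<Rightarrow> ('m,'n) covec \<Rightarrow> real \<Rightarrow> real" where
  "horizontal \<A> g c j f x \<alpha> t = (let a = cocomp \<A> c x \<alpha> in
     pd j (\<lambda>y. f (cot_pt \<A> c y a) t) (crd c x) +
     (\<Sum>l\<in>UNIV. \<Sum>m\<in>UNIV. christoffel \<A> g c x l j m *
        pd m (\<lambda>b. f (cot_pt \<A> c (crd c x) b) t) a * a $ l))"

definition horizontal_form :: "('m,'n::finite) chart set \<Rightarrow>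
    ('m \<Rightarrow> ('m,'n) tvec \<Rightarrow> ('m,'n) tvec \<Rightarrow> real) \<Rightarrow>
    ('m,'n) chart \<Rightarrow> 'n \<Rightarrow> ('m,'n) cotform \<Rightarrow> 'n \<Rightarrow> 'n \<Rightarrow> 'm \<Rightarrow> ('m,'n) covec \<Rightarrow> real \<Rightarrow> real" where
  "horizontal_form \<A> g c j A r s x \<alpha> t =
     horizontal \<A> g c j (form_component \<A> A c r s) x \<alpha> t
     - (\<Sum>q\<in>UNIV. christoffel \<A> g c x q r j * form_component \<A> A c q s (x, \<alpha>) t)
     - (\<Sum>q\<in>UNIV. christoffel \<A> g c x q s j * form_component \<A> A c r q (x, \<alpha>) t)"


section \<open>Function classes in the structure conditions\<close>

definition class_W :: "(real \<Rightarrow> real) set" where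
  "class_W = {\<omega>. continuous_on {0..} \<omega> \<and> (\<forall>t\<ge>0. \<omega> t \<ge> 0) \<and>
     ((\<lambda>t. \<omega> t / t) \<longlongrightarrow> 0) at_top \<and> (\<forall>t\<ge>0. \<omega> t - t \<le> 1)}"

definition nonneg_cont :: "('m::topological_space \<Rightarrow> real \<Rightarrow> real) \<Rightarrow> bool" where
  "nonneg_cont \<phi> \<longleftrightarrow> continuous_on UNIV (\<lambda>(x, t). \<phi> x t) \<and> (\<forall>x t. \<phi> x t \<ge> 0)"

end

theory Submission
  imports Defs "HOL-Computational_Algebra.Fundamental_Theorem_Algebra"
begin

text \<open>The estimate is an application of the maximum principle to \<open>v / \<zeta>(u)\<close>, where \<open>v = |du|\<^sup>2\<close> and
  \<open>\<zeta>\<close> is a positive function of one real variable. On the range of \<open>u\<close> the function \<open>\<zeta>\<close> lies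
  between positive constants, so a bound for \<open>v\<close> at a maximum point \<open>x\<^sub>0\<close> of the quotient bounds
  \<open>v\<close> everywhere (\<open>exists_maximum\<close>). On this range the continuous coefficient functions
  of the structure conditions are bounded by constants.

  Let \<open>h = - \<zeta>'(u) / (2 \<zeta>(u))\<close>. The vanishing of the first derivatives at \<open>x\<^sub>0\<close> reads
  \<open>\<nabla>\<^sup>2u(\<nabla>u, \<cdot>) = - h v du\<close>. So in the direction of \<open>\<nabla>u\<close> the Hessian has the eigenvalue
  \<open>- h v\<close>, which by (i) dominates the contribution of \<open>A\<close> for large \<open>v\<close>. Write \<open>B = A(du, u) + \<nabla>\<^sup>2u\<close>. If \<open>p = n\<close>,
  then all eigenvalues of \<open>B\<close> are positive, and with \<open>\<zeta>(t) = exp (- L t)\<close> and \<open>L\<close> large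
  this contradicts the negativity of \<open>B(\<nabla>u, \<nabla>u)\<close> unless \<open>v \<le> 1\<close> (\<open>gradient_bound_full\<close>).

  For general \<open>p\<close> this negativity is not a contradiction, but it makes the equation elliptic in the
  direction of \<open>\<nabla>u\<close>. Let \<open>\<mu>\<^sub>i\<close> be the eigenvalues of \<open>B\<close>, let
  \<open>T\<^sub>i\<close> be the derivative of \<open>\<sigma>\<^sub>p\<close> in \<open>\<mu>\<^sub>i\<close>, and let \<open>T = \<Sum> w\<^sub>i T\<^sub>i\<close>, where \<open>w\<^sub>i\<close> are the
  squares of the components of \<open>\<nabla>u / |\<nabla>u|\<close> in an eigenbasis. Small \<open>\<mu>\<^sub>i\<close> come with large \<open>T\<^sub>i\<close>,
  and \<open>\<Sum> w\<^sub>i \<mu>\<^sub>i \<le> - h v / 2\<close>; so Chebyshev's sum inequality makes \<open>T\<close> large. It dominates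
  \<open>(h v / 2)\<^sup>p\<^sup>-\<^sup>1\<close>, \<open>\<phi>\<^sup>p\<^sup>-\<^sup>1\<close> and the trace \<open>\<Sum> T\<^sub>i\<close> divided by \<open>n\<close> (\<open>linearised_operator_bounds\<close>). The second
  order conditions at \<open>x\<^sub>0\<close> (\<open>maximum_conditions\<close>) are summed with the weights \<open>T\<^sub>i\<close>. The third
  derivatives of \<open>u\<close> are removed by the equation, differentiated in the direction \<open>\<nabla>u\<close>
  (\<open>symf_eigenvalues_line\<close>), and by the Ricci identity, at the cost of a bounded curvature term. With
  \<open>\<zeta>(t) = (C - exp (L t))\<^sup>2\<close> the result is \<open>L h v\<^sup>2 T \<le> \<dots>\<close>, with terms on the right that contain
  \<open>A\<close>, \<open>\<phi>\<close> and their first derivatives (\<open>key_inequality\<close>).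

  By homogeneity, \<open>\<Sum> T\<^sub>i \<mu>\<^sub>i = p \<sigma>\<^sub>p = p \<phi>\<^sup>p\<close>. Therefore the derivatives
  of \<open>A\<close> and \<open>\<phi>\<close> along the fibre, in the direction \<open>\<alpha> = du\<close>, appear only after subtraction of \<open>A\<close> and
  \<open>\<phi>\<close> themselves. Conditions (iv) and (vi) control exactly these differences, since
  \<open>\<integral> \<theta> f''(\<theta>) d\<theta> = f'(1) - f(1) + f(0)\<close> for \<open>\<theta>\<close> from \<open>0\<close> to \<open>1\<close>, with \<open>f(\<theta>) = A(\<theta>\<alpha>, t)(v, v)\<close> and \<open>f(\<theta>) = \<phi>(\<theta>\<alpha>, t)\<close>.

  Every term on the right is at most a fixed multiple of \<open>h v\<^sup>2 T\<close> or of smaller order than \<open>v\<^sup>2 T\<close>.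
  One chooses \<open>L\<close> to beat the multiples, which settles \<open>\<zeta>\<close> and bounds \<open>h\<close> from below; then \<open>v\<close>
  cannot exceed a bound found from the sublinear growth of the \<open>\<omega>\<^sub>i\<close> (\<open>numeric_contradiction\<close>,
  \<open>maximum_point_bound\<close>, \<open>gradient_bound_general\<close>).

  The calculations are done in one chart around \<open>x\<^sub>0\<close>. This is legitimate because the Hessian at a
  point may be computed in any chart (\<open>Hs_jac\<close>).\<close>

section \<open>Elementary symmetric functions\<close>

text \<open>Over an index set, in contrast to a list, the deletion of an index is simply \<open>symf k (I - {i}) f\<close>.
  This is the derivative of \<open>symf (Suc k) I f\<close> in the variable \<open>f i\<close>.\<close>
definition symf :: "nat \<Rightarrow> 'i set \<Rightarrow> ('i \<Rightarrow> real) \<Rightarrow> real" where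
  "symf k I f = (\<Sum>J | J \<subseteq> I \<and> card J = k. \<Prod>j\<in>J. f j)"

lemma symf_0: "finite I \<Longrightarrow> symf 0 I f = 1"
proof -
  assume "finite I"
  hence "{J. J \<subseteq> I \<and> card J = 0} = {{}}" by (auto dest: finite_subset)
  thus ?thesis by (simp add: symf_def)
qed

lemma symf_empty: "symf (Suc k) {} f = 0"
  by (simp add: symf_def)

lemma symf_insert:
  assumes "finite I" "i \<notin> I"
  shows "symf (Suc k) (insert i I) f = f i * symf k I f + symf (Suc k) I f"
proof -
  have eq: "{J. J \<subseteq> insert i I \<and> card J = Suc k} =
      insert i ` {J. J \<subseteq> I \<and> card J = k} \<union> {J. J \<subseteq> I \<and> card J = Suc k}" (is "?L = ?A \<union> ?B")
  proof
    show "?L \<subseteq> ?A \<union> ?B"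
    proof
      fix J assume J: "J \<in> ?L"
      show "J \<in> ?A \<union> ?B"
      proof (cases "i \<in> J")
        case True
        have "finite J" using J assms finite_subset by (metis (mono_tags) finite_insert mem_Collect_eq)
        hence "J = insert i (J - {i})" "J - {i} \<subseteq> I" "card (J - {i}) = k" using J True by auto
        thus ?thesis by blast
      qed (use J in auto)
    qed
    show "?A \<union> ?B \<subseteq> ?L"
    proof
      fix J assume "J \<in> ?A \<union> ?B"
      then show "J \<in> ?L"
      proof
        assume "J \<in> ?A"
        then obtain L where "L \<subseteq> I" "card L = k" "J = insert i L" by auto
        then show ?thesis using assms by (auto simp: finite_subset card_insert_if)
      qed auto
    qed
  qed
  have dis: "?A \<inter> ?B = {}" using assms by auto
  have fin: "finite ?A" "finite ?B" using assms by auto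
  have inj: "inj_on (insert i) {J. J \<subseteq> I \<and> card J = k}"
    using assms by (auto simp: inj_on_def)
  have "symf (Suc k) (insert i I) f = (\<Sum>J\<in>?A. \<Prod>j\<in>J. f j) + (\<Sum>J\<in>?B. \<Prod>j\<in>J. f j)"
    unfolding symf_def eq by (rule sum.union_disjoint[OF fin dis])
  also have "(\<Sum>J\<in>?A. \<Prod>j\<in>J. f j) = (\<Sum>J | J \<subseteq> I \<and> card J = k. \<Prod>j\<in>insert i J. f j)"
    using inj by (simp add: sum.reindex)
  also have "\<dots> = (\<Sum>J | J \<subseteq> I \<and> card J = k. f i * (\<Prod>j\<in>J. f j))"
    using assms by (intro sum.cong) (auto simp: finite_subset subset_iff dest: finite_subset intro!: prod.insert)
  finally show ?thesis by (simp add: symf_def sum_distrib_left)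
qed

lemma symf_remove:
  assumes "finite I" "i \<in> I"
  shows "symf (Suc k) I f = f i * symf k (I - {i}) f + symf (Suc k) (I - {i}) f"
  using symf_insert[of "I - {i}" i k f] assms by (simp add: insert_absorb)

lemma symf_reindex:
  assumes "bij_betw h I J"
  shows "symf k J f = symf k I (f \<circ> h)"
proof -
  have inj: "inj_on h I" and J: "J = h ` I" using assms by (auto simp: bij_betw_def)
  have "bij_betw (\<lambda>S. h ` S) {S. S \<subseteq> I \<and> card S = k} {S. S \<subseteq> J \<and> card S = k}"
  proof (rule bij_betw_imageI)
    show "inj_on ((`) h) {S. S \<subseteq> I \<and> card S = k}"
      using inj by (auto simp: inj_on_def) (metis inj inj_on_image_eq_iff)+
    show "(`) h ` {S. S \<subseteq> I \<and> card S = k} = {S. S \<subseteq> J \<and> card S = k}"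
    proof safe
      fix S assume "S \<subseteq> J"
      then obtain T where T: "T \<subseteq> I" "S = h ` T" unfolding J by (meson subset_imageE)
      have "card T = card S" using T inj by (metis card_image inj_on_subset)
      thus "S \<in> (`) h ` {S'. S' \<subseteq> I \<and> card S' = card S}" using T by auto
    next
      fix S assume "S \<subseteq> I" thus "card (h ` S) = card S" using inj by (meson card_image inj_on_subset)
    qed (auto simp: J)
  qed
  then have "(\<Sum>S | S \<subseteq> J \<and> card S = k. \<Prod>j\<in>S. f j) = (\<Sum>S | S \<subseteq> I \<and> card S = k. \<Prod>j\<in>h ` S. f j)"
    by (rule sum.reindex_bij_betw[symmetric])
  also have "\<dots> = (\<Sum>S | S \<subseteq> I \<and> card S = k. \<Prod>j\<in>S. (f \<circ> h) j)"
    using inj by (intro sum.cong refl) (auto simp: prod.reindex inj_on_subset)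
  finally show ?thesis by (simp add: symf_def)
qed

lemma coeff_prod_symf:
  assumes "finite I"
  shows "coeff (\<Prod>i\<in>I. [:1, of_real (f i) :: 'a::real_field:]) k = of_real (symf k I f)"
  using assms
proof (induction I arbitrary: k rule: finite_induct)
  case empty
  show ?case by (cases k) (simp_all add: symf_0 symf_empty)
next
  case (insert i I)
  show ?case
    by (cases k) (simp_all add: insert symf_0 symf_insert coeff_pCons)
qed

lemma symf_gt_card:
  assumes "finite I" "card I < k" shows "symf k I f = 0"
proof -
  have "card J < k" if "J \<subseteq> I" for J
    using card_mono[OF assms(1) that] assms(2) by linarith
  then have "{J. J \<subseteq> I \<and> card J = k} = {}" by blast
  thus ?thesis unfolding symf_def by (simp only: sum.empty)
qed

lemma prod_eq_symf:
  assumes "finite I"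
  shows "(\<Prod>i\<in>I. 1 + s * f i) = (\<Sum>k\<le>card I. symf k I f * s ^ k)"
proof -
  define P where "P = (\<Prod>i\<in>I. [:1, f i:])"
  have co: "coeff P k = symf k I f" for k
    using coeff_prod_symf[OF assms, of f k, where 'a = real] by (simp add: P_def)
  have "degree P \<le> card I"
    by (rule degree_le) (auto simp: co assms symf_gt_card)
  then have "poly P s = (\<Sum>k\<le>card I. coeff P k * s ^ k)"
    unfolding poly_altdef by (intro sum.mono_neutral_left) (auto simp: coeff_eq_0)
  moreover have "poly P s = (\<Prod>i\<in>I. 1 + s * f i)" by (simp add: P_def poly_prod)
  ultimately show ?thesis by (simp add: co)
qed

text \<open>Complex coefficients make every such polynomial a product of linear factors. The zero polynomial
  is excluded, as all numbers are its roots.\<close>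
definition all_roots_real :: "complex poly \<Rightarrow> bool" where
  "all_roots_real P \<longleftrightarrow> P \<noteq> 0 \<and> (\<forall>z. poly P z = 0 \<longrightarrow> Im z = 0)"

text \<open>The logarithmic derivative is \<open>\<Sum> 1 / (z - a)\<close>, and for real \<open>a\<close> each summand has an imaginary part
  of the sign opposite to \<open>Im z\<close>. So it vanishes nowhere off the real axis, which is the theorem of
  Gauss and Lucas for polynomials with real roots.\<close>
lemma Im_log_deriv_sign:
  fixes A :: "complex multiset"
  assumes "\<forall>a\<in>#A. Im a = 0" "Im z \<noteq> 0"
  defines "P \<equiv> (\<Prod>x\<in>#A. [:-x, 1:])"
  shows "poly P z \<noteq> 0 \<and> Im z * Im (poly (pderiv P) z / poly P z) \<le> 0 \<and>
         (A \<noteq> {#} \<longrightarrow> Im z * Im (poly (pderiv P) z / poly P z) < 0)"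
  using assms(1) unfolding P_def
proof (induction A)
  case empty
  then show ?case by (simp add: pderiv_1)
next
  case (add a A)
  let ?Q = "\<Prod>x\<in>#A. [:-x, 1:]"
  have IH: "poly ?Q z \<noteq> 0" "Im z * Im (poly (pderiv ?Q) z / poly ?Q z) \<le> 0"
    using add by auto
  have za: "z - a \<noteq> 0" "Im (z - a) = Im z" using add.prems assms(2) by auto
  have eq: "poly (pderiv (\<Prod>x\<in>#add_mset a A. [:-x, 1:])) z / poly (\<Prod>x\<in>#add_mset a A. [:-x, 1:]) z
      = 1 / (z - a) + poly (pderiv ?Q) z / poly ?Q z"
  proof -
    have "pderiv (\<Prod>x\<in>#add_mset a A. [:-x, 1:]) = ?Q + [:-a, 1:] * pderiv ?Q"
      by (simp only: image_mset_add_mset prod_mset.add_mset pderiv_mult) (simp add: pderiv_pCons)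
    then have "poly (pderiv (\<Prod>x\<in>#add_mset a A. [:-x, 1:])) z = poly ?Q z + (z - a) * poly (pderiv ?Q) z"
      by (simp only: poly_add poly_mult) simp
    moreover have "poly (\<Prod>x\<in>#add_mset a A. [:-x, 1:]) z = (z - a) * poly ?Q z"
      by (simp only: image_mset_add_mset prod_mset.add_mset poly_mult) simp
    ultimately show ?thesis using IH(1) za(1) by (simp add: add_divide_distrib)
  qed
  have "Im (1 / (z - a)) = - Im z / (cmod (z - a))\<^sup>2"
    using za by (simp add: Im_divide cmod_power2)
  then have "Im z * Im (1 / (z - a)) = - ((Im z)\<^sup>2 / (cmod (z - a))\<^sup>2)"
    by (simp add: power2_eq_square)
  also have "\<dots> < 0" using assms(2) za by simp
  finally have "Im z * Im (1 / (z - a)) < 0" .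
  then have "Im z * Im (1 / (z - a) + poly (pderiv ?Q) z / poly ?Q z) < 0"
    using IH(2) by (simp add: distrib_left)
  moreover have "poly (\<Prod>x\<in>#add_mset a A. [:-x, 1:]) z \<noteq> 0" using IH(1) za(1) by simp
  ultimately show ?case unfolding eq by simp
qed

lemma all_roots_real_factorization:
  assumes "all_roots_real P"
  obtains A where "\<forall>a\<in>#A. Im a = 0" "size A = degree P"
    "P = smult (lead_coeff P) (\<Prod>x\<in>#A. [:-x, 1:])"
proof -
  from assms have "P \<noteq> 0" by (simp add: all_roots_real_def)
  then obtain A where A: "size A = degree P" "P = smult (lead_coeff P) (\<Prod>x\<in>#A. [:-x, 1:])"
    using alg_closed_imp_factorization by blast
  have "Im a = 0" if mem: "a \<in># A" for a
  proof -
    obtain B where "A = add_mset a B" using mem by (blast dest: multi_member_split)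
    then have "poly (\<Prod>x\<in>#A. [:-x, 1:]) a = 0" by simp
    then have "poly P a = 0" by (subst A(2)) simp
    then show ?thesis using assms by (simp add: all_roots_real_def)
  qed
  with A that show ?thesis by blast
qed

lemma all_roots_real_pderiv:
  assumes "all_roots_real P" "pderiv P \<noteq> 0"
  shows "all_roots_real (pderiv P)"
  unfolding all_roots_real_def
proof (intro conjI allI impI, fact, rule ccontr)
  fix z assume z: "poly (pderiv P) z = 0" "Im z \<noteq> 0"
  obtain A where A: "\<forall>a\<in>#A. Im a = 0" "size A = degree P"
    "P = smult (lead_coeff P) (\<Prod>x\<in>#A. [:-x, 1:])"
    using all_roots_real_factorization[OF assms(1)] by blast
  have "degree P \<noteq> 0" using assms(2) by (simp add: pderiv_eq_0_iff)
  then have ne: "A \<noteq> {#}" using A(2) by auto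
  have "poly (pderiv (\<Prod>x\<in>#A. [:-x, 1:])) z \<noteq> 0"
    using Im_log_deriv_sign[OF A(1) z(2)] ne by auto
  moreover have "lead_coeff P \<noteq> 0" using assms(1) by (simp add: all_roots_real_def)
  moreover have "poly (pderiv P) z = lead_coeff P * poly (pderiv (\<Prod>x\<in>#A. [:-x, 1:])) z"
    by (subst A(3)) (simp add: pderiv_smult)
  ultimately show False using z by auto
qed

text \<open>The inequality survives multiplication by \<open>x - r\<close>, because
  \<open>(c0 - r c1)\<^sup>2 - 2 (- r c0) (c1 - r c2) = c0\<^sup>2 + r\<^sup>2 (c1\<^sup>2 - 2 c0 c2)\<close>.\<close>
lemma laguerre_at_0:
  fixes A :: "complex multiset"
  assumes "\<forall>a\<in>#A. Im a = 0"
  defines "P \<equiv> (\<Prod>x\<in>#A. [:-x, 1:])"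
  shows "\<exists>c0 c1 c2. coeff P 0 = complex_of_real c0 \<and> coeff P 1 = complex_of_real c1 \<and>
    coeff P 2 = complex_of_real c2 \<and> 2 * c0 * c2 \<le> c1\<^sup>2"
  using assms(1) unfolding P_def
proof (induction A)
  case empty
  show ?case by (rule exI[of _ 1], rule exI[of _ 0], rule exI[of _ 0]) simp
next
  case (add a A)
  let ?Q = "\<Prod>x\<in>#A. [:-x, 1:]"
  from add obtain c0 c1 c2 where c: "coeff ?Q 0 = complex_of_real c0" "coeff ?Q 1 = complex_of_real c1"
    "coeff ?Q 2 = complex_of_real c2" "2 * c0 * c2 \<le> c1\<^sup>2" by auto
  obtain r where r: "a = complex_of_real r"
    using add.prems by (metis complex_is_Real_iff Reals_cases union_single_eq_member)
  have e: "(\<Prod>x\<in>#add_mset a A. [:-x, 1:]) = smult (-a) ?Q + pCons 0 ?Q" by simp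
  have "0 \<le> c0\<^sup>2 + r\<^sup>2 * (c1\<^sup>2 - 2 * c0 * c2)" using c(4) by simp
  then have "2 * (- r * c0) * (c1 - r * c2) \<le> (c0 - r * c1)\<^sup>2"
    by (simp add: power2_eq_square algebra_simps)
  moreover have "coeff (smult (-a) ?Q + pCons 0 ?Q) 0 = complex_of_real (- r * c0)"
    using c r by simp
  moreover have "coeff (smult (-a) ?Q + pCons 0 ?Q) 1 = complex_of_real (c0 - r * c1)"
    using c r by (simp add: coeff_pCons)
  moreover have "coeff (smult (-a) ?Q + pCons 0 ?Q) 2 = complex_of_real (c1 - r * c2)"
    using c r by (simp add: coeff_pCons numeral_2_eq_2)
  ultimately show ?case unfolding e by blast
qed

lemma newton_all_roots_real:
  assumes "all_roots_real P" "coeff P 0 = complex_of_real p0" "coeff P 1 = complex_of_real p1"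
    "coeff P 2 = complex_of_real p2" "Im (lead_coeff P) = 0"
  shows "2 * p0 * p2 \<le> p1\<^sup>2"
proof -
  obtain A where A: "\<forall>a\<in>#A. Im a = 0" "size A = degree P"
    "P = smult (lead_coeff P) (\<Prod>x\<in>#A. [:-x, 1:])"
    using all_roots_real_factorization[OF assms(1)] by blast
  obtain c0 c1 c2 where c: "coeff (\<Prod>x\<in>#A. [:-x, 1:]) 0 = complex_of_real c0"
    "coeff (\<Prod>x\<in>#A. [:-x, 1:]) 1 = complex_of_real c1"
    "coeff (\<Prod>x\<in>#A. [:-x, 1:]) 2 = complex_of_real c2" "2 * c0 * c2 \<le> c1\<^sup>2"
    using laguerre_at_0[OF A(1)] by blast
  define l where "l = Re (lead_coeff P)"
  have l: "lead_coeff P = complex_of_real l" using assms(5) by (simp add: l_def complex_eq_iff)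
  have "coeff P k = complex_of_real l * coeff (\<Prod>x\<in>#A. [:-x, 1:]) k" for k
    by (metis A(3) coeff_smult l)
  then have "complex_of_real p0 = complex_of_real (l * c0)" "complex_of_real p1 = complex_of_real (l * c1)"
    "complex_of_real p2 = complex_of_real (l * c2)"
    using c assms by (metis of_real_mult)+
  then have "p0 = l * c0" "p1 = l * c1" "p2 = l * c2" using of_real_eq_iff by blast+
  moreover have "l\<^sup>2 * (2 * c0 * c2) \<le> l\<^sup>2 * c1\<^sup>2" using c(4) by (simp add: mult_left_mono)
  ultimately show ?thesis by (simp add: power2_eq_square algebra_simps)
qed

text \<open>The \<open>k\<close>-th derivative of \<open>\<Prod> (1 + f\<^sub>i x)\<close> has only real roots, and its three lowest coefficients are
  factorial multiples of \<open>\<sigma>\<^sub>k\<close>, \<open>\<sigma>\<^sub>k\<^sub>+\<^sub>1\<close> and \<open>\<sigma>\<^sub>k\<^sub>+\<^sub>2\<close>. The factorials leave a constant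
  \<open>(k + 1) / (k + 2)\<close> on the right, which is weakened to \<open>1\<close>.\<close>
lemma newton_symf:
  assumes fin: "finite I"
  shows "symf k I f * symf (Suc (Suc k)) I f \<le> (symf (Suc k) I f)\<^sup>2"
proof -
  define P where "P = (\<Prod>i\<in>I. [:1, complex_of_real (f i):])"
  have co: "coeff P j = complex_of_real (symf j I f)" for j
    by (simp add: P_def coeff_prod_symf fin)
  have "coeff P 0 = 1" using fin by (simp add: co symf_0)
  then have P0: "all_roots_real P"
    unfolding all_roots_real_def
  proof (intro conjI allI impI)
    fix z assume "poly P z = 0"
    then obtain i where "i \<in> I" "1 + z * complex_of_real (f i) = 0"
      using fin by (auto simp: poly_prod P_def)
    hence "Re (1 + z * complex_of_real (f i)) = 0" "Im (1 + z * complex_of_real (f i)) = 0" by simp_all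
    thus "Im z = 0" by auto
  qed auto
  have rr: "(pderiv ^^ j) P = 0 \<or> all_roots_real ((pderiv ^^ j) P)" for j
    by (induction j) (use P0 all_roots_real_pderiv in auto)
  define Q where "Q = (pderiv ^^ k) P"
  define e where "e = (\<lambda>j. symf j I f)"
  have cQ: "coeff Q j = complex_of_real (pochhammer (of_nat (Suc j)) k * e (j + k))" for j
    by (simp add: Q_def coeff_higher_pderiv co e_def pochhammer_of_real[symmetric])
  have pc: "pochhammer (1::real) k = fact k" "pochhammer (2::real) k = fact (Suc k)"
    "2 * pochhammer (3::real) k = fact (Suc (Suc k))"
    using pochhammer_rec[of "1::real" k] pochhammer_rec[of "1::real" "Suc k"]
      pochhammer_rec[of "2::real" k]
    by (simp_all add: pochhammer_fact[symmetric])
  have "2 * (pochhammer 1 k * e k) * (pochhammer 3 k * e (2 + k)) \<le> (pochhammer 2 k * e (1 + k))\<^sup>2"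
  proof (cases "Q = 0")
    case True
    then have "pochhammer 1 k * e k = 0" using cQ[of 0]
      by (metis (mono_tags, lifting) add_0 coeff_0 of_nat_1 of_real_eq_0_iff One_nat_def)
    then show ?thesis by (simp only: mult_zero_right mult_zero_left zero_le_power2)
  next
    case False
    then have "all_roots_real Q" using rr[of k] by (simp add: Q_def)
    moreover have "Im (lead_coeff Q) = 0" unfolding cQ by simp
    ultimately show ?thesis
      using newton_all_roots_real[of Q "pochhammer 1 k * e k" "pochhammer 2 k * e (1 + k)" "pochhammer 3 k * e (2 + k)"]
        cQ[of 0] cQ[of 1] cQ[of 2] by simp
  qed
  then have "fact k * e k * fact (Suc (Suc k)) * e (Suc (Suc k)) \<le> (fact (Suc k) * e (Suc k))\<^sup>2"
    unfolding pc[symmetric] by (simp add: algebra_simps power2_eq_square)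
  then have "(fact k)\<^sup>2 * ((1 + real k) * (2 + real k) * (e k * e (Suc (Suc k))))
      \<le> (fact k)\<^sup>2 * ((1 + real k) * (1 + real k) * (e (Suc k))\<^sup>2)"
    by (simp add: algebra_simps power2_eq_square)
  then have "(1 + real k) * ((2 + real k) * (e k * e (Suc (Suc k)))) \<le> (1 + real k) * ((1 + real k) * (e (Suc k))\<^sup>2)"
    by (simp add: mult.assoc)
  then have ineq: "(2 + real k) * (e k * e (Suc (Suc k))) \<le> (1 + real k) * (e (Suc k))\<^sup>2"
    by (subst (asm) mult_le_cancel_left_pos) auto
  show ?thesis
  proof (cases "e k * e (Suc (Suc k)) \<le> 0")
    case True
    then show ?thesis by (smt (verit) e_def zero_le_power2)
  next
    case False
    then have "(1 + real k) * (e k * e (Suc (Suc k))) \<le> (2 + real k) * (e k * e (Suc (Suc k)))"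
      by (intro mult_right_mono) auto
    with ineq have "(1 + real k) * (e k * e (Suc (Suc k))) \<le> (1 + real k) * (e (Suc k))\<^sup>2" by linarith
    then show ?thesis by (subst (asm) mult_le_cancel_left_pos) (auto simp: e_def)
  qed
qed

text \<open>Induction on \<open>q\<close>: if \<open>a = \<sigma>\<^sub>q\<close> is positive and \<open>b = \<sigma>\<^sub>q\<^sub>+\<^sub>1\<close> is not, both for the family without
  \<open>f\<^sub>i = l\<close>, then \<open>l a + b > 0\<close> and \<open>l b + c > 0\<close> for \<open>c = \<sigma>\<^sub>q\<^sub>+\<^sub>2\<close> force \<open>a c > b\<^sup>2\<close>, against Newton's
  inequality.\<close>
lemma symf_delete_pos:
  assumes fin: "finite I" and pos: "\<And>q. q \<le> p \<Longrightarrow> symf q I f > 0" and i: "i \<in> I" and "q < p"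
  shows "symf q (I - {i}) f > 0"
  using \<open>q < p\<close>
proof (induction q)
  case 0
  then show ?case using fin by (simp add: symf_0)
next
  case (Suc r)
  define a b c l where "a = symf r (I - {i}) f" and "b = symf (Suc r) (I - {i}) f"
    and "c = symf (Suc (Suc r)) (I - {i}) f" and "l = f i"
  have a: "a > 0" using Suc by (simp add: a_def)
  have 1: "l * a + b > 0"
    using pos[of "Suc r"] Suc.prems symf_remove[OF fin i, of r f] by (simp add: a_def b_def l_def)
  have 2: "l * b + c > 0"
    using pos[of "Suc (Suc r)"] Suc.prems symf_remove[OF fin i, of "Suc r" f] by (simp add: c_def b_def l_def)
  have N: "a * c \<le> b\<^sup>2" using newton_symf[of "I - {i}" r f] fin by (simp add: a_def b_def c_def)
  have "b > 0"
  proof (rule ccontr)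
    assume "\<not> b > 0"
    then have b: "b \<le> 0" by simp
    have "a * (l * b + c) > 0" using a 2 by simp
    moreover have "(l * a + b) * b \<le> 0" using 1 b by (simp add: mult_nonneg_nonpos)
    ultimately show False using N by (simp add: algebra_simps power2_eq_square)
  qed
  then show ?case by (simp add: b_def)
qed

text \<open>A \<open>k\<close>-subset \<open>J\<close> contributes to the summand of \<open>i\<close> exactly if \<open>i\<close> is one of the
  \<open>card I - k\<close> indices outside \<open>J\<close>.\<close>
lemma sum_symf_delete:
  assumes fin: "finite I"
  shows "(\<Sum>i\<in>I. symf k (I - {i}) f) = (real (card I) - real k) * symf k I f"
proof -
  have "(\<Sum>i\<in>I. symf k (I - {i}) f)
      = (\<Sum>i\<in>I. \<Sum>J | J \<subseteq> I \<and> card J = k. if i \<in> J then 0 else \<Prod>j\<in>J. f j)"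
    unfolding symf_def
  proof (rule sum.cong[OF refl])
    fix i assume "i \<in> I"
    have "(\<Sum>J | J \<subseteq> I \<and> card J = k. if i \<in> J then 0 else \<Prod>j\<in>J. f j)
       = (\<Sum>J \<in> {J. J \<subseteq> I \<and> card J = k} \<inter> {J. i \<notin> J}. \<Prod>j\<in>J. f j)"
      using fin by (subst sum.inter_restrict) (auto intro!: sum.cong)
    also have "{J. J \<subseteq> I \<and> card J = k} \<inter> {J. i \<notin> J} = {J. J \<subseteq> I - {i} \<and> card J = k}" by auto
    finally show "(\<Sum>J | J \<subseteq> I - {i} \<and> card J = k. \<Prod>j\<in>J. f j) =
      (\<Sum>J | J \<subseteq> I \<and> card J = k. if i \<in> J then 0 else \<Prod>j\<in>J. f j)" by simp
  qed
  also have "\<dots> = (\<Sum>J | J \<subseteq> I \<and> card J = k. \<Sum>i\<in>I. if i \<in> J then 0 else \<Prod>j\<in>J. f j)"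
    by (rule sum.swap)
  also have "\<dots> = (\<Sum>J | J \<subseteq> I \<and> card J = k. (real (card I) - real k) * (\<Prod>j\<in>J. f j))"
  proof (rule sum.cong[OF refl])
    fix J assume J: "J \<in> {J. J \<subseteq> I \<and> card J = k}"
    have "(\<Sum>i\<in>I. if i \<in> J then 0 else \<Prod>j\<in>J. f j) = (\<Sum>i\<in>I - J. \<Prod>j\<in>J. f j)"
      using fin by (subst sum.mono_neutral_right[of I "I - J"]) auto
    also have "\<dots> = real (card (I - J)) * (\<Prod>j\<in>J. f j)" by simp
    also have "real (card (I - J)) = real (card I) - real k"
      using J fin by (subst card_Diff_subset) (auto simp: finite_subset card_mono of_nat_diff)
    finally show "(\<Sum>i\<in>I. if i \<in> J then 0 else \<Prod>j\<in>J. f j) = (real (card I) - real k) * (\<Prod>j\<in>J. f j)" .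
  qed
  finally show ?thesis by (simp add: symf_def sum_distrib_left)
qed

text \<open>Euler's relation for the homogeneous polynomial \<open>\<sigma>\<^sub>k\<^sub>+\<^sub>1\<close> of degree \<open>k + 1\<close>.\<close>
lemma symf_euler:
  assumes fin: "finite I"
  shows "(\<Sum>i\<in>I. f i * symf k (I - {i}) f) = real (Suc k) * symf (Suc k) I f"
proof -
  have "(\<Sum>i\<in>I. symf (Suc k) I f) = (\<Sum>i\<in>I. f i * symf k (I - {i}) f) + (\<Sum>i\<in>I. symf (Suc k) (I - {i}) f)"
    unfolding sum.distrib[symmetric] by (rule sum.cong) (auto simp: symf_remove[OF fin])
  then show ?thesis using sum_symf_delete[OF fin, of "Suc k" f] by (simp add: algebra_simps)
qed

text \<open>Newton's inequalities multiply up to this form of Maclaurin's inequality. The binomial normalisation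
  is absent because \<open>newton_symf\<close> is used with the constant \<open>1\<close>.\<close>
lemma maclaurin_symf:
  assumes fin: "finite I" and pos: "\<And>q. q \<le> p \<Longrightarrow> symf q I f > 0" and "Suc k \<le> p"
  shows "symf (Suc k) I f ^ k \<le> symf k I f ^ Suc k"
  using \<open>Suc k \<le> p\<close>
proof (induction k)
  case 0
  then show ?case using fin by (simp add: symf_0)
next
  case (Suc k)
  define a b c where "a = symf k I f" and "b = symf (Suc k) I f" and "c = symf (Suc (Suc k)) I f"
  have p: "a > 0" "b > 0" "c > 0" using pos Suc.prems by (auto simp: a_def b_def c_def)
  have IH: "b ^ k \<le> a ^ Suc k" using Suc by (simp add: a_def b_def)
  have "a * c \<le> b\<^sup>2" using newton_symf[OF fin, of k f] by (simp add: a_def b_def c_def)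
  then have "(a * c) ^ Suc k \<le> (b\<^sup>2) ^ Suc k" by (rule power_mono) (use p in auto)
  then have "a ^ Suc k * c ^ Suc k \<le> b ^ (2 * Suc k)" by (simp only: power_mult_distrib power_mult)
  moreover have "b ^ k * c ^ Suc k \<le> a ^ Suc k * c ^ Suc k"
    using IH p by (intro mult_right_mono) auto
  ultimately have "b ^ k * c ^ Suc k \<le> b ^ k * b ^ Suc (Suc k)"
  proof -
    have "b ^ (2 * Suc k) = b ^ k * b ^ Suc (Suc k)"
      by (simp only: power_add[symmetric]) (simp add: mult_2)
    then show ?thesis using \<open>a ^ Suc k * c ^ Suc k \<le> b ^ (2 * Suc k)\<close> \<open>b ^ k * c ^ Suc k \<le> a ^ Suc k * c ^ Suc k\<close>
      by linarith
  qed
  then have "c ^ Suc k \<le> b ^ Suc (Suc k)" using p by (subst (asm) mult_le_cancel_left_pos) auto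
  then show ?case by (simp add: b_def c_def)
qed

text \<open>The difference of the two sides is half of the double sum of
  \<open>w\<^sub>i w\<^sub>j (a\<^sub>i - a\<^sub>j) (b\<^sub>i - b\<^sub>j)\<close>.\<close>
lemma chebyshev_sum_weighted:
  fixes w a b :: "'i \<Rightarrow> real"
  assumes "\<And>i. i \<in> I \<Longrightarrow> w i \<ge> 0" "sum w I = 1"
    and anti: "\<And>i j. i \<in> I \<Longrightarrow> j \<in> I \<Longrightarrow> (a i - a j) * (b i - b j) \<le> 0"
  shows "(\<Sum>i\<in>I. w i * (a i * b i)) \<le> (\<Sum>i\<in>I. w i * a i) * (\<Sum>i\<in>I. w i * b i)"
proof -
  have "(\<Sum>i\<in>I. \<Sum>j\<in>I. w i * w j * ((a i - a j) * (b i - b j))) \<le> 0"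
    by (intro sum_nonpos mult_nonneg_nonpos anti mult_nonneg_nonneg assms)
  moreover have "(\<Sum>i\<in>I. \<Sum>j\<in>I. w i * w j * ((a i - a j) * (b i - b j)))
      = (\<Sum>i\<in>I. \<Sum>j\<in>I. w i * (a i * b i) * w j) + (\<Sum>i\<in>I. \<Sum>j\<in>I. w i * (w j * (a j * b j)))
       - (\<Sum>i\<in>I. \<Sum>j\<in>I. w i * a i * (w j * b j)) - (\<Sum>i\<in>I. \<Sum>j\<in>I. w i * b i * (w j * a j))"
    unfolding sum.distrib[symmetric] sum_subtractf[symmetric]
    by (intro sum.cong refl) (simp add: algebra_simps)
  ultimately show ?thesis
    unfolding sum_product[symmetric] using assms(2) by (simp add: algebra_simps)
qed

text \<open>Expanding both deleted functions with respect to the other index gives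
  \<open>\<sigma>\<^sub>k(I - i) - \<sigma>\<^sub>k(I - j) = (f\<^sub>j - f\<^sub>i) \<sigma>\<^sub>k\<^sub>-\<^sub>1(I - i - j)\<close>, and the last factor is positive.\<close>
lemma symf_delete_antitone:
  assumes fin: "finite I" and pos: "\<And>q. q \<le> p \<Longrightarrow> symf q I f > 0" and "k < p" "i \<in> I" "j \<in> I"
  shows "(f i - f j) * (symf k (I - {i}) f - symf k (I - {j}) f) \<le> 0"
proof (cases "k = 0 \<or> i = j")
  case True
  then show ?thesis using fin by (auto simp: symf_0)
next
  case False
  then obtain m where m: "k = Suc m" using not0_implies_Suc by auto
  have ne: "i \<noteq> j" using False by simp
  define K where "K = I - {i} - {j}"
  have K2: "I - {j} - {i} = K" by (auto simp: K_def)
  have "symf q (I - {i}) f > 0" if "q \<le> p - 1" for q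
    by (rule symf_delete_pos[OF fin pos, of p]) (use that assms in auto)
  then have pK: "symf m K f > 0"
    unfolding K_def by (rule symf_delete_pos[rotated, of "p - 1"]) (use assms ne m in auto)
  have e1: "symf k (I - {i}) f = f j * symf m K f + symf k K f"
    unfolding m K_def by (rule symf_remove) (use assms ne in auto)
  have e2: "symf k (I - {j}) f = f i * symf m K f + symf k K f"
    unfolding m K2[symmetric] by (rule symf_remove) (use assms ne in auto)
  have "(f i - f j) * (symf k (I - {i}) f - symf k (I - {j}) f) = - ((f i - f j)\<^sup>2 * symf m K f)"
    unfolding e1 e2 by (simp add: algebra_simps power2_eq_square)
  then show ?thesis using pK by simp
qed

text \<open>In the application the \<open>f\<^sub>i\<close> are eigenvalues and the \<open>w\<^sub>i\<close> squared components of a unit vector, so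
  \<open>\<Sum> w\<^sub>i f\<^sub>i\<close> is the value of the quadratic form at that vector. Since
  \<open>\<sigma>\<^sub>k\<^sub>+\<^sub>1(I) = f\<^sub>i \<sigma>\<^sub>k(I - i) + \<sigma>\<^sub>k\<^sub>+\<^sub>1(I - i)\<close>, the claim is an upper bound for
  \<open>\<Sum> w\<^sub>i f\<^sub>i \<sigma>\<^sub>k(I - i)\<close>, and \<open>f\<^sub>i\<close> and \<open>\<sigma>\<^sub>k(I - i)\<close> are ordered oppositely.\<close>
lemma symf_delete_direction_bound:
  fixes w :: "'i \<Rightarrow> real"
  assumes fin: "finite I" and pos: "\<And>q. q \<le> p \<Longrightarrow> symf q I f > 0"
    and w: "\<And>i. i \<in> I \<Longrightarrow> w i \<ge> 0" "sum w I = 1" and neg: "(\<Sum>i\<in>I. w i * f i) \<le> - b" "b \<ge> 0"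
    and "Suc k < p"
  shows "(\<Sum>i\<in>I. w i * symf (Suc k) (I - {i}) f) \<ge> symf (Suc k) I f + b * (\<Sum>i\<in>I. w i * symf k (I - {i}) f)"
proof -
  have T0: "(\<Sum>i\<in>I. w i * symf k (I - {i}) f) \<ge> 0"
    using assms by (intro sum_nonneg mult_nonneg_nonneg w less_imp_le[OF symf_delete_pos[OF fin pos, of p]]) auto
  have "(\<Sum>i\<in>I. w i * symf (Suc k) (I - {i}) f) = (\<Sum>i\<in>I. w i * symf (Suc k) I f - w i * (f i * symf k (I - {i}) f))"
    by (intro sum.cong refl) (simp add: symf_remove[OF fin, of _ k f] algebra_simps)
  also have "\<dots> = symf (Suc k) I f - (\<Sum>i\<in>I. w i * (f i * symf k (I - {i}) f))"
    using w(2) by (simp add: sum_subtractf sum_distrib_right[symmetric])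
  finally have e: "(\<Sum>i\<in>I. w i * symf (Suc k) (I - {i}) f) = symf (Suc k) I f - (\<Sum>i\<in>I. w i * (f i * symf k (I - {i}) f))" .
  have "(\<Sum>i\<in>I. w i * (f i * symf k (I - {i}) f)) \<le> (\<Sum>i\<in>I. w i * f i) * (\<Sum>i\<in>I. w i * symf k (I - {i}) f)"
    by (rule chebyshev_sum_weighted[OF w]) (use assms in \<open>auto intro!: symf_delete_antitone[OF fin pos, of p]\<close>)
  also have "\<dots> \<le> - b * (\<Sum>i\<in>I. w i * symf k (I - {i}) f)"
    using neg T0 by (intro mult_right_mono) auto
  finally show ?thesis unfolding e by simp
qed

lemma symf_delete_direction_power:
  fixes w :: "'i \<Rightarrow> real"
  assumes fin: "finite I" and pos: "\<And>q. q \<le> p \<Longrightarrow> symf q I f > 0"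
    and w: "\<And>i. i \<in> I \<Longrightarrow> w i \<ge> 0" "sum w I = 1" and neg: "(\<Sum>i\<in>I. w i * f i) \<le> - b" "b \<ge> 0"
    and "k < p"
  shows "(\<Sum>i\<in>I. w i * symf k (I - {i}) f) \<ge> b ^ k"
  using \<open>k < p\<close>
proof (induction k)
  case 0
  then show ?case using fin w by (simp add: symf_0)
next
  case (Suc k)
  have "symf (Suc k) I f + b * (\<Sum>i\<in>I. w i * symf k (I - {i}) f) \<le> (\<Sum>i\<in>I. w i * symf (Suc k) (I - {i}) f)"
    by (rule symf_delete_direction_bound[OF fin pos w neg]) (use Suc in auto)
  moreover have "b * b ^ k \<le> b * (\<Sum>i\<in>I. w i * symf k (I - {i}) f)"
    using Suc neg by (intro mult_left_mono) auto
  moreover have "symf (Suc k) I f > 0" using pos Suc by simp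
  ultimately show ?case by simp
qed

text \<open>Without \<open>f\<^sub>i\<close> there are too few entries for \<open>\<sigma>\<^sub>n\<close>, so \<open>\<sigma>\<^sub>n\<close> is the product of \<open>f\<^sub>i\<close> and the
  positive number \<open>\<sigma>\<^sub>n\<^sub>-\<^sub>1(I - i)\<close>.\<close>
lemma symf_all_pos_imp_pos:
  assumes fin: "finite I" and pos: "\<And>q. q \<le> card I \<Longrightarrow> symf q I f > 0" and i: "i \<in> I"
  shows "f i > 0"
proof -
  obtain m where m: "card I = Suc m" using fin i by (metis card_gt_0_iff empty_iff gr0_implies_Suc)
  have "symf (Suc m) (I - {i}) f = 0" using fin i m by (intro symf_gt_card) auto
  then have "f i * symf m (I - {i}) f > 0" using symf_remove[OF fin i, of m f] pos[of "Suc m"] m by simp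
  moreover have "symf m (I - {i}) f > 0" by (rule symf_delete_pos[OF fin pos i]) (use m in auto)
  ultimately show ?thesis by (simp add: zero_less_mult_iff)
qed

section \<open>Eigenvalues relative to a metric\<close>

lemma inner_matrix_commute:
  fixes G :: "real^'n^'n"
  assumes "transpose G = G"
  shows "x \<bullet> (G *v y) = y \<bullet> (G *v x)"
  by (metis assms dot_lmul_matrix inner_commute transpose_matrix_vector)

text \<open>Along the line \<open>e + t w\<close> the form is a nonnegative quadratic polynomial in \<open>t\<close> without constant
  term, so its linear coefficient vanishes.\<close>
lemma quadratic_form_nonneg_kernel:
  fixes Q :: "real^'n^'n"
  assumes sym: "transpose Q = Q" and V: "subspace V"
    and nn: "\<And>v. v \<in> V \<Longrightarrow> 0 \<le> v \<bullet> (Q *v v)" and e: "e \<in> V" "e \<bullet> (Q *v e) = 0" and w: "w \<in> V"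
  shows "w \<bullet> (Q *v e) = 0"
proof (rule ccontr)
  assume ne: "w \<bullet> (Q *v e) \<noteq> 0"
  define a c where "a = w \<bullet> (Q *v e)" and "c = w \<bullet> (Q *v w)"
  have c: "c \<ge> 0" using nn[OF w] by (simp add: c_def)
  have "0 \<le> 2 * t * a + t\<^sup>2 * c" for t
  proof -
    have "e + t *\<^sub>R w \<in> V" using V e w by (simp add: subspace_add subspace_scale)
    from nn[OF this] show ?thesis
      using e(2) inner_matrix_commute[OF sym, of e w]
      by (simp add: a_def c_def matrix_vector_right_distrib matrix_vector_mult_scaleR inner_add_left
          inner_add_right algebra_simps power2_eq_square)
  qed
  \<comment> \<open>The minimiser would be \<open>- a / c\<close>; the \<open>1\<close> allows \<open>c = 0\<close>.\<close>
  from this[of "- a / (c + 1)"] have "0 \<le> a\<^sup>2 * (c / (c + 1)\<^sup>2 - 2 / (c + 1))"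
    by (simp add: power2_eq_square algebra_simps)
  moreover have "c / (c + 1)\<^sup>2 - 2 / (c + 1) < 0"
  proof -
    have "c / (c + 1)\<^sup>2 - 2 / (c + 1) = (- c - 2) / (c + 1)\<^sup>2"
    proof -
      have "2 / (c + 1) = (2 * (c + 1)) / ((c + 1) * (c + 1))"
        by (rule nonzero_mult_divide_mult_cancel_right[symmetric]) (use c in simp)
      then show ?thesis by (simp add: diff_divide_distrib[symmetric] power2_eq_square)
    qed
    also have "\<dots> < 0" using c by (intro divide_neg_pos) auto
    finally show ?thesis .
  qed
  ultimately show False using ne by (simp add: a_def zero_le_mult_iff)
qed

text \<open>The Rayleigh quotient of \<open>B\<close> with respect to \<open>G\<close> attains a maximum \<open>m\<close> on \<open>V\<close>. There the nonnegative
  form \<open>m G - B\<close> vanishes, so a maximiser is an eigenvector, and one continues in its \<open>G\<close>-orthogonal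
  complement. For the sake of this induction the eigenvalue equation is only tested against
  vectors of \<open>V\<close>.\<close>
lemma simultaneous_diagonalization_subspace:
  fixes G B :: "real^'n^'n"
  assumes symG: "transpose G = G" and symB: "transpose B = B"
    and pos: "\<And>x. x \<noteq> 0 \<Longrightarrow> x \<bullet> (G *v x) > 0"
  shows "subspace V \<Longrightarrow> dim V = k \<Longrightarrow> \<exists>E. finite E \<and> card E = k \<and> E \<subseteq> V \<and>
    (\<forall>e\<in>E. e \<bullet> (G *v e) = 1) \<and> (\<forall>e\<in>E. \<forall>f\<in>E. e \<noteq> f \<longrightarrow> e \<bullet> (G *v f) = 0) \<and>
    (\<forall>e\<in>E. \<exists>m. \<forall>w\<in>V. w \<bullet> (B *v e) = m * (w \<bullet> (G *v e)))"
proof (induction k arbitrary: V)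
  case 0
  then show ?case by (intro exI[of _ "{}"]) auto
next
  case (Suc k)
  note V = Suc.prems(1)
  have "V \<noteq> {0}" using Suc.prems by (metis dim_eq_0 nat.simps(3) order_refl)
  then obtain v0 where v0: "v0 \<in> V" "v0 \<noteq> 0" using V subspace_0 by blast
  define K where "K = V \<inter> sphere 0 1"
  have "compact K" unfolding K_def
    by (intro closed_Int_compact closed_subspace V compact_sphere)
  moreover have "(1 / norm v0) *\<^sub>R v0 \<in> K" using v0 V by (auto simp: K_def subspace_scale)
  hence "K \<noteq> {}" by blast
  moreover have "continuous_on K (\<lambda>v. (v \<bullet> (B *v v)) / (v \<bullet> (G *v v)))"
  proof (intro continuous_intros)
    show "\<forall>x\<in>K. x \<bullet> (G *v x) \<noteq> 0"
    proof
      fix x assume "x \<in> K"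
      hence "x \<noteq> 0" by (auto simp: K_def)
      from pos[OF this] show "x \<bullet> (G *v x) \<noteq> 0" by simp
    qed
  qed
  ultimately obtain u where u: "u \<in> K"
    and max: "\<And>v. v \<in> K \<Longrightarrow> (v \<bullet> (B *v v)) / (v \<bullet> (G *v v)) \<le> (u \<bullet> (B *v u)) / (u \<bullet> (G *v u))"
    using continuous_attains_sup[of K "\<lambda>v. (v \<bullet> (B *v v)) / (v \<bullet> (G *v v))"] by auto
  define m where "m = (u \<bullet> (B *v u)) / (u \<bullet> (G *v u))"
  define Q where "Q = m *\<^sub>R G - B"
  have Qv: "Q *v x = m *\<^sub>R (G *v x) - B *v x" for x
    by (simp add: Q_def matrix_vector_mult_diff_rdistrib scaleR_matrix_vector_assoc)
  have symQ: "transpose Q = Q"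
    using symG symB by (simp add: Q_def transpose_def vec_eq_iff)
  have u0: "u \<noteq> 0" "u \<in> V" using u by (auto simp: K_def)
  have Qn: "0 \<le> v \<bullet> (Q *v v)" if "v \<in> V" for v
  proof (cases "v = 0")
    case False
    define w where "w = (1 / norm v) *\<^sub>R v"
    have "w \<in> K" using that False V by (auto simp: w_def K_def subspace_scale)
    from max[OF this] have "(v \<bullet> (B *v v)) / (v \<bullet> (G *v v)) \<le> m"
      using False by (simp add: w_def m_def matrix_vector_mult_scaleR)
    then have "v \<bullet> (B *v v) \<le> m * (v \<bullet> (G *v v))" using pos[OF False] by (simp add: pos_divide_le_eq)
    then show ?thesis by (simp add: Qv inner_diff_right)
  qed simp
  have Qu: "u \<bullet> (Q *v u) = 0" using pos[OF u0(1)] by (simp add: Qv inner_diff_right m_def)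
  have uQ: "w \<bullet> (Q *v u) = 0" if "w \<in> V" for w
    by (rule quadratic_form_nonneg_kernel[OF symQ V Qn u0(2) Qu that])
  define e where "e = (1 / sqrt (u \<bullet> (G *v u))) *\<^sub>R u"
  have e0: "e \<in> V" using u0 V by (simp add: e_def subspace_scale)
  have "sqrt (u \<bullet> (G *v u)) * sqrt (u \<bullet> (G *v u)) = u \<bullet> (G *v u)" using pos[OF u0(1)] by simp
  then have e1: "e \<bullet> (G *v e) = 1" using pos[OF u0(1)]
    by (simp add: e_def matrix_vector_mult_scaleR)
  have eB: "w \<bullet> (B *v e) = m * (w \<bullet> (G *v e))" if "w \<in> V" for w
    using uQ[OF that] by (simp add: e_def matrix_vector_mult_scaleR Qv inner_diff_right)
  define V' where "V' = {w \<in> V. w \<bullet> (G *v e) = 0}"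
  have sub': "subspace V'" using V unfolding V'_def subspace_def
    by (auto simp: inner_add_left)
  have dec: "w = (w - (w \<bullet> (G *v e)) *\<^sub>R e) + (w \<bullet> (G *v e)) *\<^sub>R e"
    "w \<in> V \<Longrightarrow> w - (w \<bullet> (G *v e)) *\<^sub>R e \<in> V'" for w
    using e0 e1 V by (auto simp: V'_def subspace_diff subspace_scale inner_diff_left)
  have "span (insert e V') = V"
  proof
    show "span (insert e V') \<subseteq> V" by (rule span_minimal) (use e0 V in \<open>auto simp: V'_def\<close>)
    show "V \<subseteq> span (insert e V')"
    proof
      fix w assume "w \<in> V"
      then show "w \<in> span (insert e V')"
        using dec[of w] by (metis insertCI span_add span_base span_scale)
    qed
  qed
  moreover have "e \<notin> span V'" using e1 sub' by (auto simp: V'_def span_eq_iff[THEN iffD2])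
  ultimately have "dim V = dim V' + 1" by (metis dim_insert dim_span)
  then have "dim V' = k" using Suc.prems by simp
  from Suc.IH[OF sub' this] obtain E where E: "finite E" "card E = k" "E \<subseteq> V'"
    "\<forall>e\<in>E. e \<bullet> (G *v e) = 1" "\<forall>e\<in>E. \<forall>f\<in>E. e \<noteq> f \<longrightarrow> e \<bullet> (G *v f) = 0"
    "\<forall>e\<in>E. \<exists>m. \<forall>w\<in>V'. w \<bullet> (B *v e) = m * (w \<bullet> (G *v e))" by blast
  have "e \<notin> E" using E(3) e1 by (auto simp: V'_def)
  moreover have "\<forall>f\<in>E. f \<bullet> (G *v e) = 0 \<and> e \<bullet> (G *v f) = 0"
    using E(3) inner_matrix_commute[OF symG] by (auto simp: V'_def)
  moreover have "\<exists>m. \<forall>w\<in>V. w \<bullet> (B *v f) = m * (w \<bullet> (G *v f))" if f: "f \<in> E" for f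
  proof -
    obtain l where l: "\<forall>w\<in>V'. w \<bullet> (B *v f) = l * (w \<bullet> (G *v f))" using E(6) f by blast
    have fV: "f \<in> V" "f \<bullet> (G *v e) = 0" using E(3) f by (auto simp: V'_def)
    have "e \<bullet> (B *v f) = 0" using eB[OF fV(1)] fV(2) inner_matrix_commute[OF symB, of e f] by simp
    moreover have "e \<bullet> (G *v f) = 0" using fV(2) inner_matrix_commute[OF symG, of e f] by simp
    ultimately have "w \<bullet> (B *v f) = l * (w \<bullet> (G *v f))" if "w \<in> V" for w
      using l dec(2)[OF that] by (auto simp: inner_diff_left dest!: bspec)
    then show ?thesis by blast
  qed
  ultimately show ?case
    using E e0 e1 eB by (intro exI[of _ "insert e E"]) (auto simp: V'_def)
qed

lemma simultaneous_diagonalization: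
  fixes G B :: "real^'n^'n"
  assumes symG: "transpose G = G" and symB: "transpose B = B"
    and pos: "\<And>x. x \<noteq> 0 \<Longrightarrow> x \<bullet> (G *v x) > 0"
  obtains e :: "'n \<Rightarrow> real^'n" and \<mu> :: "'n \<Rightarrow> real" where
    "\<And>i j. e i \<bullet> (G *v e j) = (if i = j then 1 else 0)" "\<And>i. B *v e i = \<mu> i *\<^sub>R (G *v e i)"
proof -
  obtain E :: "(real^'n) set" where E: "finite E" "card E = CARD('n)"
    "\<forall>e\<in>E. e \<bullet> (G *v e) = 1" "\<forall>e\<in>E. \<forall>f\<in>E. e \<noteq> f \<longrightarrow> e \<bullet> (G *v f) = 0"
    "\<forall>e\<in>E. \<exists>m. \<forall>w. w \<bullet> (B *v e) = m * (w \<bullet> (G *v e))"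
    using simultaneous_diagonalization_subspace[OF assms subspace_UNIV refl] by (auto simp: dim_UNIV)
  obtain e where e: "bij_betw e (UNIV :: 'n set) E"
    using E(1,2) finite_same_card_bij[of "UNIV :: 'n set" E] by auto
  obtain m where m: "\<forall>f\<in>E. \<forall>w. w \<bullet> (B *v f) = m f * (w \<bullet> (G *v f))" using E(5) by metis
  show ?thesis
  proof (rule that)
    fix i j
    have "e i \<in> E" "e j \<in> E" "e i = e j \<longleftrightarrow> i = j" using e by (auto simp: bij_betw_def inj_on_def)
    then show "e i \<bullet> (G *v e j) = (if i = j then 1 else 0)" using E by auto
    have "w \<bullet> (B *v e i) = w \<bullet> (m (e i) *\<^sub>R (G *v e i))" for w
      using m \<open>e i \<in> E\<close> by auto
    then show "B *v e i = m (e i) *\<^sub>R (G *v e i)" using vector_eq_ldot by blast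
  qed
qed

text \<open>If \<open>L\<close> has the columns \<open>e j\<close>, the matrix on the left is \<open>L\<^sup>T G M L\<close>, while \<open>L\<^sup>T G L\<close> is the identity.\<close>
lemma det_in_basis:
  fixes G M :: "real^'n^'n" and e :: "'n \<Rightarrow> real^'n"
  assumes "\<And>i j. e i \<bullet> (G *v e j) = (if i = j then 1 else 0)"
  shows "det (\<chi> i j. e i \<bullet> (G *v (M *v e j))) = det M"
proof -
  define L :: "real^'n^'n" where "L = (\<chi> k i. e i $ k)"
  have col: "M' *v e j = column j (M' ** L)" for M' :: "real^'n^'n" and j
    by (simp add: column_def vec_eq_iff matrix_vector_mult_def matrix_matrix_mult_def L_def)
  have eq: "(\<chi> i j. e i \<bullet> (G *v (M' *v e j))) = transpose L ** (G ** (M' ** L))" for M' :: "real^'n^'n"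
  proof -
    have 1: "G *v (M' *v e j) = column j (G ** (M' ** L))" for j
      using col[of "G ** M'" j] by (simp add: matrix_vector_mul_assoc matrix_mul_assoc)
    have 2: "(transpose L ** N) $ i $ j = e i \<bullet> column j N" for N :: "real^'n^'n" and i j
      by (simp add: matrix_matrix_mult_def transpose_def L_def inner_vec_def column_def)
    show ?thesis by (simp add: vec_eq_iff 1 2)
  qed
  have "(\<chi> i j. e i \<bullet> (G *v (mat 1 *v e j))) = mat 1"
    using assms by (simp only: matrix_vector_mul_lid) (simp add: vec_eq_iff mat_def)
  then have "det (transpose L) * (det G * det L) = 1"
    unfolding eq by (metis det_I det_mul matrix_mul_lid)
  then show ?thesis unfolding eq det_mul by (simp add: algebra_simps)
qed

lemma det_eigenbasis:
  fixes G X :: "real^'n^'n" and e :: "'n \<Rightarrow> real^'n"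
  assumes on: "\<And>i j. e i \<bullet> (G *v e j) = (if i = j then 1 else 0)"
    and ev: "\<And>i. X *v e i = \<mu> i *\<^sub>R e i"
  shows "det (mat a + b *\<^sub>R X) = (\<Prod>i\<in>UNIV. a + b * \<mu> i)"
proof -
  have *: "(mat a + b *\<^sub>R X) *v e j = (a + b * \<mu> j) *\<^sub>R e j" for j
  proof -
    have "mat a *v x = a *\<^sub>R x" for x :: "real^'n"
      by (simp add: vec_eq_iff matrix_vector_mult_def mat_def if_distrib[of "\<lambda>c. c * _"] cong: if_cong)
    then show ?thesis
      by (simp add: matrix_vector_mult_add_rdistrib scaleR_matrix_vector_assoc[symmetric] ev scaleR_add_left)
  qed
  have "det (mat a + b *\<^sub>R X) = det (\<chi> i j. e i \<bullet> (G *v ((mat a + b *\<^sub>R X) *v e j)))"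
    by (rule det_in_basis[OF on, symmetric])
  also have "\<dots> = (\<Prod>i\<in>UNIV. (\<chi> i j. e i \<bullet> (G *v ((mat a + b *\<^sub>R X) *v e j))) $ i $ i)"
    by (rule det_diagonal) (simp add: * matrix_vector_mult_scaleR on)
  finally show ?thesis by (simp add: * matrix_vector_mult_scaleR on)
qed

lemma sorted_list_of_roots_unique:
  fixes l l' :: "real list"
  assumes "sorted l" "sorted l'" "\<And>s. (\<Prod>r\<leftarrow>l. s - r) = (\<Prod>r\<leftarrow>l'. s - r)"
  shows "l = l'"
proof -
  have P: "poly (\<Prod>r\<leftarrow>l. [:-r, 1:]) s = (\<Prod>r\<leftarrow>l. s - r)" for s and l :: "real list"
    by (induction l) (auto simp: algebra_simps)
  have ne: "(\<Prod>r\<leftarrow>l. [:-r, 1:]) \<noteq> 0" for l :: "real list" by (auto simp: prod_list_zero_iff)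
  have R: "proots (\<Prod>r\<leftarrow>l. [:-r, 1:]) = mset l" for l :: "real list"
  proof (induction l)
    case (Cons a l)
    have "proots ([:-a, 1:] * (\<Prod>r\<leftarrow>l. [:-r, 1:])) = proots [:-a, 1:] + proots (\<Prod>r\<leftarrow>l. [:-r, 1:])"
      by (rule proots_mult) (use ne in auto)
    then show ?case by (simp only: list.map prod_list.Cons Cons.IH proots_linear_factor) simp
  qed simp
  have "poly (\<Prod>r\<leftarrow>l. [:-r, 1:]) = poly (\<Prod>r\<leftarrow>l'. [:-r, 1:])" using assms(3) by (simp add: P fun_eq_iff)
  then have "mset l = mset l'" unfolding poly_eq_poly_eq_iff by (metis R)
  then show ?thesis using assms by (metis properties_for_sort)
qed

text \<open>This links the ordered list in the definition of the equation to any enumeration of the eigenvalues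
  by an eigenbasis. The order is irrelevant to symmetric functions.\<close>
lemma eigenvalues_of_eigenbasis:
  fixes G X :: "real^'n::finite^'n" and e :: "'n \<Rightarrow> real^'n"
  assumes on: "\<And>i j. e i \<bullet> (G *v e j) = (if i = j then 1 else 0)"
    and ev: "\<And>i. X *v e i = \<mu> i *\<^sub>R e i"
  shows "length (eigenvalues X) = CARD('n)" "esym k (eigenvalues X) = symf k UNIV \<mu>"
proof -
  obtain xs :: "'n list" where xs: "set xs = UNIV" "distinct xs"
    using finite_distinct_list[of "UNIV :: 'n set"] by auto
  define ys where "ys = sort_key \<mu> xs"
  have ys: "set ys = UNIV" "distinct ys" "sorted (map \<mu> ys)" using xs by (auto simp: ys_def)
  have len: "length ys = CARD('n)" using ys distinct_card by metis
  have pr: "det (mat s - X) = (\<Prod>r\<leftarrow>map \<mu> ys. s - r)" for s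
  proof -
    have "det (mat s - X) = det (mat s + (-1) *\<^sub>R X)" by simp
    also have "\<dots> = (\<Prod>i\<in>UNIV. s + (-1) * \<mu> i)" by (rule det_eigenbasis[OF on ev])
    also have "\<dots> = (\<Prod>i\<leftarrow>ys. s - \<mu> i)" using ys by (simp add: prod.distinct_set_conv_list[symmetric])
    finally show ?thesis by (simp add: comp_def)
  qed
  have E: "eigenvalues X = map \<mu> ys" unfolding eigenvalues_def
  proof (rule the_equality)
    fix l assume "sorted l \<and> length l = CARD('n) \<and> (\<forall>s. det (mat s - X) = (\<Prod>r\<leftarrow>l. s - r))"
    then show "l = map \<mu> ys" using ys pr by (intro sorted_list_of_roots_unique) auto
  qed (use ys pr len in auto)
  show "length (eigenvalues X) = CARD('n)" by (simp add: E len)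
  have "bij_betw ((!) ys) {..<length ys} UNIV" using bij_betw_nth[OF ys(2) refl ys(1)[symmetric]] .
  from symf_reindex[OF this, of k \<mu>]
  have "symf k UNIV \<mu> = symf k {..<length ys} (\<mu> \<circ> (!) ys)" .
  also have "\<dots> = esym k (map \<mu> ys)" unfolding symf_def esym_def
    by (intro sum.cong prod.cong) auto
  finally show "esym k (eigenvalues X) = symf k UNIV \<mu>" by (simp add: E)
qed

text \<open>In the Leibniz formula a permutation other than the identity moves at least two indices. So after the
  differentiation of one factor there remains another off-diagonal entry, which is zero.\<close>
lemma has_derivative_det_at_diagonal:
  fixes M :: "real \<Rightarrow> real^'n::finite^'n"
  assumes der: "\<And>i j. ((\<lambda>t. M t $ i $ j) has_real_derivative M' i j) (at \<tau>)"
    and diag: "\<And>i j. i \<noteq> j \<Longrightarrow> M \<tau> $ i $ j = 0"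
  shows "((\<lambda>t. det (M t)) has_real_derivative (\<Sum>i\<in>UNIV. M' i i * (\<Prod>j\<in>UNIV - {i}. M \<tau> $ j $ j))) (at \<tau>)"
proof -
  have "((\<lambda>t. det (M t)) has_real_derivative
     (\<Sum>q | q permutes UNIV. of_int (sign q) * (\<Sum>i\<in>UNIV. M' i (q i) * (\<Prod>j\<in>UNIV - {i}. M \<tau> $ j $ (q j))))) (at \<tau>)"
    unfolding det_def
    by (intro DERIV_sum DERIV_cmult has_field_derivative_prod der)
  moreover have "(\<Sum>q | q permutes UNIV. of_int (sign q) * (\<Sum>i\<in>UNIV. M' i (q i) * (\<Prod>j\<in>UNIV - {i}. M \<tau> $ j $ (q j))))
     = (\<Sum>q\<in>{id}. of_int (sign q) * (\<Sum>i\<in>UNIV. M' i (q i) * (\<Prod>j\<in>UNIV - {i}. M \<tau> $ j $ (q j))))"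
  proof (rule sum.mono_neutral_right)
    show "\<forall>q\<in>{q. q permutes UNIV} - {id}.
       of_int (sign q) * (\<Sum>i\<in>UNIV. M' i (q i) * (\<Prod>j\<in>UNIV - {i}. M \<tau> $ j $ (q j))) = 0"
    proof
      fix q :: "'n \<Rightarrow> 'n" assume q: "q \<in> {q. q permutes UNIV} - {id}"
      then have inj: "inj q" using permutes_inj by blast
      have "(\<Prod>j\<in>UNIV - {i}. M \<tau> $ j $ (q j)) = 0" for i
      proof -
        obtain k where k: "q k \<noteq> k" using q by (metis DiffD2 eq_id_iff insertI1)
        have k2: "q (q k) \<noteq> q k" using inj k by (simp add: inj_eq)
        obtain j where "j \<noteq> i" "q j \<noteq> j" using k k2 by metis
        then show ?thesis by (intro prod_zero) (auto intro!: bexI[of _ j] diag)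
      qed
      then show "of_int (sign q) * (\<Sum>i\<in>UNIV. M' i (q i) * (\<Prod>j\<in>UNIV - {i}. M \<tau> $ j $ (q j))) = 0" by (simp only: mult_zero_right sum.neutral_const)
    qed
  qed (auto simp: permutes_id[of UNIV, unfolded id_def])
  ultimately show ?thesis by (simp add: id_def[symmetric])
qed

text \<open>Lagrange interpolation. As the weights do not depend on the polynomial, a family of
  polynomials whose values are differentiable in a parameter has differentiable coefficients.\<close>
lemma coeff_extraction:
  "\<exists>S w. finite S \<and> (\<forall>a :: nat \<Rightarrow> real. a k = (\<Sum>s\<in>S. w s * (\<Sum>j\<le>n. a j * s ^ j)))" if "k \<le> n"
proof -
  define S where "S = real ` {..n}"
  have S: "finite S" "card S = Suc n" by (auto simp: S_def card_image)
  define l where "l = (\<lambda>s. smult (1 / (\<Prod>r\<in>S - {s}. s - r)) (\<Prod>r\<in>S - {s}. [:-r, 1:]))"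
  have ev: "poly (l s) t = (if s = t then 1 else 0)" if "s \<in> S" "t \<in> S" for s t
    using that S by (auto simp: l_def poly_prod prod_zero_iff)
  have deg: "degree (l s) \<le> n" if "s \<in> S" for s
  proof -
    have "degree (\<Prod>r\<in>S - {s}. [:-r, 1:]) \<le> (\<Sum>r\<in>S - {s}. degree [:-r, 1:])"
      using degree_prod_sum_le[of "S - {s}" "\<lambda>r. [:-r, 1:]"] S by (simp add: o_def)
    also have "\<dots> = n" using S that by simp
    finally show ?thesis unfolding l_def using degree_smult_le order_trans by blast
  qed
  have "a k = (\<Sum>s\<in>S. coeff (l s) k * (\<Sum>j\<le>n. a j * s ^ j))" for a
  proof -
    define P where "P = (\<Sum>j\<le>n. monom (a j) j)"
    have dP: "degree P \<le> n" unfolding P_def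
      by (rule degree_sum_le) (auto intro: order_trans[OF degree_monom_le])
    have "P = (\<Sum>s\<in>S. smult (poly P s) (l s))"
    proof (rule poly_eqI_degree[of S])
      show "poly P x = poly (\<Sum>s\<in>S. smult (poly P s) (l s)) x" if "x \<in> S" for x
      proof -
        have "poly (\<Sum>s\<in>S. smult (poly P s) (l s)) x = (\<Sum>s\<in>S. if s = x then poly P s else 0)"
          unfolding poly_sum by (rule sum.cong) (use ev that in auto)
        then show ?thesis using that S by simp
      qed
      show "card S > degree P" using dP S by simp
      have "degree (\<Sum>s\<in>S. smult (poly P s) (l s)) \<le> n"
        by (rule degree_sum_le) (use S deg degree_smult_le order_trans in blast)+
      then show "card S > degree (\<Sum>s\<in>S. smult (poly P s) (l s))" using S by simp
    qed
    then have "coeff P k = (\<Sum>s\<in>S. poly P s * coeff (l s) k)"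
      by (metis (no_types, lifting) coeff_smult coeff_sum sum.cong)
    moreover have "coeff P k = a k" using that by (simp add: P_def coeff_sum)
    moreover have "poly P s = (\<Sum>j\<le>n. a j * s ^ j)" for s by (simp add: P_def poly_sum poly_monom)
    ultimately show ?thesis by (simp add: mult.commute)
  qed
  then show ?thesis using S(1) by (intro exI[of _ S] exI[of _ "\<lambda>s. coeff (l s) k"] conjI allI)
qed

text \<open>The eigenvalues themselves need not be differentiable where some of them coincide. But their elementary
  symmetric functions are the coefficients \<open>c k\<close> of \<open>det (1 + s X)\<close> as a polynomial in \<open>s\<close>. For each
  \<open>s\<close> the determinant is differentiated in a basis that makes it diagonal at \<open>\<tau>\<close>, and the
  coefficients follow by \<open>coeff_extraction\<close>.\<close>
lemma has_derivative_symf_eigenvalues: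
  fixes X :: "real \<Rightarrow> real^'n::finite^'n" and G :: "real^'n^'n" and e :: "'n \<Rightarrow> real^'n"
  assumes on: "\<And>i j. e i \<bullet> (G *v e j) = (if i = j then 1 else 0)"
    and ev: "\<And>i. X \<tau> *v e i = \<mu> i *\<^sub>R e i"
    and der: "\<And>i j. ((\<lambda>t. X t $ i $ j) has_real_derivative X' $ i $ j) (at \<tau>)"
    and S: "open S" "\<tau> \<in> S"
    and char: "\<And>t s. t \<in> S \<Longrightarrow> det (mat 1 + s *\<^sub>R X t) = (\<Sum>k\<le>CARD('n). c k t * s ^ k)"
    and k: "Suc k \<le> CARD('n)"
  shows "((c (Suc k)) has_real_derivative (\<Sum>i\<in>UNIV. (e i \<bullet> (G *v (X' *v e i))) * symf k (UNIV - {i}) \<mu>)) (at \<tau>)"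
proof -
  let ?n = "CARD('n)"
  define Z' where "Z' = (\<lambda>i j. e i \<bullet> (G *v (X' *v e j)))"
  have dZ: "((\<lambda>t. e i \<bullet> (G *v (X t *v e j))) has_real_derivative Z' i j) (at \<tau>)" for i j
    unfolding Z'_def inner_vec_def matrix_vector_mult_def
    by (auto intro!: derivative_eq_intros der simp: mult.commute sum_distrib_left intro!: sum.cong)
  \<comment> \<open>the derivative of \<open>det (1 + s X)\<close> at \<open>\<tau>\<close>, in the eigenbasis\<close>
  define D where "D = (\<lambda>s. \<Sum>i\<in>UNIV. s * Z' i i * (\<Prod>j\<in>UNIV - {i}. 1 + s * \<mu> j))"
  have dD: "((\<lambda>t. det (mat 1 + s *\<^sub>R X t)) has_real_derivative D s) (at \<tau>)" for s
  proof -
    have entry: "e i \<bullet> (G *v ((mat 1 + s *\<^sub>R X t) *v e j)) = (if i = j then 1 else 0) + s * (e i \<bullet> (G *v (X t *v e j)))" for i j t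
      by (simp add: matrix_vector_mult_add_rdistrib scaleR_matrix_vector_assoc[symmetric] matrix_vector_right_distrib
          matrix_vector_mult_scaleR inner_add_right on)
    have "((\<lambda>t. det (\<chi> i j. e i \<bullet> (G *v ((mat 1 + s *\<^sub>R X t) *v e j)))) has_real_derivative
       (\<Sum>i\<in>UNIV. s * Z' i i * (\<Prod>j\<in>UNIV - {i}. (\<chi> i j. e i \<bullet> (G *v ((mat 1 + s *\<^sub>R X \<tau>) *v e j))) $ j $ j))) (at \<tau>)"
      by (rule has_derivative_det_at_diagonal)
        (auto simp: entry ev matrix_vector_mult_scaleR on intro!: derivative_eq_intros dZ)
    moreover have "(\<lambda>t. det (\<chi> i j. e i \<bullet> (G *v ((mat 1 + s *\<^sub>R X t) *v e j)))) = (\<lambda>t. det (mat 1 + s *\<^sub>R X t))"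
      by (rule ext, rule det_in_basis[OF on])
    ultimately show ?thesis by (simp add: D_def entry ev matrix_vector_mult_scaleR on)
  qed
  define d where "d = (\<lambda>j. case j of 0 \<Rightarrow> 0 | Suc m \<Rightarrow> \<Sum>i\<in>UNIV. Z' i i * symf m (UNIV - {i}) \<mu>)"
  have Dd: "D s = (\<Sum>j\<le>?n. d j * s ^ j)" for s
  proof -
    obtain m where m: "?n = Suc m" using not0_implies_Suc[of ?n] by auto
    have pr: "(\<Prod>j\<in>UNIV - {i}. 1 + s * \<mu> j) = (\<Sum>l\<le>m. symf l (UNIV - {i}) \<mu> * s ^ l)" for i
    proof -
      have "card (UNIV - {i}) = m" using m by (simp add: card_Diff_singleton)
      then show ?thesis using prod_eq_symf[of "UNIV - {i}" s \<mu>] by simp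
    qed
    have "D s = (\<Sum>i\<in>UNIV. \<Sum>l\<le>m. (Z' i i * symf l (UNIV - {i}) \<mu>) * s ^ Suc l)"
      unfolding D_def pr by (simp add: sum_distrib_left algebra_simps)
    also have "\<dots> = (\<Sum>l\<le>m. d (Suc l) * s ^ Suc l)"
      by (subst sum.swap) (simp add: d_def sum_distrib_right)
    also have "\<dots> = (\<Sum>j\<le>?n. d j * s ^ j)"
      unfolding m by (subst sum.atMost_Suc_shift) (simp add: d_def)
    finally show ?thesis .
  qed
  obtain W w where W: "finite W" "\<And>a :: nat \<Rightarrow> real. a (Suc k) = (\<Sum>s\<in>W. w s * (\<Sum>j\<le>?n. a j * s ^ j))"
  proof -
    from coeff_extraction[OF k] obtain W w where Ww: "finite W"
      "\<forall>a :: nat \<Rightarrow> real. a (Suc k) = (\<Sum>s\<in>W. w s * (\<Sum>j\<le>?n. a j * s ^ j))" by (elim exE conjE) simp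
    show ?thesis by (rule that[OF Ww(1)]) (rule Ww(2)[rule_format])
  qed
  have "((\<lambda>t. \<Sum>s\<in>W. w s * det (mat 1 + s *\<^sub>R X t)) has_real_derivative (\<Sum>s\<in>W. w s * D s)) (at \<tau>)"
    by (intro DERIV_sum DERIV_cmult dD)
  moreover have "(\<Sum>s\<in>W. w s * D s) = d (Suc k)" unfolding Dd by (rule W(2)[symmetric])
  moreover have "(\<Sum>s\<in>W. w s * det (mat 1 + s *\<^sub>R X t)) = c (Suc k) t" if "t \<in> S" for t
    unfolding char[OF that] by (rule W(2)[of "\<lambda>j. c j t", symmetric])
  ultimately have "(c (Suc k) has_real_derivative d (Suc k)) (at \<tau>)"
    using has_field_derivative_transform_within_open[of "\<lambda>t. \<Sum>s\<in>W. w s * det (mat 1 + s *\<^sub>R X t)" "d (Suc k)" \<tau> S "c (Suc k)"] S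
    by simp
  then show ?thesis by (simp add: d_def Z'_def)
qed

section \<open>Calculus for functions of finite differentiability\<close>

lemma Ck_on_cong:
  assumes "open S" "\<And>x. x \<in> S \<Longrightarrow> f x = g x" "Ck_on k f S"
  shows "Ck_on k g S"
  using assms(2,3)
proof (induction k arbitrary: f g)
  case 0
  then show ?case by (metis Ck_on.simps(1) continuous_on_cong)
next
  case (Suc k)
  have d: "(g has_derivative frechet_derivative f (at x)) (at x)" if "x \<in> S" for x
    using has_derivative_transform_within_open[of f _ x UNIV S g] Suc.prems that assms(1)
    by (auto simp: frechet_derivative_works)
  then have "frechet_derivative f (at x) v = frechet_derivative g (at x) v" if "x \<in> S" for x v
    using frechet_derivative_at[OF d[OF that]] by simp
  then have "Ck_on k (\<lambda>x. frechet_derivative g (at x) v) S" for v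
    using Suc.IH[of "\<lambda>x. frechet_derivative f (at x) v" "\<lambda>x. frechet_derivative g (at x) v"] Suc.prems by simp
  then show ?case using d by (auto simp: differentiable_def)
qed

lemma Ck_on_SucI:
  assumes "open S" "\<And>x. x \<in> S \<Longrightarrow> (f has_derivative f' x) (at x)" "\<And>v. Ck_on k (\<lambda>x. f' x v) S"
  shows "Ck_on (Suc k) f S"
proof -
  have "f' x v = frechet_derivative f (at x) v" if "x \<in> S" for x v
    using frechet_derivative_at[OF assms(2)[OF that]] by simp
  then have "Ck_on k (\<lambda>x. frechet_derivative f (at x) v) S" for v
    using Ck_on_cong[OF assms(1) _ assms(3)[of v]] by simp
  then show ?thesis using assms(2) by (auto simp: differentiable_def)
qed

lemma Ck_on_has_derivative:
  "Ck_on (Suc k) f S \<Longrightarrow> x \<in> S \<Longrightarrow> (f has_derivative frechet_derivative f (at x)) (at x)"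
  by (simp add: frechet_derivative_works)

lemma Ck_on_Suc_imp: "Ck_on (Suc k) f S \<Longrightarrow> Ck_on k f S"
proof (induction k arbitrary: f)
  case 0
  then show ?case
    by (auto intro!: differentiable_imp_continuous_on differentiable_at_imp_differentiable_on)
qed auto

lemma Ck_on_le: "j \<le> k \<Longrightarrow> Ck_on k f S \<Longrightarrow> Ck_on j f S"
  by (induction k) (auto simp: le_Suc_eq simp del: Ck_on.simps dest: Ck_on_Suc_imp)

lemma Ck_on_continuous: "Ck_on k f S \<Longrightarrow> continuous_on S f"
  using Ck_on_le[of 0 k f S] by simp

lemma Ck_on_subset: "T \<subseteq> S \<Longrightarrow> Ck_on k f S \<Longrightarrow> Ck_on k f T"
  by (induction k arbitrary: f) (auto intro: continuous_on_subset)

lemma Ck_on_const: "Ck_on k (\<lambda>x. c) S"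
  by (induction k arbitrary: c) auto

lemma Ck_on_add:
  assumes "open S" shows "Ck_on k f S \<Longrightarrow> Ck_on k g S \<Longrightarrow> Ck_on k (\<lambda>x. f x + g x) S"
proof (induction k arbitrary: f g)
  case (Suc k)
  then show ?case
    by (intro Ck_on_SucI[OF assms, where f' = "\<lambda>x v. frechet_derivative f (at x) v + frechet_derivative g (at x) v"])
      (auto intro!: has_derivative_add simp: frechet_derivative_works)
qed (auto intro: continuous_on_add)

lemma Ck_on_mult:
  assumes "open S" shows "Ck_on k f S \<Longrightarrow> Ck_on k g S \<Longrightarrow> Ck_on k (\<lambda>x. f x * g x) S"
proof (induction k arbitrary: f g)
  case (Suc k)
  show ?case
  proof (rule Ck_on_SucI[OF assms, where f' = "\<lambda>x v. f x * frechet_derivative g (at x) v + frechet_derivative f (at x) v * g x"])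
    show "((\<lambda>x. f x * g x) has_derivative (\<lambda>v. f x * frechet_derivative g (at x) v + frechet_derivative f (at x) v * g x)) (at x)"
      if "x \<in> S" for x
      by (intro has_derivative_mult Ck_on_has_derivative[OF Suc.prems(1) that] Ck_on_has_derivative[OF Suc.prems(2) that])
    show "Ck_on k (\<lambda>x. f x * frechet_derivative g (at x) v + frechet_derivative f (at x) v * g x) S" for v
      using Suc.prems by (intro Ck_on_add[OF assms] Suc.IH Ck_on_Suc_imp[of k f] Ck_on_Suc_imp[of k g]) auto
  qed
qed (auto intro: continuous_on_mult)

lemma Ck_on_sum:
  assumes "open S" "\<And>i. i \<in> I \<Longrightarrow> Ck_on k (f i) S" shows "Ck_on k (\<lambda>x. \<Sum>i\<in>I. f i x) S"
  using assms(2)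
  by (induction I rule: infinite_finite_induct) (auto simp: Ck_on_const intro!: Ck_on_add[OF assms(1)])

lemma Ck_on_prod:
  assumes "open S" "\<And>i. i \<in> I \<Longrightarrow> Ck_on k (f i) S" shows "Ck_on k (\<lambda>x. \<Prod>i\<in>I. f i x) S"
  using assms(2)
  by (induction I rule: infinite_finite_induct) (auto simp: Ck_on_const intro!: Ck_on_mult[OF assms(1)])

lemma Ck_on_diff:
  assumes "open S" "Ck_on k f S" "Ck_on k g S" shows "Ck_on k (\<lambda>x. f x - g x) S"
  using Ck_on_add[OF assms(1,2) Ck_on_mult[OF assms(1) Ck_on_const[of k "-1"] assms(3)]] by simp

lemma Ck_on_inverse:
  assumes "open S" shows "Ck_on k f S \<Longrightarrow> (\<And>x. x \<in> S \<Longrightarrow> f x \<noteq> 0) \<Longrightarrow> Ck_on k (\<lambda>x. inverse (f x)) S"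
proof (induction k arbitrary: f)
  case (Suc k)
  show ?case
  proof (rule Ck_on_SucI[OF assms, where f' = "\<lambda>x v. (-1) * (inverse (f x) * frechet_derivative f (at x) v * inverse (f x))"])
    show "((\<lambda>x. inverse (f x)) has_derivative (\<lambda>v. (-1) * (inverse (f x) * frechet_derivative f (at x) v * inverse (f x)))) (at x)"
      if "x \<in> S" for x
      using Deriv.has_derivative_inverse[OF Suc.prems(2)[OF that] Ck_on_has_derivative[OF Suc.prems(1) that]] by simp
    have "Ck_on k (\<lambda>x. inverse (f x)) S" by (rule Suc.IH) (use Suc.prems Ck_on_Suc_imp in blast)+
    then show "Ck_on k (\<lambda>x. (-1) * (inverse (f x) * frechet_derivative f (at x) v * inverse (f x))) S" for v
      using Suc.prems by (intro Ck_on_mult[OF assms] Ck_on_const) auto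
  qed
qed (auto intro: continuous_on_inverse)

lemma Ck_on_affine:
  fixes L :: "'a::euclidean_space \<Rightarrow> 'b::euclidean_space"
  assumes "open T" "linear L"
  shows "Ck_on k f S \<Longrightarrow> (\<And>x. x \<in> T \<Longrightarrow> a + L x \<in> S) \<Longrightarrow> Ck_on k (\<lambda>x. f (a + L x)) T"
proof (induction k arbitrary: f)
  case 0
  have "continuous_on T (\<lambda>x. a + L x)" using assms(2) by (intro continuous_intros linear_continuous_on linear_conv_bounded_linear[THEN iffD1])
  then have "continuous_on T (\<lambda>x. f (a + L x))"
    using continuous_on_compose2[of S f T "\<lambda>x. a + L x"] 0 by auto
  then show ?case by simp
next
  case (Suc k)
  show ?case
  proof (rule Ck_on_SucI[OF assms(1), where f' = "\<lambda>x v. frechet_derivative f (at (a + L x)) (L v)"])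
    show "((\<lambda>x. f (a + L x)) has_derivative (\<lambda>v. frechet_derivative f (at (a + L x)) (L v))) (at x)" if "x \<in> T" for x
    proof -
      have "((\<lambda>x. a + L x) has_derivative L) (at x)"
        using linear_imp_has_derivative[OF assms(2)] by (auto intro!: derivative_eq_intros)
      from has_derivative_compose[OF this Ck_on_has_derivative[OF Suc.prems(1)]] show ?thesis
        using Suc.prems(2)[OF that] by simp
    qed
    show "Ck_on k (\<lambda>x. frechet_derivative f (at (a + L x)) (L v)) T" for v
      by (rule Suc.IH) (use Suc.prems in auto)
  qed
qed

lemma Ck_on_det:
  assumes "open S" "\<And>i j. Ck_on k (\<lambda>y. M y $ i $ j) S"
  shows "Ck_on k (\<lambda>y. det (M y :: real^'n::finite^'n)) S"
  unfolding det_def by (intro Ck_on_sum Ck_on_prod Ck_on_mult assms Ck_on_const)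

lemma matrix_inv_inverse:
  fixes A :: "real^'n^'n"
  assumes "det A \<noteq> 0" shows "A ** matrix_inv A = mat 1" "matrix_inv A ** A = mat 1"
proof -
  have "\<exists>A'. A ** A' = mat 1 \<and> A' ** A = mat 1"
    using assms invertible_det_nz[of A] by (simp add: invertible_def)
  then have "A ** matrix_inv A = mat 1 \<and> matrix_inv A ** A = mat 1"
    unfolding matrix_inv_def by (rule someI_ex)
  then show "A ** matrix_inv A = mat 1" "matrix_inv A ** A = mat 1" by auto
qed

text \<open>Cramer's rule shows the entries of the inverse as quotients of polynomials in the entries of the matrix,
  so they inherit its smoothness.\<close>
lemma matrix_inv_cramer:
  fixes A :: "real^'n::finite^'n"
  assumes "det A \<noteq> 0"
  shows "matrix_inv A $ l $ m = det (\<chi> i j. if j = l then axis m 1 $ i else A $ i $ j) * inverse (det A)"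
proof -
  have "A *v (matrix_inv A *v axis m 1) = axis m 1"
    by (simp add: matrix_vector_mul_assoc matrix_inv_inverse assms)
  then have "matrix_inv A *v axis m 1 = (\<chi> k. det (\<chi> i j. if j = k then axis m 1 $ i else A $ i $ j) / det A)"
    using cramer[OF assms] by blast
  then show ?thesis by (simp add: matrix_vector_mult_basis column_def vec_eq_iff divide_inverse)
qed

lemma Ck_on_matrix_inv:
  assumes "open S" "\<And>i j. Ck_on k (\<lambda>y. M y $ i $ j) S" "\<And>y. y \<in> S \<Longrightarrow> det (M y :: real^'n::finite^'n) \<noteq> 0"
  shows "Ck_on k (\<lambda>y. matrix_inv (M y) $ l $ m) S"
proof (rule Ck_on_cong[OF assms(1)])
  show "Ck_on k (\<lambda>y. det (\<chi> i j. if j = l then axis m 1 $ i else M y $ i $ j) * inverse (det (M y))) S"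
  proof (intro Ck_on_mult Ck_on_det Ck_on_inverse assms)
    fix i j show "Ck_on k (\<lambda>y. (\<chi> i j. if j = l then axis m 1 $ i else M y $ i $ j) $ i $ j) S"
      using assms(2) by (cases "j = l") (simp_all add: Ck_on_const)
  qed
qed (simp add: matrix_inv_cramer assms)

lemma line_derivative:
  assumes "(f has_derivative f') (at (x + t *\<^sub>R a))"
  shows "((\<lambda>s. f (x + s *\<^sub>R a)) has_real_derivative f' a) (at t)"
proof -
  have "((\<lambda>s. x + s *\<^sub>R a) has_derivative (\<lambda>s. s *\<^sub>R a)) (at t)" by (auto intro!: derivative_eq_intros)
  from has_derivative_compose[OF this assms] have "((\<lambda>s. f (x + s *\<^sub>R a)) has_derivative (\<lambda>s. f' (s *\<^sub>R a))) (at t)" .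
  moreover have "f' (s *\<^sub>R a) = f' a * s" for s
    using linear_scale[OF has_derivative_linear[OF assms], of s a] by simp
  ultimately show ?thesis by (simp add: has_field_derivative_def)
qed

text \<open>The second difference is symmetric in \<open>a\<close> and \<open>b\<close>, whereas the mean value theorem, applied twice, gives
  a mixed derivative in a fixed order. The comparison of both orders yields \<open>second_derivative_symmetric\<close>.\<close>
lemma second_difference_mvt:
  fixes f :: "'a::euclidean_space \<Rightarrow> real"
  assumes C2: "Ck_on 2 f S" and h: "h > 0"
    and inS: "\<And>s t. 0 \<le> s \<Longrightarrow> s \<le> h \<Longrightarrow> 0 \<le> t \<Longrightarrow> t \<le> h \<Longrightarrow> x + s *\<^sub>R a + t *\<^sub>R b \<in> S"
  shows "\<exists>s t. 0 \<le> s \<and> s \<le> h \<and> 0 \<le> t \<and> t \<le> h \<and>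
    f (x + h *\<^sub>R a + h *\<^sub>R b) - f (x + h *\<^sub>R a) - f (x + h *\<^sub>R b) + f x =
    h\<^sup>2 * frechet_derivative (\<lambda>y. frechet_derivative f (at y) a) (at (x + s *\<^sub>R a + t *\<^sub>R b)) b"
proof -
  let ?Da = "\<lambda>y. frechet_derivative f (at y) a"
  have d1: "(f has_derivative frechet_derivative f (at y)) (at y)" if "y \<in> S" for y
    using C2 that by (auto simp: numeral_2_eq_2 frechet_derivative_works)
  have d2: "(?Da has_derivative frechet_derivative ?Da (at y)) (at y)" if "y \<in> S" for y
    using C2 that by (auto simp: numeral_2_eq_2 frechet_derivative_works)
  have "\<exists>s>0. s < h \<and> (f (x + h *\<^sub>R b + h *\<^sub>R a) - f (x + h *\<^sub>R a)) - (f (x + h *\<^sub>R b + 0 *\<^sub>R a) - f (x + 0 *\<^sub>R a))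
     = (h - 0) * (?Da (x + h *\<^sub>R b + s *\<^sub>R a) - ?Da (x + s *\<^sub>R a))"
  proof (rule MVT2[OF h])
    fix s assume s: "0 \<le> s" "s \<le> h"
    show "((\<lambda>s. f (x + h *\<^sub>R b + s *\<^sub>R a) - f (x + s *\<^sub>R a)) has_real_derivative
        ?Da (x + h *\<^sub>R b + s *\<^sub>R a) - ?Da (x + s *\<^sub>R a)) (at s)"
      using inS[of s h] inS[of s 0] s h
      by (intro DERIV_diff line_derivative d1) (auto simp: algebra_simps)
  qed
  then obtain s where s: "0 < s" "s < h"
    "f (x + h *\<^sub>R b + h *\<^sub>R a) - f (x + h *\<^sub>R a) - (f (x + h *\<^sub>R b) - f x)
     = h * (?Da (x + h *\<^sub>R b + s *\<^sub>R a) - ?Da (x + s *\<^sub>R a))" by auto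
  have "\<exists>t>0. t < h \<and> ?Da (x + s *\<^sub>R a + h *\<^sub>R b) - ?Da (x + s *\<^sub>R a + 0 *\<^sub>R b)
     = (h - 0) * frechet_derivative ?Da (at (x + s *\<^sub>R a + t *\<^sub>R b)) b"
  proof (rule MVT2[OF h])
    fix t assume t: "0 \<le> t" "t \<le> h"
    show "((\<lambda>t. ?Da (x + s *\<^sub>R a + t *\<^sub>R b)) has_real_derivative
        frechet_derivative ?Da (at (x + s *\<^sub>R a + t *\<^sub>R b)) b) (at t)"
      using inS[of s t] s t by (intro line_derivative d2) auto
  qed
  then obtain t where t: "0 < t" "t < h" "?Da (x + s *\<^sub>R a + h *\<^sub>R b) - ?Da (x + s *\<^sub>R a)
     = h * frechet_derivative ?Da (at (x + s *\<^sub>R a + t *\<^sub>R b)) b" by auto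
  have "x + h *\<^sub>R b + s *\<^sub>R a = x + s *\<^sub>R a + h *\<^sub>R b" "x + h *\<^sub>R b + h *\<^sub>R a = x + h *\<^sub>R a + h *\<^sub>R b" by simp_all
  with s t show ?thesis
    by (intro exI[of _ s] exI[of _ t]) (auto simp: power2_eq_square)
qed

lemma second_derivative_symmetric:
  fixes f :: "'a::euclidean_space \<Rightarrow> real"
  assumes S: "open S" "x \<in> S" and C2: "Ck_on 2 f S"
  shows "frechet_derivative (\<lambda>y. frechet_derivative f (at y) a) (at x) b
       = frechet_derivative (\<lambda>y. frechet_derivative f (at y) b) (at x) a"
proof (rule ccontr)
  define A where "A = (\<lambda>y. frechet_derivative (\<lambda>y. frechet_derivative f (at y) a) (at y) b)"
  define B where "B = (\<lambda>y. frechet_derivative (\<lambda>y. frechet_derivative f (at y) b) (at y) a)"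
  assume "\<not> ?thesis"
  then have e: "\<bar>A x - B x\<bar> / 2 > 0" by (simp add: A_def B_def)
  have "continuous_on S A" "continuous_on S B" using C2 by (auto simp: A_def B_def numeral_2_eq_2)
  then have "isCont A x" "isCont B x" using S by (auto simp: continuous_on_eq_continuous_at)
  then obtain d1 d2 where d: "d1 > 0" "\<And>y. dist y x < d1 \<Longrightarrow> \<bar>A y - A x\<bar> < \<bar>A x - B x\<bar> / 2"
    "d2 > 0" "\<And>y. dist y x < d2 \<Longrightarrow> \<bar>B y - B x\<bar> < \<bar>A x - B x\<bar> / 2"
    using e unfolding continuous_at_eps_delta dist_real_def by metis
  obtain d3 where d3: "d3 > 0" "ball x d3 \<subseteq> S" using S openE by blast
  define d where "d = min d1 (min d2 d3)"
  have dp: "d > 0" using d d3 by (simp add: d_def)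
  define h where "h = d / (2 * (norm a + norm b + 1))"
  have h: "h > 0" using dp by (auto simp: h_def intro!: divide_pos_pos add_nonneg_pos)
  have close: "dist (x + s *\<^sub>R a + t *\<^sub>R b) x < d" if "0 \<le> s" "s \<le> h" "0 \<le> t" "t \<le> h" for s t
  proof -
    have "dist (x + s *\<^sub>R a + t *\<^sub>R b) x \<le> s * norm a + t * norm b"
      using that norm_triangle_ineq[of "s *\<^sub>R a" "t *\<^sub>R b"] by (simp add: dist_norm add.assoc)
    also have "\<dots> \<le> h * norm a + h * norm b" using that by (intro add_mono mult_right_mono) auto
    also have "\<dots> \<le> h * (norm a + norm b + 1)" using h by (simp add: algebra_simps)
    also have "\<dots> = d / 2"
    proof -
      have "norm a + norm b + 1 > 0" by (intro add_nonneg_pos) auto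
      then show ?thesis by (simp add: h_def divide_eq_eq algebra_simps)
    qed
    finally show ?thesis using dp by simp
  qed
  have inS: "x + s *\<^sub>R a + t *\<^sub>R b \<in> S" if "0 \<le> s" "s \<le> h" "0 \<le> t" "t \<le> h" for s t
    using close[OF that] d3 by (auto simp: d_def dist_commute)
  obtain s t where st: "0 \<le> s" "s \<le> h" "0 \<le> t" "t \<le> h"
    "f (x + h *\<^sub>R a + h *\<^sub>R b) - f (x + h *\<^sub>R a) - f (x + h *\<^sub>R b) + f x = h\<^sup>2 * A (x + s *\<^sub>R a + t *\<^sub>R b)"
    using second_difference_mvt[OF C2 h inS] unfolding A_def by blast
  have inS': "x + s *\<^sub>R b + t *\<^sub>R a \<in> S" if "0 \<le> s" "s \<le> h" "0 \<le> t" "t \<le> h" for s t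
    using inS[of t s] that by (simp add: algebra_simps)
  obtain s' t' where st': "0 \<le> s'" "s' \<le> h" "0 \<le> t'" "t' \<le> h"
    "f (x + h *\<^sub>R b + h *\<^sub>R a) - f (x + h *\<^sub>R b) - f (x + h *\<^sub>R a) + f x = h\<^sup>2 * B (x + s' *\<^sub>R b + t' *\<^sub>R a)"
    using second_difference_mvt[OF C2 h inS'] unfolding B_def by blast
  have "x + h *\<^sub>R b + h *\<^sub>R a = x + h *\<^sub>R a + h *\<^sub>R b" by simp
  then have "h\<^sup>2 * A (x + s *\<^sub>R a + t *\<^sub>R b) = h\<^sup>2 * B (x + s' *\<^sub>R b + t' *\<^sub>R a)"
    using st(5) st'(5) by (simp only:)
  then have eq: "A (x + s *\<^sub>R a + t *\<^sub>R b) = B (x + s' *\<^sub>R b + t' *\<^sub>R a)" using h by simp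
  have "dist (x + s *\<^sub>R a + t *\<^sub>R b) x < d1" using close[OF st(1-4)] by (simp add: d_def)
  moreover have "dist (x + s' *\<^sub>R b + t' *\<^sub>R a) x < d2"
    using close[OF st'(3,4,1,2)] by (simp add: d_def algebra_simps)
  ultimately show False using d(2,4) eq by (smt (verit) field_sum_of_halves)
qed

lemma second_order_max:
  fixes f f1 :: "real \<Rightarrow> real"
  assumes d: "d > 0" and max: "\<And>t. \<bar>t\<bar> < d \<Longrightarrow> f t \<le> f 0"
    and f1: "\<And>t. \<bar>t\<bar> < d \<Longrightarrow> (f has_real_derivative f1 t) (at t)"
    and f2: "(f1 has_real_derivative f2) (at 0)"
  shows "f1 0 = 0" "f2 \<le> 0"
proof -
  show z: "f1 0 = 0" using DERIV_local_max[OF f1[of 0] d] max d by auto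
  show "f2 \<le> 0"
  proof (rule ccontr)
    assume "\<not> f2 \<le> 0"
    then obtain r where r: "r > 0" "\<And>h. 0 < h \<Longrightarrow> h < r \<Longrightarrow> f1 0 < f1 h"
      using DERIV_pos_inc_right[OF f2] by auto
    define t where "t = min r d / 2"
    have t: "0 < t" "t < r" "t < d" using r d by (auto simp: t_def)
    obtain s where s: "0 < s" "s < t" "f t - f 0 = (t - 0) * f1 s"
      using MVT2[OF t(1), of f f1] f1 t by force
    then have "f t - f 0 > 0" using r(2)[of s] t z by simp
    then have "f t > f 0" by simp
    then show False using max[of t] t by simp
  qed
qed

lemma bounded_bilinear_matrix_vector: "bounded_bilinear (\<lambda>(A::real^'n::finite^'m::finite) v. A *v v)"
proof
  fix A B :: "real^'n^'m" and x y :: "real^'n" and r :: real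
  show "(A + B) *v x = A *v x + B *v x" by (rule matrix_vector_mult_add_rdistrib)
  show "A *v (x + y) = A *v x + A *v y" by (rule matrix_vector_right_distrib)
  show "(r *\<^sub>R A) *v x = r *\<^sub>R (A *v x)" by (simp add: scaleR_matrix_vector_assoc)
  show "A *v (r *\<^sub>R x) = r *\<^sub>R (A *v x)" by (rule matrix_vector_mult_scaleR)
  show "\<exists>K. \<forall>(A::real^'n^'m) v. norm (A *v v) \<le> norm A * norm v * K"
  proof (intro exI allI)
    fix A :: "real^'n^'m" and v :: "real^'n"
    have "\<bar>(A *v v) $ i\<bar> \<le> norm A * norm v" for i
    proof -
      have "(A *v v) $ i = A $ i \<bullet> v" by (simp add: matrix_vector_mult_def inner_vec_def)
      also have "\<bar>\<dots>\<bar> \<le> norm (A $ i) * norm v" by (rule Cauchy_Schwarz_ineq2)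
      also have "\<dots> \<le> norm A * norm v" by (intro mult_right_mono Finite_Cartesian_Product.norm_nth_le) auto
      finally show ?thesis .
    qed
    then have "(\<Sum>i\<in>UNIV. \<bar>(A *v v) $ i\<bar>) \<le> (\<Sum>i\<in>(UNIV::'m set). norm A * norm v)" by (rule sum_mono)
    moreover have "norm (A *v v) \<le> (\<Sum>i\<in>UNIV. \<bar>(A *v v) $ i\<bar>)" by (rule norm_le_l1_cart)
    ultimately show "norm (A *v v) \<le> norm A * norm v * real CARD('m)" by (simp add: mult.commute)
  qed
qed

lemmas has_vector_derivative_matrix_vector =
  bounded_bilinear.has_vector_derivative[OF bounded_bilinear_matrix_vector]

lemmas has_vector_derivative_inner = bounded_bilinear.has_vector_derivative[OF bounded_bilinear_inner]

lemma has_vector_derivative_vecI: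
  fixes F :: "real \<Rightarrow> real^'n::finite"
  assumes "\<And>i. ((\<lambda>t. F t $ i) has_real_derivative F' $ i) (at t)"
  shows "(F has_vector_derivative F') (at t)"
proof -
  have "((\<lambda>t. \<Sum>i\<in>UNIV. F t $ i *\<^sub>R axis i (1::real)) has_vector_derivative (\<Sum>i\<in>UNIV. F' $ i *\<^sub>R axis i 1)) (at t)"
    using assms by (auto intro!: derivative_eq_intros simp: has_real_derivative_iff_has_vector_derivative)
  moreover have "(\<Sum>i\<in>UNIV. v $ i *\<^sub>R axis i 1) = v" for v :: "real^'n"
    using basis_expansion[of v] by (simp add: scalar_mult_eq_scaleR)
  ultimately show ?thesis by simp
qed

lemma has_vector_derivative_matI:
  fixes F :: "real \<Rightarrow> real^'n::finite^'m::finite"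
  assumes "\<And>i j. ((\<lambda>t. F t $ i $ j) has_real_derivative F' $ i $ j) (at t)"
  shows "(F has_vector_derivative F') (at t)"
proof -
  have row: "((\<lambda>t. F t $ i) has_vector_derivative F' $ i) (at t)" for i
    by (rule has_vector_derivative_vecI) (rule assms)
  have bl: "bounded_linear (axis i :: real^'n \<Rightarrow> real^'n^'m)" for i
  proof -
    have "linear (axis i :: real^'n \<Rightarrow> real^'n^'m)"
      by (rule linearI) (auto simp: vec_eq_iff axis_def)
    then show ?thesis by (simp add: linear_linear)
  qed
  have "((\<lambda>t. \<Sum>i\<in>UNIV. axis i (F t $ i)) has_vector_derivative (\<Sum>i\<in>UNIV. axis i (F' $ i))) (at t)"
    by (intro has_vector_derivative_sum bounded_linear.has_vector_derivative[OF bl] row)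
  moreover have "(\<Sum>i\<in>UNIV. axis i (v $ i)) = v" for v :: "real^'n^'m"
    by (simp add: vec_eq_iff axis_def if_distrib[of "\<lambda>z. z $ _"] cong: if_cong)
  ultimately show ?thesis by simp
qed

lemma frechet_derivative_pd:
  assumes "f differentiable (at y)"
  shows "frechet_derivative f (at y) v = (\<Sum>j\<in>UNIV. v $ j * pd j f y)"
proof -
  have lin: "linear (frechet_derivative f (at y))" using assms by (rule linear_frechet_derivative)
  have "v = (\<Sum>j\<in>UNIV. v $ j *\<^sub>R axis j 1)"
    using basis_expansion[of v] by (simp add: scalar_mult_eq_scaleR)
  then have "frechet_derivative f (at y) v = frechet_derivative f (at y) (\<Sum>j\<in>UNIV. v $ j *\<^sub>R axis j 1)" by simp
  also have "\<dots> = (\<Sum>j\<in>UNIV. v $ j * frechet_derivative f (at y) (axis j 1))"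
    by (simp add: linear_sum[OF lin] linear_scale[OF lin])
  finally show ?thesis by (simp add: pd_def)
qed

lemma Ck_on_pd: "Ck_on (Suc k) f S \<Longrightarrow> Ck_on k (pd j f) S"
  by (simp add: pd_def[abs_def])

lemma Ck_on_differentiable: "Ck_on k f S \<Longrightarrow> k > 0 \<Longrightarrow> x \<in> S \<Longrightarrow> f differentiable (at x)"
  by (cases k) auto

lemma pd_commute:
  assumes "open S" "y \<in> S" "Ck_on 2 f S"
  shows "pd i (pd j f) y = pd j (pd i f) y"
  using second_derivative_symmetric[OF assms, of "axis j 1" "axis i 1"] by (simp add: pd_def[abs_def])

lemma frechet_cong:
  assumes "open S" "y \<in> S" "\<And>x. x \<in> S \<Longrightarrow> f x = g x" "f differentiable (at y)"
  shows "frechet_derivative f (at y) = frechet_derivative g (at y)"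
  by (rule frechet_derivative_transform_within_open[OF assms(4,1,2)]) (use assms(3) in auto)

lemma pd_cong:
  assumes "open S" "y \<in> S" "\<And>x. x \<in> S \<Longrightarrow> f x = g x" "f differentiable (at y)"
  shows "pd j f y = pd j g y"
  using frechet_cong[OF assms] by (simp add: pd_def)

lemma line_derivative_at:
  assumes "f differentiable (at (x + t *\<^sub>R a))"
  shows "((\<lambda>s. f (x + s *\<^sub>R a)) has_real_derivative frechet_derivative f (at (x + t *\<^sub>R a)) a) (at t)"
  using assms line_derivative frechet_derivative_works by blast

lemma inner_matrix_transpose:
  fixes A :: "real^'n^'m"
  shows "(transpose A *v x) \<bullet> y = x \<bullet> (A *v y)"
  by (metis dot_lmul_matrix transpose_matrix_vector)

lemma sum_rotate3:
  "(\<Sum>j\<in>A. \<Sum>k\<in>B. \<Sum>l\<in>C. f j k l) = (\<Sum>l\<in>C. \<Sum>j\<in>A. \<Sum>k\<in>B. f j k l)"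
proof -
  have "(\<Sum>j\<in>A. \<Sum>k\<in>B. \<Sum>l\<in>C. f j k l) = (\<Sum>j\<in>A. \<Sum>l\<in>C. \<Sum>k\<in>B. f j k l)"
    by (intro sum.cong refl sum.swap)
  also have "\<dots> = (\<Sum>l\<in>C. \<Sum>j\<in>A. \<Sum>k\<in>B. f j k l)" by (rule sum.swap)
  finally show ?thesis .
qed

section \<open>Riemannian geometry in coordinates\<close>

text \<open>\<open>chr G l j k\<close> is the Christoffel symbol \<open>\<Gamma>\<^sup>l\<^sub>j\<^sub>k\<close> of the metric with matrix \<open>G\<close>.\<close>
definition chr :: "(real^'n::finite \<Rightarrow> real^'n^'n) \<Rightarrow> 'n \<Rightarrow> 'n \<Rightarrow> 'n \<Rightarrow> real^'n \<Rightarrow> real" where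
  "chr G l j k y = 1/2 * (\<Sum>m\<in>UNIV. matrix_inv (G y) $ l $ m *
     (pd j (\<lambda>y. G y $ m $ k) y + pd k (\<lambda>y. G y $ j $ m) y - pd m (\<lambda>y. G y $ j $ k) y))"

locale local_metric =
  fixes \<Omega> :: "(real^'n::finite) set" and G :: "real^'n \<Rightarrow> real^'n^'n"
  assumes open_dom: "open \<Omega>"
    and G_smooth: "\<And>i j k. Ck_on k (\<lambda>y. G y $ i $ j) \<Omega>"
    and G_sym: "\<And>y i j. y \<in> \<Omega> \<Longrightarrow> G y $ i $ j = G y $ j $ i"
    and G_pos: "\<And>y x. y \<in> \<Omega> \<Longrightarrow> x \<noteq> 0 \<Longrightarrow> x \<bullet> (G y *v x) > 0"
begin

text \<open>\<open>Gam y f\<close> is the connection matrix: the covariant derivative of a vector field \<open>X\<close> along \<open>f\<close> is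
  its componentwise derivative plus \<open>Gam y f *v X\<close>.\<close>
definition Gam :: "real^'n \<Rightarrow> real^'n \<Rightarrow> real^'n^'n" where
  "Gam y f = (\<chi> l k. \<Sum>j\<in>UNIV. chr G l j k y * f $ j)"

text \<open>The derivative, in the direction \<open>f\<close>, of the bilinear map \<open>(a, b) \<mapsto> \<Gamma>(a, b)\<close>.\<close>
definition DGam :: "real^'n \<Rightarrow> real^'n \<Rightarrow> real^'n \<Rightarrow> real^'n \<Rightarrow> real^'n" where
  "DGam y f a b = (\<chi> l. \<Sum>j\<in>UNIV. \<Sum>k\<in>UNIV. frechet_derivative (chr G l j k) (at y) f * a $ j * b $ k)"

lemma transpose_G: "y \<in> \<Omega> \<Longrightarrow> transpose (G y) = G y"
  by (simp add: vec_eq_iff transpose_def G_sym)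

lemma det_G: "y \<in> \<Omega> \<Longrightarrow> det (G y) \<noteq> 0"
proof -
  assume y: "y \<in> \<Omega>"
  have "x = 0" if "G y *v x = 0" for x
    using G_pos[OF y, of x] that by (cases "x = 0") auto
  then have "\<exists>B. B ** G y = mat 1" using matrix_left_invertible_ker by blast
  then have "invertible (G y)" by (meson invertible_left_inverse)
  then show ?thesis by (simp add: invertible_det_nz)
qed

lemma G_inv:
  assumes "y \<in> \<Omega>"
  shows "G y ** matrix_inv (G y) = mat 1" "matrix_inv (G y) ** G y = mat 1"
    "G y *v (matrix_inv (G y) *v x) = x" "matrix_inv (G y) *v (G y *v x) = x"
  using matrix_inv_inverse[OF det_G[OF assms]] by (auto simp: matrix_vector_mul_assoc)

lemma inv_smooth: "Ck_on k (\<lambda>y. matrix_inv (G y) $ i $ j) \<Omega>"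
  by (intro Ck_on_matrix_inv open_dom G_smooth det_G)

lemma chr_smooth: "Ck_on k (chr G l i j) \<Omega>"
proof -
  have "Ck_on k (pd i (\<lambda>y. G y $ r $ s)) \<Omega>" for i r s
    by (rule Ck_on_pd) (rule G_smooth)
  then have "Ck_on k (\<lambda>y. 1/2 * (\<Sum>m\<in>UNIV. matrix_inv (G y) $ l $ m *
     (pd i (\<lambda>y. G y $ m $ j) y + pd j (\<lambda>y. G y $ i $ m) y - pd m (\<lambda>y. G y $ i $ j) y))) \<Omega>"
    by (intro Ck_on_mult Ck_on_sum Ck_on_diff Ck_on_add Ck_on_const inv_smooth open_dom)
  then show ?thesis by (simp add: chr_def[abs_def])
qed

lemma G_diff: "y \<in> \<Omega> \<Longrightarrow> (\<lambda>y. G y $ i $ j) differentiable (at y)"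
  using Ck_on_differentiable[OF G_smooth[of 1]] by simp

lemma pd_G_sym: "y \<in> \<Omega> \<Longrightarrow> pd k (\<lambda>y. G y $ i $ j) y = pd k (\<lambda>y. G y $ j $ i) y"
  by (rule pd_cong[OF open_dom _ _ G_diff]) (auto simp: G_sym)

lemma chr_sym:
  assumes y: "y \<in> \<Omega>" shows "chr G l j k y = chr G l k j y"
proof -
  have "pd j (\<lambda>y. G y $ m $ k) y + pd k (\<lambda>y. G y $ j $ m) y - pd m (\<lambda>y. G y $ j $ k) y
      = pd k (\<lambda>y. G y $ m $ j) y + pd j (\<lambda>y. G y $ k $ m) y - pd m (\<lambda>y. G y $ k $ j) y" for m
    using pd_G_sym[OF y, of j m k] pd_G_sym[OF y, of k j m] pd_G_sym[OF y, of m j k] by linarith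
  then show ?thesis unfolding chr_def by (simp only:)
qed

lemma Gam_commute: "y \<in> \<Omega> \<Longrightarrow> Gam y e *v f = Gam y f *v e"
proof -
  assume y: "y \<in> \<Omega>"
  have "(\<Sum>k\<in>UNIV. (\<Sum>j\<in>UNIV. chr G l j k y * e $ j) * f $ k) = (\<Sum>k\<in>UNIV. (\<Sum>j\<in>UNIV. chr G l j k y * f $ j) * e $ k)" for l
    unfolding sum_distrib_right
    by (subst sum.swap) (intro sum.cong refl, simp add: chr_sym[OF y, of l] mult.commute mult.left_commute)
  then show ?thesis by (simp add: vec_eq_iff matrix_vector_mult_def Gam_def)
qed

lemma chr_lower:
  assumes y: "y \<in> \<Omega>"
  shows "(\<Sum>l\<in>UNIV. G y $ r $ l * chr G l j k y) =
    1/2 * (pd j (\<lambda>y. G y $ r $ k) y + pd k (\<lambda>y. G y $ j $ r) y - pd r (\<lambda>y. G y $ j $ k) y)"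
proof -
  let ?X = "\<lambda>m. pd j (\<lambda>y. G y $ m $ k) y + pd k (\<lambda>y. G y $ j $ m) y - pd m (\<lambda>y. G y $ j $ k) y"
  have id: "(\<Sum>l\<in>UNIV. G y $ r $ l * matrix_inv (G y) $ l $ m) = (if r = m then 1 else 0)" for m
  proof -
    have "(G y ** matrix_inv (G y)) $ r $ m = mat 1 $ r $ m" using G_inv(1)[OF y] by simp
    then show ?thesis by (simp add: matrix_matrix_mult_def mat_def)
  qed
  have "(\<Sum>l\<in>UNIV. G y $ r $ l * chr G l j k y) = (\<Sum>l\<in>UNIV. \<Sum>m\<in>UNIV. 1/2 * (G y $ r $ l * matrix_inv (G y) $ l $ m * ?X m))"
    unfolding chr_def sum_distrib_left by (intro sum.cong refl) (simp only: mult_ac)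
  also have "\<dots> = (\<Sum>m\<in>UNIV. \<Sum>l\<in>UNIV. 1/2 * (G y $ r $ l * matrix_inv (G y) $ l $ m * ?X m))"
    by (rule sum.swap)
  also have "\<dots> = (\<Sum>m\<in>UNIV. 1/2 * ((\<Sum>l\<in>UNIV. G y $ r $ l * matrix_inv (G y) $ l $ m) * ?X m))"
    by (simp only: sum_distrib_left sum_distrib_right)
  also have "\<dots> = (\<Sum>m\<in>UNIV. if r = m then 1/2 * ?X m else 0)"
    unfolding id by (intro sum.cong refl) simp
  finally show ?thesis by simp
qed

text \<open>The metric is parallel for its Levi-Civita connection.\<close>
lemma metric_compat:
  assumes y: "y \<in> \<Omega>"
  shows "frechet_derivative (\<lambda>y. G y $ r $ s) (at y) f = (transpose (Gam y f) ** G y + G y ** Gam y f) $ r $ s"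
proof -
  let ?g = "\<lambda>i r s. pd i (\<lambda>y. G y $ r $ s) y"
  have low: "(G y ** Gam y f) $ r $ s = (\<Sum>j\<in>UNIV. f $ j * (1/2 * (?g j r s + ?g s j r - ?g r j s)))" for r s
  proof -
    have "(G y ** Gam y f) $ r $ s = (\<Sum>l\<in>UNIV. \<Sum>j\<in>UNIV. f $ j * (G y $ r $ l * chr G l j s y))"
      unfolding matrix_matrix_mult_def Gam_def by (simp add: sum_distrib_left mult_ac)
    also have "\<dots> = (\<Sum>j\<in>UNIV. f $ j * (\<Sum>l\<in>UNIV. G y $ r $ l * chr G l j s y))"
      by (subst sum.swap) (simp add: sum_distrib_left)
    finally show ?thesis unfolding chr_lower[OF y] .
  qed
  have tr: "(transpose (Gam y f) ** G y) $ r $ s = (G y ** Gam y f) $ s $ r"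
    by (simp add: matrix_matrix_mult_def transpose_def G_sym[OF y, of _ s] mult.commute)
  have "frechet_derivative (\<lambda>y. G y $ r $ s) (at y) f = (\<Sum>j\<in>UNIV. f $ j * ?g j r s)"
    by (rule frechet_derivative_pd[OF G_diff[OF y]])
  also have "\<dots> = (\<Sum>j\<in>UNIV. f $ j * (1/2 * (?g j s r + ?g r j s - ?g s j r))) + (\<Sum>j\<in>UNIV. f $ j * (1/2 * (?g j r s + ?g s j r - ?g r j s)))"
    unfolding sum.distrib[symmetric] by (intro sum.cong refl) (simp add: pd_G_sym[OF y, of _ s r] field_simps)
  finally show ?thesis by (simp add: low tr)
qed

lemma G_line:
  assumes "x + t *\<^sub>R f \<in> \<Omega>"
  shows "((\<lambda>s. G (x + s *\<^sub>R f)) has_vector_derivative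
    (transpose (Gam (x + t *\<^sub>R f) f) ** G (x + t *\<^sub>R f) + G (x + t *\<^sub>R f) ** Gam (x + t *\<^sub>R f) f)) (at t)"
proof (rule has_vector_derivative_matI)
  fix i j
  show "((\<lambda>s. G (x + s *\<^sub>R f) $ i $ j) has_real_derivative
    (transpose (Gam (x + t *\<^sub>R f) f) ** G (x + t *\<^sub>R f) + G (x + t *\<^sub>R f) ** Gam (x + t *\<^sub>R f) f) $ i $ j) (at t)"
    using line_derivative_at[OF G_diff[OF assms, of i j]] by (simp add: metric_compat[OF assms])
qed

lemma open_line: "open {s. x + s *\<^sub>R f \<in> \<Omega>}"
proof -
  have "continuous_on UNIV (\<lambda>s. x + s *\<^sub>R f)" by (intro continuous_intros)
  then show ?thesis using open_vimage[OF open_dom, of "\<lambda>s. x + s *\<^sub>R f"]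
    by (simp add: vimage_def)
qed

lemma inv_line:
  assumes "x + t *\<^sub>R f \<in> \<Omega>"
  obtains H' where "((\<lambda>s. matrix_inv (G (x + s *\<^sub>R f))) has_vector_derivative H') (at t)"
proof -
  have "((\<lambda>s. matrix_inv (G (x + s *\<^sub>R f))) has_vector_derivative
     (\<chi> i j. frechet_derivative (\<lambda>y. matrix_inv (G y) $ i $ j) (at (x + t *\<^sub>R f)) f)) (at t)"
  proof (rule has_vector_derivative_matI)
    fix i j
    have "(\<lambda>y. matrix_inv (G y) $ i $ j) differentiable (at (x + t *\<^sub>R f))"
      using Ck_on_differentiable[OF inv_smooth[of 1]] assms by simp
    from line_derivative_at[OF this]
    show "((\<lambda>s. matrix_inv (G (x + s *\<^sub>R f)) $ i $ j) has_real_derivative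
      (\<chi> i j. frechet_derivative (\<lambda>y. matrix_inv (G y) $ i $ j) (at (x + t *\<^sub>R f)) f) $ i $ j) (at t)" by simp
  qed
  with that show ?thesis by blast
qed

text \<open>Differentiating \<open>G X = B\<close> gives \<open>G X' = B' - G' X\<close>. On an eigenvector \<open>e\<^sub>i\<close>, compatibility of the
  connection with the metric turns \<open>G'\<close> into Christoffel symbols, and \<open>e\<^sub>i\<close> pairs with \<open>G X' e\<^sub>i\<close> to the
  covariant derivative of \<open>B\<close> along \<open>f\<close>, evaluated at \<open>(e\<^sub>i, e\<^sub>i)\<close>.\<close>
lemma symf_eigenvalues_line:
  fixes B :: "real^'n \<Rightarrow> real^'n^'n" and e :: "'n \<Rightarrow> real^'n"
  assumes y: "y \<in> \<Omega>"
    and B_sym: "\<And>z. z \<in> \<Omega> \<Longrightarrow> transpose (B z) = B z"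
    and B_line: "((\<lambda>s. B (y + s *\<^sub>R f)) has_vector_derivative B') (at 0)"
    and on: "\<And>i j. e i \<bullet> (G y *v e j) = (if i = j then 1 else 0)"
    and ev: "\<And>i. B y *v e i = \<mu> i *\<^sub>R (G y *v e i)"
    and k: "Suc k \<le> CARD('n)"
  shows "((\<lambda>s. esym (Suc k) (eigenvalues (matrix_inv (G (y + s *\<^sub>R f)) ** B (y + s *\<^sub>R f)))) has_real_derivative
    (\<Sum>i\<in>UNIV. (e i \<bullet> (B' *v e i) - 2 * ((Gam y f *v e i) \<bullet> (B y *v e i))) * symf k (UNIV - {i}) \<mu>)) (at 0)"
proof -
  define X where "X = (\<lambda>s. matrix_inv (G (y + s *\<^sub>R f)) ** B (y + s *\<^sub>R f))"
  have y0: "y + 0 *\<^sub>R f \<in> \<Omega>" using y by simp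
  have X0: "X 0 *v e i = \<mu> i *\<^sub>R e i" for i
    by (simp add: X_def matrix_vector_mul_assoc[symmetric] ev matrix_vector_mult_scaleR G_inv[OF y])
  obtain H' where H': "((\<lambda>s. matrix_inv (G (y + s *\<^sub>R f))) has_vector_derivative H') (at 0)"
    using inv_line[OF y0] by blast
  have Xv: "((\<lambda>s. X s *v v) has_vector_derivative matrix_inv (G y) *v (B' *v v) + H' *v (B y *v v)) (at 0)" for v
  proof -
    have "((\<lambda>s. B (y + s *\<^sub>R f) *v v) has_vector_derivative B (y + 0 *\<^sub>R f) *v 0 + B' *v v) (at 0)"
      by (intro has_vector_derivative_matrix_vector B_line has_vector_derivative_const)
    from has_vector_derivative_matrix_vector[OF H' this]
    show ?thesis by (simp add: X_def matrix_vector_mul_assoc)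
  qed
  define X' where "X' = matrix_inv (G y) ** B' + H' ** B y"
  have Xv': "((\<lambda>s. X s *v v) has_vector_derivative X' *v v) (at 0)" for v
    using Xv[of v] by (simp add: X'_def matrix_vector_mult_add_rdistrib matrix_vector_mul_assoc)
  have Xij: "((\<lambda>s. X s $ i $ j) has_real_derivative X' $ i $ j) (at 0)" for i j
  proof -
    have "((\<lambda>s. axis i 1 \<bullet> (X s *v axis j 1)) has_vector_derivative (axis i 1 \<bullet> (X' *v axis j 1) + 0 \<bullet> (X 0 *v axis j 1))) (at 0)"
      by (intro has_vector_derivative_inner Xv' has_vector_derivative_const)
    then show ?thesis
      by (simp add: has_real_derivative_iff_has_vector_derivative inner_axis' matrix_vector_mult_basis column_def)
  qed
  have char: "det (mat 1 + r *\<^sub>R X s) = (\<Sum>k\<le>CARD('n). esym k (eigenvalues (X s)) * r ^ k)"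
    if s: "s \<in> {s. y + s *\<^sub>R f \<in> \<Omega>}" for s r
  proof -
    let ?z = "y + s *\<^sub>R f"
    have z: "?z \<in> \<Omega>" using s by simp
    obtain e' :: "'n \<Rightarrow> real^'n" and \<mu>' where on': "\<And>i j. e' i \<bullet> (G ?z *v e' j) = (if i = j then 1 else 0)"
      and ev': "\<And>i. B ?z *v e' i = \<mu>' i *\<^sub>R (G ?z *v e' i)"
      using simultaneous_diagonalization[OF transpose_G[OF z] B_sym[OF z] G_pos[OF z]] by blast
    have Xe: "X s *v e' i = \<mu>' i *\<^sub>R e' i" for i
      by (simp add: X_def matrix_vector_mul_assoc[symmetric] ev' matrix_vector_mult_scaleR G_inv[OF z])
    have "det (mat 1 + r *\<^sub>R X s) = (\<Prod>i\<in>UNIV. 1 + r * \<mu>' i)"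
      by (rule det_eigenbasis[OF on' Xe])
    also have "\<dots> = (\<Sum>k\<le>CARD('n). symf k UNIV \<mu>' * r ^ k)" by (rule prod_eq_symf) simp
    finally show ?thesis by (simp add: eigenvalues_of_eigenbasis(2)[OF on' Xe])
  qed
  have main: "((\<lambda>s. esym (Suc k) (eigenvalues (X s))) has_real_derivative
     (\<Sum>i\<in>UNIV. (e i \<bullet> (G y *v (X' *v e i))) * symf k (UNIV - {i}) \<mu>)) (at 0)"
  proof -
    note L = has_derivative_symf_eigenvalues[where c = "\<lambda>k s. esym k (eigenvalues (X s))" and X = X
          and S = "{s. y + s *\<^sub>R f \<in> \<Omega>}" and X' = X' and \<tau> = 0 and e = e and G = "G y" and \<mu> = \<mu> and k = k]
    show ?thesis by (rule L) (rule on X0 Xij open_line k char | assumption | (use y in simp))+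
  qed
  have "e i \<bullet> (G y *v (X' *v e i)) = e i \<bullet> (B' *v e i) - 2 * ((Gam y f *v e i) \<bullet> (B y *v e i))" for i
  proof -
    have "((\<lambda>s. G (y + s *\<^sub>R f) *v (X s *v e i)) has_vector_derivative
       G (y + 0 *\<^sub>R f) *v (X' *v e i) + (transpose (Gam (y + 0 *\<^sub>R f) f) ** G (y + 0 *\<^sub>R f) + G (y + 0 *\<^sub>R f) ** Gam (y + 0 *\<^sub>R f) f) *v (X 0 *v e i)) (at 0)"
      by (intro has_vector_derivative_matrix_vector Xv' G_line y0)
    then have "((\<lambda>s. B (y + s *\<^sub>R f) *v e i) has_vector_derivative
       G y *v (X' *v e i) + (transpose (Gam y f) ** G y + G y ** Gam y f) *v (X 0 *v e i)) (at 0)"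
      unfolding scaleR_zero_left add_0_right
      by (rule has_vector_derivative_transform_within_open[OF _ open_line[of y f]])
        (use y in \<open>auto simp: X_def matrix_vector_mul_assoc[symmetric] G_inv\<close>)
    moreover have "((\<lambda>s. B (y + s *\<^sub>R f) *v e i) has_vector_derivative B (y + 0 *\<^sub>R f) *v 0 + B' *v e i) (at 0)"
      by (intro has_vector_derivative_matrix_vector B_line has_vector_derivative_const)
    ultimately have "G y *v (X' *v e i) + (transpose (Gam y f) ** G y + G y ** Gam y f) *v (X 0 *v e i) = B (y + 0 *\<^sub>R f) *v 0 + B' *v e i"
      by (rule vector_derivative_unique_at)
    then have "G y *v (X' *v e i) = B' *v e i - (transpose (Gam y f) ** G y + G y ** Gam y f) *v (X 0 *v e i)"
      by (simp add: eq_diff_eq)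
    then have "e i \<bullet> (G y *v (X' *v e i)) = e i \<bullet> (B' *v e i) - \<mu> i * (e i \<bullet> (transpose (Gam y f) *v (G y *v e i)) + e i \<bullet> (G y *v (Gam y f *v e i)))"
      unfolding X0 by (simp only: matrix_vector_mult_add_rdistrib matrix_vector_mult_scaleR matrix_vector_mul_assoc[symmetric]
        inner_add_right inner_diff_right inner_scaleR_right distrib_left)
    moreover have "e i \<bullet> (transpose (Gam y f) *v (G y *v e i)) = (Gam y f *v e i) \<bullet> (G y *v e i)"
      using inner_matrix_transpose[of "Gam y f" "G y *v e i" "e i"] by (simp add: inner_commute)
    moreover have "e i \<bullet> (G y *v (Gam y f *v e i)) = (Gam y f *v e i) \<bullet> (G y *v e i)"
      by (rule inner_matrix_commute[OF transpose_G[OF y]])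
    ultimately show ?thesis by (simp add: ev)
  qed
  with main show ?thesis by (simp add: X_def)
qed

end

locale local_metric_function = local_metric \<Omega> G
  for \<Omega> :: "(real^'n::finite) set" and G :: "real^'n \<Rightarrow> real^'n^'n" +
  fixes U :: "real^'n \<Rightarrow> real"
  assumes U_C3: "Ck_on 3 U \<Omega>"
begin

text \<open>In invariant terms, \<open>grad\<close> is \<open>du\<close>, \<open>nab\<close> is \<open>\<nabla>u\<close>, \<open>Hs\<close> is \<open>\<nabla>\<^sup>2u\<close> and \<open>nsq\<close> is \<open>|du|\<^sup>2\<close>,
  while \<open>DHs y f\<close> differentiates the components of \<open>\<nabla>\<^sup>2u\<close> in the direction \<open>f\<close> without connection
  terms. \<open>Rm y e w\<close> is \<open>du(R(w, e) e)\<close> for the curvature tensor \<open>R\<close>.\<close>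
definition grad :: "real^'n \<Rightarrow> real^'n" where "grad y = (\<chi> j. pd j U y)"
definition D2 :: "real^'n \<Rightarrow> real^'n^'n" where "D2 y = (\<chi> j k. pd j (pd k U) y)"
definition nab :: "real^'n \<Rightarrow> real^'n" where "nab y = matrix_inv (G y) *v grad y"
definition Hs :: "real^'n \<Rightarrow> real^'n^'n" where
  "Hs y = (\<chi> j k. pd j (pd k U) y - (\<Sum>l\<in>UNIV. chr G l j k y * pd l U y))"
definition nsq :: "real^'n \<Rightarrow> real" where "nsq y = grad y \<bullet> nab y"
definition DHs :: "real^'n \<Rightarrow> real^'n \<Rightarrow> real^'n^'n" where
  "DHs y f = (\<chi> j k. frechet_derivative (\<lambda>y. Hs y $ j $ k) (at y) f)"
definition Rm :: "real^'n \<Rightarrow> real^'n \<Rightarrow> real^'n \<Rightarrow> real" where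
  "Rm y e w = grad y \<bullet> (DGam y w e e - DGam y e w e + Gam y w *v (Gam y e *v e) - Gam y e *v (Gam y w *v e))"

lemma U1: "Ck_on 2 (pd j U) \<Omega>" using U_C3 by (auto simp: numeral_3_eq_3 numeral_2_eq_2 pd_def[abs_def])
lemma U2: "Ck_on 1 (pd i (pd j U)) \<Omega>" using U1[of j] by (auto simp: numeral_2_eq_2 pd_def[abs_def])
lemma U0: "Ck_on 2 U \<Omega>" using U_C3 by (rule Ck_on_le[rotated]) simp

lemma U_diff: "y \<in> \<Omega> \<Longrightarrow> U differentiable (at y)" "y \<in> \<Omega> \<Longrightarrow> pd j U differentiable (at y)"
  "y \<in> \<Omega> \<Longrightarrow> pd i (pd j U) differentiable (at y)"
  using Ck_on_differentiable[OF U0] Ck_on_differentiable[OF U1] Ck_on_differentiable[OF U2] by auto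

lemma U_line:
  assumes "x + t *\<^sub>R f \<in> \<Omega>"
  shows "((\<lambda>s. U (x + s *\<^sub>R f)) has_real_derivative grad (x + t *\<^sub>R f) \<bullet> f) (at t)"
  using line_derivative_at[OF U_diff(1)[OF assms]] frechet_derivative_pd[OF U_diff(1)[OF assms], of f]
  by (simp add: grad_def inner_vec_def mult.commute)

lemma Hs_sym: "y \<in> \<Omega> \<Longrightarrow> Hs y $ i $ j = Hs y $ j $ i"
  by (simp add: Hs_def pd_commute[OF open_dom _ U0, of _ i j] chr_sym[of y _ i j])

lemma transpose_Hs: "y \<in> \<Omega> \<Longrightarrow> transpose (Hs y) = Hs y"
  by (simp add: vec_eq_iff transpose_def Hs_sym)

lemma grad_line:
  assumes "x + t *\<^sub>R f \<in> \<Omega>"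
  shows "((\<lambda>s. grad (x + s *\<^sub>R f)) has_vector_derivative D2 (x + t *\<^sub>R f) *v f) (at t)"
proof (rule has_vector_derivative_vecI)
  fix i
  let ?y = "x + t *\<^sub>R f"
  have "frechet_derivative (pd i U) (at ?y) f = (\<Sum>j\<in>UNIV. f $ j * pd j (pd i U) ?y)"
    by (rule frechet_derivative_pd[OF U_diff(2)[OF assms]])
  also have "\<dots> = (D2 ?y *v f) $ i"
    by (simp add: matrix_vector_mult_def D2_def mult.commute pd_commute[OF open_dom assms U0, of _ i])
  finally show "((\<lambda>s. grad (x + s *\<^sub>R f) $ i) has_real_derivative (D2 ?y *v f) $ i) (at t)"
    using line_derivative_at[OF U_diff(2)[OF assms, of i]] by (simp add: grad_def)
qed

lemma Hs_apply:
  assumes "y \<in> \<Omega>"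
  shows "Hs y *v f = D2 y *v f - transpose (Gam y f) *v grad y"
proof -
  have "(\<Sum>k\<in>UNIV. (\<Sum>l\<in>UNIV. chr G l j k y * pd l U y) * f $ k)
      = (\<Sum>l\<in>UNIV. (\<Sum>k\<in>UNIV. chr G l k j y * f $ k) * pd l U y)" for j
    unfolding sum_distrib_right
    by (subst sum.swap) (intro sum.cong refl, simp add: chr_sym[OF assms, of _ j] mult_ac)
  then show ?thesis
    by (simp add: vec_eq_iff matrix_vector_mult_def Hs_def D2_def transpose_def Gam_def grad_def
        left_diff_distrib sum_subtractf)
qed

lemma G_nab: "y \<in> \<Omega> \<Longrightarrow> G y *v nab y = grad y"
  by (simp add: nab_def G_inv)

lemma nab_line:
  assumes y: "x + t *\<^sub>R f \<in> \<Omega>"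
  defines "y \<equiv> x + t *\<^sub>R f"
  shows "((\<lambda>s. nab (x + s *\<^sub>R f)) has_vector_derivative matrix_inv (G y) *v (Hs y *v f) - Gam y f *v nab y) (at t)"
proof -
  obtain H' where H': "((\<lambda>s. matrix_inv (G (x + s *\<^sub>R f))) has_vector_derivative H') (at t)"
    using inv_line[OF y] by blast
  define N' where "N' = matrix_inv (G y) *v (D2 y *v f) + H' *v grad y"
  have N': "((\<lambda>s. nab (x + s *\<^sub>R f)) has_vector_derivative N') (at t)"
    using has_vector_derivative_matrix_vector[OF H' grad_line[OF y]] by (simp add: nab_def N'_def y_def)
  have yO: "y \<in> \<Omega>" using y by (simp add: y_def)
  have "((\<lambda>s. G (x + s *\<^sub>R f) *v nab (x + s *\<^sub>R f)) has_vector_derivative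
      G y *v N' + (transpose (Gam y f) ** G y + G y ** Gam y f) *v nab y) (at t)"
    unfolding y_def by (rule has_vector_derivative_matrix_vector[OF G_line[OF y] N'])
  then have "((\<lambda>s. grad (x + s *\<^sub>R f)) has_vector_derivative
      G y *v N' + (transpose (Gam y f) ** G y + G y ** Gam y f) *v nab y) (at t)"
    by (rule has_vector_derivative_transform_within_open[OF _ open_line[of x f]]) (use y G_nab in auto)
  moreover note grad_line[OF y]
  ultimately have eq: "G y *v N' + (transpose (Gam y f) ** G y + G y ** Gam y f) *v nab y = D2 y *v f"
    unfolding y_def using vector_derivative_unique_at by blast
  have "G y *v N' = Hs y *v f - G y *v (Gam y f *v nab y)"
    using eq by (simp add: Hs_apply[OF yO] matrix_vector_mult_add_rdistrib matrix_vector_mul_assoc[symmetric] G_nab[OF yO] algebra_simps)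
  then have "matrix_inv (G y) *v (G y *v N') = matrix_inv (G y) *v (Hs y *v f) - matrix_inv (G y) *v (G y *v (Gam y f *v nab y))"
    by (simp add: matrix_vector_mult_diff_distrib)
  then have "N' = matrix_inv (G y) *v (Hs y *v f) - Gam y f *v nab y" by (simp add: G_inv[OF yO])
  with N' show ?thesis by simp
qed

text \<open>The connection terms cancel because the metric is parallel.\<close>
lemma nsq_line:
  assumes y: "x + t *\<^sub>R f \<in> \<Omega>"
  defines "y \<equiv> x + t *\<^sub>R f"
  shows "((\<lambda>s. nsq (x + s *\<^sub>R f)) has_real_derivative 2 * ((Hs y *v f) \<bullet> nab y)) (at t)"
proof -
  have yO: "y \<in> \<Omega>" using y by (simp add: y_def)
  have main: "((\<lambda>s. nsq (x + s *\<^sub>R f)) has_real_derivative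
     grad y \<bullet> (matrix_inv (G y) *v (Hs y *v f) - Gam y f *v nab y) + (D2 y *v f) \<bullet> nab y) (at t)"
    unfolding nsq_def has_real_derivative_iff_has_vector_derivative y_def
    by (rule has_vector_derivative_inner[OF grad_line[OF y] nab_line[OF y]])
  have "grad y \<bullet> (matrix_inv (G y) *v (Hs y *v f)) = (Hs y *v f) \<bullet> nab y"
    using inner_matrix_commute[OF transpose_G[OF yO], of "matrix_inv (G y) *v (Hs y *v f)" "nab y"]
    by (simp add: G_nab[OF yO] G_inv[OF yO] inner_commute)
  moreover have "grad y \<bullet> (Gam y f *v nab y) = (transpose (Gam y f) *v grad y) \<bullet> nab y"
    by (simp add: inner_matrix_transpose dot_lmul_matrix)
  moreover have "(Hs y *v f) \<bullet> nab y = (D2 y *v f) \<bullet> nab y - (transpose (Gam y f) *v grad y) \<bullet> nab y"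
    by (simp only: Hs_apply[OF yO] inner_diff_left)
  ultimately have "grad y \<bullet> (matrix_inv (G y) *v (Hs y *v f) - Gam y f *v nab y) + (D2 y *v f) \<bullet> nab y
     = 2 * ((Hs y *v f) \<bullet> nab y)"
  proof -
    have ring: "d - t - t + d = 2 * (d - t)" for d t :: real by simp
    from \<open>grad y \<bullet> (matrix_inv (G y) *v (Hs y *v f)) = (Hs y *v f) \<bullet> nab y\<close>
      \<open>grad y \<bullet> (Gam y f *v nab y) = (transpose (Gam y f) *v grad y) \<bullet> nab y\<close>
      \<open>(Hs y *v f) \<bullet> nab y = (D2 y *v f) \<bullet> nab y - (transpose (Gam y f) *v grad y) \<bullet> nab y\<close>
    show ?thesis by (simp only: inner_diff_right ring)
  qed
  with main show ?thesis by (simp only:)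
qed

lemma Hs_smooth: "Ck_on 1 (\<lambda>y. Hs y $ i $ j) \<Omega>"
  unfolding Hs_def vec_lambda_beta
  by (intro Ck_on_diff Ck_on_sum Ck_on_mult open_dom U2 chr_smooth Ck_on_le[OF _ U1]) simp

lemma Hs_line:
  assumes y: "x + t *\<^sub>R f \<in> \<Omega>"
  shows "((\<lambda>s. Hs (x + s *\<^sub>R f)) has_vector_derivative DHs (x + t *\<^sub>R f) f) (at t)"
proof (rule has_vector_derivative_matI)
  fix i j
  have "(\<lambda>y. Hs y $ i $ j) differentiable (at (x + t *\<^sub>R f))"
    using Ck_on_differentiable[OF Hs_smooth] y by simp
  from line_derivative_at[OF this]
  show "((\<lambda>s. Hs (x + s *\<^sub>R f) $ i $ j) has_real_derivative DHs (x + t *\<^sub>R f) f $ i $ j) (at t)"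
    by (simp add: DHs_def)
qed

text \<open>The third derivative \<open>D\<^sup>3U(f, b, a)\<close> in the coordinates.\<close>
definition T3 :: "real^'n \<Rightarrow> real^'n \<Rightarrow> real^'n \<Rightarrow> real^'n \<Rightarrow> real" where
  "T3 y f b a = (\<Sum>j\<in>UNIV. \<Sum>k\<in>UNIV. frechet_derivative (pd j (pd k U)) (at y) f * b $ j * a $ k)"

lemma T3_swap:
  assumes y: "y \<in> \<Omega>"
  shows "T3 y f b a = T3 y b f a"
proof -
  let ?d = "\<lambda>m j k. pd m (pd j (pd k U)) y"
  have e: "T3 y f b a = (\<Sum>k\<in>UNIV. \<Sum>j\<in>UNIV. \<Sum>m\<in>UNIV. ?d m j k * f $ m * b $ j * a $ k)" for f b a
    unfolding T3_def frechet_derivative_pd[OF U_diff(3)[OF y]] sum_distrib_right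
    by (subst sum.swap) (intro sum.cong refl, simp only: mult_ac)
  have "(\<Sum>j\<in>UNIV. \<Sum>m\<in>UNIV. ?d m j k * f $ m * b $ j * a $ k) = (\<Sum>j\<in>UNIV. \<Sum>m\<in>UNIV. ?d m j k * b $ m * f $ j * a $ k)" for k
    by (subst sum.swap) (intro sum.cong refl, simp add: pd_commute[OF open_dom y U1, of _ _ k] mult_ac)
  then show ?thesis unfolding e by simp
qed

lemma DHs_apply:
  assumes y: "y \<in> \<Omega>"
  shows "(DHs y f *v a) \<bullet> b = T3 y f b a - grad y \<bullet> DGam y f b a - (D2 y *v f) \<bullet> (Gam y b *v a)"
proof -
  have chrd: "chr G l j k differentiable (at y)" for l j k
    using Ck_on_differentiable[OF chr_smooth[of 1]] y by simp
  have D: "DHs y f $ j $ k = frechet_derivative (pd j (pd k U)) (at y) f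
     - (\<Sum>l\<in>UNIV. frechet_derivative (chr G l j k) (at y) f * pd l U y + chr G l j k y * (D2 y *v f) $ l)" for j k
  proof -
    have g: "frechet_derivative (pd l U) (at y) f = (D2 y *v f) $ l" for l
    proof -
      have "frechet_derivative (pd l U) (at y) f = (\<Sum>j\<in>UNIV. f $ j * pd j (pd l U) y)"
        by (rule frechet_derivative_pd[OF U_diff(2)[OF y]])
      also have "\<dots> = (D2 y *v f) $ l"
        by (simp add: matrix_vector_mult_def D2_def mult.commute pd_commute[OF open_dom y U0, of _ l])
      finally show ?thesis .
    qed
    have "((\<lambda>y. Hs y $ j $ k) has_derivative (\<lambda>f. frechet_derivative (pd j (pd k U)) (at y) f
      - (\<Sum>l\<in>UNIV. chr G l j k y * frechet_derivative (pd l U) (at y) f + frechet_derivative (chr G l j k) (at y) f * pd l U y))) (at y)"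
      unfolding Hs_def vec_lambda_beta
      by (intro has_derivative_diff has_derivative_sum has_derivative_mult)
        (simp_all add: frechet_derivative_works[symmetric] U_diff[OF y] chrd)
    from frechet_derivative_at[OF this, symmetric] show ?thesis
      by (simp add: DHs_def g add.commute)
  qed
  have "(DHs y f *v a) \<bullet> b = (\<Sum>j\<in>UNIV. \<Sum>k\<in>UNIV. DHs y f $ j $ k * b $ j * a $ k)"
    by (simp add: inner_vec_def matrix_vector_mult_def sum_distrib_right sum_distrib_left mult_ac)
  also have "\<dots> = T3 y f b a - (\<Sum>j\<in>UNIV. \<Sum>k\<in>UNIV. \<Sum>l\<in>UNIV. pd l U y * (frechet_derivative (chr G l j k) (at y) f * b $ j * a $ k))
     - (\<Sum>j\<in>UNIV. \<Sum>k\<in>UNIV. \<Sum>l\<in>UNIV. (D2 y *v f) $ l * (chr G l j k y * b $ j * a $ k))"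
    unfolding D T3_def sum_subtractf[symmetric]
    by (intro sum.cong refl)
      (simp add: left_diff_distrib right_diff_distrib sum.distrib distrib_right distrib_left sum_distrib_right sum_distrib_left mult_ac)
  also have "(\<Sum>j\<in>UNIV. \<Sum>k\<in>UNIV. \<Sum>l\<in>UNIV. pd l U y * (frechet_derivative (chr G l j k) (at y) f * b $ j * a $ k)) = grad y \<bullet> DGam y f b a"
  proof -
    have "grad y \<bullet> DGam y f b a = (\<Sum>l\<in>UNIV. \<Sum>j\<in>UNIV. \<Sum>k\<in>UNIV. pd l U y * (frechet_derivative (chr G l j k) (at y) f * b $ j * a $ k))"
      by (simp add: inner_vec_def grad_def DGam_def sum_distrib_left)
    then show ?thesis by (subst sum_rotate3) (rule sym)
  qed
  also have "(\<Sum>j\<in>UNIV. \<Sum>k\<in>UNIV. \<Sum>l\<in>UNIV. (D2 y *v f) $ l * (chr G l j k y * b $ j * a $ k)) = (D2 y *v f) \<bullet> (Gam y b *v a)"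
  proof -
    have "X \<bullet> (Gam y b *v a) = (\<Sum>l\<in>UNIV. \<Sum>j\<in>UNIV. \<Sum>k\<in>UNIV. X $ l * (chr G l j k y * b $ j * a $ k))" for X
    proof -
      have "X \<bullet> (Gam y b *v a) = (\<Sum>l\<in>UNIV. \<Sum>k\<in>UNIV. \<Sum>j\<in>UNIV. X $ l * (chr G l j k y * b $ j * a $ k))"
        by (simp add: inner_vec_def Gam_def matrix_vector_mult_def sum_distrib_left sum_distrib_right mult_ac)
      also have "\<dots> = (\<Sum>l\<in>UNIV. \<Sum>j\<in>UNIV. \<Sum>k\<in>UNIV. X $ l * (chr G l j k y * b $ j * a $ k))"
        by (intro sum.cong refl sum.swap)
      finally show ?thesis .
    qed
    then show ?thesis by (subst sum_rotate3) (rule sym)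
  qed
  finally show ?thesis .
qed

text \<open>The left-hand side is half of the second derivative of \<open>|du|\<^sup>2\<close> along a coordinate line, if \<open>w\<close> is
  the gradient. On the right, third derivatives occur only as the derivative of \<open>\<nabla>\<^sup>2u\<close> in the direction \<open>w\<close>,
  as in the differentiated equation. Since third partial derivatives commute, the exchange costs
  the curvature term and Christoffel symbols (Ricci identity).\<close>
lemma DHs_commute:
  assumes y: "y \<in> \<Omega>"
  shows "(DHs y e *v e) \<bullet> w + (Hs y *v e) \<bullet> (matrix_inv (G y) *v (Hs y *v e) - Gam y e *v w)
    = (DHs y w *v e) \<bullet> e - 2 * ((Hs y *v e) \<bullet> (Gam y w *v e)) + (Hs y *v w) \<bullet> (Gam y e *v e)
      + (Hs y *v e) \<bullet> (matrix_inv (G y) *v (Hs y *v e)) + Rm y e w"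
proof -
  have d: "D2 y *v f = Hs y *v f + transpose (Gam y f) *v grad y" for f by (simp add: Hs_apply[OF y])
  show ?thesis
    unfolding DHs_apply[OF y] T3_swap[OF y, of e w] d Rm_def Gam_commute[OF y, of e w]
    by (simp add: inner_add_left inner_add_right inner_diff_right inner_diff_left inner_matrix_transpose dot_lmul_matrix)
qed

text \<open>The function \<open>|du|\<^sup>2 - \<kappa> \<zeta>(u)\<close> is differentiated twice along the coordinate lines through \<open>y\<close>. These are
  not geodesics in general; the Christoffel terms by which their second derivatives differ from the Hessian are
  multiples of the first order condition and drop out.\<close>
lemma maximum_conditions:
  assumes y: "y \<in> \<Omega>"
    and z1: "\<And>t. (\<zeta> has_real_derivative \<zeta>1 t) (at t)" and z2: "\<And>t. (\<zeta>1 has_real_derivative \<zeta>2 t) (at t)"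
    and max: "\<And>x. x \<in> \<Omega> \<Longrightarrow> nsq x - \<kappa> * \<zeta> (U x) \<le> nsq y - \<kappa> * \<zeta> (U y)"
  shows "Hs y *v nab y = (\<kappa> * \<zeta>1 (U y) / 2) *\<^sub>R grad y"
    and "(DHs y (nab y) *v e) \<bullet> e - 2 * ((Hs y *v e) \<bullet> (Gam y (nab y) *v e))
      + (Hs y *v e) \<bullet> (matrix_inv (G y) *v (Hs y *v e)) + Rm y e (nab y)
      \<le> \<kappa> / 2 * (\<zeta>2 (U y) * (grad y \<bullet> e)\<^sup>2 + \<zeta>1 (U y) * ((Hs y *v e) \<bullet> e))"
proof -
  obtain r where r: "r > 0" "ball y r \<subseteq> \<Omega>" using open_dom y openE by blast
  have line: "2 * ((Hs y *v e) \<bullet> nab y) - \<kappa> * (\<zeta>1 (U y) * (grad y \<bullet> e)) = 0 \<and>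
     2 * ((Hs y *v e) \<bullet> (matrix_inv (G y) *v (Hs y *v e) - Gam y e *v nab y) + (DHs y e *v e) \<bullet> nab y)
       - \<kappa> * (\<zeta>1 (U y) * ((D2 y *v e) \<bullet> e) + \<zeta>2 (U y) * (grad y \<bullet> e) * (grad y \<bullet> e)) \<le> 0" for e
  proof -
    define d where "d = r / (norm e + 1)"
    have d: "d > 0" using r by (auto simp: d_def intro!: divide_pos_pos add_nonneg_pos)
    have inO: "y + t *\<^sub>R e \<in> \<Omega>" if "\<bar>t\<bar> < d" for t
    proof -
      have "norm (t *\<^sub>R e) \<le> \<bar>t\<bar> * (norm e + 1)" by (simp add: algebra_simps)
      also have "\<dots> < d * (norm e + 1)" using that by (intro mult_strict_right_mono add_nonneg_pos) auto
      also have "\<dots> = r"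
      proof -
        have "norm e + 1 \<noteq> 0" using norm_ge_zero[of e] by linarith
        then show ?thesis by (simp add: d_def)
      qed
      finally show ?thesis using r by (intro subsetD[OF r(2)]) (simp add: dist_norm)
    qed
    define f1 where "f1 = (\<lambda>t. 2 * ((Hs (y + t *\<^sub>R e) *v e) \<bullet> nab (y + t *\<^sub>R e)) - \<kappa> * (\<zeta>1 (U (y + t *\<^sub>R e)) * (grad (y + t *\<^sub>R e) \<bullet> e)))"
    have f1: "((\<lambda>t. nsq (y + t *\<^sub>R e) - \<kappa> * \<zeta> (U (y + t *\<^sub>R e))) has_real_derivative f1 t) (at t)" if "\<bar>t\<bar> < d" for t
      unfolding f1_def
      by (intro DERIV_diff DERIV_cmult nsq_line DERIV_chain2[OF z1] U_line inO that)
    have y0: "y + 0 *\<^sub>R e \<in> \<Omega>" using y by simp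
    have f2: "(f1 has_real_derivative 2 * ((Hs y *v e) \<bullet> (matrix_inv (G y) *v (Hs y *v e) - Gam y e *v nab y) + (DHs y e *v e) \<bullet> nab y)
       - \<kappa> * (\<zeta>1 (U y) * ((D2 y *v e) \<bullet> e) + \<zeta>2 (U y) * (grad y \<bullet> e) * (grad y \<bullet> e))) (at 0)"
    proof -
      have "((\<lambda>t. Hs (y + t *\<^sub>R e) *v e) has_vector_derivative Hs (y + 0 *\<^sub>R e) *v 0 + DHs (y + 0 *\<^sub>R e) e *v e) (at 0)"
        by (intro has_vector_derivative_matrix_vector Hs_line y0 has_vector_derivative_const)
      from has_vector_derivative_inner[OF this nab_line[OF y0]]
      have 1: "((\<lambda>t. (Hs (y + t *\<^sub>R e) *v e) \<bullet> nab (y + t *\<^sub>R e)) has_real_derivative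
         (Hs y *v e) \<bullet> (matrix_inv (G y) *v (Hs y *v e) - Gam y e *v nab y) + (DHs y e *v e) \<bullet> nab y) (at 0)"
        by (simp add: has_real_derivative_iff_has_vector_derivative)
      have 2: "((\<lambda>t. grad (y + t *\<^sub>R e) \<bullet> e) has_real_derivative (D2 y *v e) \<bullet> e) (at 0)"
        using has_vector_derivative_inner[OF grad_line[OF y0] has_vector_derivative_const[of e]]
        by (simp add: has_real_derivative_iff_has_vector_derivative)
      have 3: "((\<lambda>t. \<zeta>1 (U (y + t *\<^sub>R e))) has_real_derivative \<zeta>2 (U y) * (grad y \<bullet> e)) (at 0)"
        using DERIV_chain2[OF z2 U_line[OF y0]] by simp
      have "((\<lambda>t. \<zeta>1 (U (y + t *\<^sub>R e)) * (grad (y + t *\<^sub>R e) \<bullet> e)) has_real_derivative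
          \<zeta>1 (U y) * ((D2 y *v e) \<bullet> e) + \<zeta>2 (U y) * (grad y \<bullet> e) * (grad y \<bullet> e)) (at 0)"
        using DERIV_mult'[OF 3 2] by simp
      then show ?thesis unfolding f1_def by (intro DERIV_diff DERIV_cmult 1)
    qed
    have "f1 0 = 0" "2 * ((Hs y *v e) \<bullet> (matrix_inv (G y) *v (Hs y *v e) - Gam y e *v nab y) + (DHs y e *v e) \<bullet> nab y)
       - \<kappa> * (\<zeta>1 (U y) * ((D2 y *v e) \<bullet> e) + \<zeta>2 (U y) * (grad y \<bullet> e) * (grad y \<bullet> e)) \<le> 0"
      using second_order_max[OF d _ f1 f2] max inO by auto
    then show ?thesis by (simp add: f1_def)
  qed
  have "(Hs y *v nab y) \<bullet> e = ((\<kappa> * \<zeta>1 (U y) / 2) *\<^sub>R grad y) \<bullet> e" for e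
  proof -
    have "(Hs y *v nab y) \<bullet> e = (Hs y *v e) \<bullet> nab y"
      using inner_matrix_commute[OF transpose_Hs[OF y], of e "nab y"] by (simp add: inner_commute)
    then show ?thesis using line[of e] by simp
  qed
  then show first: "Hs y *v nab y = (\<kappa> * \<zeta>1 (U y) / 2) *\<^sub>R grad y"
    using vector_eq_rdot by blast
  have d: "(D2 y *v e) \<bullet> e = (Hs y *v e) \<bullet> e + grad y \<bullet> (Gam y e *v e)"
    by (simp add: Hs_apply[OF y] inner_diff_left inner_matrix_transpose dot_lmul_matrix)
  have "(Hs y *v nab y) \<bullet> (Gam y e *v e) = \<kappa> * \<zeta>1 (U y) / 2 * (grad y \<bullet> (Gam y e *v e))"
    unfolding first by simp
  with line[of e] DHs_commute[OF y, of e "nab y"]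
  show "(DHs y (nab y) *v e) \<bullet> e - 2 * ((Hs y *v e) \<bullet> (Gam y (nab y) *v e))
      + (Hs y *v e) \<bullet> (matrix_inv (G y) *v (Hs y *v e)) + Rm y e (nab y)
      \<le> \<kappa> / 2 * (\<zeta>2 (U y) * (grad y \<bullet> e)\<^sup>2 + \<zeta>1 (U y) * ((Hs y *v e) \<bullet> e))"
    unfolding d by (simp add: algebra_simps power2_eq_square)
qed

end

section \<open>The differential inequality at a maximum point\<close>

lemma orthonormal_expansion:
  fixes G :: "real^'n::finite^'n" and e :: "'n \<Rightarrow> real^'n"
  assumes on: "\<And>i j. e i \<bullet> (G *v e j) = (if i = j then 1 else 0)" and sym: "transpose G = G"
  shows "x = (\<Sum>i\<in>UNIV. (x \<bullet> (G *v e i)) *\<^sub>R e i)"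
proof -
  define L M :: "real^'n^'n" where "L = (\<chi> k i. e i $ k)" and "M = (\<chi> i. G *v e i)"
  have "M ** L = mat 1"
  proof -
    have "(M ** L) $ i $ j = (if i = j then 1 else 0)" for i j
    proof -
      have "(M ** L) $ i $ j = (G *v e i) \<bullet> e j"
        by (simp add: matrix_matrix_mult_def M_def L_def inner_vec_def)
      then show ?thesis using on[of j i] by (simp add: inner_commute)
    qed
    then show ?thesis by (simp add: vec_eq_iff mat_def)
  qed
  then have "L ** M = mat 1" by (simp add: matrix_left_right_inverse)
  then have "x = L *v (M *v x)" by (simp add: matrix_vector_mul_assoc)
  also have "\<dots> = (\<Sum>i\<in>UNIV. (M *v x) $ i *\<^sub>R e i)"
  proof -
    have "(L *v w) $ k = (\<Sum>i\<in>UNIV. w $ i *\<^sub>R e i) $ k" for w k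
      by (simp add: matrix_vector_mult_def L_def mult.commute)
    then show ?thesis by (simp add: vec_eq_iff)
  qed
  finally have x: "x = (\<Sum>i\<in>UNIV. (M *v x) $ i *\<^sub>R e i)" .
  have Mi: "(M *v x) $ i = x \<bullet> (G *v e i)" for i
  proof -
    have "(M *v x) $ i = M $ i \<bullet> x" by (simp add: matrix_vector_mult_def inner_vec_def)
    then show ?thesis by (simp add: M_def inner_commute)
  qed
  from x show ?thesis by (simp only: Mi)
qed

lemma eigenbasis_quadratic:
  fixes G :: "real^'n::finite^'n" and e :: "'n \<Rightarrow> real^'n"
  assumes on: "\<And>i j. e i \<bullet> (G *v e j) = (if i = j then 1 else 0)" and sym: "transpose G = G"
    and ev: "\<And>i. B *v e i = \<mu> i *\<^sub>R (G *v e i)"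
  shows "x \<bullet> (B *v x) = (\<Sum>i\<in>UNIV. \<mu> i * (x \<bullet> (G *v e i))\<^sup>2)"
proof -
  have "B *v x = B *v (\<Sum>i\<in>UNIV. (x \<bullet> (G *v e i)) *\<^sub>R e i)"
    using orthonormal_expansion[OF on sym, of x] by simp
  also have "\<dots> = (\<Sum>i\<in>UNIV. (x \<bullet> (G *v e i)) *\<^sub>R (\<mu> i *\<^sub>R (G *v e i)))"
    by (simp add: linear_sum[OF matrix_vector_mul_linear] matrix_vector_mult_scaleR ev)
  finally have "x \<bullet> (B *v x) = (\<Sum>i\<in>UNIV. (x \<bullet> (G *v e i)) * (\<mu> i * (x \<bullet> (G *v e i))))"
    by (simp add: inner_sum_right mult_ac)
  then show ?thesis by (simp add: power2_eq_square mult_ac)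
qed

lemma form_cauchy_schwarz:
  fixes Q :: "real^'n::finite^'n"
  assumes sym: "transpose Q = Q" and nn: "\<And>v. 0 \<le> v \<bullet> (Q *v v)" and pos: "b \<bullet> (Q *v b) > 0"
  shows "(a \<bullet> (Q *v b))\<^sup>2 \<le> (a \<bullet> (Q *v a)) * (b \<bullet> (Q *v b))"
proof -
  define B C where "B = b \<bullet> (Q *v b)" and "C = a \<bullet> (Q *v b)"
  have "0 \<le> (B *\<^sub>R a - C *\<^sub>R b) \<bullet> (Q *v (B *\<^sub>R a - C *\<^sub>R b))" by (rule nn)
  also have "\<dots> = B * (B * (a \<bullet> (Q *v a)) - C\<^sup>2)"
    using inner_matrix_commute[OF sym, of b a]
    by (simp add: matrix_vector_mult_diff_distrib matrix_vector_mult_scaleR inner_diff_left inner_diff_right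
        B_def C_def power2_eq_square algebra_simps)
  finally have "0 \<le> B * (a \<bullet> (Q *v a)) - C\<^sup>2" using pos by (simp add: B_def zero_le_mult_iff)
  then show ?thesis by (simp add: B_def C_def mult.commute)
qed

context local_metric_function
begin

lemma nsq_G: "y \<in> \<Omega> \<Longrightarrow> nsq y = nab y \<bullet> (G y *v nab y)"
  by (simp add: nsq_def G_nab inner_commute)

lemma grad_inner: "y \<in> \<Omega> \<Longrightarrow> grad y \<bullet> e = nab y \<bullet> (G y *v e)"
  using inner_matrix_commute[OF transpose_G, of y e "nab y"] by (simp add: G_nab inner_commute)

lemma jet_line:
  fixes f :: "(real^'n) \<times> (real^'n) \<times> real \<Rightarrow> real"
  assumes y: "y \<in> \<Omega>" and f: "f differentiable (at (y, grad y, U y))"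
  shows "((\<lambda>s. f (y + s *\<^sub>R w, grad (y + s *\<^sub>R w), U (y + s *\<^sub>R w))) has_real_derivative
    frechet_derivative f (at (y, grad y, U y)) (w, D2 y *v w, grad y \<bullet> w)) (at 0)"
proof -
  have y0: "y + 0 *\<^sub>R w \<in> \<Omega>" using y by simp
  have "((\<lambda>s. (y + s *\<^sub>R w, grad (y + s *\<^sub>R w), U (y + s *\<^sub>R w))) has_vector_derivative
      (w, D2 (y + 0 *\<^sub>R w) *v w, grad (y + 0 *\<^sub>R w) \<bullet> w)) (at 0)"
    by (intro has_vector_derivative_Pair grad_line y0 U_line[OF y0, unfolded has_real_derivative_iff_has_vector_derivative])
      (auto intro!: derivative_eq_intros)
  then have path: "((\<lambda>s. (y + s *\<^sub>R w, grad (y + s *\<^sub>R w), U (y + s *\<^sub>R w))) has_derivative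
      (\<lambda>r. r *\<^sub>R (w, D2 y *v w, grad y \<bullet> w))) (at 0)"
    by (simp add: has_vector_derivative_def)
  have df: "(f has_derivative frechet_derivative f (at (y, grad y, U y))) (at (y + 0 *\<^sub>R w, grad (y + 0 *\<^sub>R w), U (y + 0 *\<^sub>R w)))"
    using f by (simp add: frechet_derivative_works)
  have "frechet_derivative f (at (y, grad y, U y)) (r *\<^sub>R d) = frechet_derivative f (at (y, grad y, U y)) d * r" for r d
    using linear_scale[OF linear_frechet_derivative[OF f], of r d] by simp
  then have "(\<lambda>r. frechet_derivative f (at (y, grad y, U y)) (r *\<^sub>R (w, D2 y *v w, grad y \<bullet> w)))
      = (*) (frechet_derivative f (at (y, grad y, U y)) (w, D2 y *v w, grad y \<bullet> w))" by (intro ext)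
  with has_derivative_compose[OF path df] show ?thesis
    unfolding has_field_derivative_def by (simp only:)
qed

text \<open>At a maximum point \<open>\<nabla>\<^sup>2u(\<nabla>u)\<close> is a multiple of \<open>du\<close>. So the derivative of \<open>f(x, du, u)\<close> along \<open>\<nabla>u\<close>
  is a combination of two terms: \<open>hort\<close>, in which \<open>du\<close> is transported parallelly, together with the
  derivative in \<open>u\<close>, and \<open>vert\<close>, the radial derivative along the fibre. For the components of a tensor,
  \<open>hort\<close> still lacks the Christoffel terms of the lower indices.\<close>
definition hort :: "((real^'n) \<times> (real^'n) \<times> real \<Rightarrow> real) \<Rightarrow> real^'n \<Rightarrow> real" where
  "hort f y = frechet_derivative f (at (y, grad y, U y)) (nab y, transpose (Gam y (nab y)) *v grad y, 0)
     + nsq y * frechet_derivative f (at (y, grad y, U y)) (0, 0, 1)"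
definition vert :: "((real^'n) \<times> (real^'n) \<times> real \<Rightarrow> real) \<Rightarrow> real^'n \<Rightarrow> real" where
  "vert f y = frechet_derivative f (at (y, grad y, U y)) (0, grad y, 0)"

lemma jet_derivative_split:
  fixes f :: "(real^'n) \<times> (real^'n) \<times> real \<Rightarrow> real"
  assumes y: "y \<in> \<Omega>" and f: "f differentiable (at (y, grad y, U y))"
    and first: "Hs y *v nab y = c *\<^sub>R grad y"
  shows "frechet_derivative f (at (y, grad y, U y)) (nab y, D2 y *v nab y, grad y \<bullet> nab y) = hort f y + c * vert f y"
proof -
  have "D2 y *v nab y = c *\<^sub>R grad y + transpose (Gam y (nab y)) *v grad y"
    using Hs_apply[OF y, of "nab y"] first by (simp add: algebra_simps)
  then have "(nab y, D2 y *v nab y, grad y \<bullet> nab y) = (nab y, transpose (Gam y (nab y)) *v grad y, 0)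
      + (nsq y *\<^sub>R (0, 0, 1) + c *\<^sub>R (0, grad y, 0))"
    by (simp add: nsq_def)
  then show ?thesis
    using linear_frechet_derivative[OF f]
    by (simp only: hort_def vert_def linear_add linear_scale real_scaleR_def add.assoc)
qed

text \<open>The second order conditions for the eigenvectors \<open>e\<^sub>i\<close> are added up with the weights \<open>T\<^sub>i \<ge> 0\<close>. The sum
  of the derivatives of \<open>\<nabla>\<^sup>2u\<close> in the direction \<open>\<nabla>u\<close> is expressed by the differentiated equation.
  Writing \<open>\<nabla>\<^sup>2u = B - A\<close> and \<open>\<Sum> T\<^sub>i B(e\<^sub>i, e\<^sub>i) = p \<phi>\<^sup>p\<close> (Euler), one finds the radial derivatives
  \<open>vert\<close> of \<open>A\<close> and \<open>\<phi>\<close> diminished by \<open>A\<close> and \<open>\<phi>\<close> themselves. If the maximum of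
  \<open>nsq - \<kappa> \<zeta>(u)\<close> is \<open>0\<close>, then \<open>h\<close> is \<open>- \<zeta>' / (2 \<zeta>)\<close>, and \<open>K h\<close> is the defect
  \<open>h\<^sup>2 - \<zeta>'' / (2 \<zeta>)\<close>. The left-hand side is the gain from this defect.\<close>
lemma key_inequality:
  fixes F :: "(real^'n) \<times> (real^'n) \<times> real \<Rightarrow> real"
    and Ac :: "'n \<Rightarrow> 'n \<Rightarrow> (real^'n) \<times> (real^'n) \<times> real \<Rightarrow> real"
    and e :: "'n \<Rightarrow> real^'n"
  defines "A \<equiv> \<lambda>y. \<chi> r s. Ac r s (y, grad y, U y)"
  defines "\<phi> \<equiv> \<lambda>y. F (y, grad y, U y)"
  defines "B \<equiv> \<lambda>y. A y + Hs y"
  assumes y: "y \<in> \<Omega>"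
    and F_diff: "F differentiable (at (y, grad y, U y))"
    and Ac_diff: "\<And>r s. Ac r s differentiable (at (y, grad y, U y))"
    and A_sym: "\<And>z. z \<in> \<Omega> \<Longrightarrow> transpose (A z) = A z"
    and eq: "\<And>z. z \<in> \<Omega> \<Longrightarrow> esym p (eigenvalues (matrix_inv (G z) ** B z)) = \<phi> z ^ p"
    and on: "\<And>i j. e i \<bullet> (G y *v e j) = (if i = j then 1 else 0)"
    and ev: "\<And>i. B y *v e i = \<mu> i *\<^sub>R (G y *v e i)"
    and p: "1 \<le> p" "p \<le> CARD('n)"
    and Tpos: "\<And>i. symf (p - 1) (UNIV - {i}) \<mu> \<ge> 0"
    and v: "nsq y > 0"
    and z1: "\<And>t. (\<zeta> has_real_derivative \<zeta>1 t) (at t)" and z2: "\<And>t. (\<zeta>1 has_real_derivative \<zeta>2 t) (at t)"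
    and max: "\<And>x. x \<in> \<Omega> \<Longrightarrow> nsq x - \<kappa> * \<zeta> (U x) \<le> nsq y - \<kappa> * \<zeta> (U y)"
    and c: "\<kappa> * \<zeta>1 (U y) / 2 = - h * nsq y"
    and K: "\<kappa> * \<zeta>2 (U y) / 2 = nsq y * h\<^sup>2 - nsq y * K * h"
  defines "T \<equiv> \<lambda>i. symf (p - 1) (UNIV - {i}) \<mu>"
  shows "K * h * nsq y * (\<Sum>i\<in>UNIV. T i * (grad y \<bullet> e i)\<^sup>2)
    \<le> - (real p * \<phi> y ^ (p - 1) * hort F y) + real p * h * nsq y * \<phi> y ^ (p - 1) * (vert F y - \<phi> y)
      + (\<Sum>i\<in>UNIV. T i * ((\<Sum>r\<in>UNIV. \<Sum>s\<in>UNIV. hort (Ac r s) y * e i $ r * e i $ s) - 2 * ((A y *v e i) \<bullet> (Gam y (nab y) *v e i))))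
      - h * nsq y * (\<Sum>i\<in>UNIV. T i * ((\<Sum>r\<in>UNIV. \<Sum>s\<in>UNIV. vert (Ac r s) y * e i $ r * e i $ s) - e i \<bullet> (A y *v e i)))
      - (\<Sum>i\<in>UNIV. T i * Rm y (e i) (nab y))"
proof -
  note mc = maximum_conditions[OF y z1 z2 max]
  let ?N = "nab y" and ?v = "nsq y" and ?q = "grad y"
  have first: "Hs y *v ?N = (- h * ?v) *\<^sub>R ?q" using mc(1) unfolding c .
  have y0: "y + 0 *\<^sub>R ?N \<in> \<Omega>" using y by simp
  define A' where "A' = (\<chi> r s. hort (Ac r s) y + (- h * ?v) * vert (Ac r s) y)"
  have A_line: "((\<lambda>s. A (y + s *\<^sub>R ?N)) has_vector_derivative A') (at 0)"
  proof (rule has_vector_derivative_matI)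
    fix i j
    show "((\<lambda>s. A (y + s *\<^sub>R ?N) $ i $ j) has_real_derivative A' $ i $ j) (at 0)"
      unfolding A_def A'_def vec_lambda_beta jet_derivative_split[OF y Ac_diff first, symmetric]
      by (rule jet_line[OF y Ac_diff])
  qed
  have B_line: "((\<lambda>s. B (y + s *\<^sub>R ?N)) has_vector_derivative A' + DHs y ?N) (at 0)"
    unfolding B_def using has_vector_derivative_add[OF A_line Hs_line[OF y0]] by simp
  have B_sym: "transpose (B z) = B z" if "z \<in> \<Omega>" for z
    using A_sym[OF that] transpose_Hs[OF that] by (simp add: B_def transpose_def vec_eq_iff)
  have p1: "Suc (p - 1) = p" using p by simp
  have "((\<lambda>s. esym (Suc (p - 1)) (eigenvalues (matrix_inv (G (y + s *\<^sub>R ?N)) ** B (y + s *\<^sub>R ?N)))) has_real_derivative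
    (\<Sum>i\<in>UNIV. (e i \<bullet> ((A' + DHs y ?N) *v e i) - 2 * ((Gam y ?N *v e i) \<bullet> (B y *v e i))) * T i)) (at 0)"
    unfolding T_def by (rule symf_eigenvalues_line[OF y B_sym B_line on ev]) (use p in auto)
  then have d1: "((\<lambda>s. \<phi> (y + s *\<^sub>R ?N) ^ p) has_real_derivative
    (\<Sum>i\<in>UNIV. (e i \<bullet> ((A' + DHs y ?N) *v e i) - 2 * ((Gam y ?N *v e i) \<bullet> (B y *v e i))) * T i)) (at 0)"
    unfolding p1
    by (rule has_field_derivative_transform_within_open[OF _ open_line[of y ?N]]) (use y eq in auto)
  have "((\<lambda>s. \<phi> (y + s *\<^sub>R ?N)) has_real_derivative hort F y + (- h * ?v) * vert F y) (at 0)"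
    unfolding \<phi>_def jet_derivative_split[OF y F_diff first, symmetric] by (rule jet_line[OF y F_diff])
  from DERIV_power[OF this, of p]
  have d2: "((\<lambda>s. \<phi> (y + s *\<^sub>R ?N) ^ p) has_real_derivative real p * \<phi> y ^ (p - 1) * (hort F y - h * ?v * vert F y)) (at 0)"
    by (simp add: mult_ac)
  have EQ: "real p * \<phi> y ^ (p - 1) * (hort F y - h * ?v * vert F y)
    = (\<Sum>i\<in>UNIV. (e i \<bullet> ((A' + DHs y ?N) *v e i) - 2 * ((Gam y ?N *v e i) \<bullet> (B y *v e i))) * T i)"
    using DERIV_unique[OF d2 d1] .
  have nn: "0 \<le> x \<bullet> (G y *v x)" for x using G_pos[OF y, of x] by (cases "x = 0") auto
  \<comment> \<open>By Cauchy-Schwarz and the first order condition, the square of \<open>\<nabla>\<^sup>2u(e\<^sub>i, \<cdot>)\<close> is at least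
    \<open>v h\<^sup>2 du(e\<^sub>i)\<^sup>2\<close>, which absorbs the same term from \<open>\<zeta>''\<close>.\<close>
  have MP: "(DHs y ?N *v e i) \<bullet> e i - 2 * ((Hs y *v e i) \<bullet> (Gam y ?N *v e i))
      \<le> - (?v * K * h * (?q \<bullet> e i)\<^sup>2) - h * ?v * ((Hs y *v e i) \<bullet> e i) - Rm y (e i) ?N" for i
  proof -
    define a where "a = matrix_inv (G y) *v (Hs y *v e i)"
    have Ga: "G y *v a = Hs y *v e i" by (simp add: a_def G_inv[OF y])
    have "(a \<bullet> (G y *v ?N))\<^sup>2 \<le> (a \<bullet> (G y *v a)) * (?N \<bullet> (G y *v ?N))"
      by (rule form_cauchy_schwarz[OF transpose_G[OF y] nn]) (use v nsq_G[OF y] in simp)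
    moreover have "a \<bullet> (G y *v ?N) = (- h * ?v) * (?q \<bullet> e i)"
    proof -
      have "a \<bullet> (G y *v ?N) = ?N \<bullet> (Hs y *v e i)"
        using inner_matrix_commute[OF transpose_G[OF y], of a ?N] by (simp add: Ga)
      also have "\<dots> = e i \<bullet> (Hs y *v ?N)" by (rule inner_matrix_commute[OF transpose_Hs[OF y]])
      finally show ?thesis unfolding first by (simp add: inner_commute)
    qed
    ultimately have "((- h * ?v) * (?q \<bullet> e i))\<^sup>2 \<le> ((Hs y *v e i) \<bullet> a) * ?v"
      using nsq_G[OF y] by (simp add: Ga inner_commute)
    then have "?v * (?v * h\<^sup>2 * (?q \<bullet> e i)\<^sup>2) \<le> ?v * ((Hs y *v e i) \<bullet> a)"
      by (simp add: power2_eq_square mult_ac)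
    then have CS: "?v * h\<^sup>2 * (?q \<bullet> e i)\<^sup>2 \<le> (Hs y *v e i) \<bullet> a" using v by simp
    have r: "\<kappa> / 2 * (\<zeta>2 (U y) * (?q \<bullet> e i)\<^sup>2 + \<zeta>1 (U y) * ((Hs y *v e i) \<bullet> e i))
       = (?v * h\<^sup>2 - ?v * K * h) * (?q \<bullet> e i)\<^sup>2 + (- h * ?v) * ((Hs y *v e i) \<bullet> e i)"
      unfolding c[symmetric] K[symmetric] by (simp add: algebra_simps)
    from mc(2)[of "e i"] CS show ?thesis unfolding r a_def by (simp add: algebra_simps)
  qed
  have split: "e i \<bullet> ((A' + DHs y ?N) *v e i) - 2 * ((Gam y ?N *v e i) \<bullet> (B y *v e i))
     = ((DHs y ?N *v e i) \<bullet> e i - 2 * ((Hs y *v e i) \<bullet> (Gam y ?N *v e i)))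
      + ((\<Sum>r\<in>UNIV. \<Sum>s\<in>UNIV. hort (Ac r s) y * e i $ r * e i $ s) - 2 * ((A y *v e i) \<bullet> (Gam y ?N *v e i)))
      - h * ?v * (\<Sum>r\<in>UNIV. \<Sum>s\<in>UNIV. vert (Ac r s) y * e i $ r * e i $ s)" for i
  proof -
    have "e i \<bullet> (A' *v e i) = (\<Sum>r\<in>UNIV. \<Sum>s\<in>UNIV. hort (Ac r s) y * e i $ r * e i $ s - h * ?v * (vert (Ac r s) y * e i $ r * e i $ s))"
      by (simp add: A'_def inner_vec_def matrix_vector_mult_def sum_distrib_left sum_distrib_right algebra_simps)
    also have "\<dots> = (\<Sum>r\<in>UNIV. \<Sum>s\<in>UNIV. hort (Ac r s) y * e i $ r * e i $ s) - h * ?v * (\<Sum>r\<in>UNIV. \<Sum>s\<in>UNIV. vert (Ac r s) y * e i $ r * e i $ s)"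
      by (simp only: sum_subtractf sum_distrib_left)
    finally show ?thesis
      by (simp add: matrix_vector_mult_add_rdistrib inner_add_right inner_add_left B_def inner_commute algebra_simps)
  qed
  have sumB: "(\<Sum>i\<in>UNIV. T i * (e i \<bullet> (B y *v e i))) = real p * \<phi> y ^ p"
  proof -
    have X: "(matrix_inv (G y) ** B y) *v e i = \<mu> i *\<^sub>R e i" for i
      by (simp add: matrix_vector_mul_assoc[symmetric] ev matrix_vector_mult_scaleR G_inv[OF y])
    have "symf p UNIV \<mu> = \<phi> y ^ p" using eq[OF y] eigenvalues_of_eigenbasis(2)[OF on X, of p] by simp
    moreover have "(\<Sum>i\<in>UNIV. T i * (e i \<bullet> (B y *v e i))) = (\<Sum>i\<in>UNIV. \<mu> i * symf (p - 1) (UNIV - {i}) \<mu>)"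
      by (simp add: T_def ev on mult.commute)
    ultimately show ?thesis using symf_euler[of UNIV \<mu> "p - 1"] p1 by simp
  qed
  have "real p * \<phi> y ^ (p - 1) * (hort F y - h * ?v * vert F y)
     \<le> (\<Sum>i\<in>UNIV. ((- (?v * K * h * (?q \<bullet> e i)\<^sup>2) - h * ?v * ((Hs y *v e i) \<bullet> e i) - Rm y (e i) ?N)
      + ((\<Sum>r\<in>UNIV. \<Sum>s\<in>UNIV. hort (Ac r s) y * e i $ r * e i $ s) - 2 * ((A y *v e i) \<bullet> (Gam y ?N *v e i)))
      - h * ?v * (\<Sum>r\<in>UNIV. \<Sum>s\<in>UNIV. vert (Ac r s) y * e i $ r * e i $ s)) * T i)"
    unfolding EQ split
    by (intro sum_mono mult_right_mono add_right_mono diff_right_mono MP)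
      (unfold T_def, rule Tpos)
  also have "\<dots> = - (K * h * ?v * (\<Sum>i\<in>UNIV. T i * (?q \<bullet> e i)\<^sup>2))
      - h * ?v * (\<Sum>i\<in>UNIV. T i * (e i \<bullet> (B y *v e i)))
      - (\<Sum>i\<in>UNIV. T i * Rm y (e i) ?N)
      + (\<Sum>i\<in>UNIV. T i * ((\<Sum>r\<in>UNIV. \<Sum>s\<in>UNIV. hort (Ac r s) y * e i $ r * e i $ s) - 2 * ((A y *v e i) \<bullet> (Gam y ?N *v e i))))
      - h * ?v * (\<Sum>i\<in>UNIV. T i * ((\<Sum>r\<in>UNIV. \<Sum>s\<in>UNIV. vert (Ac r s) y * e i $ r * e i $ s) - e i \<bullet> (A y *v e i)))"
  proof -
    have Hsi: "(Hs y *v e i) \<bullet> e i = e i \<bullet> (B y *v e i) - e i \<bullet> (A y *v e i)" for i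
      by (simp add: B_def matrix_vector_mult_add_rdistrib inner_add_right inner_commute)
    have gen: "(\<Sum>i\<in>UNIV. ((- (?v * K * h * a i) - h * ?v * (b i - d i) - r i) + ha i - h * ?v * va i) * T i)
      = - (K * h * ?v * (\<Sum>i\<in>UNIV. T i * a i)) - h * ?v * (\<Sum>i\<in>UNIV. T i * b i) - (\<Sum>i\<in>UNIV. T i * r i)
        + (\<Sum>i\<in>UNIV. T i * ha i) - h * ?v * (\<Sum>i\<in>UNIV. T i * (va i - d i))" for a b d r ha va :: "'n \<Rightarrow> real"
      unfolding sum_distrib_left sum_negf[symmetric] sum.distrib[symmetric] sum_subtractf[symmetric]
      by (intro sum.cong refl) (simp add: algebra_simps)
    show ?thesis unfolding Hsi by (rule gen)
  qed
  finally show ?thesis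
  proof -
    have pp: "\<phi> y ^ p = \<phi> y ^ (p - 1) * \<phi> y" using p1 by (metis power_Suc2)
    assume "real p * \<phi> y ^ (p - 1) * (hort F y - h * ?v * vert F y)
     \<le> - (K * h * ?v * (\<Sum>i\<in>UNIV. T i * (?q \<bullet> e i)\<^sup>2))
      - h * ?v * (\<Sum>i\<in>UNIV. T i * (e i \<bullet> (B y *v e i)))
      - (\<Sum>i\<in>UNIV. T i * Rm y (e i) ?N)
      + (\<Sum>i\<in>UNIV. T i * ((\<Sum>r\<in>UNIV. \<Sum>s\<in>UNIV. hort (Ac r s) y * e i $ r * e i $ s) - 2 * ((A y *v e i) \<bullet> (Gam y ?N *v e i))))
      - h * ?v * (\<Sum>i\<in>UNIV. T i * ((\<Sum>r\<in>UNIV. \<Sum>s\<in>UNIV. vert (Ac r s) y * e i $ r * e i $ s) - e i \<bullet> (A y *v e i)))"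
    then show ?thesis unfolding sumB pp by (simp add: algebra_simps)
  qed
qed

end

section \<open>The Hessian in terms of scalar functions\<close>

context local_metric
begin

text \<open>The scalar function \<open>\<langle>dU, dV\<rangle>\<close>.\<close>
definition pair :: "(real^'n \<Rightarrow> real) \<Rightarrow> (real^'n \<Rightarrow> real) \<Rightarrow> real^'n \<Rightarrow> real" where
  "pair U V y = (\<chi> j. pd j U y) \<bullet> (matrix_inv (G y) *v (\<chi> j. pd j V y))"

lemma pair_derivative:
  assumes U: "Ck_on 3 U \<Omega>" and V: "Ck_on 3 V \<Omega>" and y: "y \<in> \<Omega>"
  shows "pair U V differentiable (at y)"
    and "frechet_derivative (pair U V) (at y) f =
      (local_metric_function.Hs G U y *v f) \<bullet> local_metric_function.nab G V y
      + (local_metric_function.Hs G V y *v f) \<bullet> local_metric_function.nab G U y"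
proof -
  interpret u: local_metric_function \<Omega> G U by unfold_locales (rule U)
  interpret v: local_metric_function \<Omega> G V by unfold_locales (rule V)
  have smooth: "Ck_on 1 (pair U V) \<Omega>"
  proof -
    have "Ck_on 1 (\<lambda>y. \<Sum>i\<in>UNIV. pd i U y * (\<Sum>j\<in>UNIV. matrix_inv (G y) $ i $ j * pd j V y)) \<Omega>"
      by (intro Ck_on_sum Ck_on_mult open_dom inv_smooth Ck_on_le[OF _ u.U1] Ck_on_le[OF _ v.U1]) auto
    then show ?thesis by (simp add: pair_def[abs_def] inner_vec_def matrix_vector_mult_def)
  qed
  then show d: "pair U V differentiable (at y)" using Ck_on_differentiable[of 1] y by simp
  have y0: "y + 0 *\<^sub>R f \<in> \<Omega>" using y by simp
  have "((\<lambda>s. pair U V (y + s *\<^sub>R f)) has_real_derivative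
     u.grad y \<bullet> (matrix_inv (G y) *v (v.Hs y *v f) - Gam y f *v v.nab y) + (u.D2 y *v f) \<bullet> v.nab y) (at 0)"
    using has_vector_derivative_inner[OF u.grad_line[OF y0] v.nab_line[OF y0]]
    by (simp add: has_real_derivative_iff_has_vector_derivative pair_def u.grad_def v.grad_def v.nab_def)
  moreover have "((\<lambda>s. pair U V (y + s *\<^sub>R f)) has_real_derivative frechet_derivative (pair U V) (at y) f) (at 0)"
    using line_derivative_at[of "pair U V" y 0 f] d by simp
  ultimately have "frechet_derivative (pair U V) (at y) f =
     u.grad y \<bullet> (matrix_inv (G y) *v (v.Hs y *v f) - Gam y f *v v.nab y) + (u.D2 y *v f) \<bullet> v.nab y"
    by (rule DERIV_unique[rotated])
  moreover have "u.grad y \<bullet> (matrix_inv (G y) *v (v.Hs y *v f)) = (v.Hs y *v f) \<bullet> u.nab y"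
    using inner_matrix_commute[OF transpose_G[OF y], of "matrix_inv (G y) *v (v.Hs y *v f)" "u.nab y"]
    by (simp add: u.G_nab[OF y] G_inv[OF y] inner_commute)
  moreover have "u.grad y \<bullet> (Gam y f *v v.nab y) = (transpose (Gam y f) *v u.grad y) \<bullet> v.nab y"
    by (simp add: dot_lmul_matrix)
  ultimately show "frechet_derivative (pair U V) (at y) f = (u.Hs y *v f) \<bullet> v.nab y + (v.Hs y *v f) \<bullet> u.nab y"
    by (simp only: u.Hs_apply[OF y] inner_diff_left inner_diff_right)
qed

text \<open>The derivative of \<open>\<langle>dU, dV\<rangle>\<close> along \<open>X\<close> is \<open>\<nabla>\<^sup>2U(X, \<nabla>V) + \<nabla>\<^sup>2V(X, \<nabla>U)\<close>; polarisation isolates one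
  Hessian. As the right-hand side consists of derivatives of scalar functions, it has the same value
  in all charts.\<close>
lemma Hs_from_pair:
  assumes U: "Ck_on 3 U \<Omega>" and V: "Ck_on 3 V \<Omega>" and W: "Ck_on 3 W \<Omega>" and y: "y \<in> \<Omega>"
  defines "nab \<equiv> \<lambda>U. local_metric_function.nab G U y"
  shows "2 * (nab V \<bullet> (local_metric_function.Hs G U y *v nab W)) =
     frechet_derivative (pair U W) (at y) (nab V) + frechet_derivative (pair U V) (at y) (nab W)
     - frechet_derivative (pair V W) (at y) (nab U)"
proof -
  interpret u: local_metric_function \<Omega> G U by unfold_locales (rule U)
  interpret v: local_metric_function \<Omega> G V by unfold_locales (rule V)
  interpret w: local_metric_function \<Omega> G W by unfold_locales (rule W)
  have s: "(v.Hs y *v a) \<bullet> b = (v.Hs y *v b) \<bullet> a" "(w.Hs y *v a) \<bullet> b = (w.Hs y *v b) \<bullet> a" "(u.Hs y *v a) \<bullet> b = (u.Hs y *v b) \<bullet> a" for a b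
    using inner_matrix_commute[OF v.transpose_Hs[OF y], of b a] inner_matrix_commute[OF w.transpose_Hs[OF y], of b a]
      inner_matrix_commute[OF u.transpose_Hs[OF y], of b a]
    by (simp_all add: inner_commute)
  show ?thesis unfolding nab_def pair_derivative(2)[OF U W y] pair_derivative(2)[OF U V y] pair_derivative(2)[OF V W y]
    using s(1)[of "w.nab y" "u.nab y"] s(2)[of "v.nab y" "u.nab y"] s(3)[of "v.nab y" "w.nab y"]
    by (simp add: inner_commute[of "v.nab y" "u.Hs y *v w.nab y"])
qed

end

section \<open>Charts and tangent vectors\<close>

definition transition :: "('m,'n) chart \<Rightarrow> ('m,'n) chart \<Rightarrow> real^'n \<Rightarrow> real^'n" where
  "transition c d = (\<lambda>y. crd d (cinv c y))"

definition jac :: "('m,'n::finite) chart \<Rightarrow> ('m,'n) chart \<Rightarrow> 'm \<Rightarrow> real^'n \<Rightarrow> real^'n" where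
  "jac c d x = frechet_derivative (transition c d) (at (crd c x))"

lemma smooth_fun_onD: "smooth_fun_on f S \<Longrightarrow> Ck_on k f S"
  by (simp add: smooth_fun_on_def)

locale manifold =
  fixes \<A> :: "('m::topological_space,'n::finite) chart set"
  assumes structure_A: "smooth_structure \<A>"
begin

abbreviation loc :: "('m,'n) chart \<Rightarrow> ('m \<Rightarrow> real) \<Rightarrow> real^'n \<Rightarrow> real" where
  "loc c u \<equiv> \<lambda>y. u (cinv c y)"

lemma chart:
  assumes "c \<in> \<A>"
  shows "open (cdom c)" "open (img c)" "homeomorphism (cdom c) (img c) (crd c) (cinv c)"
  using structure_A assms by (auto simp: smooth_structure_def is_chart_def)

lemma cinv_crd: "c \<in> \<A> \<Longrightarrow> x \<in> cdom c \<Longrightarrow> cinv c (crd c x) = x"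
  using chart(3)[of c] by (simp add: homeomorphism_def)

lemma crd_cinv: "c \<in> \<A> \<Longrightarrow> y \<in> img c \<Longrightarrow> crd c (cinv c y) = y"
  using chart(3)[of c] by (auto simp: homeomorphism_def)

lemma cinv_mem: "c \<in> \<A> \<Longrightarrow> y \<in> img c \<Longrightarrow> cinv c y \<in> cdom c"
  using chart(3)[of c] by (auto simp: homeomorphism_def)

lemma chart_at: "chart_at \<A> x \<in> \<A>" "x \<in> cdom (chart_at \<A> x)"
proof -
  have "x \<in> (\<Union>c\<in>\<A>. cdom c)" using structure_A by (simp only: smooth_structure_def UNIV_I)
  then have "\<exists>c. c \<in> \<A> \<and> x \<in> cdom c" by blast
  then have "chart_at \<A> x \<in> \<A> \<and> x \<in> cdom (chart_at \<A> x)"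
    unfolding chart_at_def by (rule someI_ex)
  then show "chart_at \<A> x \<in> \<A>" "x \<in> cdom (chart_at \<A> x)" by auto
qed

lemma open_overlap:
  assumes c: "c \<in> \<A>" and d: "d \<in> \<A>"
  shows "open (crd c ` (cdom c \<inter> cdom d))"
proof -
  have "openin (top_of_set (cdom c)) (cdom c \<inter> cdom d)"
    using chart(1)[OF d] by (rule openin_open_Int)
  then have "openin (top_of_set (img c)) (crd c ` (cdom c \<inter> cdom d))"
    by (rule homeomorphism_imp_open_map[OF chart(3)[OF c]])
  then show ?thesis using chart(2)[OF c] openin_open_trans by blast
qed

lemma transition_smooth:
  assumes "c \<in> \<A>" "d \<in> \<A>"
  shows "Ck_on k (\<lambda>y. transition c d y $ i) (crd c ` (cdom c \<inter> cdom d))"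
  using structure_A assms
  by (auto simp: smooth_structure_def compatible_def transition_def intro!: smooth_fun_onD)

lemma transition_derivative:
  assumes "c \<in> \<A>" "d \<in> \<A>" "x \<in> cdom c" "x \<in> cdom d"
  shows "(transition c d has_derivative jac c d x) (at (crd c x))"
proof -
  have "(\<lambda>y. transition c d y $ i) differentiable (at (crd c x))" for i
    using Ck_on_differentiable[OF transition_smooth[OF assms(1,2), of 1]] assms by auto
  then have "transition c d differentiable (at (crd c x))"
    unfolding differentiable_componentwise_within[of "transition c d"]
    by (auto simp: Basis_vec_def inner_axis)
  then show ?thesis by (simp add: jac_def frechet_derivative_works)
qed

lemma jac_linear: "c \<in> \<A> \<Longrightarrow> d \<in> \<A> \<Longrightarrow> x \<in> cdom c \<Longrightarrow> x \<in> cdom d \<Longrightarrow> linear (jac c d x)"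
  using transition_derivative has_derivative_linear by blast

lemma transition_crd: "c \<in> \<A> \<Longrightarrow> x \<in> cdom c \<Longrightarrow> transition c d (crd c x) = crd d x"
  by (simp add: transition_def cinv_crd)

lemma jac_compose:
  assumes "c \<in> \<A>" "d \<in> \<A>" "e \<in> \<A>" "x \<in> cdom c" "x \<in> cdom d" "x \<in> cdom e"
  shows "jac d e x (jac c d x w) = jac c e x w"
proof -
  have "(transition d e has_derivative jac d e x) (at (transition c d (crd c x)))"
    using transition_derivative[of d e x] assms by (simp add: transition_crd)
  from has_derivative_compose[OF transition_derivative[of c d x] this]
  have "((\<lambda>y. transition d e (transition c d y)) has_derivative (\<lambda>w. jac d e x (jac c d x w))) (at (crd c x))"
    using assms by simp
  then have "(transition c e has_derivative (\<lambda>w. jac d e x (jac c d x w))) (at (crd c x))"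
    by (rule has_derivative_transform_within_open[OF _ open_overlap[OF assms(1,2)]])
      (use assms in \<open>auto simp: transition_crd\<close>)
  then show ?thesis using transition_derivative[of c e x] assms has_derivative_unique by metis
qed

lemma jac_self:
  assumes "c \<in> \<A>" "x \<in> cdom c" shows "jac c c x w = w"
proof -
  have "((\<lambda>y. y) has_derivative (\<lambda>w. w)) (at (crd c x))" by (rule has_derivative_ident)
  then have "(transition c c has_derivative (\<lambda>w. w)) (at (crd c x))"
    by (rule has_derivative_transform_within_open[OF _ open_overlap[OF assms(1,1)]])
      (use assms in \<open>auto simp: transition_crd\<close>)
  then show ?thesis using transition_derivative[of c c x] assms has_derivative_unique by metis
qed

text \<open>\<open>tv c x w\<close> is the tangent vector at \<open>x\<close> with the components \<open>w\<close> in the chart \<open>c\<close>.\<close>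
definition tv :: "('m,'n) chart \<Rightarrow> 'm \<Rightarrow> real^'n \<Rightarrow> ('m,'n) tvec" where
  "tv c x w = (\<lambda>d. if d \<in> \<A> \<and> x \<in> cdom d then jac c d x w else 0)"

lemma coord_vec_tv: "coord_vec \<A> c x j = tv c x (axis j 1)"
  unfolding coord_vec_def tv_def jac_def transition_def ..

lemma tv_coord: "c \<in> \<A> \<Longrightarrow> x \<in> cdom c \<Longrightarrow> tv c x w c = w"
  by (simp add: tv_def jac_self)

lemma tv_coord': "d \<in> \<A> \<Longrightarrow> x \<in> cdom d \<Longrightarrow> tv c x w d = jac c d x w"
  by (simp add: tv_def)

lemma tv_tspace:
  assumes "c \<in> \<A>" "x \<in> cdom c" shows "tv c x w \<in> tspace \<A> x"
  using jac_compose[OF assms(1) _ _ assms(2)]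
  by (auto simp: tspace_def tv_def jac_def[symmetric] transition_def[symmetric])

lemma tspace_tv:
  assumes v: "v \<in> tspace \<A> x" and c: "c \<in> \<A>" "x \<in> cdom c" shows "v = tv c x (v c)"
proof
  fix d
  show "v d = tv c x (v c) d"
  proof (cases "d \<in> \<A> \<and> x \<in> cdom d")
    case True
    then have "v d = frechet_derivative (\<lambda>y. crd d (cinv c y)) (at (crd c x)) (v c)"
      using v c unfolding tspace_def by blast
    then show ?thesis using True by (simp add: tv_def jac_def transition_def)
  next
    case False
    then have "v d = 0" using v unfolding tspace_def by blast
    then show ?thesis using False by (auto simp: tv_def)
  qed
qed

lemma tv_jac:
  assumes "c \<in> \<A>" "x \<in> cdom c" "d \<in> \<A>" "x \<in> cdom d"
  shows "tv d x (jac c d x w) = tv c x w"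
  using assms by (auto simp: tv_def jac_compose fun_eq_iff)

lemma tv_lincomb:
  assumes "c \<in> \<A>" "x \<in> cdom c"
  shows "lincomb r (tv c x a) s (tv c x b) = tv c x (r *\<^sub>R a + s *\<^sub>R b)"
  using assms by (auto simp: lincomb_def tv_def fun_eq_iff linear_add[OF jac_linear] linear_scale[OF jac_linear])

lemma linear_expand:
  assumes "linear (h :: real^'n \<Rightarrow> real)" shows "h w = (\<chi> j. h (axis j 1)) \<bullet> w"
proof -
  have "w = (\<Sum>j\<in>UNIV. w $ j *\<^sub>R axis j 1)" using basis_expansion[of w] by (simp add: scalar_mult_eq_scaleR)
  then have "h w = h (\<Sum>j\<in>UNIV. w $ j *\<^sub>R axis j 1)" by simp
  then show ?thesis by (simp add: linear_sum[OF assms] linear_scale[OF assms] inner_vec_def mult.commute)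
qed

lemma bilinear_components:
  assumes b: "sym_bilinear_on (tspace \<A> x) (B x)" and c: "c \<in> \<A>" "x \<in> cdom c"
  shows "B x (tv c x v) (tv c x w) = v \<bullet> (components \<A> B c x *v w)"
proof -
  have l1: "linear (\<lambda>v. B x (tv c x v) (tv c x w))" for w
  proof (rule linearI)
    fix a a' and r :: real
    show "B x (tv c x (a + a')) (tv c x w) = B x (tv c x a) (tv c x w) + B x (tv c x a') (tv c x w)"
      using b tv_lincomb[OF c, of 1 a 1 a'] tv_tspace[OF c] unfolding sym_bilinear_on_def by (metis mult_1 scaleR_one)
    show "B x (tv c x (r *\<^sub>R a)) (tv c x w) = r *\<^sub>R B x (tv c x a) (tv c x w)"
      using b tv_lincomb[OF c, of r a 0 a] tv_tspace[OF c] unfolding sym_bilinear_on_def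
      by (metis add.right_neutral mult_zero_left scaleR_zero_left real_scaleR_def)
  qed
  have sym: "B x (tv c x v) (tv c x w) = B x (tv c x w) (tv c x v)" for v w
    using b tv_tspace[OF c] by (auto simp: sym_bilinear_on_def)
  have l2: "linear (\<lambda>w. B x (tv c x v) (tv c x w))" for v
    unfolding sym[of v] by (rule l1)
  have "B x (tv c x v) (tv c x w) = (\<chi> j. B x (tv c x (axis j 1)) (tv c x w)) \<bullet> v"
    by (rule linear_expand[OF l1])
  also have "(\<chi> j. B x (tv c x (axis j 1)) (tv c x w)) = components \<A> B c x *v w"
  proof -
    have "B x (tv c x (axis j 1)) (tv c x w) = (components \<A> B c x *v w) $ j" for j
      using linear_expand[OF l2, of "axis j 1" w]
      by (simp add: components_def coord_vec_tv matrix_vector_mult_def inner_vec_def)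
    then show ?thesis by (simp add: vec_eq_iff)
  qed
  finally show ?thesis by (simp add: inner_commute)
qed

lemma components_sym:
  assumes b: "sym_bilinear_on (tspace \<A> x) (B x)" and c: "c \<in> \<A>" "x \<in> cdom c"
  shows "transpose (components \<A> B c x) = components \<A> B c x"
  using b tv_tspace[OF c] by (simp add: transpose_def components_def vec_eq_iff coord_vec_tv sym_bilinear_on_def)

lemma covector_tv:
  assumes a: "\<alpha> \<in> cotspace \<A> x" and c: "c \<in> \<A>" "x \<in> cdom c"
  shows "\<alpha> (tv c x w) = cocomp \<A> c x \<alpha> \<bullet> w"
proof -
  have lc: "\<alpha> (lincomb r v s w) = r * \<alpha> v + s * \<alpha> w" if "v \<in> tspace \<A> x" "w \<in> tspace \<A> x" for r s v w
    using a that by (auto simp: cotspace_def)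
  have "linear (\<lambda>w. \<alpha> (tv c x w))"
  proof (rule linearI)
    fix v w and r :: real
    show "\<alpha> (tv c x (v + w)) = \<alpha> (tv c x v) + \<alpha> (tv c x w)"
      using lc[of "tv c x v" "tv c x w" 1 1] tv_lincomb[OF c, of 1 v 1 w] tv_tspace[OF c] by simp
    show "\<alpha> (tv c x (r *\<^sub>R v)) = r *\<^sub>R \<alpha> (tv c x v)"
      using lc[of "tv c x v" "tv c x v" r 0] tv_lincomb[OF c, of r v 0 v] tv_tspace[OF c] by simp
  qed
  from linear_expand[OF this, of w] show ?thesis by (simp add: cocomp_def coord_vec_tv)
qed

lemma covec_of_tv:
  assumes c: "c \<in> \<A>" "x \<in> cdom c" shows "covec_of \<A> c x a (tv c x w) = a \<bullet> w"
  using tv_tspace[OF c] by (simp add: covec_of_def tv_coord[OF c] inner_vec_def)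

lemma covec_of_cotspace:
  assumes c: "c \<in> \<A>" "x \<in> cdom c" shows "covec_of \<A> c x a \<in> cotspace \<A> x"
proof -
  have "covec_of \<A> c x a (lincomb r v s w) = r * covec_of \<A> c x a v + s * covec_of \<A> c x a w"
    if "v \<in> tspace \<A> x" "w \<in> tspace \<A> x" for r s v w
  proof -
    define v' w' where "v' = v c" and "w' = w c"
    have e: "v = tv c x v'" "w = tv c x w'" unfolding v'_def w'_def using tspace_tv[OF _ c] that by blast+
    show ?thesis unfolding e tv_lincomb[OF c] covec_of_tv[OF c] by (simp add: inner_add_right)
  qed
  moreover have "covec_of \<A> c x a v = 0" if "v \<notin> tspace \<A> x" for v using that by (simp add: covec_of_def)
  ultimately show ?thesis by (auto simp: cotspace_def)
qed

lemma cocomp_covec_of: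
  assumes c: "c \<in> \<A>" "x \<in> cdom c" shows "cocomp \<A> c x (covec_of \<A> c x a) = a"
  by (simp add: cocomp_def coord_vec_tv covec_of_tv[OF c] vec_eq_iff inner_axis)

lemma covector_eqI:
  assumes "\<alpha> \<in> cotspace \<A> x" "\<beta> \<in> cotspace \<A> x" and c: "c \<in> \<A>" "x \<in> cdom c"
    and "cocomp \<A> c x \<alpha> = cocomp \<A> c x \<beta>"
  shows "\<alpha> = \<beta>"
proof
  fix v
  show "\<alpha> v = \<beta> v"
  proof (cases "v \<in> tspace \<A> x")
    case True
    show ?thesis using covector_tv[OF assms(1) c, of "v c"] covector_tv[OF assms(2) c, of "v c"] assms(5)
      by (simp add: tspace_tv[OF True c, symmetric])
  next
    case False
    then show ?thesis using assms by (auto simp: cotspace_def)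
  qed
qed

lemma covec_of_cocomp:
  assumes "\<alpha> \<in> cotspace \<A> x" and c: "c \<in> \<A>" "x \<in> cdom c"
  shows "covec_of \<A> c x (cocomp \<A> c x \<alpha>) = \<alpha>"
  by (rule covector_eqI[OF covec_of_cotspace[OF c] assms(1) c]) (rule cocomp_covec_of[OF c])

lemma cocomp_jac:
  assumes "\<alpha> \<in> cotspace \<A> x" and c: "c \<in> \<A>" "x \<in> cdom c" and d: "d \<in> \<A>" "x \<in> cdom d"
  shows "cocomp \<A> c x \<alpha> \<bullet> w = cocomp \<A> d x \<alpha> \<bullet> jac c d x w"
  using covector_tv[OF assms(1) c, of w] covector_tv[OF assms(1) d, of "jac c d x w"] tv_jac[OF c d, of w] by simp

lemma local_rep_chain:
  assumes c: "c \<in> \<A>" "x \<in> cdom c" and d: "d \<in> \<A>" "x \<in> cdom d"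
    and diff: "(loc d u) differentiable (at (crd d x))"
  shows "(loc c u) differentiable (at (crd c x))"
    and "frechet_derivative (loc c u) (at (crd c x)) w = frechet_derivative (loc d u) (at (crd d x)) (jac c d x w)"
proof -
  have "((loc d u) has_derivative frechet_derivative (loc d u) (at (crd d x))) (at (transition c d (crd c x)))"
    using diff c by (simp add: transition_crd frechet_derivative_works)
  from has_derivative_compose[OF transition_derivative[OF c(1) d(1) c(2) d(2)] this]
  have "((\<lambda>y. u (cinv d (transition c d y))) has_derivative
     (\<lambda>w. frechet_derivative (loc d u) (at (crd d x)) (jac c d x w))) (at (crd c x))" .
  then have h: "((loc c u) has_derivative
     (\<lambda>w. frechet_derivative (loc d u) (at (crd d x)) (jac c d x w))) (at (crd c x))"
    by (rule has_derivative_transform_within_open[OF _ open_overlap[OF c(1) d(1)]])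
      (use c d in \<open>auto simp: transition_crd cinv_crd\<close>)
  then show "(loc c u) differentiable (at (crd c x))" by (auto simp: differentiable_def)
  show "frechet_derivative (loc c u) (at (crd c x)) w = frechet_derivative (loc d u) (at (crd d x)) (jac c d x w)"
    using frechet_derivative_at[OF h, symmetric] by simp
qed

lemma grad_frechet:
  "f differentiable (at y) \<Longrightarrow> frechet_derivative f (at y) w = (\<chi> j. pd j f y) \<bullet> w"
  by (simp add: frechet_derivative_pd inner_vec_def mult.commute)

text \<open>By the chain rule, the arbitrary chart in the definition of \<open>differential\<close> may be replaced by \<open>c\<close>.\<close>
lemma differential_chart:
  assumes u: "Ck_fun \<A> (Suc k) u" and c: "c \<in> \<A>" "x \<in> cdom c"
  shows "differential \<A> u x = covec_of \<A> c x (\<chi> j. pd j (loc c u) (crd c x))"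
proof -
  let ?d = "chart_at \<A> x"
  have diff: "(loc e u) differentiable (at (crd e x))" if "e \<in> \<A>" "x \<in> cdom e" for e
    using u that by (auto simp: Ck_fun_def)
  show ?thesis unfolding differential_def Let_def
  proof (rule covector_eqI[OF covec_of_cotspace[OF chart_at] covec_of_cotspace[OF c] c])
    let ?qd = "\<chi> j. pd j (loc ?d u) (crd ?d x)" and ?qc = "\<chi> j. pd j (loc c u) (crd c x)"
    have "cocomp \<A> c x (covec_of \<A> ?d x ?qd) \<bullet> w = ?qc \<bullet> w" for w
    proof -
      have "cocomp \<A> c x (covec_of \<A> ?d x ?qd) \<bullet> w = ?qd \<bullet> jac c ?d x w"
        using cocomp_jac[OF covec_of_cotspace[OF chart_at] c chart_at] cocomp_covec_of[OF chart_at] by simp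
      also have "\<dots> = ?qc \<bullet> w"
        using local_rep_chain(2)[OF c chart_at, of u w] diff[OF chart_at] diff[OF c] by (simp add: grad_frechet)
      finally show ?thesis .
    qed
    then show "cocomp \<A> c x (covec_of \<A> ?d x ?qd) = cocomp \<A> c x (covec_of \<A> c x ?qc)"
      unfolding cocomp_covec_of[OF c] by (subst vector_eq_rdot[symmetric]) (rule allI)
  qed
qed

end

section \<open>Riemannian metrics in charts\<close>

locale riemannian_manifold = manifold \<A>
  for \<A> :: "('m::topological_space,'n::finite) chart set" +
  fixes g :: "'m \<Rightarrow> ('m,'n) tvec \<Rightarrow> ('m,'n) tvec \<Rightarrow> real"
  assumes metric: "riemannian_metric \<A> g"
begin

definition Gc :: "('m,'n) chart \<Rightarrow> real^'n \<Rightarrow> real^'n^'n" where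
  "Gc c y = components \<A> g c (cinv c y)"

lemma g_components:
  assumes c: "c \<in> \<A>" "x \<in> cdom c"
  shows "g x (tv c x v) (tv c x w) = v \<bullet> (Gc c (crd c x) *v w)"
  using bilinear_components[of x g, OF _ c] metric by (simp add: riemannian_metric_def Gc_def cinv_crd c)

lemma local_metric_chart:
  assumes c: "c \<in> \<A>" shows "local_metric (img c) (Gc c)"
proof
  show "open (img c)" by (rule chart(2)[OF c])
  show "Ck_on k (\<lambda>y. Gc c y $ i $ j) (img c)" for i j k
    using metric c by (auto simp: riemannian_metric_def Gc_def intro!: smooth_fun_onD)
  fix y assume y: "y \<in> img c"
  note x = cinv_mem[OF c y]
  show "Gc c y $ i $ j = Gc c y $ j $ i" for i j
  proof -
    have "transpose (Gc c y) = Gc c y"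
      unfolding Gc_def using metric by (intro components_sym[OF _ c x]) (simp add: riemannian_metric_def)
    then have "transpose (Gc c y) $ j $ i = Gc c y $ j $ i" by simp
    then show ?thesis by (simp add: transpose_def)
  qed
  show "0 < v \<bullet> (Gc c y *v v)" if "v \<noteq> 0" for v
  proof -
    have "tv c (cinv c y) v \<noteq> (\<lambda>c. 0)" using that tv_coord[OF c x, of v] by auto
    then have "0 < g (cinv c y) (tv c (cinv c y) v) (tv c (cinv c y) v)"
      using metric tv_tspace[OF c x] by (simp add: riemannian_metric_def)
    then show ?thesis using g_components[OF c x, of v v] by (simp add: crd_cinv[OF c y])
  qed
qed

lemma metric_jac:
  assumes c: "c \<in> \<A>" "x \<in> cdom c" and d: "d \<in> \<A>" "x \<in> cdom d"
  shows "v \<bullet> (Gc c (crd c x) *v w) = jac c d x v \<bullet> (Gc d (crd d x) *v jac c d x w)"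
  using g_components[OF c, of v w] g_components[OF d, of "jac c d x v" "jac c d x w"] tv_jac[OF c d] by simp

lemma metric_nonneg:
  assumes v: "v \<in> tspace \<A> x" shows "0 \<le> g x v v"
proof (cases "v = (\<lambda>c. 0)")
  case True
  have "g x (tv (chart_at \<A> x) x 0) (tv (chart_at \<A> x) x 0) = 0" by (simp add: g_components[OF chart_at])
  moreover have "v = tv (chart_at \<A> x) x 0" using tspace_tv[OF v chart_at] True by simp
  ultimately show ?thesis by simp
next
  case False
  then show ?thesis using metric v by (auto simp: riemannian_metric_def less_imp_le)
qed

lemma ginv_Gc: "c \<in> \<A> \<Longrightarrow> x \<in> cdom c \<Longrightarrow> ginv \<A> g c x = matrix_inv (Gc c (crd c x))"
  by (simp add: ginv_def Gc_def cinv_crd)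

lemma christoffel_chr: "c \<in> \<A> \<Longrightarrow> x \<in> cdom c \<Longrightarrow> christoffel \<A> g c x l j k = chr (Gc c) l j k (crd c x)"
  by (simp add: christoffel_def chr_def ginv_Gc Gc_def)

lemma crd_img: "x \<in> cdom c \<Longrightarrow> crd c x \<in> img c" by simp

text \<open>The raised vector is characterised by its metric products with all vectors, and these agree in
  both charts.\<close>
lemma raise_jac:
  assumes c: "c \<in> \<A>" "x \<in> cdom c" and d: "d \<in> \<A>" "x \<in> cdom d"
    and q: "\<And>w. q \<bullet> w = q' \<bullet> jac c d x w"
  shows "jac c d x (matrix_inv (Gc c (crd c x)) *v q) = matrix_inv (Gc d (crd d x)) *v q'"
proof -
  interpret c: local_metric "img c" "Gc c" by (rule local_metric_chart[OF c(1)])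
  interpret d: local_metric "img d" "Gc d" by (rule local_metric_chart[OF d(1)])
  let ?N = "matrix_inv (Gc c (crd c x)) *v q"
  have "w \<bullet> (Gc d (crd d x) *v jac c d x ?N) = w \<bullet> q'" for w
  proof -
    define w' where "w' = jac d c x w"
    have w: "w = jac c d x w'" using jac_compose[of d c d x w] jac_self[OF d, of w] c d by (simp add: w'_def)
    have "w \<bullet> (Gc d (crd d x) *v jac c d x ?N) = w' \<bullet> (Gc c (crd c x) *v ?N)"
      unfolding w by (rule metric_jac[OF c d, symmetric])
    also have "\<dots> = w' \<bullet> q" using c.G_inv(3)[OF crd_img[OF c(2)]] by simp
    also have "\<dots> = w \<bullet> q'" using q[of w'] by (simp add: w inner_commute)
    finally show ?thesis .
  qed
  then have "Gc d (crd d x) *v jac c d x ?N = q'" using vector_eq_ldot by blast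
  then have "matrix_inv (Gc d (crd d x)) *v (Gc d (crd d x) *v jac c d x ?N) = matrix_inv (Gc d (crd d x)) *v q'" by (rule arg_cong)
  then show ?thesis using d.G_inv(4)[OF crd_img[OF d(2)]] by simp
qed

lemma conorm_sq:
  assumes a: "\<alpha> \<in> cotspace \<A> x" and c: "c \<in> \<A>" "x \<in> cdom c"
  shows "(conorm \<A> g x \<alpha>)\<^sup>2 = cocomp \<A> c x \<alpha> \<bullet> (matrix_inv (Gc c (crd c x)) *v cocomp \<A> c x \<alpha>)"
proof -
  let ?d = "chart_at \<A> x"
  let ?a = "cocomp \<A> ?d x \<alpha>" and ?b = "cocomp \<A> c x \<alpha>"
  interpret d: local_metric "img ?d" "Gc ?d" by (rule local_metric_chart[OF chart_at(1)])
  let ?H = "matrix_inv (Gc ?d (crd ?d x))"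
  have nn: "0 \<le> ?a \<bullet> (?H *v ?a)"
  proof -
    have "?a = Gc ?d (crd ?d x) *v (?H *v ?a)" using d.G_inv(3)[OF crd_img[OF chart_at(2)]] by simp
    then have "?a \<bullet> (?H *v ?a) = (?H *v ?a) \<bullet> (Gc ?d (crd ?d x) *v (?H *v ?a))" by (metis inner_commute)
    then show ?thesis using d.G_pos[OF crd_img[OF chart_at(2)], of "?H *v ?a"] by (cases "?H *v ?a = 0") auto
  qed
  have "(\<Sum>j\<in>UNIV. \<Sum>k\<in>UNIV. ?H $ j $ k * ?a $ j * ?a $ k) = ?a \<bullet> (?H *v ?a)"
    by (simp add: inner_vec_def matrix_vector_mult_def sum_distrib_left mult_ac)
  then have e: "conorm \<A> g x \<alpha> = sqrt (?a \<bullet> (?H *v ?a))"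
    by (simp add: conorm_def Let_def ginv_Gc[OF chart_at])
  have "jac c ?d x (matrix_inv (Gc c (crd c x)) *v ?b) = ?H *v ?a"
    by (rule raise_jac[OF c chart_at]) (rule cocomp_jac[OF a c chart_at])
  then have "?a \<bullet> (?H *v ?a) = ?b \<bullet> (matrix_inv (Gc c (crd c x)) *v ?b)"
    using cocomp_jac[OF a c chart_at] by metis
  then show ?thesis unfolding e using nn by simp
qed

text \<open>By \<open>Hs_from_pair\<close> the Hessian is known on gradients of functions, through scalars
  that agree in both charts. The gradients of functions that are linear in the chart \<open>c\<close> exhaust the tangent
  space. In this way the transformation law of the Christoffel symbols is bypassed.\<close>
lemma Hs_jac:
  assumes u: "Ck_fun \<A> 3 u" and c: "c \<in> \<A>" "x \<in> cdom c" and d: "d \<in> \<A>" "x \<in> cdom d"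
  shows "v \<bullet> (local_metric_function.Hs (Gc c) (loc c u) (crd c x) *v w)
    = jac c d x v \<bullet> (local_metric_function.Hs (Gc d) (loc d u) (crd d x) *v jac c d x w)"
proof -
  let ?D = "cdom c \<inter> cdom d"
  let ?Wc = "crd c ` ?D" and ?Wd = "crd d ` (cdom d \<inter> cdom c)"
  have Wd: "?Wd = crd d ` ?D" by (simp add: Int_commute)
  have "local_metric ?Wc (Gc c) \<and> local_metric ?Wd (Gc d)"
  proof -
    have "local_metric (crd e ` (cdom e \<inter> cdom f)) (Gc e)" if "e \<in> \<A>" "f \<in> \<A>" for e f
    proof -
      interpret e: local_metric "img e" "Gc e" by (rule local_metric_chart[OF that(1)])
      have sub: "crd e ` (cdom e \<inter> cdom f) \<subseteq> img e" by auto
      show ?thesis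
      proof
        show "open (crd e ` (cdom e \<inter> cdom f))" by (rule open_overlap[OF that])
        show "Ck_on k (\<lambda>y. Gc e y $ i $ j) (crd e ` (cdom e \<inter> cdom f))" for i j k
          by (rule Ck_on_subset[OF sub e.G_smooth])
      qed (use sub e.G_sym e.G_pos in blast)+
    qed
    then show ?thesis using c d by blast
  qed
  then interpret c: local_metric ?Wc "Gc c" + d: local_metric ?Wd "Gc d" by auto
  define lin where "lin = (\<lambda>a z. a \<bullet> crd c z)"
  have y: "crd c x \<in> ?Wc" "crd d x \<in> ?Wd" using c d by auto
  \<comment> \<open>the functions to which \<open>Hs_from_pair\<close> applies in both charts\<close>
  define adm where "adm = (\<lambda>f :: 'm \<Rightarrow> real. Ck_on 3 (\<lambda>y. f (cinv c y)) ?Wc \<and> Ck_on 3 (\<lambda>y. f (cinv d y)) ?Wd)"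
  have admu: "adm u" using u c d by (auto simp: adm_def Ck_fun_def intro: Ck_on_subset)
  have adml: "adm (lin a)" for a
  proof -
    have "Ck_on 3 (\<lambda>y. \<Sum>i\<in>UNIV. a $ i * transition e c y $ i) (crd e ` (cdom e \<inter> cdom f))"
      if "e = c \<and> f = d \<or> e = d \<and> f = c" for e f
    proof (intro Ck_on_sum Ck_on_mult Ck_on_const)
      show "open (crd e ` (cdom e \<inter> cdom f))" using that c d open_overlap by blast
      then show "open (crd e ` (cdom e \<inter> cdom f))" .
      show "Ck_on 3 (\<lambda>y. transition e c y $ i) (crd e ` (cdom e \<inter> cdom f))" for i
        using that c d by (auto intro: Ck_on_subset[OF _ transition_smooth])
    qed
    from this[of c d] this[of d c] show ?thesis
      by (simp add: adm_def lin_def inner_vec_def transition_def)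
  qed
  let ?c = "\<lambda>f y. f (cinv c y)" and ?d = "\<lambda>f y. f (cinv d y)"
  have diff: "(\<lambda>y. f (cinv d y)) differentiable (at (crd d z))" "(\<lambda>y. f (cinv c y)) differentiable (at (crd c z))"
    if "adm f" "z \<in> ?D" for f z
    using that Ck_on_differentiable[of 3] by (auto simp: adm_def)
  have gr: "(\<chi> j. pd j (?c f) (crd c z)) \<bullet> w = (\<chi> j. pd j (?d f) (crd d z)) \<bullet> jac c d z w" if "adm f" "z \<in> ?D" for f z w
    using local_rep_chain(2)[of c z d f w] diff[OF that] that(2) c d by (simp add: grad_frechet)
  have nab: "jac c d z (local_metric_function.nab (Gc c) (?c f) (crd c z)) = local_metric_function.nab (Gc d) (?d f) (crd d z)"
    if f: "adm f" and z: "z \<in> ?D" for f z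
  proof -
    interpret cf: local_metric_function ?Wc "Gc c" "?c f" using f by unfold_locales (simp add: adm_def)
    interpret df: local_metric_function ?Wd "Gc d" "?d f" using f by unfold_locales (simp add: adm_def)
    show ?thesis unfolding cf.nab_def df.nab_def cf.grad_def df.grad_def
      by (rule raise_jac[OF c(1) _ d(1) _ gr[OF f z]]) (use z in auto)
  qed
  have pair: "c.pair (?c f) (?c h) (crd c z) = d.pair (?d f) (?d h) (crd d z)" if f: "adm f" "adm h" and z: "z \<in> ?D" for f h z
  proof -
    have "jac c d z (matrix_inv (Gc c (crd c z)) *v (\<chi> j. pd j (?c h) (crd c z))) = matrix_inv (Gc d (crd d z)) *v (\<chi> j. pd j (?d h) (crd d z))"
      by (rule raise_jac[OF c(1) _ d(1) _ gr[OF f(2) z]]) (use z in auto)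
    then show ?thesis unfolding c.pair_def d.pair_def gr[OF f(1) z] by simp
  qed
  have dpair: "frechet_derivative (c.pair (?c f) (?c h)) (at (crd c x)) w = frechet_derivative (d.pair (?d f) (?d h)) (at (crd d x)) (jac c d x w)"
    if f: "adm f" "adm h" for f h w
  proof -
    have 1: "d.pair (?d f) (?d h) differentiable (at (transition c d (crd c x)))"
      using d.pair_derivative(1)[of "?d f" "?d h"] f y c by (simp add: adm_def transition_crd)
    have "((\<lambda>y. d.pair (?d f) (?d h) (transition c d y)) has_derivative
       (\<lambda>w. frechet_derivative (d.pair (?d f) (?d h)) (at (crd d x)) (jac c d x w))) (at (crd c x))"
      using has_derivative_compose[OF transition_derivative[OF c(1) d(1) c(2) d(2)] 1[unfolded frechet_derivative_works]] c
      by (simp add: transition_crd)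
    then have "(c.pair (?c f) (?c h) has_derivative
       (\<lambda>w. frechet_derivative (d.pair (?d f) (?d h)) (at (crd d x)) (jac c d x w))) (at (crd c x))"
      by (rule has_derivative_transform_within_open[OF _ open_overlap[OF c(1) d(1)] y(1)])
        (use c d pair[OF f] in \<open>auto simp: transition_crd\<close>)
    then show ?thesis using frechet_derivative_at by metis
  qed
  \<comment> \<open>Every vector at \<open>x\<close> is the gradient of a function that is linear in the chart \<open>c\<close>.\<close>
  have real: "local_metric_function.nab (Gc c) (?c (lin (Gc c (crd c x) *v a))) (crd c x) = a" for a
  proof -
    let ?q = "Gc c (crd c x) *v a"
    interpret cf: local_metric_function ?Wc "Gc c" "?c (lin ?q)" using adml by unfold_locales (simp add: adm_def)
    have "((\<lambda>y. ?q \<bullet> y) has_derivative (\<lambda>w. ?q \<bullet> w)) (at (crd c x))" by (auto intro!: derivative_eq_intros)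
    then have "(?c (lin ?q) has_derivative (\<lambda>w. ?q \<bullet> w)) (at (crd c x))"
      by (rule has_derivative_transform_within_open[OF _ chart(2)[OF c(1)]])
        (use c in \<open>auto simp: lin_def crd_cinv cinv_crd\<close>)
    then have "frechet_derivative (?c (lin ?q)) (at (crd c x)) = (\<lambda>w. ?q \<bullet> w)" using frechet_derivative_at by metis
    then have "cf.grad (crd c x) = ?q" by (simp add: cf.grad_def pd_def inner_axis vec_eq_iff)
    then show ?thesis using c.G_inv(4)[OF y(1)] by (simp add: cf.nab_def)
  qed
  define V W where "V = lin (Gc c (crd c x) *v v)" and "W = lin (Gc c (crd c x) *v w)"
  have a: "adm V" "adm W" by (auto simp: V_def W_def adml)
  have N: "local_metric_function.nab (Gc c) (?c V) (crd c x) = v" "local_metric_function.nab (Gc c) (?c W) (crd c x) = w"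
    by (auto simp: V_def W_def real)
  have x: "x \<in> ?D" using c d by simp
  have "2 * (v \<bullet> (local_metric_function.Hs (Gc c) (?c u) (crd c x) *v w)) = 
     2 * (jac c d x v \<bullet> (local_metric_function.Hs (Gc d) (?d u) (crd d x) *v jac c d x w))"
    using c.Hs_from_pair[of "?c u" "?c V" "?c W" "crd c x"] d.Hs_from_pair[of "?d u" "?d V" "?d W" "crd d x"]
      nab[OF a(1) x] nab[OF a(2) x] nab[OF admu x] dpair[OF admu a(2)] dpair[OF admu a(1)] dpair[OF a] admu a y
    by (simp add: adm_def N)
  then show ?thesis by simp
qed

lemma hessian_chart:
  assumes u: "Ck_fun \<A> 3 u" and c: "c \<in> \<A>" "x \<in> cdom c"
  shows "hessian \<A> g u x (tv c x v) (tv c x w) = v \<bullet> (local_metric_function.Hs (Gc c) (loc c u) (crd c x) *v w)"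
proof -
  let ?d = "chart_at \<A> x"
  interpret d: local_metric "img ?d" "Gc ?d" by (rule local_metric_chart[OF chart_at(1)])
  interpret d: local_metric_function "img ?d" "Gc ?d" "loc ?d u"
    by unfold_locales (use u chart_at(1) in \<open>simp add: Ck_fun_def\<close>)
  have "hessian \<A> g u x (tv c x v) (tv c x w) = jac c ?d x v \<bullet> (d.Hs (crd ?d x) *v jac c ?d x w)"
    by (simp add: hessian_def Let_def christoffel_chr[OF chart_at] tv_coord'[OF chart_at] d.Hs_def inner_vec_def
        matrix_vector_mult_def sum_distrib_left mult_ac)
  then show ?thesis using Hs_jac[OF u c chart_at, of v w] by simp
qed

end

section \<open>The structure conditions in charts\<close>

text \<open>Integration by parts: \<open>\<theta> f'(\<theta>) - f(\<theta>)\<close> is a primitive of \<open>\<theta> f''(\<theta>)\<close>.\<close>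
lemma has_integral_radial:
  fixes f :: "real \<Rightarrow> real"
  assumes f1: "\<And>\<theta>. (f has_real_derivative f1 \<theta>) (at \<theta>)" and f2: "\<And>\<theta>. (f1 has_real_derivative f2 \<theta>) (at \<theta>)"
  shows "integral {0..1} (\<lambda>\<theta>. \<theta> * f2 \<theta>) = f1 1 - f 1 + f 0"
proof -
  have "((\<lambda>\<theta>. \<theta> * f2 \<theta>) has_integral (1 * f1 1 - f 1) - (0 * f1 0 - f 0)) {0..1}"
  proof (rule fundamental_theorem_of_calculus)
    fix \<theta> :: real
    have "((\<lambda>\<theta>. \<theta> * f1 \<theta> - f \<theta>) has_real_derivative (\<theta> * f2 \<theta> + 1 * f1 \<theta>) - f1 \<theta>) (at \<theta>)"
      by (intro DERIV_diff DERIV_mult' DERIV_ident f1 f2)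
    then show "((\<lambda>\<theta>. \<theta> * f1 \<theta> - f \<theta>) has_vector_derivative \<theta> * f2 \<theta>) (at \<theta> within {0..1})"
      by (simp add: has_real_derivative_iff_has_vector_derivative has_vector_derivative_at_within)
  qed simp
  then show ?thesis by (simp add: integral_unique)
qed

context manifold
begin

lemma covec_scale:
  assumes a: "\<alpha> \<in> cotspace \<A> x" and c: "c \<in> \<A>" "x \<in> cdom c"
  shows "(\<lambda>z. \<theta> * \<alpha> z) = covec_of \<A> c x (\<theta> *\<^sub>R cocomp \<A> c x \<alpha>)"
proof -
  have "(\<lambda>z. \<theta> * \<alpha> z) = (\<lambda>z. \<theta> * covec_of \<A> c x (cocomp \<A> c x \<alpha>) z)" by (simp add: covec_of_cocomp[OF a c])
  also have "\<dots> = covec_of \<A> c x (\<theta> *\<^sub>R cocomp \<A> c x \<alpha>)"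
    by (auto simp: covec_of_def fun_eq_iff sum_distrib_left mult_ac)
  finally show ?thesis .
qed

text \<open>The second derivative at \<open>\<theta> \<alpha>\<close> in the direction \<open>(\<alpha>, \<alpha>)\<close> is the second derivative of the function
  \<open>\<theta> \<mapsto> \<psi>(\<theta> \<alpha>)\<close>.\<close>
lemma integral_second_deriv:
  assumes a: "\<alpha> \<in> cotspace \<A> x"
    and C2: "Ck_on 2 (\<lambda>b. \<psi> (covec_of \<A> (chart_at \<A> x) x b)) UNIV"
    and d: "((\<lambda>\<theta>. \<psi> (\<lambda>z. \<theta> * \<alpha> z)) has_real_derivative D) (at 1)"
  shows "integral {0..1} (\<lambda>\<theta>. \<theta> * second_deriv \<A> x \<psi> (\<lambda>z. \<theta> * \<alpha> z) \<alpha> \<alpha>) = D - \<psi> \<alpha> + \<psi> (\<lambda>z. 0)"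
proof -
  let ?c = "chart_at \<A> x"
  let ?a = "cocomp \<A> ?c x \<alpha>"
  define h where "h = (\<lambda>b. \<psi> (covec_of \<A> ?c x b))"
  have C2h: "Ck_on (Suc (Suc 0)) h UNIV" using C2 by (simp add: h_def numeral_2_eq_2)
  let ?f1 = "\<lambda>b. frechet_derivative h (at b) ?a"
  have d1: "h differentiable (at b)" "?f1 differentiable (at b)" for b using C2h by auto
  have f1: "((\<lambda>\<theta>. h (\<theta> *\<^sub>R ?a)) has_real_derivative ?f1 (\<theta> *\<^sub>R ?a)) (at \<theta>)" for \<theta>
    using line_derivative_at[of h 0 \<theta> ?a] d1 by simp
  have f2: "((\<lambda>\<theta>. ?f1 (\<theta> *\<^sub>R ?a)) has_real_derivative frechet_derivative ?f1 (at (\<theta> *\<^sub>R ?a)) ?a) (at \<theta>)" for \<theta>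
    using line_derivative_at[of ?f1 0 \<theta> ?a] d1 by simp
  have sd: "second_deriv \<A> x \<psi> (\<lambda>z. \<theta> * \<alpha> z) \<alpha> \<alpha> = frechet_derivative ?f1 (at (\<theta> *\<^sub>R ?a)) ?a" for \<theta>
    unfolding second_deriv_def Let_def covec_scale[OF a chart_at] cocomp_covec_of[OF chart_at] h_def ..
  have hs: "h (\<theta> *\<^sub>R ?a) = \<psi> (\<lambda>z. \<theta> * \<alpha> z)" for \<theta> by (simp add: h_def covec_scale[OF a chart_at])
  have "?f1 (1 *\<^sub>R ?a) = D" using DERIV_unique[OF f1[of 1]] d by (simp only: hs)
  then show ?thesis
    unfolding sd using has_integral_radial[OF f1 f2] hs[of 1] hs[of 0] by simp
qed

end

context riemannian_manifold
begin

text \<open>The function in the canonical coordinates \<open>(y, a)\<close> of the cotangent bundle.\<close>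
definition rep :: "('m,'n) chart \<Rightarrow> ('m,'n) cotfun \<Rightarrow> (real^'n) \<times> (real^'n) \<times> real \<Rightarrow> real" where
  "rep c f = (\<lambda>(y, a, t). f (cot_pt \<A> c y a) t)"

lemma rep_at:
  assumes "\<alpha> \<in> cotspace \<A> x" and c: "c \<in> \<A>" "x \<in> cdom c"
  shows "rep c f (crd c x, cocomp \<A> c x \<alpha>, t) = f (x, \<alpha>) t"
  by (simp add: rep_def cot_pt_def cinv_crd[OF c] covec_of_cocomp[OF assms])

lemma rep_smooth: "smooth_cotfun_in \<A> c f \<Longrightarrow> Ck_on k (rep c f) (img c \<times> UNIV \<times> UNIV)"
  by (simp add: smooth_cotfun_in_def smooth_fun_on_def rep_def)

lemma rep_diff: "smooth_cotfun_in \<A> c f \<Longrightarrow> y \<in> img c \<Longrightarrow> rep c f differentiable (at (y, a, t))"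
  by (rule Ck_on_differentiable[OF rep_smooth[of c f 1]]) auto

lemma rep_fibre_smooth:
  assumes "smooth_cotfun_in \<A> c f" "c \<in> \<A>" "x \<in> cdom c"
  shows "Ck_on k (\<lambda>b. f (x, covec_of \<A> c x b) t) UNIV"
proof -
  have "Ck_on k (\<lambda>b. rep c f ((crd c x, 0, t) + (0, b, 0))) UNIV"
    by (rule Ck_on_affine[OF open_UNIV _ rep_smooth[OF assms(1)]])
      (use assms in \<open>auto intro!: linearI\<close>)
  then show ?thesis by (simp add: rep_def cot_pt_def cinv_crd assms)
qed

lemma affine_chain:
  assumes "(f has_derivative f') (at (L z))" "(L has_derivative L') (at z)"
  shows "frechet_derivative (\<lambda>y. f (L y)) (at z) w = f' (L' w)"
  using frechet_derivative_at[OF has_derivative_compose[OF assms(2,1)], symmetric] by simp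

lemma rep_partial:
  assumes f: "smooth_cotfun_in \<A> c f" and y: "y \<in> img c"
  shows "pd j (\<lambda>y. f (cot_pt \<A> c y a) t) y = frechet_derivative (rep c f) (at (y, a, t)) (axis j 1, 0, 0)"
    and "pd j (\<lambda>b. f (cot_pt \<A> c y b) t) a = frechet_derivative (rep c f) (at (y, a, t)) (0, axis j 1, 0)"
    and "((\<lambda>\<tau>. f (cot_pt \<A> c y a) \<tau>) has_real_derivative frechet_derivative (rep c f) (at (y, a, t)) (0, 0, 1)) (at t)"
    and "((\<lambda>\<theta>. f (cot_pt \<A> c y (\<theta> *\<^sub>R a)) t) has_real_derivative frechet_derivative (rep c f) (at (y, a, t)) (0, a, 0)) (at 1)"
proof -
  have D: "(rep c f has_derivative frechet_derivative (rep c f) (at (y, a, t))) (at (y, a, t))"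
    using rep_diff[OF f y] by (simp add: frechet_derivative_works)
  show "pd j (\<lambda>y. f (cot_pt \<A> c y a) t) y = frechet_derivative (rep c f) (at (y, a, t)) (axis j 1, 0, 0)"
  proof -
    have "((\<lambda>y. (y, a, t)) has_derivative (\<lambda>w. (w, 0, 0))) (at y)"
      by (intro has_derivative_Pair has_derivative_ident has_derivative_const)
    from affine_chain[of "rep c f", OF D this, of "axis j 1"] show ?thesis by (simp add: pd_def rep_def)
  qed
  show "pd j (\<lambda>b. f (cot_pt \<A> c y b) t) a = frechet_derivative (rep c f) (at (y, a, t)) (0, axis j 1, 0)"
  proof -
    have "((\<lambda>b. (y, b, t)) has_derivative (\<lambda>w. (0, w, 0))) (at a)"
      by (intro has_derivative_Pair has_derivative_ident has_derivative_const)
    from affine_chain[of "rep c f", OF D this, of "axis j 1"] show ?thesis by (simp add: pd_def rep_def)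
  qed
  have "((\<lambda>s. rep c f ((y, a, 0) + s *\<^sub>R (0, 0, 1))) has_real_derivative frechet_derivative (rep c f) (at (y, a, t)) (0, 0, 1)) (at t)"
    using line_derivative_at[of "rep c f" "(y, a, 0)" t "(0, 0, 1)"] rep_diff[OF f y] by simp
  then show "((\<lambda>\<tau>. f (cot_pt \<A> c y a) \<tau>) has_real_derivative frechet_derivative (rep c f) (at (y, a, t)) (0, 0, 1)) (at t)"
    by (simp add: rep_def)
  have "((\<lambda>s. rep c f ((y, 0, t) + s *\<^sub>R (0, a, 0))) has_real_derivative frechet_derivative (rep c f) (at (y, a, t)) (0, a, 0)) (at 1)"
    using line_derivative_at[of "rep c f" "(y, 0, t)" 1 "(0, a, 0)"] rep_diff[OF f y] by simp
  then show "((\<lambda>\<theta>. f (cot_pt \<A> c y (\<theta> *\<^sub>R a)) t) has_real_derivative frechet_derivative (rep c f) (at (y, a, t)) (0, a, 0)) (at 1)"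
    by (simp add: rep_def)
qed

definition raise :: "('m,'n) chart \<Rightarrow> 'm \<Rightarrow> real^'n \<Rightarrow> real^'n" where
  "raise c x a = matrix_inv (Gc c (crd c x)) *v a"

text \<open>The velocity of the components of a covector with components \<open>a\<close> under parallel transport along
  the vector that corresponds to it. It is the fibre component of the horizontal derivative.\<close>
definition GamT :: "('m,'n) chart \<Rightarrow> 'm \<Rightarrow> real^'n \<Rightarrow> real^'n" where
  "GamT c x a = transpose (local_metric.Gam (Gc c) (crd c x) (raise c x a)) *v a"

lemma sum_raise:
  assumes c: "c \<in> \<A>" "x \<in> cdom c"
  shows "(\<Sum>j\<in>UNIV. \<Sum>k\<in>UNIV. ginv \<A> g c x $ j $ k * X j * a $ k) = (\<Sum>j\<in>UNIV. raise c x a $ j * X j)"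
  by (simp add: ginv_Gc[OF c] raise_def matrix_vector_mult_def sum_distrib_left sum_distrib_right mult_ac)

lemma horizontal_sum:
  assumes f: "smooth_cotfun_in \<A> c f" and a: "\<alpha> \<in> cotspace \<A> x" and c: "c \<in> \<A>" "x \<in> cdom c"
  defines "a \<equiv> cocomp \<A> c x \<alpha>"
  shows "(\<Sum>j\<in>UNIV. raise c x a $ j * horizontal \<A> g c j f x \<alpha> t)
    = frechet_derivative (rep c f) (at (crd c x, a, t)) (raise c x a, GamT c x a, 0)"
proof -
  interpret c: local_metric "img c" "Gc c" by (rule local_metric_chart[OF c(1)])
  let ?y = "crd c x" and ?N = "raise c x a"
  let ?D = "frechet_derivative (rep c f) (at (?y, a, t))"
  have y: "?y \<in> img c" using c by simp
  have lin: "linear ?D" by (rule linear_frechet_derivative[OF rep_diff[OF f y]])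
  have l1: "linear (\<lambda>w. ?D (w, 0, 0))" "linear (\<lambda>w. ?D (0, w, 0))"
  proof -
    have i: "linear (\<lambda>w :: real^'n. (w, 0 :: real^'n, 0 :: real))" "linear (\<lambda>w :: real^'n. (0 :: real^'n, w, 0 :: real))"
      by (auto intro!: linearI)
    show "linear (\<lambda>w. ?D (w, 0, 0))" "linear (\<lambda>w. ?D (0, w, 0))"
      using linear_compose[OF i(1) lin] linear_compose[OF i(2) lin] by (simp_all add: o_def)
  qed
  have h: "horizontal \<A> g c j f x \<alpha> t = ?D (axis j 1, 0, 0) + (\<Sum>l\<in>UNIV. \<Sum>m\<in>UNIV. chr (Gc c) l j m ?y * ?D (0, axis m 1, 0) * a $ l)" for j
    by (simp add: horizontal_def Let_def a_def[symmetric] christoffel_chr[OF c] rep_partial[OF f y])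
  have "(\<Sum>j\<in>UNIV. ?N $ j * horizontal \<A> g c j f x \<alpha> t) = (\<Sum>j\<in>UNIV. ?N $ j * ?D (axis j 1, 0, 0))
     + (\<Sum>j\<in>UNIV. \<Sum>l\<in>UNIV. \<Sum>m\<in>UNIV. ?D (0, axis m 1, 0) * (chr (Gc c) l j m ?y * ?N $ j * a $ l))"
    unfolding h by (simp add: distrib_left sum.distrib sum_distrib_left mult_ac)
  also have "(\<Sum>j\<in>UNIV. ?N $ j * ?D (axis j 1, 0, 0)) = ?D (?N, 0, 0)"
    unfolding linear_expand[OF l1(1), of ?N] by (simp add: inner_vec_def mult.commute)
  also have "(\<Sum>j\<in>UNIV. \<Sum>l\<in>UNIV. \<Sum>m\<in>UNIV. ?D (0, axis m 1, 0) * (chr (Gc c) l j m ?y * ?N $ j * a $ l))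
      = (\<Sum>m\<in>UNIV. \<Sum>j\<in>UNIV. \<Sum>l\<in>UNIV. ?D (0, axis m 1, 0) * (chr (Gc c) l j m ?y * ?N $ j * a $ l))"
    by (rule sum_rotate3)
  also have "\<dots> = (\<Sum>m\<in>UNIV. ?D (0, axis m 1, 0) * GamT c x a $ m)"
  proof (rule sum.cong[OF refl])
    fix m
    have "GamT c x a $ m = (\<Sum>l\<in>UNIV. \<Sum>j\<in>UNIV. chr (Gc c) l j m ?y * ?N $ j * a $ l)"
      by (simp add: GamT_def c.Gam_def transpose_def matrix_vector_mult_def[of "vec_lambda _"] sum_distrib_right
          del: transpose_matrix_vector)
    also have "\<dots> = (\<Sum>j\<in>UNIV. \<Sum>l\<in>UNIV. chr (Gc c) l j m ?y * ?N $ j * a $ l)" by (rule sum.swap)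
    finally show "(\<Sum>j\<in>UNIV. \<Sum>l\<in>UNIV. ?D (0, axis m 1, 0) * (chr (Gc c) l j m ?y * ?N $ j * a $ l))
        = ?D (0, axis m 1, 0) * GamT c x a $ m" by (simp add: sum_distrib_left)
  qed
  also have "\<dots> = ?D (0, GamT c x a, 0)"
    unfolding linear_expand[OF l1(2), of "GamT c x a"] by (simp add: inner_vec_def)
  also have "?D (?N, 0, 0) + ?D (0, GamT c x a, 0) = ?D (?N, GamT c x a, 0)"
    unfolding linear_add[OF lin, symmetric] by simp
  finally show ?thesis .
qed

text \<open>Together with the next lemmas this brings the conditions (iii) to (vi) to the form of the terms
  \<open>hort\<close> and \<open>vert\<close> in \<open>key_inequality\<close>, by the choice \<open>\<alpha> = du\<close>.\<close>
lemma structure_v: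
  assumes f: "smooth_cotfun_in \<A> c f" and a: "\<alpha> \<in> cotspace \<A> x" and c: "c \<in> \<A>" "x \<in> cdom c"
  defines "a \<equiv> cocomp \<A> c x \<alpha>"
  shows "(\<Sum>j\<in>UNIV. \<Sum>k\<in>UNIV. ginv \<A> g c x $ j $ k * horizontal \<A> g c j f x \<alpha> t * cocomp \<A> c x \<alpha> $ k)
      + deriv (\<lambda>\<tau>. f (x, \<alpha>) \<tau>) t * (conorm \<A> g x \<alpha>)\<^sup>2
    = frechet_derivative (rep c f) (at (crd c x, a, t)) (raise c x a, GamT c x a, 0)
      + (a \<bullet> raise c x a) * frechet_derivative (rep c f) (at (crd c x, a, t)) (0, 0, 1)"
proof -
  have y: "crd c x \<in> img c" using c by simp
  have "f (x, \<alpha>) = (\<lambda>\<tau>. f (cot_pt \<A> c (crd c x) a) \<tau>)"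
    by (simp add: cot_pt_def cinv_crd[OF c] a_def covec_of_cocomp[OF a c])
  then have "deriv (\<lambda>\<tau>. f (x, \<alpha>) \<tau>) t = frechet_derivative (rep c f) (at (crd c x, a, t)) (0, 0, 1)"
    using DERIV_imp_deriv[OF rep_partial(3)[OF f y, of a t]] by simp
  then show ?thesis
    unfolding sum_raise[OF c] using horizontal_sum[OF f a c, of t]
    by (simp add: a_def[symmetric] conorm_sq[OF a c] raise_def)
qed

lemma structure_vi:
  assumes f: "\<And>c. c \<in> \<A> \<Longrightarrow> smooth_cotfun_in \<A> c f" and a: "\<alpha> \<in> cotspace \<A> x" and c: "c \<in> \<A>" "x \<in> cdom c"
  defines "a \<equiv> cocomp \<A> c x \<alpha>"
  shows "integral {0..1} (\<lambda>\<theta>. \<theta> * second_deriv \<A> x (\<lambda>\<beta>. f (x, \<beta>) t) (\<lambda>z. \<theta> * \<alpha> z) \<alpha> \<alpha>)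
    = frechet_derivative (rep c f) (at (crd c x, a, t)) (0, a, 0) - f (x, \<alpha>) t + f (x, \<lambda>z. 0) t"
proof (rule integral_second_deriv[OF a])
  have y: "crd c x \<in> img c" using c by simp
  show "Ck_on 2 (\<lambda>b. f (x, covec_of \<A> (chart_at \<A> x) x b) t) UNIV"
    by (rule rep_fibre_smooth[OF f chart_at]) (rule chart_at)
  have "f (x, \<lambda>z. \<theta> * \<alpha> z) t = f (cot_pt \<A> c (crd c x) (\<theta> *\<^sub>R a)) t" for \<theta>
    by (simp add: cot_pt_def cinv_crd[OF c] a_def covec_scale[OF a c])
  then show "((\<lambda>\<theta>. f (x, \<lambda>z. \<theta> * \<alpha> z) t) has_real_derivative frechet_derivative (rep c f) (at (crd c x, a, t)) (0, a, 0)) (at 1)"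
    using rep_partial(4)[OF f[OF c(1)] y, of a t] by simp
qed

lemma form_value:
  assumes A: "smooth_cotform \<A> A" and a: "\<alpha> \<in> cotspace \<A> x" and c: "c \<in> \<A>" "x \<in> cdom c"
  shows "A (x, \<alpha>) t (tv c x v) (tv c x w) = v \<bullet> ((\<chi> r s. rep c (form_component \<A> A c r s) (crd c x, cocomp \<A> c x \<alpha>, t)) *v w)"
    and "A (x, \<alpha>) t (tv c x v) (tv c x w) = (\<Sum>r\<in>UNIV. \<Sum>s\<in>UNIV. form_component \<A> A c r s (x, \<alpha>) t * v $ r * w $ s)"
    and "form_component \<A> A c r s (x, \<alpha>) t = form_component \<A> A c s r (x, \<alpha>) t"
proof -
  have sb: "sym_bilinear_on (tspace \<A> x) (A (x, \<alpha>) t)" using A a by (simp add: smooth_cotform_def)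
  have "A (x, \<alpha>) t (tv c x v) (tv c x w) = v \<bullet> (components \<A> (\<lambda>_. A (x, \<alpha>) t) c x *v w)"
    by (rule bilinear_components[OF _ c, of "\<lambda>_. A (x, \<alpha>) t"]) (rule sb)
  also have "components \<A> (\<lambda>_. A (x, \<alpha>) t) c x = (\<chi> r s. form_component \<A> A c r s (x, \<alpha>) t)"
    by (simp add: components_def form_component_def)
  finally have e: "A (x, \<alpha>) t (tv c x v) (tv c x w) = v \<bullet> ((\<chi> r s. form_component \<A> A c r s (x, \<alpha>) t) *v w)" .
  then show "A (x, \<alpha>) t (tv c x v) (tv c x w) = v \<bullet> ((\<chi> r s. rep c (form_component \<A> A c r s) (crd c x, cocomp \<A> c x \<alpha>, t)) *v w)"
    by (simp add: rep_at[OF a c])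
  show "A (x, \<alpha>) t (tv c x v) (tv c x w) = (\<Sum>r\<in>UNIV. \<Sum>s\<in>UNIV. form_component \<A> A c r s (x, \<alpha>) t * v $ r * w $ s)"
    unfolding e by (simp add: inner_vec_def matrix_vector_mult_def sum_distrib_left mult_ac)
  show "form_component \<A> A c r s (x, \<alpha>) t = form_component \<A> A c s r (x, \<alpha>) t"
    using sb tv_tspace[OF c] by (simp add: form_component_def coord_vec_tv sym_bilinear_on_def)
qed

lemma form_smooth: "smooth_cotform \<A> A \<Longrightarrow> c \<in> \<A> \<Longrightarrow> smooth_cotfun_in \<A> c (form_component \<A> A c r s)"
  by (simp add: smooth_cotform_def)

lemma structure_iii:
  fixes w :: "real^'n"
  assumes A: "smooth_cotform \<A> A" and a: "\<alpha> \<in> cotspace \<A> x" and c: "c \<in> \<A>" "x \<in> cdom c"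
  defines "a \<equiv> cocomp \<A> c x \<alpha>" and "v \<equiv> tv c x w"
  defines "R \<equiv> \<lambda>r s. rep c (form_component \<A> A c r s)"
  shows "(\<Sum>j\<in>UNIV. \<Sum>k\<in>UNIV. \<Sum>r\<in>UNIV. \<Sum>s\<in>UNIV.
         ginv \<A> g c x $ j $ k * horizontal_form \<A> g c j A r s x \<alpha> t * v c $ r * v c $ s * cocomp \<A> c x \<alpha> $ k)
      + deriv (\<lambda>\<tau>. A (x, \<alpha>) \<tau> v v) t * (conorm \<A> g x \<alpha>)\<^sup>2
    = (\<Sum>r\<in>UNIV. \<Sum>s\<in>UNIV. (frechet_derivative (R r s) (at (crd c x, a, t)) (raise c x a, GamT c x a, 0)
        + (a \<bullet> raise c x a) * frechet_derivative (R r s) (at (crd c x, a, t)) (0, 0, 1)) * w $ r * w $ s)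
      - 2 * (((\<chi> r s. R r s (crd c x, a, t)) *v w) \<bullet> (local_metric.Gam (Gc c) (crd c x) (raise c x a) *v w))"
proof -
  interpret c: local_metric "img c" "Gc c" by (rule local_metric_chart[OF c(1)])
  let ?y = "crd c x" and ?N = "raise c x a"
  have y: "?y \<in> img c" using c by simp
  let ?f = "\<lambda>r s. form_component \<A> A c r s"
  have sm: "smooth_cotfun_in \<A> c (?f r s)" for r s by (rule form_smooth[OF A c(1)])
  have vc: "v c = w" by (simp add: v_def tv_coord[OF c])
  have "((\<lambda>\<tau>. A (x, \<alpha>) \<tau> v v) has_real_derivative (\<Sum>r\<in>UNIV. \<Sum>s\<in>UNIV. frechet_derivative (R r s) (at (?y, a, t)) (0, 0, 1) * w $ r * w $ s)) (at t)"
  proof -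
    have "((\<lambda>\<tau>. ?f r s (x, \<alpha>) \<tau>) has_real_derivative frechet_derivative (R r s) (at (?y, a, t)) (0, 0, 1)) (at t)" for r s
      using rep_partial(3)[OF sm y, of r s a t]
      by (simp add: R_def cot_pt_def cinv_crd[OF c] a_def covec_of_cocomp[OF a c])
    then show ?thesis unfolding v_def form_value(2)[OF A a c]
      by (intro DERIV_sum DERIV_cmult_right)
  qed
  then have dt: "deriv (\<lambda>\<tau>. A (x, \<alpha>) \<tau> v v) t = (\<Sum>r\<in>UNIV. \<Sum>s\<in>UNIV. frechet_derivative (R r s) (at (?y, a, t)) (0, 0, 1) * w $ r * w $ s)"
    by (rule DERIV_imp_deriv)
  let ?Am = "\<chi> r s. R r s (?y, a, t)"
  have Am: "?f r s (x, \<alpha>) t = ?Am $ r $ s" for r s by (simp add: R_def a_def rep_at[OF a c])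
  have Asym: "?Am $ r $ s = ?Am $ s $ r" for r s using form_value(3)[OF A a c, of r s t] by (simp only: Am)
  have chrsum: "(\<Sum>j\<in>UNIV. ?N $ j * christoffel \<A> g c x q r j) = c.Gam ?y ?N $ q $ r" for q r
    by (simp add: christoffel_chr[OF c] c.Gam_def c.chr_sym[OF y, of q r] mult.commute)
  have hf: "(\<Sum>j\<in>UNIV. ?N $ j * horizontal_form \<A> g c j A r s x \<alpha> t)
     = frechet_derivative (R r s) (at (?y, a, t)) (?N, GamT c x a, 0)
       - (\<Sum>q\<in>UNIV. c.Gam ?y ?N $ q $ r * ?Am $ q $ s) - (\<Sum>q\<in>UNIV. c.Gam ?y ?N $ q $ s * ?Am $ r $ q)" for r s
  proof -
    have sw: "(\<Sum>j\<in>UNIV. ?N $ j * (\<Sum>q\<in>UNIV. christoffel \<A> g c x q r j * X q)) = (\<Sum>q\<in>UNIV. c.Gam ?y ?N $ q $ r * X q)" for X r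
      unfolding chrsum[symmetric] sum_distrib_left sum_distrib_right
      by (subst sum.swap) (simp only: mult.assoc)
    show ?thesis
      unfolding horizontal_form_def right_diff_distrib sum_subtractf sw Am
      using horizontal_sum[OF sm a c, of r s t] by (simp add: a_def[symmetric] R_def)
  qed
  have "(\<Sum>j\<in>UNIV. \<Sum>k\<in>UNIV. \<Sum>r\<in>UNIV. \<Sum>s\<in>UNIV.
         ginv \<A> g c x $ j $ k * horizontal_form \<A> g c j A r s x \<alpha> t * w $ r * w $ s * a $ k)
     = (\<Sum>j\<in>UNIV. \<Sum>k\<in>UNIV. ginv \<A> g c x $ j $ k * (\<Sum>r\<in>UNIV. \<Sum>s\<in>UNIV. horizontal_form \<A> g c j A r s x \<alpha> t * w $ r * w $ s) * a $ k)"
    by (simp add: sum_distrib_left sum_distrib_right mult_ac)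
  also have "\<dots> = (\<Sum>j\<in>UNIV. ?N $ j * (\<Sum>r\<in>UNIV. \<Sum>s\<in>UNIV. horizontal_form \<A> g c j A r s x \<alpha> t * w $ r * w $ s))"
    by (rule sum_raise[OF c])
  also have "\<dots> = (\<Sum>r\<in>UNIV. \<Sum>s\<in>UNIV. (\<Sum>j\<in>UNIV. ?N $ j * horizontal_form \<A> g c j A r s x \<alpha> t) * w $ r * w $ s)"
    unfolding sum_distrib_left sum_distrib_right mult.assoc
    by (subst sum_rotate3[symmetric], subst sum_rotate3[symmetric]) (rule refl)
  also have "\<dots> = (\<Sum>r\<in>UNIV. \<Sum>s\<in>UNIV. frechet_derivative (R r s) (at (?y, a, t)) (?N, GamT c x a, 0) * w $ r * w $ s)
      - 2 * ((?Am *v w) \<bullet> (c.Gam ?y ?N *v w))"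
  proof -
    have q: "(\<Sum>r\<in>UNIV. \<Sum>s\<in>UNIV. (\<Sum>q\<in>UNIV. M $ q $ r * Y $ q $ s) * w $ r * w $ s) = (Y *v w) \<bullet> (M *v w)" for M Y :: "real^'n^'n"
    proof -
      have "(Y *v w) \<bullet> (M *v w) = (\<Sum>q\<in>UNIV. \<Sum>r\<in>UNIV. \<Sum>s\<in>UNIV. M $ q $ r * Y $ q $ s * w $ r * w $ s)"
        by (simp add: inner_vec_def matrix_vector_mult_def sum_product mult_ac)
      then show ?thesis by (simp add: sum_distrib_right) (rule sum_rotate3)
    qed
    have q2: "(\<Sum>r\<in>UNIV. \<Sum>s\<in>UNIV. (\<Sum>q\<in>UNIV. M $ q $ s * ?Am $ r $ q) * w $ r * w $ s) = (?Am *v w) \<bullet> (M *v w)" for M :: "real^'n^'n"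
    proof -
      have "(\<Sum>q\<in>UNIV. M $ q $ s * ?Am $ r $ q) = (\<Sum>q\<in>UNIV. M $ q $ s * ?Am $ q $ r)" for r s
        by (intro sum.cong refl arg_cong[where f = "(*) _"] Asym)
      then show ?thesis unfolding q[symmetric] by (subst sum.swap) (simp only: mult_ac)
    qed
    show ?thesis unfolding hf left_diff_distrib sum_subtractf q q2 by simp
  qed
  finally have e1: "(\<Sum>j\<in>UNIV. \<Sum>k\<in>UNIV. \<Sum>r\<in>UNIV. \<Sum>s\<in>UNIV.
         ginv \<A> g c x $ j $ k * horizontal_form \<A> g c j A r s x \<alpha> t * w $ r * w $ s * a $ k)
     = (\<Sum>r\<in>UNIV. \<Sum>s\<in>UNIV. frechet_derivative (R r s) (at (?y, a, t)) (?N, GamT c x a, 0) * w $ r * w $ s)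
      - 2 * ((?Am *v w) \<bullet> (c.Gam ?y ?N *v w))" .
  have e2: "(\<Sum>r\<in>UNIV. \<Sum>s\<in>UNIV. (X r s + l * Y r s) * w $ r * w $ s)
      = (\<Sum>r\<in>UNIV. \<Sum>s\<in>UNIV. X r s * w $ r * w $ s) + (\<Sum>r\<in>UNIV. \<Sum>s\<in>UNIV. Y r s * w $ r * w $ s) * l" for X Y l
    by (simp only: distrib_right sum.distrib sum_distrib_right) (simp only: mult_ac)
  show ?thesis
    unfolding vc dt conorm_sq[OF a c] a_def[symmetric] raise_def[symmetric] e1 e2 by simp
qed

lemma structure_iv:
  fixes w :: "real^'n"
  assumes A: "smooth_cotform \<A> A" and a: "\<alpha> \<in> cotspace \<A> x" and c: "c \<in> \<A>" "x \<in> cdom c"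
  defines "a \<equiv> cocomp \<A> c x \<alpha>" and "v \<equiv> tv c x w"
  defines "R \<equiv> \<lambda>r s. rep c (form_component \<A> A c r s)"
  shows "integral {0..1} (\<lambda>\<theta>. \<theta> * second_deriv \<A> x (\<lambda>\<beta>. A (x, \<beta>) t v v) (\<lambda>z. \<theta> * \<alpha> z) \<alpha> \<alpha>)
    = (\<Sum>r\<in>UNIV. \<Sum>s\<in>UNIV. frechet_derivative (R r s) (at (crd c x, a, t)) (0, a, 0) * w $ r * w $ s) - A (x, \<alpha>) t v v + A (x, \<lambda>z. 0) t v v"
proof (rule integral_second_deriv[OF a])
  have y: "crd c x \<in> img c" using c by simp
  let ?d = "chart_at \<A> x"
  have vd: "v = tv ?d x (v ?d)" unfolding v_def by (rule tspace_tv[OF tv_tspace[OF c] chart_at])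
  have "A (x, covec_of \<A> ?d x b) t v v = (\<Sum>r\<in>UNIV. \<Sum>s\<in>UNIV. form_component \<A> A ?d r s (x, covec_of \<A> ?d x b) t * v ?d $ r * v ?d $ s)" for b
  proof -
    have "covec_of \<A> ?d x b \<in> cotspace \<A> x" by (rule covec_of_cotspace[OF chart_at])
    from form_value(2)[OF A this chart_at, where v = "v ?d" and w = "v ?d" and t = t] show ?thesis
      using vd by simp
  qed
  moreover have "Ck_on 2 (\<lambda>b. \<Sum>r\<in>UNIV. \<Sum>s\<in>UNIV. form_component \<A> A ?d r s (x, covec_of \<A> ?d x b) t * v ?d $ r * v ?d $ s) UNIV"
    by (intro Ck_on_sum Ck_on_mult Ck_on_const open_UNIV rep_fibre_smooth[OF form_smooth[OF A] chart_at] chart_at)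
  ultimately show "Ck_on 2 (\<lambda>b. A (x, covec_of \<A> ?d x b) t v v) UNIV" by simp
  have "A (x, \<lambda>z. \<theta> * \<alpha> z) t v v = (\<Sum>r\<in>UNIV. \<Sum>s\<in>UNIV. form_component \<A> A c r s (cot_pt \<A> c (crd c x) (\<theta> *\<^sub>R a)) t * w $ r * w $ s)" for \<theta>
    using form_value(2)[OF A covec_of_cotspace[OF c, of "\<theta> *\<^sub>R a"] c, where v = w and w = w and t = t]
    by (simp add: v_def cot_pt_def cinv_crd[OF c] a_def covec_scale[OF a c])
  moreover have "((\<lambda>\<theta>. \<Sum>r\<in>UNIV. \<Sum>s\<in>UNIV. form_component \<A> A c r s (cot_pt \<A> c (crd c x) (\<theta> *\<^sub>R a)) t * w $ r * w $ s)
     has_real_derivative (\<Sum>r\<in>UNIV. \<Sum>s\<in>UNIV. frechet_derivative (R r s) (at (crd c x, a, t)) (0, a, 0) * w $ r * w $ s)) (at 1)"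
    unfolding R_def by (intro DERIV_sum DERIV_cmult_right rep_partial(4) form_smooth[OF A c(1)] y)
  ultimately show "((\<lambda>\<theta>. A (x, \<lambda>z. \<theta> * \<alpha> z) t v v) has_real_derivative
      (\<Sum>r\<in>UNIV. \<Sum>s\<in>UNIV. frechet_derivative (R r s) (at (crd c x, a, t)) (0, a, 0) * w $ r * w $ s)) (at 1)" by simp
qed

end

section \<open>Uniform curvature bound\<close>

context local_metric
begin

text \<open>The number \<open>g(R(w, e) e, w)\<close>. In contrast to \<open>Rm\<close> it is defined without reference to a function, and
  it is homogeneous of degree two in \<open>w\<close> and in \<open>e\<close>.\<close>
definition curv :: "real^'n \<Rightarrow> real^'n \<Rightarrow> real^'n \<Rightarrow> real" where
  "curv y w e = (G y *v w) \<bullet> (DGam y w e e - DGam y e w e + Gam y w *v (Gam y e *v e) - Gam y e *v (Gam y w *v e))"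

lemma continuous_comp:
  assumes "continuous_on \<Omega> f" "continuous_on D y" "y ` D \<subseteq> \<Omega>"
  shows "continuous_on D (\<lambda>p. f (y p))"
  using continuous_on_compose2[OF assms(1,2)] assms(3) by auto

lemma continuous_G: "continuous_on D y \<Longrightarrow> y ` D \<subseteq> \<Omega> \<Longrightarrow> continuous_on D (\<lambda>p. G (y p))"
proof -
  assume y: "continuous_on D y" "y ` D \<subseteq> \<Omega>"
  have "continuous_on D (\<lambda>p. \<chi> i j. G (y p) $ i $ j)"
    by (intro continuous_on_vec_lambda continuous_comp[OF Ck_on_continuous[OF G_smooth] y])
  then show ?thesis by simp
qed

lemma continuous_Gam:
  "continuous_on D y \<Longrightarrow> y ` D \<subseteq> \<Omega> \<Longrightarrow> continuous_on D f \<Longrightarrow> continuous_on D (\<lambda>p. Gam (y p) (f p))"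
  unfolding Gam_def
  by (intro continuous_on_vec_lambda continuous_intros continuous_comp[OF Ck_on_continuous[OF chr_smooth]])

lemma continuous_DGam:
  assumes y: "continuous_on D y" "y ` D \<subseteq> \<Omega>" and "continuous_on D f" "continuous_on D a" "continuous_on D b"
  shows "continuous_on D (\<lambda>p. DGam (y p) (f p) (a p) (b p))"
proof -
  have pdc: "continuous_on \<Omega> (pd m (chr G l j k))" for m l j k
    by (rule Ck_on_continuous[OF Ck_on_pd[OF chr_smooth]])
  have "continuous_on D (\<lambda>p. \<chi> l. \<Sum>j\<in>UNIV. \<Sum>k\<in>UNIV. (\<Sum>m\<in>UNIV. f p $ m * pd m (chr G l j k) (y p)) * a p $ j * b p $ k)"
    by (intro continuous_on_vec_lambda continuous_intros assms continuous_comp[OF pdc])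
  then show ?thesis
  proof (rule continuous_on_eq)
    fix p assume "p \<in> D"
    then have "y p \<in> \<Omega>" using y by auto
    then have "chr G l j k differentiable (at (y p))" for l j k
      using Ck_on_differentiable[OF chr_smooth[of 1]] by simp
    then show "(\<chi> l. \<Sum>j\<in>UNIV. \<Sum>k\<in>UNIV. (\<Sum>m\<in>UNIV. f p $ m * pd m (chr G l j k) (y p)) * a p $ j * b p $ k) = DGam (y p) (f p) (a p) (b p)"
      by (simp add: DGam_def frechet_derivative_pd)
  qed
qed

lemmas continuous_matrix_vector = bounded_bilinear.continuous_on[OF bounded_bilinear_matrix_vector]

lemma curv_scale: "y \<in> \<Omega> \<Longrightarrow> curv y (s *\<^sub>R w) (r *\<^sub>R e) = s\<^sup>2 * r\<^sup>2 * curv y w e"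
proof -
  assume y: "y \<in> \<Omega>"
  have d: "chr G l j k differentiable (at y)" for l j k
    using Ck_on_differentiable[OF chr_smooth[of 1]] y by simp
  have D: "DGam y (s *\<^sub>R f) (t *\<^sub>R a) (r *\<^sub>R b) = (s * t * r) *\<^sub>R DGam y f a b" for s t r f a b
    by (simp add: DGam_def vec_eq_iff linear_scale[OF linear_frechet_derivative[OF d]] sum_distrib_left mult_ac)
  have g: "Gam y (s *\<^sub>R f) = s *\<^sub>R Gam y f" for s f
    by (simp add: Gam_def vec_eq_iff sum_distrib_left mult_ac)
  show ?thesis
    by (simp add: curv_def D g matrix_vector_mult_scaleR scaleR_matrix_vector_assoc[symmetric]
        inner_diff_right inner_add_right algebra_simps power2_eq_square)
qed

text \<open>By homogeneity it suffices to bound the continuous function \<open>curv\<close> above and the metric below on unit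
  vectors over a compact ball.\<close>
lemma curv_locally_bounded:
  assumes y0: "y0 \<in> \<Omega>"
  obtains r C where "r > 0" "ball y0 r \<subseteq> \<Omega>" "C \<ge> 0"
    "\<And>y w e. y \<in> ball y0 r \<Longrightarrow> \<bar>curv y w e\<bar> \<le> C * (w \<bullet> (G y *v w)) * (e \<bullet> (G y *v e))"
proof -
  obtain r where r: "r > 0" "cball y0 r \<subseteq> \<Omega>" using open_dom y0 open_contains_cball by blast
  let ?S = "sphere (0 :: real^'n) 1" and ?B = "cball y0 r"
  have "continuous_on (?B \<times> ?S \<times> ?S) (\<lambda>p. curv (fst p) (fst (snd p)) (snd (snd p)))"
    unfolding curv_def using r
    by (intro continuous_intros continuous_matrix_vector continuous_G continuous_Gam continuous_DGam) auto
  then have "bounded ((\<lambda>p. curv (fst p) (fst (snd p)) (snd (snd p))) ` (?B \<times> ?S \<times> ?S))"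
    by (intro compact_imp_bounded compact_continuous_image compact_Times compact_cball compact_sphere)
  then obtain C1 where C1: "C1 > 0" "\<And>p. p \<in> ?B \<times> ?S \<times> ?S \<Longrightarrow> \<bar>curv (fst p) (fst (snd p)) (snd (snd p))\<bar> \<le> C1"
    unfolding bounded_pos by auto
  have "continuous_on (?B \<times> ?S) (\<lambda>p. snd p \<bullet> (G (fst p) *v snd p))"
    using r by (intro continuous_intros continuous_matrix_vector continuous_G) auto
  moreover have "compact (?B \<times> ?S)" by (intro compact_Times compact_cball compact_sphere)
  moreover have "?B \<times> ?S \<noteq> {}" using r by (auto intro: exI[of _ "axis undefined 1"])
  ultimately obtain p0 where p0: "p0 \<in> ?B \<times> ?S" "\<And>p. p \<in> ?B \<times> ?S \<Longrightarrow> snd p0 \<bullet> (G (fst p0) *v snd p0) \<le> snd p \<bullet> (G (fst p) *v snd p)"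
    using continuous_attains_inf[of "?B \<times> ?S" "\<lambda>p. snd p \<bullet> (G (fst p) *v snd p)"] by auto
  define m where "m = snd p0 \<bullet> (G (fst p0) *v snd p0)"
  have m: "m > 0" unfolding m_def by (rule G_pos) (use p0 r in auto)
  have lower: "m * (norm w)\<^sup>2 \<le> w \<bullet> (G y *v w)" if "y \<in> ?B" for y w
  proof (cases "w = 0")
    case False
    have "m \<le> (w /\<^sub>R norm w) \<bullet> (G y *v (w /\<^sub>R norm w))"
      using p0(2)[of "(y, w /\<^sub>R norm w)"] that False by (simp add: m_def)
    also have "\<dots> = (w \<bullet> (G y *v w)) / (norm w)\<^sup>2"
      by (simp add: matrix_vector_mult_scaleR power2_eq_square divide_inverse)
    finally show ?thesis using False by (simp add: pos_le_divide_eq)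
  qed simp
  have upper: "\<bar>curv y w e\<bar> \<le> C1 * (norm w)\<^sup>2 * (norm e)\<^sup>2" if "y \<in> ?B" for y w e
  proof (cases "w = 0 \<or> e = 0")
    case True
    have yO: "y \<in> \<Omega>" using that r by auto
    from True show ?thesis
      using curv_scale[OF yO, of 0 w 1 e] curv_scale[OF yO, of 1 w 0 e] by auto
  next
    case False
    have yO: "y \<in> \<Omega>" using that r by auto
    have "\<bar>curv y (w /\<^sub>R norm w) (e /\<^sub>R norm e)\<bar> \<le> C1"
      using C1(2)[of "(y, w /\<^sub>R norm w, e /\<^sub>R norm e)"] that False by simp
    moreover have "curv y w e = (norm w)\<^sup>2 * (norm e)\<^sup>2 * curv y (w /\<^sub>R norm w) (e /\<^sub>R norm e)"
      using curv_scale[OF yO, of "norm w" "w /\<^sub>R norm w" "norm e" "e /\<^sub>R norm e"] False by simp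
    ultimately have "\<bar>curv y w e\<bar> \<le> (norm w)\<^sup>2 * (norm e)\<^sup>2 * C1"
      by (simp add: abs_mult mult_left_mono)
    then show ?thesis by (simp add: mult_ac)
  qed
  show ?thesis
  proof (rule that[of r "C1 / m\<^sup>2"])
    show "r > 0" "ball y0 r \<subseteq> \<Omega>" using r by (auto intro: subset_trans[OF ball_subset_cball])
    show "C1 / m\<^sup>2 \<ge> 0" using C1 by simp
    fix y w e assume "y \<in> ball y0 r"
    then have y: "y \<in> ?B" by simp
    have "m * (norm w)\<^sup>2 * (m * (norm e)\<^sup>2) \<le> (w \<bullet> (G y *v w)) * (e \<bullet> (G y *v e))"
    proof (rule mult_mono)
      show "0 \<le> w \<bullet> (G y *v w)" using lower[OF y, of w] m by (smt (verit) mult_nonneg_nonneg zero_le_power2)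
    qed (use lower[OF y] m in auto)
    then have "C1 / m\<^sup>2 * (m * (norm w)\<^sup>2 * (m * (norm e)\<^sup>2)) \<le> C1 / m\<^sup>2 * ((w \<bullet> (G y *v w)) * (e \<bullet> (G y *v e)))"
      using C1 by (intro mult_left_mono) auto
    moreover have "C1 / m\<^sup>2 * (m * (norm w)\<^sup>2 * (m * (norm e)\<^sup>2)) = C1 * (norm w)\<^sup>2 * (norm e)\<^sup>2"
      using m by (simp add: power2_eq_square)
    ultimately show "\<bar>curv y w e\<bar> \<le> C1 / m\<^sup>2 * (w \<bullet> (G y *v w)) * (e \<bullet> (G y *v e))"
      using upper[OF y, of w e] by (simp add: mult.assoc)
  qed
qed

end

lemma (in local_metric_function) Rm_curv: "y \<in> \<Omega> \<Longrightarrow> Rm y e (nab y) = curv y (nab y) e"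
  by (simp add: Rm_def curv_def G_nab)

context riemannian_manifold
begin

abbreviation curv_le :: "real \<Rightarrow> ('m,'n) chart \<Rightarrow> 'm \<Rightarrow> bool" where
  "curv_le C c x \<equiv> \<forall>w e. \<bar>local_metric.curv (Gc c) (crd c x) w e\<bar>
     \<le> C * (w \<bullet> (Gc c (crd c x) *v w)) * (e \<bullet> (Gc c (crd c x) *v e))"

text \<open>Finitely many of the balls of \<open>curv_locally_bounded\<close> cover the manifold; the sum of their constants
  serves for all. At each point the bound is stated in one suitable chart, where the maximum principle
  is applied later.\<close>
lemma curvature_bound:
  assumes compact: "compact (UNIV :: 'm set)"
  obtains C where "C \<ge> 0" "\<And>x. \<exists>c\<in>\<A>. x \<in> cdom c \<and> curv_le C c x"
proof -
  define P where "P = (\<lambda>C x c. c \<in> \<A> \<and> x \<in> cdom c \<and> curv_le C c x)"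
  have "\<exists>O' C. open O' \<and> x \<in> O' \<and> C \<ge> 0 \<and> (\<forall>z\<in>O'. \<exists>c. P C z c)" for x
  proof -
    let ?c = "chart_at \<A> x"
    interpret c: local_metric "img ?c" "Gc ?c" by (rule local_metric_chart[OF chart_at(1)])
    have "crd ?c x \<in> img ?c" using chart_at(2) by simp
    then obtain r C where r: "r > 0" "ball (crd ?c x) r \<subseteq> img ?c" "C \<ge> 0"
      "\<And>y w e. y \<in> ball (crd ?c x) r \<Longrightarrow> \<bar>c.curv y w e\<bar> \<le> C * (w \<bullet> (Gc ?c y *v w)) * (e \<bullet> (Gc ?c y *v e))"
      using c.curv_locally_bounded by metis
    have "continuous_on (cdom ?c) (crd ?c)" using chart(3)[OF chart_at(1)] by (simp add: homeomorphism_def)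
    then have "open (crd ?c -` ball (crd ?c x) r \<inter> cdom ?c)"
      using chart(1)[OF chart_at(1)] continuous_on_open_vimage open_ball by blast
    moreover have "x \<in> crd ?c -` ball (crd ?c x) r \<inter> cdom ?c" using r chart_at(2) by simp
    moreover have "\<exists>c. P C z c" if "z \<in> crd ?c -` ball (crd ?c x) r \<inter> cdom ?c" for z
      using that r(4) chart_at(1) by (intro exI[of _ ?c]) (auto simp: P_def)
    ultimately show ?thesis using r(3) by blast
  qed
  then obtain O' C where O': "\<And>x. open (O' x)" "\<And>x. x \<in> O' x" "\<And>x. C x \<ge> 0" "\<And>x z. z \<in> O' x \<Longrightarrow> \<exists>c. P (C x) z c"
    by metis
  obtain F where F: "finite F" "UNIV \<subseteq> (\<Union>x\<in>F. O' x)"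
    by (rule compactE_image[OF compact, of UNIV O']) (use O' in auto)
  define C0 where "C0 = (\<Sum>x\<in>F. C x)"
  show ?thesis
  proof (rule that[of C0])
    show "C0 \<ge> 0" unfolding C0_def by (intro sum_nonneg O')
    fix z
    obtain x where x: "x \<in> F" "z \<in> O' x" using F by blast
    obtain c where c: "P (C x) z c" using O'(4)[OF x(2)] by blast
    then have c': "c \<in> \<A>" "z \<in> cdom c" by (auto simp: P_def)
    interpret c: local_metric "img c" "Gc c" by (rule local_metric_chart[OF c'(1)])
    have nn: "0 \<le> w \<bullet> (Gc c (crd c z) *v w)" for w
      using c.G_pos[of "crd c z" w] c' by (cases "w = 0") auto
    have "C x \<le> C0" unfolding C0_def by (rule member_le_sum[OF x(1)]) (use O' F in auto)
    then have "C x * (w \<bullet> (Gc c (crd c z) *v w)) * (e \<bullet> (Gc c (crd c z) *v e)) \<le> C0 * (w \<bullet> (Gc c (crd c z) *v w)) * (e \<bullet> (Gc c (crd c z) *v e))" for w e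
      using nn by (intro mult_right_mono) auto
    then show "\<exists>c\<in>\<A>. z \<in> cdom c \<and> curv_le C0 c z"
      using c c' unfolding P_def by (meson order_trans)
  qed
qed

section \<open>The solution in a chart\<close>

abbreviation nsqc :: "('m,'n) chart \<Rightarrow> ('m \<Rightarrow> real) \<Rightarrow> real^'n \<Rightarrow> real" where
  "nsqc c u \<equiv> local_metric_function.nsq (Gc c) (loc c u)"

lemma chart_function:
  assumes u: "Ck_fun \<A> 3 u" and c: "c \<in> \<A>"
  shows "local_metric_function (img c) (Gc c) (loc c u)"
proof -
  interpret c: local_metric "img c" "Gc c" by (rule local_metric_chart[OF c])
  show ?thesis by unfold_locales (use u c in \<open>simp add: Ck_fun_def\<close>)
qed

lemma chart_grad:
  assumes u: "Ck_fun \<A> 3 u" and c: "c \<in> \<A>" "x \<in> cdom c"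
  shows "differential \<A> u x \<in> cotspace \<A> x"
    and "cocomp \<A> c x (differential \<A> u x) = local_metric_function.grad (loc c u) (crd c x)"
    and "(conorm \<A> g x (differential \<A> u x))\<^sup>2 = nsqc c u (crd c x)"
proof -
  interpret l: local_metric_function "img c" "Gc c" "loc c u" by (rule chart_function[OF u c(1)])
  have d: "differential \<A> u x = covec_of \<A> c x (l.grad (crd c x))"
    using differential_chart[OF _ c, of 2 u] u by (simp add: l.grad_def eval_nat_numeral)
  show 1: "differential \<A> u x \<in> cotspace \<A> x" unfolding d by (rule covec_of_cotspace[OF c])
  show 2: "cocomp \<A> c x (differential \<A> u x) = l.grad (crd c x)" unfolding d by (rule cocomp_covec_of[OF c])
  show "(conorm \<A> g x (differential \<A> u x))\<^sup>2 = l.nsq (crd c x)"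
    unfolding conorm_sq(1)[OF 1 c] 2 l.nsq_def l.nab_def ..
qed

lemma continuous_chartwise:
  assumes "\<And>c. c \<in> \<A> \<Longrightarrow> continuous_on (img c) (\<lambda>y. f (cinv c y))"
  shows "continuous_on UNIV (f :: 'm \<Rightarrow> real)"
proof -
  have "continuous_on (cdom c) f" if c: "c \<in> \<A>" for c
  proof -
    have "continuous_on (cdom c) (crd c)" using chart(3)[OF c] by (simp add: homeomorphism_def)
    then have "continuous_on (cdom c) (\<lambda>z. f (cinv c (crd c z)))"
      using continuous_on_compose2[OF assms[OF c], of "cdom c" "crd c"] by auto
    then show ?thesis by (rule continuous_on_eq) (simp add: cinv_crd[OF c])
  qed
  then have "continuous_on (\<Union>c\<in>\<A>. cdom c) f"
    by (intro continuous_on_open_UN chart(1))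
  moreover have "(\<Union>c\<in>\<A>. cdom c) = UNIV" using structure_A by (simp only: smooth_structure_def)
  ultimately show ?thesis by simp
qed

lemma continuous_u:
  assumes u: "Ck_fun \<A> 3 u" shows "continuous_on UNIV u"
  by (rule continuous_chartwise) (use u in \<open>auto simp: Ck_fun_def intro: Ck_on_continuous\<close>)

lemma abs_u_le_SUP:
  assumes compact: "compact (UNIV :: 'm set)" and u: "Ck_fun \<A> 3 u"
  shows "\<bar>u x\<bar> \<le> (SUP x. \<bar>u x\<bar>)"
proof -
  have "compact (u ` UNIV)" by (rule compact_continuous_image[OF continuous_u[OF u] compact])
  then obtain B where "\<And>z. z \<in> range u \<Longrightarrow> norm z \<le> B" using compact_imp_bounded bounded_iff by metis
  then have "bdd_above (range (\<lambda>x. \<bar>u x\<bar>))" by (intro bdd_aboveI[of _ B]) auto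
  then show ?thesis by (rule cSUP_upper[OF UNIV_I])
qed

lemma continuous_conorm_sq:
  assumes u: "Ck_fun \<A> 3 u"
  shows "continuous_on UNIV (\<lambda>x. (conorm \<A> g x (differential \<A> u x))\<^sup>2)"
proof (rule continuous_chartwise)
  fix c assume c: "c \<in> \<A>"
  interpret l: local_metric_function "img c" "Gc c" "loc c u" by (rule chart_function[OF u c(1)])
  have "continuous_on (img c) (l.pair (loc c u) (loc c u))"
    by (intro differentiable_imp_continuous_on differentiable_at_imp_differentiable_on l.pair_derivative(1) l.U_C3)
  then show "continuous_on (img c) (\<lambda>y. (conorm \<A> g (cinv c y) (differential \<A> u (cinv c y)))\<^sup>2)"
  proof (rule continuous_on_eq)
    fix y assume y: "y \<in> img c"
    show "l.pair (loc c u) (loc c u) y = (conorm \<A> g (cinv c y) (differential \<A> u (cinv c y)))\<^sup>2"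
      using chart_grad(3)[OF u c cinv_mem[OF c y]]
      by (simp add: crd_cinv[OF c y] l.nsq_def l.pair_def l.grad_def l.nab_def)
  qed
qed

text \<open>If \<open>\<kappa>\<close> is the maximal value of \<open>|du|\<^sup>2 / \<zeta>(u)\<close>, attained at \<open>x\<^sub>0\<close>, then \<open>|du|\<^sup>2 - \<kappa> \<zeta>(u)\<close> is nonpositive and
  vanishes at \<open>x\<^sub>0\<close>. This difference is more convenient to differentiate than the quotient. The number \<open>R\<close>
  bounds the oscillation of \<open>\<zeta>(u)\<close> and carries the bound at \<open>x\<^sub>0\<close> to other points.\<close>
lemma exists_maximum:
  assumes compact: "compact (UNIV :: 'm set)" and u: "Ck_fun \<A> 3 u" and K: "\<And>x. \<bar>u x\<bar> \<le> K"
    and \<zeta>: "continuous_on UNIV \<zeta>" "\<And>t. \<bar>t\<bar> \<le> K \<Longrightarrow> \<zeta> t > 0"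
    and R: "\<And>s t. \<bar>s\<bar> \<le> K \<Longrightarrow> \<bar>t\<bar> \<le> K \<Longrightarrow> \<zeta> s \<le> R * \<zeta> t"
  obtains x0 where "\<And>x. (conorm \<A> g x (differential \<A> u x))\<^sup>2 \<le> R * (conorm \<A> g x0 (differential \<A> u x0))\<^sup>2"
    "\<And>c y. c \<in> \<A> \<Longrightarrow> x0 \<in> cdom c \<Longrightarrow> y \<in> img c \<Longrightarrow>
      nsqc c u y
        - (nsqc c u (crd c x0) / \<zeta> (u x0)) * \<zeta> (u (cinv c y)) \<le> 0"
proof -
  let ?v = "\<lambda>x. (conorm \<A> g x (differential \<A> u x))\<^sup>2"
  have pos: "\<zeta> (u x) > 0" for x by (rule \<zeta>(2)[OF K])
  have "continuous_on UNIV (\<lambda>x. \<zeta> (u x))"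
    using continuous_on_compose2[OF \<zeta>(1) continuous_u[OF u]] by simp
  moreover have "\<forall>x\<in>UNIV. \<zeta> (u x) \<noteq> 0" using pos by (simp add: less_imp_neq[symmetric])
  ultimately have "continuous_on UNIV (\<lambda>x. ?v x / \<zeta> (u x))"
    by (intro continuous_on_divide continuous_conorm_sq[OF u])
  then obtain x0 where x0: "\<And>x. ?v x / \<zeta> (u x) \<le> ?v x0 / \<zeta> (u x0)"
    using continuous_attains_sup[OF compact, of "\<lambda>x. ?v x / \<zeta> (u x)"] by auto
  have le: "?v x \<le> ?v x0 / \<zeta> (u x0) * \<zeta> (u x)" for x
    using x0[of x] pos[of x] by (simp add: pos_divide_le_eq)
  show ?thesis
  proof (rule that[of x0])
    fix x
    have "?v x0 / \<zeta> (u x0) * \<zeta> (u x) \<le> ?v x0 / \<zeta> (u x0) * (R * \<zeta> (u x0))"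
      using pos[of x0] by (intro mult_left_mono R K) auto
    then show "?v x \<le> R * ?v x0" using le[of x] pos[of x0] by (simp add: mult.commute)
  next
    fix c y assume c: "c \<in> \<A>" "x0 \<in> cdom c" and y: "y \<in> img c"
    have "?v (cinv c y) = nsqc c u y"
      using chart_grad(3)[OF u c(1) cinv_mem[OF c(1) y]] crd_cinv[OF c(1) y] by simp
    then show "nsqc c u y
        - (nsqc c u (crd c x0) / \<zeta> (u x0)) * \<zeta> (u (cinv c y)) \<le> 0"
      using le[of "cinv c y"] chart_grad(3)[OF u c] by simp
  qed
qed

definition formc :: "('m,'n) cotform \<Rightarrow> ('m \<Rightarrow> real) \<Rightarrow> ('m,'n) chart \<Rightarrow> real^'n \<Rightarrow> real^'n^'n" where
  "formc A u c y = (\<chi> r s. rep c (form_component \<A> A c r s)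
     (y, local_metric_function.grad (loc c u) y, u (cinv c y)))"

text \<open>Both sides of the equation, which is stated with tensors on the tangent spaces, in the matrices of one chart.\<close>
lemma chart_equation:
  assumes u: "Ck_fun \<A> 3 u" and A: "smooth_cotform \<A> A" and \<phi>: "pos_smooth_cotfun \<A> \<phi>" and p: "1 \<le> p"
    and sol: "solves_hessian_eq \<A> g p A \<phi> u" and c: "c \<in> \<A>" and y: "y \<in> img c"
  defines "B \<equiv> formc A u c y + local_metric_function.Hs (Gc c) (loc c u) y"
  shows "transpose (formc A u c y) = formc A u c y"
    and "\<And>q. 1 \<le> q \<Longrightarrow> q \<le> p \<Longrightarrow> esym q (eigenvalues (matrix_inv (Gc c y) ** B)) > 0"
    and "esym p (eigenvalues (matrix_inv (Gc c y) ** B)) = rep c \<phi> (y, local_metric_function.grad (loc c u) y, u (cinv c y)) ^ p"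
    and "rep c \<phi> (y, local_metric_function.grad (loc c u) y, u (cinv c y)) > 0"
proof -
  interpret l: local_metric_function "img c" "Gc c" "loc c u" by (rule chart_function[OF u c])
  define x where "x = cinv c y"
  have x: "x \<in> cdom c" and yx: "crd c x = y" using cinv_mem[OF c y] crd_cinv[OF c y] by (auto simp: x_def)
  let ?\<alpha> = "differential \<A> u x"
  have a: "?\<alpha> \<in> cotspace \<A> x" by (rule chart_grad(1)[OF u c x])
  have gr: "cocomp \<A> c x ?\<alpha> = l.grad y" using chart_grad(2)[OF u c x] by (simp add: yx)
  have ux: "u (cinv c y) = u x" by (simp add: x_def)
  have rp: "rep c f (y, l.grad y, u (cinv c y)) = f (x, ?\<alpha>) (u x)" for f
    using rep_at[OF a c x, of f "u x"] unfolding gr yx ux .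
  show "transpose (formc A u c y) = formc A u c y"
    using form_value(3)[OF A a c x] by (simp add: formc_def transpose_def vec_eq_iff rp)
  let ?T = "\<lambda>x v w. A (x, differential \<A> u x) (u x) v w + hessian \<A> g u x v w"
  have "components \<A> ?T c x = B"
  proof -
    have "hessian \<A> g u x (coord_vec \<A> c x i) (coord_vec \<A> c x j) = l.Hs y $ i $ j" for i j
      unfolding coord_vec_tv hessian_chart[OF u c x] yx
      by (simp add: matrix_vector_mult_basis column_def inner_axis')
    then show ?thesis
      by (simp add: components_def B_def formc_def vec_eq_iff rp form_component_def)
  qed
  then have lv: "lambda_vec \<A> g ?T c x = eigenvalues (matrix_inv (Gc c y) ** B)"
    by (simp add: lambda_vec_def ginv_Gc[OF c x] yx)
  have S: "root p (esym p (lambda_vec \<A> g ?T c x)) = \<phi> (x, ?\<alpha>) (u x)" "lambda_vec \<A> g ?T c x \<in> Gamma_cone CARD('n) p"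
    using sol c x by (auto simp: solves_hessian_eq_def Let_def)
  show pos: "esym q (eigenvalues (matrix_inv (Gc c y) ** B)) > 0" if "1 \<le> q" "q \<le> p" for q
    using S(2) that by (auto simp: lv Gamma_cone_def)
  show "rep c \<phi> (y, l.grad y, u (cinv c y)) > 0"
    using \<phi> a by (simp add: rp pos_smooth_cotfun_def)
  show "esym p (eigenvalues (matrix_inv (Gc c y) ** B)) = rep c \<phi> (y, l.grad y, u (cinv c y)) ^ p"
  proof -
    have "root p (esym p (lambda_vec \<A> g ?T c x)) ^ p = esym p (lambda_vec \<A> g ?T c x)"
      by (rule real_root_pow_pos2) (use p pos[of p] in \<open>simp_all add: lv\<close>)
    then show ?thesis unfolding S(1) unfolding rp lv by (rule sym)
  qed
qed

end

section \<open>The gradient estimate\<close>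

text \<open>In the application \<open>v = |du|\<^sup>2\<close> at the maximum point, \<open>T\<close> is the linearised operator in the direction \<open>\<nabla>u\<close>,
  \<open>TT\<close> its trace, \<open>f = \<phi>\<^sup>p\<^sup>-\<^sup>1\<close>, \<open>W = v\<^sup>p\<^sup>-\<^sup>1\<close>, and \<open>w3, w4, w5\<close> are values of the functions \<open>\<omega>\<^sub>i\<close>.
  After division by \<open>v\<^sup>2 T\<close> the right-hand side of \<open>ineq\<close> is at most \<open>h (L - 1)\<close> plus a multiple of \<open>\<epsilon>\<close> that
  is smaller than \<open>h0 \<le> h\<close>, while the left-hand side is \<open>L h\<close>.\<close>
lemma numeric_contradiction:
  fixes v h h0 L T f W D TT w3 w4 w5 \<epsilon> C3 C5 C6 C7 C8 CR p n :: real
  assumes v: "v \<ge> 1" and h: "0 < h0" "h0 \<le> h" "h \<le> L" and T: "T > 0"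
    and f: "0 \<le> f" "f \<le> T" and W: "W \<le> D * T" and D: "D \<ge> 1" and TT: "0 \<le> TT" "TT \<le> n * T"
    and C: "C3 \<ge> 0" "C5 \<ge> 0" "C6 \<ge> 0" "C7 \<ge> 0" "C8 \<ge> 0" "CR \<ge> 0" and pn: "p \<ge> 0" "n \<ge> 0"
    and w: "0 \<le> w4" "w4 \<le> \<epsilon> * v\<^sup>2" "w3 \<le> \<epsilon> * v\<^sup>2" "w5 \<le> \<epsilon> * (D * T)" and e: "\<epsilon> > 0" "1 \<le> \<epsilon> * v"
    and L: "L \<ge> 2 * p * C8 + n * (C3 + 2 * C6) + 1"
    and ineq: "L * h * v\<^sup>2 * T \<le> p * C7 * (w4 * max f W) + p * h * v * (C8 * (v + 1) * max f w5)
       + TT * (C5 * w3 + h * v * (C3 + C6 * (v + 1))) + TT * (CR * v)"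
    and small: "\<epsilon> * (p * C7 * D + 2 * p * L * C8 * D + n * C5 + n * CR) < h0"
  shows False
proof -
  have hp: "h > 0" using h by simp
  have vv: "v \<le> v\<^sup>2" using v by (simp add: power2_eq_square)
  have DT: "D * T \<ge> T" using D T by simp
  have "max f W \<le> D * T" using f W DT by simp
  then have "w4 * max f W \<le> (\<epsilon> * v\<^sup>2) * (D * T)" using w f by (intro mult_mono) auto
  then have t1: "p * C7 * (w4 * max f W) \<le> p * C7 * ((\<epsilon> * v\<^sup>2) * (D * T))"
    using C pn by (intro mult_left_mono) auto
  have eDT: "0 \<le> \<epsilon> * (D * T)" using e D T by simp
  have m5: "max f w5 \<le> T + \<epsilon> * (D * T)" using f w eDT T by simp
  have "C8 * (v + 1) * max f w5 \<le> C8 * (2 * v) * (T + \<epsilon> * (D * T))"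
    using m5 v C f by (intro mult_mono mult_left_mono mult_nonneg_nonneg) auto
  then have t2: "p * h * v * (C8 * (v + 1) * max f w5) \<le> p * h * v * (C8 * (2 * v) * (T + \<epsilon> * (D * T)))"
    using pn hp v by (intro mult_left_mono) auto
  have t2': "p * h * v * (C8 * (2 * v) * (T + \<epsilon> * (D * T))) \<le> (2 * p * C8 * h) * (v\<^sup>2 * T) + (2 * p * C8 * L * \<epsilon> * D) * (v\<^sup>2 * T)"
  proof -
    have "(2 * p * C8 * \<epsilon> * D * (v\<^sup>2 * T)) * h \<le> (2 * p * C8 * \<epsilon> * D * (v\<^sup>2 * T)) * L"
      using pn C e D T h by (intro mult_left_mono) auto
    then show ?thesis by (simp add: algebra_simps power2_eq_square)
  qed
  have "C5 * w3 \<le> C5 * (\<epsilon> * v\<^sup>2)" using w C by (intro mult_left_mono) auto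
  moreover have "h * v * (C3 + C6 * (v + 1)) \<le> h * v * (C3 * v + C6 * (2 * v))"
    using hp v C mult_left_mono[of 1 v C3] by (intro mult_left_mono add_mono) auto
  ultimately have b3: "C5 * w3 + h * v * (C3 + C6 * (v + 1)) \<le> C5 * (\<epsilon> * v\<^sup>2) + h * v * (C3 * v + C6 * (2 * v))" by simp
  have n3: "0 \<le> C5 * (\<epsilon> * v\<^sup>2) + h * v * (C3 * v + C6 * (2 * v))" using C e hp v by simp
  have t3: "TT * (C5 * w3 + h * v * (C3 + C6 * (v + 1))) \<le> (n * T) * (C5 * (\<epsilon> * v\<^sup>2) + h * v * (C3 * v + C6 * (2 * v)))"
    using mult_left_mono[OF b3 TT(1)] mult_right_mono[OF TT(2) n3] by linarith
  have t3': "(n * T) * (C5 * (\<epsilon> * v\<^sup>2) + h * v * (C3 * v + C6 * (2 * v))) = (n * C5 * \<epsilon>) * (v\<^sup>2 * T) + (n * (C3 + 2 * C6) * h) * (v\<^sup>2 * T)"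
    by (simp add: algebra_simps power2_eq_square)
  have "v \<le> \<epsilon> * v\<^sup>2" using mult_right_mono[OF e(2), of v] v by (simp add: power2_eq_square)
  then have "CR * v \<le> CR * (\<epsilon> * v\<^sup>2)" using C by (intro mult_left_mono) auto
  then have t4: "TT * (CR * v) \<le> (n * T) * (CR * (\<epsilon> * v\<^sup>2))"
    by (rule mult_mono[OF TT(2)]) (use C v T pn in auto)
  have t4': "(n * T) * (CR * (\<epsilon> * v\<^sup>2)) = (n * CR * \<epsilon>) * (v\<^sup>2 * T)" by simp
  have "(L * h) * (v\<^sup>2 * T) \<le> (\<epsilon> * (p * C7 * D + 2 * p * L * C8 * D + n * C5 + n * CR) + h * (2 * p * C8 + n * (C3 + 2 * C6))) * (v\<^sup>2 * T)"
    using ineq t1 t2 t2' t3 t4 unfolding t3' t4' by (simp add: algebra_simps)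
  then have "L * h \<le> \<epsilon> * (p * C7 * D + 2 * p * L * C8 * D + n * C5 + n * CR) + h * (2 * p * C8 + n * (C3 + 2 * C6))"
    using v T by (subst (asm) mult_le_cancel_right_pos) auto
  moreover have "h * (2 * p * C8 + n * (C3 + 2 * C6)) \<le> h * (L - 1)" using L hp by (intro mult_left_mono) auto
  ultimately have "L * h < h0 + h * (L - 1)" using small by linarith
  then show False using h by (simp add: algebra_simps)
qed

lemma class_W_small:
  assumes "\<omega> \<in> class_W" "\<epsilon> > 0"
  shows "\<forall>\<^sub>F t in at_top. \<omega> t \<le> \<epsilon> * t"
proof -
  have "((\<lambda>t. \<omega> t / t) \<longlongrightarrow> 0) at_top" using assms by (simp add: class_W_def)
  then have "\<forall>\<^sub>F t in at_top. \<omega> t / t < \<epsilon>" using assms(2) by (rule order_tendstoD)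
  then show ?thesis using eventually_gt_at_top[of 0]
    by eventually_elim (simp add: pos_divide_less_eq less_imp_le)
qed

lemma class_W_bounds: "\<omega> \<in> class_W \<Longrightarrow> t \<ge> 0 \<Longrightarrow> 0 \<le> \<omega> t \<and> \<omega> t \<le> t + 1"
  by (auto simp: class_W_def)

lemma nonneg_cont_bounded:
  fixes f :: "'m::topological_space \<Rightarrow> real \<Rightarrow> real"
  assumes "compact (UNIV :: 'm set)" "nonneg_cont f"
  obtains C where "C \<ge> 0" "\<And>x t. \<bar>t\<bar> \<le> K \<Longrightarrow> f x t \<le> C"
proof -
  have "compact ((UNIV :: 'm set) \<times> {-K..K})" using assms(1) by (intro compact_Times) auto
  moreover have "continuous_on (UNIV \<times> {-K..K}) (\<lambda>(x, t). f x t)"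
    using assms(2) by (auto simp: nonneg_cont_def intro: continuous_on_subset)
  ultimately have "bounded ((\<lambda>(x, t). f x t) ` (UNIV \<times> {-K..K}))"
    by (intro compact_imp_bounded compact_continuous_image)
  then obtain C where C: "\<And>z. z \<in> (\<lambda>(x, t). f x t) ` (UNIV \<times> {-K..K}) \<Longrightarrow> norm z \<le> C" "C > 0"
    using bounded_pos by metis
  show ?thesis
  proof (rule that[of C])
    fix x t assume "\<bar>t\<bar> \<le> K"
    then have "f x t \<in> (\<lambda>(x, t). f x t) ` (UNIV \<times> {-K..K})" by (force simp: image_iff)
    then show "f x t \<le> C" using C(1) by fastforce
  qed (use C in simp)
qed

context riemannian_manifold
begin

text \<open>For \<open>p = n\<close> all eigenvalues of \<open>B = A + \<nabla>\<^sup>2u\<close> are positive. But \<open>\<zeta>(t) = exp (- L t)\<close> gives \<open>h = L / 2\<close> and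
  \<open>B(\<nabla>u, \<nabla>u) \<le> C3 v (v + 1) - (L / 2) v\<^sup>2\<close> at a maximum point, which is negative for \<open>v > 1\<close> if
  \<open>L = 4 C3 + 2\<close>. The exponential in the conclusion is the oscillation of \<open>\<zeta>\<close>.\<close>
lemma gradient_bound_full:
  assumes compact: "compact (UNIV :: 'm set)" and A: "smooth_cotform \<A> A" and \<phi>: "pos_smooth_cotfun \<A> \<phi>"
    and C3: "C3 \<ge> 0"
    and i: "\<And>x t \<alpha> v. \<bar>t\<bar> \<le> K \<Longrightarrow> \<alpha> \<in> cotspace \<A> x \<Longrightarrow> v \<in> tspace \<A> x \<Longrightarrow>
      A (x, \<alpha>) t v v \<le> C3 * g x v v * ((conorm \<A> g x \<alpha>)\<^sup>2 + 1)"
    and u: "Ck_fun \<A> 3 u" and sol: "solves_hessian_eq \<A> g CARD('n) A \<phi> u" and K: "\<And>x. \<bar>u x\<bar> \<le> K"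
  shows "(conorm \<A> g x (differential \<A> u x))\<^sup>2 \<le> exp (2 * (4 * C3 + 2) * K)"
proof -
  define L where "L = 4 * C3 + 2"
  define \<zeta> where "\<zeta> = (\<lambda>t. exp (- L * t))"
  have L0: "L > 0" using C3 by (simp add: L_def)
  have R: "\<zeta> s \<le> exp (2 * L * K) * \<zeta> t" if "\<bar>s\<bar> \<le> K" "\<bar>t\<bar> \<le> K" for s t
  proof -
    have "- L * s \<le> 2 * L * K - L * t"
      using mult_left_mono[of "t - s" "2 * K" L] that L0 by (simp add: algebra_simps)
    then show ?thesis by (simp add: \<zeta>_def exp_add[symmetric])
  qed
  have cont: "continuous_on UNIV \<zeta>" unfolding \<zeta>_def by (intro continuous_intros)
  obtain x0 where x0: "\<And>x. (conorm \<A> g x (differential \<A> u x))\<^sup>2 \<le> exp (2 * L * K) * (conorm \<A> g x0 (differential \<A> u x0))\<^sup>2"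
    and max: "\<And>c y. c \<in> \<A> \<Longrightarrow> x0 \<in> cdom c \<Longrightarrow> y \<in> img c \<Longrightarrow>
      nsqc c u y
        - (nsqc c u (crd c x0) / \<zeta> (u x0)) * \<zeta> (u (cinv c y)) \<le> 0"
    by (rule exists_maximum[OF compact u K cont _ R]) (auto simp: \<zeta>_def)
  let ?c = "chart_at \<A> x0"
  have c: "?c \<in> \<A>" "x0 \<in> cdom ?c" by (rule chart_at)+
  interpret l: local_metric_function "img ?c" "Gc ?c" "loc ?c u" by (rule chart_function[OF u c(1)])
  define y where "y = crd ?c x0"
  have y: "y \<in> img ?c" using c by (simp add: y_def)
  have xy: "cinv ?c y = x0" using cinv_crd[OF c] by (simp add: y_def)
  define v where "v = l.nsq y"
  have "v \<le> 1"
  proof (rule ccontr)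
    assume "\<not> v \<le> 1"
    then have v1: "v > 1" by simp
    \<comment> \<open>so that \<open>|du|\<^sup>2 - \<kappa> \<zeta>(u)\<close> has the maximal value \<open>0\<close>\<close>
    define \<kappa> where "\<kappa> = v / \<zeta> (u x0)"
    have z1: "(\<zeta> has_real_derivative - L * exp (- L * t)) (at t)" for t
      unfolding \<zeta>_def by (auto intro!: derivative_eq_intros)
    have z2: "((\<lambda>t. - L * exp (- L * t)) has_real_derivative L * L * exp (- L * t)) (at t)" for t
      by (auto intro!: derivative_eq_intros)
    have mx: "l.nsq x - \<kappa> * \<zeta> (u (cinv ?c x)) \<le> l.nsq y - \<kappa> * \<zeta> (u (cinv ?c y))" if "x \<in> img ?c" for x
    proof -
      have "l.nsq y - \<kappa> * \<zeta> (u (cinv ?c y)) = 0"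
        by (simp add: xy \<kappa>_def v_def \<zeta>_def)
      then show ?thesis using max[OF c that] by (simp add: \<kappa>_def v_def y_def)
    qed
    have "l.Hs y *v l.nab y = (\<kappa> * (- L * exp (- L * u (cinv ?c y))) / 2) *\<^sub>R l.grad y"
      by (rule l.maximum_conditions(1)[OF y z1 z2 mx])
    moreover have "\<kappa> * (- L * exp (- L * u (cinv ?c y))) / 2 = - (L / 2) * v"
      by (simp add: \<kappa>_def xy \<zeta>_def)
    ultimately have "l.nab y \<bullet> (l.Hs y *v l.nab y) = - (L / 2) * v * v"
      by (simp add: v_def l.nsq_def inner_commute)
    note HN = this
    define B where "B = formc A u ?c y + l.Hs y"
    have Bsym: "transpose B = B"
      using chart_equation(1)[OF u A \<phi> _ sol c(1) y] l.transpose_Hs[OF y]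
      by (simp add: B_def transpose_def vec_eq_iff Suc_leI)
    obtain e :: "'n \<Rightarrow> real^'n" and \<mu> where on: "\<And>i j. e i \<bullet> (Gc ?c y *v e j) = (if i = j then 1 else 0)"
      and ev: "\<And>i. B *v e i = \<mu> i *\<^sub>R (Gc ?c y *v e i)"
      using simultaneous_diagonalization[OF l.transpose_G[OF y] Bsym l.G_pos[OF y]] by blast
    have X: "(matrix_inv (Gc ?c y) ** B) *v e i = \<mu> i *\<^sub>R e i" for i
      by (simp add: matrix_vector_mul_assoc[symmetric] ev matrix_vector_mult_scaleR l.G_inv[OF y])
    have spos: "symf q UNIV \<mu> > 0" if "q \<le> CARD('n)" for q
    proof (cases "q = 0")
      case False
      then show ?thesis
        using chart_equation(2)[OF u A \<phi> _ sol c(1) y, of q] that eigenvalues_of_eigenbasis(2)[OF on X, of q]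
        by (simp add: B_def Suc_leI)
    qed (simp add: symf_0)
    have mpos: "\<mu> i > 0" for i by (rule symf_all_pos_imp_pos[OF finite spos]) auto
    have "l.nab y \<bullet> (B *v l.nab y) = (\<Sum>i\<in>UNIV. \<mu> i * (l.nab y \<bullet> (Gc ?c y *v e i))\<^sup>2)"
      by (rule eigenbasis_quadratic[OF on l.transpose_G[OF y] ev])
    also have "\<dots> \<ge> 0" using mpos by (intro sum_nonneg mult_nonneg_nonneg) (auto simp: less_imp_le)
    finally have "l.nab y \<bullet> (B *v l.nab y) \<ge> 0" .
    moreover have "l.nab y \<bullet> (formc A u ?c y *v l.nab y) \<le> C3 * v * (v + 1)"
    proof -
      note a = chart_grad(1)[OF u c]
      have "A (x0, differential \<A> u x0) (u x0) (tv ?c x0 (l.nab y)) (tv ?c x0 (l.nab y)) = l.nab y \<bullet> (formc A u ?c y *v l.nab y)"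
        unfolding form_value(1)[OF A a c] chart_grad(2)[OF u c] formc_def y_def cinv_crd[OF c] ..
      moreover have "g x0 (tv ?c x0 (l.nab y)) (tv ?c x0 (l.nab y)) = v"
        using g_components[OF c] l.nsq_G[OF y] by (simp add: v_def y_def)
      moreover have "(conorm \<A> g x0 (differential \<A> u x0))\<^sup>2 = v"
        using chart_grad(3)[OF u c] by (simp add: v_def y_def)
      ultimately show ?thesis using i[OF K a tv_tspace[OF c], of x0 "l.nab y"] by simp
    qed
    ultimately have "L / 2 * v * v \<le> C3 * v * (v + 1)"
      using HN by (simp add: B_def matrix_vector_mult_add_rdistrib inner_add_right)
    then have "v * (L / 2 * v) \<le> v * (C3 * (v + 1))" by (simp add: mult_ac)
    then have "L / 2 * v \<le> C3 * (v + 1)" using v1 by (subst (asm) mult_le_cancel_left_pos) auto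
    then have "C3 * v + v \<le> C3" by (simp add: L_def algebra_simps)
    moreover have "C3 * v \<ge> C3 * 1" using C3 v1 by (intro mult_left_mono) auto
    ultimately show False using v1 by simp
  qed
  then have "(conorm \<A> g x0 (differential \<A> u x0))\<^sup>2 \<le> 1"
    using chart_grad(3)[OF u c] by (simp add: v_def y_def)
  then have "exp (2 * L * K) * (conorm \<A> g x0 (differential \<A> u x0))\<^sup>2 \<le> exp (2 * L * K) * 1"
    by (intro mult_left_mono) auto
  from order_trans[OF x0 this] show ?thesis by (simp add: L_def)
qed

text \<open>Conditions (i) and (iii) to (vi) for \<open>|t| \<le> K\<close>, where the coefficient functions are bounded by constants.\<close>
definition structure_bounds where
  "structure_bounds p A \<phi> K C3 C5 C6 C7 C8 \<omega>1 \<omega>3 \<omega>4 \<omega>5 \<longleftrightarrow>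
    (\<forall>x t. \<bar>t\<bar> \<le> K \<longrightarrow> (\<forall>\<alpha>\<in>cotspace \<A> x. \<forall>v\<in>tspace \<A> x.
      A (x, \<alpha>) t v v \<le> C3 * g x v v * \<omega>1 ((conorm \<A> g x \<alpha>)^2) \<and>
      (\<forall>c\<in>\<A>. x \<in> cdom c \<longrightarrow>
        (\<Sum>j\<in>UNIV. \<Sum>k\<in>UNIV. \<Sum>r\<in>UNIV. \<Sum>s\<in>UNIV.
           ginv \<A> g c x $ j $ k * horizontal_form \<A> g c j A r s x \<alpha> t
           * v c $ r * v c $ s * cocomp \<A> c x \<alpha> $ k)
        + deriv (\<lambda>\<tau>. A (x, \<alpha>) \<tau> v v) t * (conorm \<A> g x \<alpha>)^2
        \<le> C5 * g x v v * \<omega>3 ((conorm \<A> g x \<alpha>)^4)) \<and>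
      integral {0..1} (\<lambda>\<theta>. \<theta> * second_deriv \<A> x (\<lambda>\<beta>. A (x, \<beta>) t v v) (\<lambda>z. \<theta> * \<alpha> z) \<alpha> \<alpha>)
        \<ge> - C6 * g x v v * ((conorm \<A> g x \<alpha>)^2 + 1) \<and>
      (\<forall>c\<in>\<A>. x \<in> cdom c \<longrightarrow>
        (\<Sum>j\<in>UNIV. \<Sum>k\<in>UNIV.
           ginv \<A> g c x $ j $ k * horizontal \<A> g c j \<phi> x \<alpha> t * cocomp \<A> c x \<alpha> $ k)
        + deriv (\<lambda>\<tau>. \<phi> (x, \<alpha>) \<tau>) t * (conorm \<A> g x \<alpha>)^2
        \<ge> - C7 * \<omega>4 ((conorm \<A> g x \<alpha>)^4)
           * max 1 ((conorm \<A> g x \<alpha>)^(2 * (p - 1)) / (\<phi> (x, \<alpha>) t)^(p - 1))) \<and>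
      integral {0..1} (\<lambda>\<theta>. \<theta> * second_deriv \<A> x (\<lambda>\<beta>. \<phi> (x, \<beta>) t) (\<lambda>z. \<theta> * \<alpha> z) \<alpha> \<alpha>)
        \<le> C8 * ((conorm \<A> g x \<alpha>)^2 + 1)
           * max 1 (\<omega>5 ((conorm \<A> g x \<alpha>)^(2 * (p - 1))) / (\<phi> (x, \<alpha>) t)^(p - 1))))"

lemma zero_cotspace: "(\<lambda>z. 0) \<in> cotspace \<A> x" by (simp add: cotspace_def)

lemma conorm_zero: "conorm \<A> g x (\<lambda>z. 0) = 0"
  by (simp add: conorm_def cocomp_def Let_def)

text \<open>The bounds in the form required by \<open>key_inequality\<close>. The value at the zero covector that comes with the integrals
  in (iv) and (vi) is bounded by (i) in the case of \<open>A\<close>, whence the assumption on \<open>\<omega>1 0\<close>; in the case of \<open>\<phi>\<close>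
  it is positive and may be dropped.\<close>
lemma structure_bounds_at:
  fixes p :: nat
  assumes A: "smooth_cotform \<A> A" and \<phi>: "pos_smooth_cotfun \<A> \<phi>"
    and sb: "structure_bounds p A \<phi> K C3 C5 C6 C7 C8 \<omega>1 \<omega>3 \<omega>4 \<omega>5"
    and u: "Ck_fun \<A> 3 u" and K: "\<And>x. \<bar>u x\<bar> \<le> K" and c: "c \<in> \<A>" "x \<in> cdom c"
    and C3: "C3 \<ge> 0" and w1: "\<omega>1 0 \<le> 1"
  defines "y \<equiv> crd c x" and "U \<equiv> \<lambda>y. u (cinv c y)"
  defines "nsq \<equiv> local_metric_function.nsq (Gc c) U y"
    and "F \<equiv> rep c \<phi>" and "R \<equiv> \<lambda>r s. rep c (form_component \<A> A c r s)"
  defines "\<Phi> \<equiv> F (y, local_metric_function.grad U y, U y)"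
  defines "am \<equiv> formc A u c y"
  shows "w \<bullet> (am *v w) \<le> C3 * (w \<bullet> (Gc c y *v w)) * \<omega>1 nsq"
    and "(\<Sum>r\<in>UNIV. \<Sum>s\<in>UNIV. local_metric_function.hort (Gc c) U (R r s) y * w $ r * w $ s)
      - 2 * ((am *v w) \<bullet> (local_metric.Gam (Gc c) y (local_metric_function.nab (Gc c) U y) *v w))
      \<le> C5 * (w \<bullet> (Gc c y *v w)) * \<omega>3 (nsq\<^sup>2)"
    and "- ((\<Sum>r\<in>UNIV. \<Sum>s\<in>UNIV. local_metric_function.vert U (R r s) y * w $ r * w $ s) - w \<bullet> (am *v w))
      \<le> (C3 + C6 * (nsq + 1)) * (w \<bullet> (Gc c y *v w))"
    and "- local_metric_function.hort (Gc c) U F y \<le> C7 * \<omega>4 (nsq\<^sup>2) * max 1 (nsq ^ (p - 1) / \<Phi> ^ (p - 1))"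
    and "local_metric_function.vert U F y - \<Phi> \<le> C8 * (nsq + 1) * max 1 (\<omega>5 (nsq ^ (p - 1)) / \<Phi> ^ (p - 1))"
proof -
  interpret l: local_metric_function "img c" "Gc c" U unfolding U_def by (rule chart_function[OF u c(1)])
  have y: "y \<in> img c" using c by (simp add: y_def)
  let ?\<alpha> = "differential \<A> u x" and ?t = "u x" and ?v = "tv c x w"
  note a = chart_grad(1)[OF u c]
  have gr: "cocomp \<A> c x ?\<alpha> = l.grad y" using chart_grad(2)[OF u c] by (simp add: y_def U_def)
  have Uy: "U y = ?t" by (simp add: U_def y_def cinv_crd[OF c])
  have cn: "(conorm \<A> g x ?\<alpha>)\<^sup>2 = nsq" using chart_grad(3)[OF u c] by (simp add: nsq_def y_def U_def)
  have cn4: "(conorm \<A> g x ?\<alpha>) ^ 4 = nsq\<^sup>2"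
    unfolding cn[symmetric] power_mult[symmetric] by simp
  have cnp: "(conorm \<A> g x ?\<alpha>) ^ (2 * (p - 1)) = nsq ^ (p - 1)"
    unfolding cn[symmetric] power_mult ..
  have gv: "g x ?v ?v = w \<bullet> (Gc c y *v w)" unfolding y_def by (rule g_components[OF c])
  have vT: "?v \<in> tspace \<A> x" by (rule tv_tspace[OF c])
  have Av: "A (x, ?\<alpha>) ?t ?v ?v = w \<bullet> (am *v w)"
    unfolding form_value(1)[OF A a c] gr am_def formc_def y_def U_def cinv_crd[OF c] ..
  have ra: "raise c x (l.grad y) = l.nab y" by (simp add: raise_def l.nab_def y_def)
  have gt: "GamT c x (l.grad y) = transpose (l.Gam y (l.nab y)) *v l.grad y"
    by (simp only: GamT_def y_def[symmetric] ra)
  have P: "\<phi> (x, ?\<alpha>) ?t = \<Phi>"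
    using rep_at[OF a c, of \<phi> ?t] unfolding gr y_def[symmetric] by (simp only: \<Phi>_def F_def Uy)
  have nz: "conorm \<A> g x (\<lambda>z. 0) = 0" by (rule conorm_zero)
  have ww: "w \<bullet> (Gc c y *v w) \<ge> 0" using l.G_pos[OF y, of w] by (cases "w = 0") auto
  note S = sb[unfolded structure_bounds_def, rule_format, OF K[of x] a vT]
  show "w \<bullet> (am *v w) \<le> C3 * (w \<bullet> (Gc c y *v w)) * \<omega>1 nsq"
    using S unfolding Av gv cn by blast
  have hd: "l.hort f y = frechet_derivative f (at (y, l.grad y, ?t)) (l.nab y, GamT c x (l.grad y), 0)
     + (l.grad y \<bullet> raise c x (l.grad y)) * frechet_derivative f (at (y, l.grad y, ?t)) (0, 0, 1)" for f
    unfolding l.hort_def Uy gt ra l.nsq_def ..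
  have vd: "l.vert f y = frechet_derivative f (at (y, l.grad y, ?t)) (0, l.grad y, 0)" for f
    unfolding l.vert_def Uy ..
  have Rc: "rep c (form_component \<A> A c r s) = R r s" for r s by (simp add: R_def)
  have am: "(\<chi> r s. R r s (y, l.grad y, ?t)) = am"
    by (simp add: R_def am_def formc_def U_def y_def cinv_crd[OF c])
  have "(\<Sum>j\<in>UNIV. \<Sum>k\<in>UNIV. \<Sum>r\<in>UNIV. \<Sum>s\<in>UNIV.
           ginv \<A> g c x $ j $ k * horizontal_form \<A> g c j A r s x ?\<alpha> ?t
           * ?v c $ r * ?v c $ s * cocomp \<A> c x ?\<alpha> $ k)
        + deriv (\<lambda>\<tau>. A (x, ?\<alpha>) \<tau> ?v ?v) ?t * (conorm \<A> g x ?\<alpha>)^2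
        \<le> C5 * g x ?v ?v * \<omega>3 ((conorm \<A> g x ?\<alpha>)^4)"
    using S c by blast
  then show "(\<Sum>r\<in>UNIV. \<Sum>s\<in>UNIV. l.hort (R r s) y * w $ r * w $ s)
      - 2 * ((am *v w) \<bullet> (l.Gam y (l.nab y) *v w)) \<le> C5 * (w \<bullet> (Gc c y *v w)) * \<omega>3 (nsq\<^sup>2)"
    unfolding structure_iii[OF A a c] unfolding gr gv cn4 y_def[symmetric] hd Rc am ra .
  have "integral {0..1} (\<lambda>\<theta>. \<theta> * second_deriv \<A> x (\<lambda>\<beta>. A (x, \<beta>) ?t ?v ?v) (\<lambda>z. \<theta> * ?\<alpha> z) ?\<alpha> ?\<alpha>)
        \<ge> - C6 * g x ?v ?v * ((conorm \<A> g x ?\<alpha>)^2 + 1)"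
    using S by blast
  then have iv: "- C6 * (w \<bullet> (Gc c y *v w)) * (nsq + 1) \<le>
     (\<Sum>r\<in>UNIV. \<Sum>s\<in>UNIV. l.vert (R r s) y * w $ r * w $ s) - w \<bullet> (am *v w) + A (x, \<lambda>z. 0) ?t ?v ?v"
    unfolding structure_iv[OF A a c] unfolding gr gv cn y_def[symmetric] vd Rc Av .
  have "A (x, \<lambda>z. 0) ?t ?v ?v \<le> C3 * g x ?v ?v * \<omega>1 ((conorm \<A> g x (\<lambda>z. 0))^2)"
    using sb[unfolded structure_bounds_def, rule_format, OF K[of x] zero_cotspace vT] by blast
  also have "\<dots> \<le> C3 * g x ?v ?v * 1"
    unfolding nz gv using C3 ww w1 by (intro mult_left_mono) auto
  finally have "A (x, \<lambda>z. 0) ?t ?v ?v \<le> C3 * (w \<bullet> (Gc c y *v w))" by (simp add: gv)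
  with iv show "- ((\<Sum>r\<in>UNIV. \<Sum>s\<in>UNIV. l.vert (R r s) y * w $ r * w $ s) - w \<bullet> (am *v w))
      \<le> (C3 + C6 * (nsq + 1)) * (w \<bullet> (Gc c y *v w))"
    by (simp add: algebra_simps)
  have sm: "smooth_cotfun_in \<A> d \<phi>" if "d \<in> \<A>" for d using \<phi> that by (simp add: pos_smooth_cotfun_def)
  have "(\<Sum>j\<in>UNIV. \<Sum>k\<in>UNIV.
           ginv \<A> g c x $ j $ k * horizontal \<A> g c j \<phi> x ?\<alpha> ?t * cocomp \<A> c x ?\<alpha> $ k)
        + deriv (\<lambda>\<tau>. \<phi> (x, ?\<alpha>) \<tau>) ?t * (conorm \<A> g x ?\<alpha>)^2
        \<ge> - C7 * \<omega>4 ((conorm \<A> g x ?\<alpha>)^4)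
           * max 1 ((conorm \<A> g x ?\<alpha>)^(2 * (p - 1)) / (\<phi> (x, ?\<alpha>) ?t)^(p - 1))"
    using S c by blast
  then have "- C7 * \<omega>4 (nsq\<^sup>2) * max 1 (nsq ^ (p - 1) / \<Phi> ^ (p - 1)) \<le> l.hort F y"
    unfolding structure_v[OF sm[OF c(1)] a c] unfolding gr cn4 cnp P y_def[symmetric] hd F_def ra .
  then show "- l.hort F y \<le> C7 * \<omega>4 (nsq\<^sup>2) * max 1 (nsq ^ (p - 1) / \<Phi> ^ (p - 1))" by simp
  have vi: "integral {0..1} (\<lambda>\<theta>. \<theta> * second_deriv \<A> x (\<lambda>\<beta>. \<phi> (x, \<beta>) ?t) (\<lambda>z. \<theta> * ?\<alpha> z) ?\<alpha> ?\<alpha>)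
    = frechet_derivative (rep c \<phi>) (at (crd c x, cocomp \<A> c x ?\<alpha>, ?t)) (0, cocomp \<A> c x ?\<alpha>, 0) - \<phi> (x, ?\<alpha>) ?t + \<phi> (x, \<lambda>z. 0) ?t"
    by (rule structure_vi[OF _ a c]) (rule sm)
  have "integral {0..1} (\<lambda>\<theta>. \<theta> * second_deriv \<A> x (\<lambda>\<beta>. \<phi> (x, \<beta>) ?t) (\<lambda>z. \<theta> * ?\<alpha> z) ?\<alpha> ?\<alpha>)
        \<le> C8 * ((conorm \<A> g x ?\<alpha>)^2 + 1)
           * max 1 (\<omega>5 ((conorm \<A> g x ?\<alpha>)^(2 * (p - 1))) / (\<phi> (x, ?\<alpha>) ?t)^(p - 1))"
    using S by blast
  then have "l.vert F y - \<Phi> + \<phi> (x, \<lambda>z. 0) ?t \<le> C8 * (nsq + 1) * max 1 (\<omega>5 (nsq ^ (p - 1)) / \<Phi> ^ (p - 1))"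
    unfolding vi unfolding gr cn cnp P y_def[symmetric] vd F_def .
  moreover have "\<phi> (x, \<lambda>z. 0) ?t > 0" using \<phi> zero_cotspace by (auto simp: pos_smooth_cotfun_def)
  ultimately show "l.vert F y - \<Phi> \<le> C8 * (nsq + 1) * max 1 (\<omega>5 (nsq ^ (p - 1)) / \<Phi> ^ (p - 1))" by simp
qed

end

lemma mult_max_1_divide: "(f::real) > 0 \<Longrightarrow> f * max 1 (w / f) = max f w"
  by (simp add: max_def field_simps)

text \<open>The bound by the power of \<open>b\<close> is \<open>symf_delete_direction_power\<close>. One step of the same recursion gives
  \<open>T \<ge> \<sigma>\<^sub>p\<^sub>-\<^sub>1\<close>. By Maclaurin's inequality \<open>\<sigma>\<^sub>p\<^sub>-\<^sub>1\<close> is at least \<open>\<phi>\<^sup>p\<^sup>-\<^sup>1\<close>, and the trace is a multiple of it.\<close>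
lemma linearised_operator_bounds:
  fixes \<mu> w :: "'n::finite \<Rightarrow> real"
  assumes pos: "\<And>q. q \<le> p \<Longrightarrow> symf q UNIV \<mu> > 0" and p: "2 \<le> p" "p \<le> CARD('n)"
    and w: "\<And>i. w i \<ge> 0" "sum w UNIV = 1" and neg: "(\<Sum>i\<in>UNIV. w i * \<mu> i) \<le> - b" "b \<ge> 0"
    and \<phi>: "\<phi> > 0" "symf p UNIV \<mu> = \<phi> ^ p"
  defines "T \<equiv> \<Sum>i\<in>UNIV. w i * symf (p - 1) (UNIV - {i}) \<mu>"
  shows "\<And>i. symf (p - 1) (UNIV - {i}) \<mu> > 0" and "T > 0" and "b ^ (p - 1) \<le> T" and "\<phi> ^ (p - 1) \<le> T"
    and "(\<Sum>i\<in>UNIV. symf (p - 1) (UNIV - {i}) \<mu>) \<le> real CARD('n) * T"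
proof -
  show Ti: "symf (p - 1) (UNIV - {i}) \<mu> > 0" for i
    by (rule symf_delete_pos[where p = p, OF finite pos]) (use p in auto)
  show "b ^ (p - 1) \<le> T" unfolding T_def
    by (rule symf_delete_direction_power[where p = p, OF finite pos w neg]) (use p in auto)
  have p2: "Suc (p - 2) = p - 1" using p by simp
  have "symf (Suc (p - 2)) UNIV \<mu> + b * (\<Sum>i\<in>UNIV. w i * symf (p - 2) (UNIV - {i}) \<mu>) \<le> (\<Sum>i\<in>UNIV. w i * symf (Suc (p - 2)) (UNIV - {i}) \<mu>)"
    by (rule symf_delete_direction_bound[where p = p, OF finite pos w neg]) (use p in auto)
  moreover have "0 \<le> (\<Sum>i\<in>UNIV. w i * symf (p - 2) (UNIV - {i}) \<mu>)"
    by (intro sum_nonneg mult_nonneg_nonneg w less_imp_le[OF symf_delete_pos[where p = p, OF finite pos]]) (use p in auto)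
  ultimately have sT: "symf (p - 1) UNIV \<mu> \<le> T"
    unfolding T_def p2 using neg(2) by (smt (verit) mult_nonneg_nonneg)
  have s0: "symf (p - 1) UNIV \<mu> > 0" by (rule pos) simp
  then show "T > 0" using sT by simp
  have p1: "Suc (p - 1) = p" using p by simp
  have "symf (Suc (p - 1)) UNIV \<mu> ^ (p - 1) \<le> symf (p - 1) UNIV \<mu> ^ Suc (p - 1)"
    by (rule maclaurin_symf[where p = p, OF finite pos]) (use p in auto)
  then have "(\<phi> ^ (p - 1)) ^ p \<le> symf (p - 1) UNIV \<mu> ^ p"
    unfolding p1 \<phi>(2) by (simp add: power_mult[symmetric] mult.commute)
  then have "\<phi> ^ (p - 1) \<le> symf (p - 1) UNIV \<mu>"
    using s0 p by (subst (asm) power_mono_iff) (use \<phi> in auto)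
  then show "\<phi> ^ (p - 1) \<le> T" using sT by simp
  have "(\<Sum>i\<in>UNIV. symf (p - 1) (UNIV - {i}) \<mu>) = (real CARD('n) - real (p - 1)) * symf (p - 1) UNIV \<mu>"
    by (rule sum_symf_delete) simp
  also have "\<dots> \<le> real CARD('n) * T" using s0 sT by (intro mult_mono) auto
  finally show "(\<Sum>i\<in>UNIV. symf (p - 1) (UNIV - {i}) \<mu>) \<le> real CARD('n) * T" .
qed

context riemannian_manifold
begin

text \<open>The function \<open>\<zeta>(t) = (C0 - exp (L t))\<^sup>2\<close> has the property \<open>\<zeta>'' / (2 \<zeta>) = h\<^sup>2 - L h\<close> for
  \<open>h = - \<zeta>' / (2 \<zeta>) = L exp (L t) / (C0 - exp (L t))\<close>. So \<open>key_inequality\<close> holds with \<open>K = L\<close>, and all its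
  terms are estimated by multiples of \<open>T\<close>.\<close>
lemma maximum_point_bound:
  fixes p :: nat
  assumes A: "smooth_cotform \<A> A" and \<phi>: "pos_smooth_cotfun \<A> \<phi>" and p: "2 \<le> p" "p \<le> CARD('n)"
    and sb: "structure_bounds p A \<phi> K C3 C5 C6 C7 C8 \<omega>1 \<omega>3 \<omega>4 \<omega>5"
    and C: "C3 \<ge> 0" "C5 \<ge> 0" "C6 \<ge> 0" "C7 \<ge> 0" "C8 \<ge> 0" "CR \<ge> 0"
    and \<omega>: "\<omega>1 0 \<le> 1" "\<And>t. t \<ge> 0 \<Longrightarrow> \<omega>4 t \<ge> 0"
    and u: "Ck_fun \<A> 3 u" and sol: "solves_hessian_eq \<A> g p A \<phi> u" and K: "\<And>x. \<bar>u x\<bar> \<le> K"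
    and c: "c \<in> \<A>" "x0 \<in> cdom c"
    and curv: "curv_le CR c x0"
    and \<eta>: "\<And>t. \<bar>t\<bar> \<le> K \<Longrightarrow> C0 - exp (L * t) > 0"
    and h0: "0 < h0" "\<And>t. \<bar>t\<bar> \<le> K \<Longrightarrow> h0 \<le> L * exp (L * t) / (C0 - exp (L * t))"
      "\<And>t. \<bar>t\<bar> \<le> K \<Longrightarrow> L * exp (L * t) / (C0 - exp (L * t)) \<le> L"
    and L: "L \<ge> 2 * real p * C8 + real CARD('n) * (C3 + 2 * C6) + 1"
    and D: "D = 1 + (2 / h0) ^ (p - 1)"
    and small: "\<epsilon> > 0" "\<epsilon> * (real p * C7 * D + 2 * real p * L * C8 * D + real CARD('n) * C5 + real CARD('n) * CR) < h0"
    and max: "\<And>y. y \<in> img c \<Longrightarrow>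
      nsqc c u y
        - (nsqc c u (crd c x0) / (C0 - exp (L * u x0))\<^sup>2) * (C0 - exp (L * u (cinv c y)))\<^sup>2 \<le> 0"
    and v_def: "v = (conorm \<A> g x0 (differential \<A> u x0))\<^sup>2"
    and v: "v \<ge> 1" "1 \<le> \<epsilon> * v" "C3 * \<omega>1 v \<le> h0 / 2 * v" "\<omega>3 (v\<^sup>2) \<le> \<epsilon> * v\<^sup>2" "\<omega>4 (v\<^sup>2) \<le> \<epsilon> * v\<^sup>2"
      "\<omega>5 (v ^ (p - 1)) \<le> \<epsilon> * v ^ (p - 1)"
  shows False
proof -
  interpret l: local_metric_function "img c" "Gc c" "loc c u" by (rule chart_function[OF u c(1)])
  define y where "y = crd c x0"
  have y: "y \<in> img c" using c by (simp add: y_def)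
  have xy: "cinv c y = x0" using cinv_crd[OF c] by (simp add: y_def)
  have vn: "l.nsq y = v" using chart_grad(3)[OF u c] by (simp add: v_def y_def)
  have vpos: "v > 0" using v(1) by simp
  note sba = structure_bounds_at[OF A \<phi> sb u K c C(1) \<omega>(1), folded y_def, unfolded vn]
  let ?R = "\<lambda>r s. rep c (form_component \<A> A c r s)" and ?F = "rep c \<phi>"
  let ?A = "formc A u c y"
  define \<Phi> where "\<Phi> = ?F (y, l.grad y, u (cinv c y))"
  define E where "E = exp (L * u x0)"
  define \<eta>0 where "\<eta>0 = C0 - E"
  have \<eta>p: "\<eta>0 > 0" unfolding \<eta>0_def E_def by (rule \<eta>[OF K])
  \<comment> \<open>the value of \<open>- \<zeta>' / (2 \<zeta>)\<close> at \<open>u(x\<^sub>0)\<close>\<close>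
  define h where "h = L * E / \<eta>0"
  have hb: "h0 \<le> h" "h \<le> L" using h0(2,3)[OF K[of x0]] by (auto simp: h_def E_def \<eta>0_def)
  have hp: "h > 0" using hb h0(1) by simp
  define \<zeta> \<zeta>1 \<zeta>2 where "\<zeta> = (\<lambda>t. (C0 - exp (L * t))\<^sup>2)" and "\<zeta>1 = (\<lambda>t. 2 * (C0 - exp (L * t)) * (- (L * exp (L * t))))"
    and "\<zeta>2 = (\<lambda>t. 2 * (L * exp (L * t))\<^sup>2 - 2 * (C0 - exp (L * t)) * (L * L * exp (L * t)))"
  have z1: "(\<zeta> has_real_derivative \<zeta>1 t) (at t)" for t
    unfolding \<zeta>_def \<zeta>1_def by (auto intro!: derivative_eq_intros simp: algebra_simps)
  have z2: "(\<zeta>1 has_real_derivative \<zeta>2 t) (at t)" for t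
    unfolding \<zeta>1_def \<zeta>2_def by (auto intro!: derivative_eq_intros simp: algebra_simps power2_eq_square)
  define \<kappa> where "\<kappa> = v / \<eta>0\<^sup>2"
  have mx: "l.nsq x - \<kappa> * \<zeta> (u (cinv c x)) \<le> l.nsq y - \<kappa> * \<zeta> (u (cinv c y))" if "x \<in> img c" for x
  proof -
    have "l.nsq y - \<kappa> * \<zeta> (u (cinv c y)) = 0"
      using \<eta>p by (simp add: xy \<kappa>_def vn \<zeta>_def \<eta>0_def[symmetric] E_def[symmetric])
    then show ?thesis using max[OF that] by (simp add: \<kappa>_def vn y_def[symmetric] \<zeta>_def \<eta>0_def E_def)
  qed
  have k1: "\<kappa> * \<zeta>1 (u (cinv c y)) / 2 = - h * l.nsq y"
  proof -
    have "\<zeta>1 (u (cinv c y)) = 2 * \<eta>0 * (- (L * E))" by (simp only: \<zeta>1_def xy E_def \<eta>0_def)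
    then show ?thesis using \<eta>p by (simp add: \<kappa>_def h_def vn power2_eq_square)
  qed
  have k2: "\<kappa> * \<zeta>2 (u (cinv c y)) / 2 = l.nsq y * h\<^sup>2 - l.nsq y * L * h"
  proof -
    have e2: "\<zeta>2 (u (cinv c y)) = 2 * (L * E)\<^sup>2 - 2 * \<eta>0 * (L * L * E)" by (simp only: \<zeta>2_def xy E_def \<eta>0_def)
    show ?thesis unfolding \<kappa>_def h_def vn e2 using \<eta>p by (simp add: power2_eq_square field_simps)
  qed
  define B where "B = (\<lambda>y. formc A u c y + l.Hs y)"
  note eqn = chart_equation[OF u A \<phi> _ sol c(1)]
  have p1: "1 \<le> p" using p by simp
  have Bsym: "transpose (B y) = B y"
    using eqn(1)[OF p1 y] l.transpose_Hs[OF y] by (simp add: B_def transpose_def vec_eq_iff)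
  obtain e :: "'n \<Rightarrow> real^'n" and \<mu> where on: "\<And>i j. e i \<bullet> (Gc c y *v e j) = (if i = j then 1 else 0)"
    and ev: "\<And>i. B y *v e i = \<mu> i *\<^sub>R (Gc c y *v e i)"
    using simultaneous_diagonalization[OF l.transpose_G[OF y] Bsym l.G_pos[OF y]] by blast
  have X: "(matrix_inv (Gc c y) ** B y) *v e i = \<mu> i *\<^sub>R e i" for i
    by (simp add: matrix_vector_mul_assoc[symmetric] ev matrix_vector_mult_scaleR l.G_inv[OF y])
  have spos: "symf q UNIV \<mu> > 0" if "q \<le> p" for q
  proof (cases "q = 0")
    case False
    then show ?thesis
      using eqn(2)[OF p1 y, of q] that eigenvalues_of_eigenbasis(2)[OF on X, of q] by (simp add: B_def)
  qed (simp add: symf_0)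
  have \<Phi>p: "\<Phi> > 0" unfolding \<Phi>_def by (rule eqn(4)[OF p1 y])
  have sp: "symf p UNIV \<mu> = \<Phi> ^ p"
    using eqn(3)[OF p1 y] eigenvalues_of_eigenbasis(2)[OF on X, of p] by (simp add: B_def \<Phi>_def)
  \<comment> \<open>the squares of the components of the unit vector \<open>\<nabla>u / |\<nabla>u|\<close>\<close>
  define w where "w = (\<lambda>i. (l.grad y \<bullet> e i)\<^sup>2 / v)"
  have w0: "w i \<ge> 0" for i using vpos by (simp add: w_def)
  have Gquad: "l.nab y \<bullet> (Gc c y *v l.nab y) = v" using l.nsq_G[OF y] vn by simp
  have w1: "sum w UNIV = 1"
  proof -
    have "v = (\<Sum>i\<in>UNIV. 1 * (l.nab y \<bullet> (Gc c y *v e i))\<^sup>2)"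
      unfolding Gquad[symmetric] by (rule eigenbasis_quadratic[OF on l.transpose_G[OF y]]) simp
    then show ?thesis using vpos by (simp add: w_def sum_divide_distrib[symmetric] l.grad_inner[OF y])
  qed
  \<comment> \<open>The Hessian contributes \<open>- h v\<close>; by (i) and the choice of \<open>v\<close>, the form \<open>A\<close> contributes at most \<open>h v / 2\<close>.\<close>
  have wmu: "(\<Sum>i\<in>UNIV. w i * \<mu> i) \<le> - (h * v / 2)"
  proof -
    have "l.Hs y *v l.nab y = (\<kappa> * \<zeta>1 (u (cinv c y)) / 2) *\<^sub>R l.grad y"
      by (rule l.maximum_conditions(1)[OF y z1 z2 mx])
    then have "l.nab y \<bullet> (l.Hs y *v l.nab y) = - h * v * v"
      unfolding k1 by (simp add: vn[symmetric] l.nsq_def inner_commute)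
    moreover have "l.nab y \<bullet> (?A *v l.nab y) \<le> C3 * v * \<omega>1 v" using sba(1)[of "l.nab y"] by (simp add: Gquad)
    moreover have "C3 * v * \<omega>1 v \<le> v * (h0 / 2 * v)" using mult_left_mono[OF v(3), of v] vpos by (simp add: mult_ac)
    moreover have "v * (h0 / 2 * v) \<le> v * (h / 2 * v)" using hb vpos by (intro mult_left_mono mult_right_mono) auto
    ultimately have "l.nab y \<bullet> (B y *v l.nab y) \<le> - (h * v / 2) * v"
      by (simp add: B_def matrix_vector_mult_add_rdistrib inner_add_right algebra_simps)
    moreover have "l.nab y \<bullet> (B y *v l.nab y) = (\<Sum>i\<in>UNIV. \<mu> i * (l.nab y \<bullet> (Gc c y *v e i))\<^sup>2)"
      by (rule eigenbasis_quadratic[OF on l.transpose_G[OF y] ev])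
    moreover have "(\<Sum>i\<in>UNIV. w i * \<mu> i) = (\<Sum>i\<in>UNIV. \<mu> i * (l.nab y \<bullet> (Gc c y *v e i))\<^sup>2) / v"
      by (simp add: w_def sum_divide_distrib l.grad_inner[OF y] mult.commute)
    ultimately show ?thesis using vpos by (simp add: pos_divide_le_eq)
  qed
  define T where "T = (\<lambda>i. symf (p - 1) (UNIV - {i}) \<mu>)"
  have Tf: "symf (p - 1) (UNIV - {i}) \<mu> = T i" for i by (simp only: T_def)
  define Tw where "Tw = (\<Sum>i\<in>UNIV. w i * T i)"
  have hv0: "h * v / 2 \<ge> 0" using hp vpos by simp
  have lin: "T i > 0" "Tw > 0" "(h * v / 2) ^ (p - 1) \<le> Tw" "\<Phi> ^ (p - 1) \<le> Tw"
    "(\<Sum>i\<in>UNIV. T i) \<le> real CARD('n) * Tw" for i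
    unfolding Tw_def T_def by (rule linearised_operator_bounds[OF spos p w0 w1 wmu hv0 \<Phi>p sp], assumption)+
  have Tq: "(\<Sum>i\<in>UNIV. T i * (l.grad y \<bullet> e i)\<^sup>2) = v * Tw"
    unfolding Tw_def w_def using vpos by (simp add: sum_distrib_left mult_ac)
  have F_diff: "?F differentiable (at (y, l.grad y, u (cinv c y)))"
    using \<phi> c y by (intro rep_diff) (auto simp: pos_smooth_cotfun_def)
  have R_diff: "?R r s differentiable (at (y, l.grad y, u (cinv c y)))" for r s
    by (rule rep_diff[OF form_smooth[OF A c(1)] y])
  have Tnn: "symf (p - 1) (UNIV - {i}) \<mu> \<ge> 0" for i using lin(1)[of i] by (simp add: T_def less_imp_le)
  have Asym: "transpose (\<chi> r s. ?R r s (z, l.grad z, u (cinv c z))) = (\<chi> r s. ?R r s (z, l.grad z, u (cinv c z)))" if "z \<in> img c" for z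
    using eqn(1)[OF p1 that] by (simp add: formc_def)
  have Eq: "esym p (eigenvalues (matrix_inv (Gc c z) ** ((\<chi> r s. ?R r s (z, l.grad z, u (cinv c z))) + l.Hs z)))
      = ?F (z, l.grad z, u (cinv c z)) ^ p" if "z \<in> img c" for z
    using eqn(3)[OF p1 that] by (simp add: formc_def)
  have evk: "((\<chi> r s. ?R r s (y, l.grad y, u (cinv c y))) + l.Hs y) *v e i = \<mu> i *\<^sub>R (Gc c y *v e i)" for i
    using ev[of i] by (simp add: B_def formc_def)
  have vn0: "l.nsq y > 0" using vn vpos by simp
  have key: "L * h * v * (v * Tw)
    \<le> - (real p * \<Phi> ^ (p - 1) * l.hort ?F y) + real p * h * v * \<Phi> ^ (p - 1) * (l.vert ?F y - \<Phi>)
      + (\<Sum>i\<in>UNIV. T i * ((\<Sum>r\<in>UNIV. \<Sum>s\<in>UNIV. l.hort (?R r s) y * e i $ r * e i $ s) - 2 * ((?A *v e i) \<bullet> (l.Gam y (l.nab y) *v e i))))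
      - h * v * (\<Sum>i\<in>UNIV. T i * ((\<Sum>r\<in>UNIV. \<Sum>s\<in>UNIV. l.vert (?R r s) y * e i $ r * e i $ s) - e i \<bullet> (?A *v e i)))
      - (\<Sum>i\<in>UNIV. T i * l.Rm y (e i) (l.nab y))"
    using l.key_inequality[OF y F_diff R_diff Asym Eq on evk p1 p(2) Tnn vn0 z1 z2 mx k1 k2]
    unfolding Tf Tq vn \<Phi>_def[symmetric] formc_def[symmetric] .
  define f where "f = \<Phi> ^ (p - 1)"
  have fp: "f > 0" using \<Phi>p by (simp add: f_def)
  define W where "W = v ^ (p - 1)"
  have W0: "W \<ge> 0" using vpos by (simp add: W_def)
  define TT where "TT = (\<Sum>i\<in>UNIV. T i)"
  have TT0: "TT \<ge> 0" unfolding TT_def by (intro sum_nonneg less_imp_le lin(1))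
  \<comment> \<open>So powers of \<open>v\<close> in (v) and (vi) are controlled by the linearised operator.\<close>
  have WD: "W \<le> D * Tw"
  proof -
    have "W = (2 / h) ^ (p - 1) * (h * v / 2) ^ (p - 1)"
      using hp by (simp add: W_def power_mult_distrib[symmetric])
    also have "\<dots> \<le> (2 / h0) ^ (p - 1) * Tw"
      using lin(3) hb h0(1) hp hv0 by (intro mult_mono power_mono frac_le) auto
    also have "\<dots> \<le> D * Tw" unfolding D using lin(2) by (intro mult_right_mono) auto
    finally show ?thesis .
  qed
  have D1: "D \<ge> 1" using h0(1) by (simp add: D)
  have t1: "- (real p * \<Phi> ^ (p - 1) * l.hort ?F y) \<le> real p * C7 * (\<omega>4 (v\<^sup>2) * max f W)"
  proof -
    have "f * (- l.hort ?F y) \<le> f * (C7 * \<omega>4 (v\<^sup>2) * max 1 (W / f))"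
      using sba(4) fp by (intro mult_left_mono) (auto simp: f_def W_def \<Phi>_def)
    also have "\<dots> = C7 * (\<omega>4 (v\<^sup>2) * (f * max 1 (W / f)))" by (simp only: mult_ac)
    also have "\<dots> = C7 * (\<omega>4 (v\<^sup>2) * max f W)" by (simp only: mult_max_1_divide[OF fp])
    finally have "real p * (f * (- l.hort ?F y)) \<le> real p * (C7 * (\<omega>4 (v\<^sup>2) * max f W))" by (intro mult_left_mono) auto
    then show ?thesis by (simp add: f_def mult_ac)
  qed
  have t2: "real p * h * v * \<Phi> ^ (p - 1) * (l.vert ?F y - \<Phi>) \<le> real p * h * v * (C8 * (v + 1) * max f (\<omega>5 W))"
  proof -
    have "f * (l.vert ?F y - \<Phi>) \<le> f * (C8 * (v + 1) * max 1 (\<omega>5 W / f))"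
      using sba(5) fp by (intro mult_left_mono) (auto simp: f_def W_def \<Phi>_def)
    also have "\<dots> = C8 * (v + 1) * (f * max 1 (\<omega>5 W / f))" by (simp only: mult_ac)
    also have "\<dots> = C8 * (v + 1) * max f (\<omega>5 W)" by (simp only: mult_max_1_divide[OF fp])
    finally have "real p * h * v * (f * (l.vert ?F y - \<Phi>)) \<le> real p * h * v * (C8 * (v + 1) * max f (\<omega>5 W))"
      using hp vpos by (intro mult_left_mono) auto
    then show ?thesis by (simp only: f_def mult_ac)
  qed
  have t3: "(\<Sum>i\<in>UNIV. T i * ((\<Sum>r\<in>UNIV. \<Sum>s\<in>UNIV. l.hort (?R r s) y * e i $ r * e i $ s) - 2 * ((?A *v e i) \<bullet> (l.Gam y (l.nab y) *v e i))))
      \<le> (\<Sum>i\<in>UNIV. T i * (C5 * \<omega>3 (v\<^sup>2)))"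
  proof (intro sum_mono mult_left_mono less_imp_le[OF lin(1)])
    fix i
    show "(\<Sum>r\<in>UNIV. \<Sum>s\<in>UNIV. l.hort (?R r s) y * e i $ r * e i $ s) - 2 * ((?A *v e i) \<bullet> (l.Gam y (l.nab y) *v e i)) \<le> C5 * \<omega>3 (v\<^sup>2)"
      using sba(2)[of "e i"] by (simp only: on if_True refl mult.right_neutral)
  qed
  have t4: "- h * v * (\<Sum>i\<in>UNIV. T i * ((\<Sum>r\<in>UNIV. \<Sum>s\<in>UNIV. l.vert (?R r s) y * e i $ r * e i $ s) - e i \<bullet> (?A *v e i)))
      \<le> h * v * (\<Sum>i\<in>UNIV. T i * (C3 + C6 * (v + 1)))"
  proof -
    have "(\<Sum>i\<in>UNIV. T i * (- ((\<Sum>r\<in>UNIV. \<Sum>s\<in>UNIV. l.vert (?R r s) y * e i $ r * e i $ s) - e i \<bullet> (?A *v e i))))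
        \<le> (\<Sum>i\<in>UNIV. T i * (C3 + C6 * (v + 1)))"
    proof (intro sum_mono mult_left_mono less_imp_le[OF lin(1)])
      fix i
      show "- ((\<Sum>r\<in>UNIV. \<Sum>s\<in>UNIV. l.vert (?R r s) y * e i $ r * e i $ s) - e i \<bullet> (?A *v e i)) \<le> C3 + C6 * (v + 1)"
        using sba(3)[of "e i"] by (simp only: on if_True refl mult.right_neutral)
    qed
    then have "h * v * (\<Sum>i\<in>UNIV. T i * (- ((\<Sum>r\<in>UNIV. \<Sum>s\<in>UNIV. l.vert (?R r s) y * e i $ r * e i $ s) - e i \<bullet> (?A *v e i))))
        \<le> h * v * (\<Sum>i\<in>UNIV. T i * (C3 + C6 * (v + 1)))" using hp vpos by (intro mult_left_mono) auto
    then show ?thesis by (simp only: mult_minus_right mult_minus_left sum_negf)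
  qed
  have t5: "- (\<Sum>i\<in>UNIV. T i * l.Rm y (e i) (l.nab y)) \<le> (\<Sum>i\<in>UNIV. T i * (CR * v))"
  proof -
    have "- l.Rm y (e i) (l.nab y) \<le> CR * v" for i
      using curv[rule_format, of "l.nab y" "e i"] by (simp add: l.Rm_curv[OF y] y_def[symmetric] Gquad on)
    then have "(\<Sum>i\<in>UNIV. T i * (- l.Rm y (e i) (l.nab y))) \<le> (\<Sum>i\<in>UNIV. T i * (CR * v))"
      by (intro sum_mono mult_left_mono less_imp_le[OF lin(1)])
    then show ?thesis by (simp add: sum_negf)
  qed
  have sums: "(\<Sum>i\<in>UNIV. T i * a) = TT * a" for a by (simp add: TT_def sum_distrib_right)
  have "L * h * v * (v * Tw) \<le> real p * C7 * (\<omega>4 (v\<^sup>2) * max f W) + real p * h * v * (C8 * (v + 1) * max f (\<omega>5 W))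
      + TT * (C5 * \<omega>3 (v\<^sup>2)) + h * v * (TT * (C3 + C6 * (v + 1))) + TT * (CR * v)"
    using key t1 t2 t3 t4 t5 unfolding sums by linarith
  then have ineq: "L * h * v\<^sup>2 * Tw \<le> real p * C7 * (\<omega>4 (v\<^sup>2) * max f W) + real p * h * v * (C8 * (v + 1) * max f (\<omega>5 W))
      + TT * (C5 * \<omega>3 (v\<^sup>2) + h * v * (C3 + C6 * (v + 1))) + TT * (CR * v)"
    by (simp add: power2_eq_square algebra_simps)
  have w5: "\<omega>5 W \<le> \<epsilon> * (D * Tw)"
    by (rule order_trans[OF v(6)[folded W_def] mult_left_mono[OF WD less_imp_le[OF small(1)]]])
  show False
    by (rule numeric_contradiction[OF v(1) h0(1) hb lin(2) less_imp_le[OF fp] lin(4)[folded f_def] WD D1 TT0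
          lin(5)[folded TT_def] C of_nat_0_le_iff of_nat_0_le_iff _ v(5,4) w5 small(1) v(2) L ineq small(2)])
      (simp add: \<omega>(2))
qed

text \<open>The constants are chosen in the order \<open>L\<close>, \<open>C0\<close>, \<open>h0\<close>, \<open>D\<close>, \<open>\<epsilon>\<close>, \<open>V0\<close>, each from the preceding ones and
  the data. In particular none of them depends on the solution.\<close>
lemma gradient_bound_general:
  fixes p :: nat
  assumes compact: "compact (UNIV :: 'm set)"
    and A: "smooth_cotform \<A> A" and \<phi>: "pos_smooth_cotfun \<A> \<phi>" and p: "2 \<le> p" "p \<le> CARD('n)"
    and sb: "structure_bounds p A \<phi> K C3 C5 C6 C7 C8 \<omega>1 \<omega>3 \<omega>4 \<omega>5"
    and C: "C3 \<ge> 0" "C5 \<ge> 0" "C6 \<ge> 0" "C7 \<ge> 0" "C8 \<ge> 0"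
    and \<omega>: "\<omega>1 \<in> class_W" "\<omega>3 \<in> class_W" "\<omega>4 \<in> class_W" "\<omega>5 \<in> class_W"
  obtains M where "M > 0" "\<And>u x. Ck_fun \<A> 3 u \<Longrightarrow> solves_hessian_eq \<A> g p A \<phi> u \<Longrightarrow> (\<And>x. \<bar>u x\<bar> \<le> K) \<Longrightarrow>
    conorm \<A> g x (differential \<A> u x) \<le> M"
proof -
  obtain CR where CR: "CR \<ge> 0" "\<And>x. \<exists>c\<in>\<A>. x \<in> cdom c \<and> curv_le CR c x"
    using curvature_bound[OF compact] by metis
  define L where "L = 2 * real p * C8 + real CARD('n) * (C3 + 2 * C6) + 1"
  have L1: "L \<ge> 1" using C by (simp add: L_def)
  \<comment> \<open>With this choice \<open>C0 - exp (L t)\<close> lies between \<open>exp (L K)\<close> and twice that number. This bounds \<open>h\<close> by \<open>h0\<close>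
    from below and by \<open>L\<close> from above, and the oscillation of \<open>\<zeta>\<close> by \<open>4\<close>.\<close>
  define C0 where "C0 = 2 * exp (L * K)"
  define h0 where "h0 = L * exp (- L * K) / (2 * exp (L * K))"
  have h0: "h0 > 0" using L1 by (simp add: h0_def)
  have ex: "exp (- L * K) \<le> exp (L * t)" "exp (L * t) \<le> exp (L * K)" if "\<bar>t\<bar> \<le> K" for t
  proof -
    have "- K \<le> t" "t \<le> K" using that by auto
    then have "L * (- K) \<le> L * t" "L * t \<le> L * K" using L1 mult_left_mono[of "- K" t L] mult_left_mono[of t K L] by auto
    then show "exp (- L * K) \<le> exp (L * t)" "exp (L * t) \<le> exp (L * K)" by auto
  qed
  have eta: "C0 - exp (L * t) \<ge> exp (L * K)" "C0 - exp (L * t) \<le> 2 * exp (L * K)" if "\<bar>t\<bar> \<le> K" for t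
    using ex[OF that] by (auto simp: C0_def)
  have eta0: "C0 - exp (L * t) > 0" if "\<bar>t\<bar> \<le> K" for t
    using eta(1)[OF that] by (smt (verit) exp_gt_zero)
  have hlow: "h0 \<le> L * exp (L * t) / (C0 - exp (L * t))" if "\<bar>t\<bar> \<le> K" for t
    unfolding h0_def using ex[OF that] eta[OF that] eta0[OF that] L1 by (intro frac_le mult_left_mono) auto
  have hup: "L * exp (L * t) / (C0 - exp (L * t)) \<le> L" if "\<bar>t\<bar> \<le> K" for t
  proof -
    have "L * exp (L * t) \<le> L * (C0 - exp (L * t))"
      by (rule mult_left_mono[OF order_trans[OF ex(2)[OF that] eta(1)[OF that]]]) (use L1 in simp)
    then show ?thesis using eta0[OF that] by (simp add: pos_divide_le_eq)
  qed
  define D where "D = 1 + (2 / h0) ^ (p - 1)"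
  define Q where "Q = real p * C7 * D + 2 * real p * L * C8 * D + real CARD('n) * C5 + real CARD('n) * CR"
  have Q0: "Q \<ge> 0" using C CR(1) L1 h0 by (simp add: Q_def D_def)
  \<comment> \<open>\<open>\<epsilon>\<close> is the slope below which the \<open>\<omega>\<^sub>i\<close> have to fall for large arguments.\<close>
  define \<epsilon> where "\<epsilon> = h0 / (Q + 1)"
  have e0: "\<epsilon> > 0" using h0 Q0 by (simp add: \<epsilon>_def)
  have small: "\<epsilon> * Q < h0"
  proof -
    have "h0 * Q < h0 * (Q + 1)" using h0 by simp
    then show ?thesis using Q0 by (simp add: \<epsilon>_def pos_divide_less_eq)
  qed
  have "\<forall>\<^sub>F v in at_top. v \<ge> 1 \<and> 1 \<le> \<epsilon> * v \<and> C3 * \<omega>1 v \<le> h0 / 2 * v \<and> \<omega>3 (v\<^sup>2) \<le> \<epsilon> * v\<^sup>2 \<and> \<omega>4 (v\<^sup>2) \<le> \<epsilon> * v\<^sup>2 \<and>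
      \<omega>5 (v ^ (p - 1)) \<le> \<epsilon> * v ^ (p - 1)"
  proof (intro eventually_conj)
    show "\<forall>\<^sub>F v in at_top. (1::real) \<le> v" by (rule eventually_ge_at_top)
    show "\<forall>\<^sub>F v in at_top. 1 \<le> \<epsilon> * v"
      using eventually_ge_at_top[of "1 / \<epsilon>"] by eventually_elim (use e0 in \<open>simp add: pos_divide_le_eq mult.commute\<close>)
    have d: "h0 / (2 * (C3 + 1)) > 0" using h0 C by simp
    show "\<forall>\<^sub>F v in at_top. C3 * \<omega>1 v \<le> h0 / 2 * v"
      using class_W_small[OF \<omega>(1) d] eventually_ge_at_top[of 0]
    proof eventually_elim
      case (elim v)
      have "\<omega>1 v \<ge> 0" using class_W_bounds[OF \<omega>(1) elim(2)] by simp
      then have "C3 * \<omega>1 v \<le> (C3 + 1) * \<omega>1 v" by (intro mult_right_mono) auto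
      also have "\<dots> \<le> (C3 + 1) * (h0 / (2 * (C3 + 1)) * v)" using elim C by (intro mult_left_mono) auto
      also have "\<dots> = h0 / 2 * v"
      proof -
        have "k * (h0 / (2 * k) * v) = h0 / 2 * v" if "k > 0" for k using that by simp
        from this[of "C3 + 1"] show ?thesis using C by simp
      qed
      finally show ?case .
    qed
    have sq: "filterlim (\<lambda>v::real. v ^ k) at_top at_top" if "k > 0" for k
      by (rule filterlim_pow_at_top[OF that filterlim_ident])
    show "\<forall>\<^sub>F v in at_top. \<omega>3 (v\<^sup>2) \<le> \<epsilon> * v\<^sup>2"
      using filterlim_iff[THEN iffD1, OF sq[of 2]] class_W_small[OF \<omega>(2) e0] by auto
    show "\<forall>\<^sub>F v in at_top. \<omega>4 (v\<^sup>2) \<le> \<epsilon> * v\<^sup>2"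
      using filterlim_iff[THEN iffD1, OF sq[of 2]] class_W_small[OF \<omega>(3) e0] by auto
    show "\<forall>\<^sub>F v in at_top. \<omega>5 (v ^ (p - 1)) \<le> \<epsilon> * v ^ (p - 1)"
      using filterlim_iff[THEN iffD1, OF sq[of "p - 1"]] class_W_small[OF \<omega>(4) e0] p by auto
  qed
  then obtain V0 where V0: "\<And>v. v \<ge> V0 \<Longrightarrow> v \<ge> 1 \<and> 1 \<le> \<epsilon> * v \<and> C3 * \<omega>1 v \<le> h0 / 2 * v \<and> \<omega>3 (v\<^sup>2) \<le> \<epsilon> * v\<^sup>2 \<and> \<omega>4 (v\<^sup>2) \<le> \<epsilon> * v\<^sup>2 \<and>
      \<omega>5 (v ^ (p - 1)) \<le> \<epsilon> * v ^ (p - 1)"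
    unfolding eventually_at_top_linorder by blast
  have w10: "\<omega>1 0 \<le> 1" using class_W_bounds[OF \<omega>(1), of 0] by simp
  have w4: "\<omega>4 t \<ge> 0" if "t \<ge> 0" for t using class_W_bounds[OF \<omega>(3) that] by simp
  define \<zeta> where "\<zeta> = (\<lambda>t. (C0 - exp (L * t))\<^sup>2)"
  have zc: "continuous_on UNIV \<zeta>" unfolding \<zeta>_def by (intro continuous_intros)
  have zp: "\<zeta> t > 0" if "\<bar>t\<bar> \<le> K" for t using eta0[OF that] by (simp add: \<zeta>_def)
  have zR: "\<zeta> s \<le> 4 * \<zeta> t" if "\<bar>s\<bar> \<le> K" "\<bar>t\<bar> \<le> K" for s t
  proof -
    have "C0 - exp (L * s) \<le> 2 * (C0 - exp (L * t))" 
      by (rule order_trans[OF eta(2)[OF that(1)]]) (use eta(1)[OF that(2)] in simp)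
    then have "(C0 - exp (L * s))\<^sup>2 \<le> (2 * (C0 - exp (L * t)))\<^sup>2"
      using eta0[OF that(1)] by (intro power_mono) auto
    then show ?thesis unfolding \<zeta>_def power_mult_distrib by simp
  qed
  define M where "M = sqrt (4 * \<bar>V0\<bar> + 1)"
  show ?thesis
  proof (rule that[of M])
    show "M > 0" by (simp add: M_def)
    fix u x assume u: "Ck_fun \<A> 3 u" and sol: "solves_hessian_eq \<A> g p A \<phi> u" and K: "\<And>x. \<bar>u x\<bar> \<le> K"
    let ?v = "\<lambda>x. (conorm \<A> g x (differential \<A> u x))\<^sup>2"
    obtain x0 where x0: "\<And>x. ?v x \<le> 4 * ?v x0"
      and max: "\<And>c y. c \<in> \<A> \<Longrightarrow> x0 \<in> cdom c \<Longrightarrow> y \<in> img c \<Longrightarrow>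
        nsqc c u y
          - (nsqc c u (crd c x0) / \<zeta> (u x0)) * \<zeta> (u (cinv c y)) \<le> 0"
    proof (rule exists_maximum[OF compact u K zc])
      show "\<zeta> t > 0" if "\<bar>t\<bar> \<le> K" for t by (rule zp[OF that])
      show "\<zeta> s \<le> 4 * \<zeta> t" if "\<bar>s\<bar> \<le> K" "\<bar>t\<bar> \<le> K" for s t by (rule zR[OF that])
    qed (rule that, blast+)
    obtain c where c: "c \<in> \<A>" "x0 \<in> cdom c" and curv: "curv_le CR c x0"
      using CR(2)[of x0] by blast
    have "?v x0 \<le> V0"
    proof (rule ccontr)
      assume "\<not> ?v x0 \<le> V0"
      then have big: "?v x0 \<ge> V0" by simp
      note V = V0[OF big]
      show False
        by (rule maximum_point_bound[OF A \<phi> p sb C CR(1) w10 w4 u sol K c curv eta0 h0 hlow hup _ D_def e0 _ max[OF c, unfolded \<zeta>_def] refl])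
          (use V small L_def Q_def in auto)
    qed
    then have "?v x \<le> 4 * \<bar>V0\<bar> + 1" using x0[of x] by linarith
    then show "conorm \<A> g x (differential \<A> u x) \<le> M"
      unfolding M_def by (rule real_le_rsqrt)
  qed
qed

end

text \<open>The structure conditions do not mention \<open>u\<close>. So the functions that occur in them may be
  chosen before the bound, although the statement quantifies them after \<open>u\<close>.\<close>
lemma bound_under_common_hypothesis:
  fixes f :: "'u \<Rightarrow> 'x \<Rightarrow> real"
  assumes "H \<Longrightarrow> \<exists>M>0. \<forall>u. P u \<longrightarrow> Q u \<longrightarrow> R u \<longrightarrow> (\<forall>x. f u x \<le> M)"
  shows "\<exists>M>0. \<forall>u. P u \<longrightarrow> Q u \<longrightarrow> R u \<longrightarrow> H \<longrightarrow> (\<forall>x. f u x \<le> M)"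
  using assms zero_less_one by (cases H) blast+

theorem theorem1p6:
  fixes \<A> :: "('m::{t2_space,second_countable_topology},'n::finite) chart set"
    and g :: "'m \<Rightarrow> ('m,'n) tvec \<Rightarrow> ('m,'n) tvec \<Rightarrow> real"
    and A :: "('m,'n) cotform"
    and \<phi> :: "('m,'n) cotfun"
    and p :: nat
  assumes "smooth_structure \<A>"
    and "compact (UNIV :: 'm set)"
    and "connected (UNIV :: 'm set)"
    and "riemannian_metric \<A> g"
    and "smooth_cotform \<A> A"
    and "pos_smooth_cotfun \<A> \<phi>"
    and "3 \<le> CARD('n)"
    and "2 \<le> p" and "p \<le> CARD('n)"
  shows
    "(\<forall>K. \<exists>M>0. \<forall>u.
        Ck_fun \<A> 3 u \<longrightarrow>
        solves_hessian_eq \<A> g p A \<phi> u \<longrightarrow>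
        (SUP x. \<bar>u x\<bar>) = K \<longrightarrow>
        (\<exists>\<phi>3 \<phi>4 \<phi>5 \<phi>6 \<phi>7 \<phi>8 \<omega>1 \<omega>2 \<omega>3 \<omega>4 \<omega>5.
          (\<forall>f\<in>{\<phi>3, \<phi>4, \<phi>5, \<phi>6, \<phi>7, \<phi>8}. nonneg_cont f) \<and>
          {\<omega>1, \<omega>2, \<omega>3, \<omega>4, \<omega>5} \<subseteq> class_W \<and>
          (\<forall>x t. \<forall>\<alpha>\<in>cotspace \<A> x. \<forall>v\<in>tspace \<A> x.
            A (x, \<alpha>) t v v \<le> \<phi>3 x t * g x v v * \<omega>1 ((conorm \<A> g x \<alpha>)^2) \<and>
            (\<forall>w\<in>tspace \<A> x. g x v w = 0 \<longrightarrow>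
              A (x, \<alpha>) t v w \<le> \<phi>4 x t * sqrt (g x v v * g x w w) * \<omega>2 ((conorm \<A> g x \<alpha>)^2)) \<and>
            (\<forall>c\<in>\<A>. x \<in> cdom c \<longrightarrow>
              (\<Sum>j\<in>UNIV. \<Sum>k\<in>UNIV. \<Sum>r\<in>UNIV. \<Sum>s\<in>UNIV.
                 ginv \<A> g c x $ j $ k * horizontal_form \<A> g c j A r s x \<alpha> t
                 * v c $ r * v c $ s * cocomp \<A> c x \<alpha> $ k)
              + deriv (\<lambda>\<tau>. A (x, \<alpha>) \<tau> v v) t * (conorm \<A> g x \<alpha>)^2
              \<le> \<phi>5 x t * g x v v * \<omega>3 ((conorm \<A> g x \<alpha>)^4)) \<and>
            integral {0..1} (\<lambda>\<theta>. \<theta> *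
                second_deriv \<A> x (\<lambda>\<beta>. A (x, \<beta>) t v v) (\<lambda>z. \<theta> * \<alpha> z) \<alpha> \<alpha>)
              \<ge> - \<phi>6 x t * g x v v * ((conorm \<A> g x \<alpha>)^2 + 1) \<and>
            (\<forall>c\<in>\<A>. x \<in> cdom c \<longrightarrow>
              (\<Sum>j\<in>UNIV. \<Sum>k\<in>UNIV.
                 ginv \<A> g c x $ j $ k * horizontal \<A> g c j \<phi> x \<alpha> t * cocomp \<A> c x \<alpha> $ k)
              + deriv (\<lambda>\<tau>. \<phi> (x, \<alpha>) \<tau>) t * (conorm \<A> g x \<alpha>)^2
              \<ge> - \<phi>7 x t * \<omega>4 ((conorm \<A> g x \<alpha>)^4)
                 * max 1 ((conorm \<A> g x \<alpha>)^(2 * (p - 1)) / (\<phi> (x, \<alpha>) t)^(p - 1))) \<and>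
            integral {0..1} (\<lambda>\<theta>. \<theta> *
                second_deriv \<A> x (\<lambda>\<beta>. \<phi> (x, \<beta>) t) (\<lambda>z. \<theta> * \<alpha> z) \<alpha> \<alpha>)
              \<le> \<phi>8 x t * ((conorm \<A> g x \<alpha>)^2 + 1)
                 * max 1 (\<omega>5 ((conorm \<A> g x \<alpha>)^(2 * (p - 1))) / (\<phi> (x, \<alpha>) t)^(p - 1)))) \<longrightarrow>
        (\<forall>x. conorm \<A> g x (differential \<A> u x) \<le> M)) \<and>
     (p = CARD('n) \<longrightarrow>
       (\<forall>K. \<exists>M>0. \<forall>u.
          Ck_fun \<A> 3 u \<longrightarrow>
          solves_hessian_eq \<A> g p A \<phi> u \<longrightarrow>
          (SUP x. \<bar>u x\<bar>) = K \<longrightarrow>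
          (\<exists>\<phi>3. nonneg_cont \<phi>3 \<and>
            (\<forall>x t. \<forall>\<alpha>\<in>cotspace \<A> x. \<forall>v\<in>tspace \<A> x.
              A (x, \<alpha>) t v v \<le> \<phi>3 x t * g x v v * ((conorm \<A> g x \<alpha>)^2 + 1))) \<longrightarrow>
          (\<forall>x. conorm \<A> g x (differential \<A> u x) \<le> M)))"
proof -
  interpret riemannian_manifold \<A> g
    using assms(1,4) by unfold_locales
  have compact: "compact (UNIV :: 'm set)" by fact
  have A: "smooth_cotform \<A> A" and \<phi>: "pos_smooth_cotfun \<A> \<phi>" by fact+
  have p: "2 \<le> p" "p \<le> CARD('n)" by fact+
  have uK: "\<bar>u x\<bar> \<le> K" if "Ck_fun \<A> 3 u" "(SUP x. \<bar>u x\<bar>) = K" for u K x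
    using abs_u_le_SUP[OF compact that(1)] that(2) by simp
  show ?thesis
  proof (intro conjI impI allI, goal_cases)
    case (1 K)
    show ?case
    proof (rule bound_under_common_hypothesis, elim exE, goal_cases)
      case (1 \<phi>3 \<phi>4 \<phi>5 \<phi>6 \<phi>7 \<phi>8 \<omega>1 \<omega>2 \<omega>3 \<omega>4 \<omega>5)
      have nc: "nonneg_cont \<phi>3" "nonneg_cont \<phi>5" "nonneg_cont \<phi>6" "nonneg_cont \<phi>7" "nonneg_cont \<phi>8"
        and W: "\<omega>1 \<in> class_W" "\<omega>3 \<in> class_W" "\<omega>4 \<in> class_W" "\<omega>5 \<in> class_W"
        using 1 by simp_all
      obtain C3 where C3: "C3 \<ge> 0" "\<And>x t. \<bar>t\<bar> \<le> K \<Longrightarrow> \<phi>3 x t \<le> C3"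
        using nonneg_cont_bounded[where K = K, OF compact nc(1)] by blast
      obtain C5 where C5: "C5 \<ge> 0" "\<And>x t. \<bar>t\<bar> \<le> K \<Longrightarrow> \<phi>5 x t \<le> C5"
        using nonneg_cont_bounded[where K = K, OF compact nc(2)] by blast
      obtain C6 where C6: "C6 \<ge> 0" "\<And>x t. \<bar>t\<bar> \<le> K \<Longrightarrow> \<phi>6 x t \<le> C6"
        using nonneg_cont_bounded[where K = K, OF compact nc(3)] by blast
      obtain C7 where C7: "C7 \<ge> 0" "\<And>x t. \<bar>t\<bar> \<le> K \<Longrightarrow> \<phi>7 x t \<le> C7"
        using nonneg_cont_bounded[where K = K, OF compact nc(4)] by blast
      obtain C8 where C8: "C8 \<ge> 0" "\<And>x t. \<bar>t\<bar> \<le> K \<Longrightarrow> \<phi>8 x t \<le> C8"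
        using nonneg_cont_bounded[where K = K, OF compact nc(5)] by blast
      have "structure_bounds p A \<phi> K C3 C5 C6 C7 C8 \<omega>1 \<omega>3 \<omega>4 \<omega>5"
        unfolding structure_bounds_def
      proof (intro allI impI ballI, goal_cases)
        case bounds: (1 x t \<alpha> v)
        note t = bounds(1) and a = bounds(2) and v = bounds(3)
        let ?a = "conorm \<A> g x \<alpha>" and ?g = "g x v v"
        have w: "0 \<le> \<omega>1 (?a^2)" "0 \<le> \<omega>3 (?a^4)" "0 \<le> \<omega>4 (?a^4)"
          using class_W_bounds[OF W(1)] class_W_bounds[OF W(2)] class_W_bounds[OF W(3)] by simp_all
        have m: "\<phi>3 x t * ?g * \<omega>1 (?a^2) \<le> C3 * ?g * \<omega>1 (?a^2)"
          "\<phi>5 x t * ?g * \<omega>3 (?a^4) \<le> C5 * ?g * \<omega>3 (?a^4)"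
          "- C6 * ?g * (?a^2 + 1) \<le> - \<phi>6 x t * ?g * (?a^2 + 1)"
          "- C7 * \<omega>4 (?a^4) * max 1 r \<le> - \<phi>7 x t * \<omega>4 (?a^4) * max 1 r"
          "\<phi>8 x t * (?a^2 + 1) * max 1 r \<le> C8 * (?a^2 + 1) * max 1 r" for r
          using mult_right_mono[OF C3(2)[OF t], of "?g * \<omega>1 (?a^2)"] mult_right_mono[OF C5(2)[OF t], of "?g * \<omega>3 (?a^4)"]
            mult_right_mono[OF C6(2)[OF t], of "?g * (?a^2 + 1)"] mult_right_mono[OF C7(2)[OF t], of "\<omega>4 (?a^4) * max 1 r"]
            mult_right_mono[OF C8(2)[OF t], of "(?a^2 + 1) * max 1 r"] w metric_nonneg[OF v]
          by (simp_all add: mult.assoc)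
        note S = 1[THEN conjunct2, THEN conjunct2, rule_format, OF a v, of t]
        note S3 = S[THEN conjunct2, THEN conjunct2]
        show ?case
        proof (intro conjI ballI impI, goal_cases)
          case 1 show ?case by (rule order_trans[OF S[THEN conjunct1] m(1)])
        next
          case (2 c) then show ?case by (rule order_trans[OF S3[THEN conjunct1, rule_format] m(2)])
        next
          case 3 show ?case by (rule order_trans[OF m(3) S3[THEN conjunct2, THEN conjunct1]])
        next
          case (4 c) then show ?case by (rule order_trans[OF m(4) S3[THEN conjunct2, THEN conjunct2, THEN conjunct1, rule_format]])
        next
          case 5 show ?case by (rule order_trans[OF S3[THEN conjunct2, THEN conjunct2, THEN conjunct2] m(5)])
        qed
      qed
      then obtain M where M: "M > 0" "\<And>u x. Ck_fun \<A> 3 u \<Longrightarrow> solves_hessian_eq \<A> g p A \<phi> u \<Longrightarrow> (\<And>x. \<bar>u x\<bar> \<le> K) \<Longrightarrow>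
          conorm \<A> g x (differential \<A> u x) \<le> M"
        by (rule gradient_bound_general[OF compact A \<phi> p _ C3(1) C5(1) C6(1) C7(1) C8(1) W]) blast
      show ?case
      proof (intro exI[of _ M] conjI allI impI)
        show "M > 0" by (rule M(1))
        fix u x
        assume u: "Ck_fun \<A> 3 u" "solves_hessian_eq \<A> g p A \<phi> u" "(SUP x. \<bar>u x\<bar>) = K"
        show "conorm \<A> g x (differential \<A> u x) \<le> M" by (rule M(2)[OF u(1,2) uK[OF u(1,3)]])
      qed
    qed
  next
    case (2 K)
    show ?case
    proof (rule bound_under_common_hypothesis, elim exE conjE)
      fix \<phi>3 :: "'m \<Rightarrow> real \<Rightarrow> real"
      assume nc: "nonneg_cont \<phi>3" and S: "\<forall>x t. \<forall>\<alpha>\<in>cotspace \<A> x. \<forall>v\<in>tspace \<A> x.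
          A (x, \<alpha>) t v v \<le> \<phi>3 x t * g x v v * ((conorm \<A> g x \<alpha>)^2 + 1)"
      obtain C3 where C3: "C3 \<ge> 0" "\<And>x t. \<bar>t\<bar> \<le> K \<Longrightarrow> \<phi>3 x t \<le> C3"
        using nonneg_cont_bounded[where K = K, OF compact nc] by blast
      have i: "A (x, \<alpha>) t v v \<le> C3 * g x v v * ((conorm \<A> g x \<alpha>)\<^sup>2 + 1)"
        if "\<bar>t\<bar> \<le> K" "\<alpha> \<in> cotspace \<A> x" "v \<in> tspace \<A> x" for x t \<alpha> v
      proof -
        have "\<phi>3 x t * g x v v * ((conorm \<A> g x \<alpha>)\<^sup>2 + 1) \<le> C3 * g x v v * ((conorm \<A> g x \<alpha>)\<^sup>2 + 1)"
          using C3(2)[OF that(1)] metric_nonneg[OF that(3)] by (intro mult_right_mono) auto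
        then show ?thesis using S that(2,3) order_trans by blast
      qed
      define M where "M = sqrt (exp (2 * (4 * C3 + 2) * K))"
      have M0: "M > 0" by (simp add: M_def)
      have "conorm \<A> g x (differential \<A> u x) \<le> M"
        if "Ck_fun \<A> 3 u" "solves_hessian_eq \<A> g p A \<phi> u" "(SUP x. \<bar>u x\<bar>) = K" for u x
        unfolding M_def
        by (rule real_le_rsqrt) (rule gradient_bound_full[OF compact A \<phi> C3(1) i that(1) that(2)[unfolded 2] uK[OF that(1,3)]])
      with M0 show "\<exists>M>0. \<forall>u. Ck_fun \<A> 3 u \<longrightarrow> solves_hessian_eq \<A> g p A \<phi> u \<longrightarrow> (SUP x. \<bar>u x\<bar>) = K \<longrightarrow>
          (\<forall>x. conorm \<A> g x (differential \<A> u x) \<le> M)" by blast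
    qed
  qed
qed

end
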